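(* Let $G$ be a soluble group of finite rank and let $k$ be a locally finite field. Suppose that $\mathrm{Sp}(B) \not\subset \{\mathrm{char}\,k\}$ for every nontrivial abelian torsion-free normal subgroup $B$ of $G$. Then $G$ has a faithful irreducible representation over $k$ if and only if $\mathrm{Soc}(G)$ is a locally cyclic $\mathbb{Z}G$-module, where $G$ acts on $\mathrm{Soc}(G)$ by conjugation, and $\mathrm{char}\,k \notin \pi(\mathrm{Soc}(G))$.
   Context: A group $G$ has finite (Prüfer) rank if there is an integer $r$ such that every finitely generated subgroup of $G$ can be generated by $r$ elements. The socle $\mathrm{Soc}(G)$ is the subgroup of $G$ generated by all minimal normal subgroups of $G$ (and $\mathrm{Soc}(G)=1$ if $G$ has no minimal normal subgroups); for soluble $G$ it is abelian, and is regarded as a $\mathbb{Z}G$-module via conjugation. A module is locally cyclic if each of its finitely generated submodules is cyclic (generated by one element). For a group $X$, $\pi(X)$ denotes the set of primes $p$ such that $X$ has an element of order $p$. For an abelian group $B$ of finite rank, the spectrum $\mathrm{Sp}(B)$ is the set of primes $p$ such that $B$ has an infinite $p$-section (a section, i.e. quotient of a subgroup, that is an infinite $p$-group). The relation $\mathrm{Sp}(B)\not\subset\{q\}$ means that $\mathrm{Sp}(B)$ contains a prime different from $q$. A field is locally finite if every finitely generated subfield is finite, i.e. it is an algebraic extension of a finite field. An irreducible representation of $G$ over $k$ is one afforded by a simple $kG$-module (of arbitrary, possibly infinite, $k$-dimension); it is faithful if its kernel is trivial. *)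

theory Defs
  imports "HOL-Algebra.Algebra"
begin

section \<open>Groups of finite rank, socle, spectrum\<close>

definition finite_rank :: "('g, 'm) monoid_scheme \<Rightarrow> bool" where
  "finite_rank G \<longleftrightarrow>
     (\<exists>r::nat. \<forall>S \<subseteq> carrier G. finite S \<longrightarrow>
        (\<exists>T \<subseteq> carrier G. finite T \<and> card T \<le> r \<and> generate G T = generate G S))"

definition minimal_normal :: "'g set \<Rightarrow> ('g, 'm) monoid_scheme \<Rightarrow> bool" where
  "minimal_normal N G \<longleftrightarrow>
     N \<lhd> G \<and> N \<noteq> {\<one>\<^bsub>G\<^esub>} \<and>
     (\<forall>M. M \<lhd> G \<and> M \<subseteq> N \<and> M \<noteq> {\<one>\<^bsub>G\<^esub>} \<longrightarrow> M = N)"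

definition socle :: "('g, 'm) monoid_scheme \<Rightarrow> 'g set" where
  "socle G = generate G (\<Union>{N. minimal_normal N G})"

definition torsion_free :: "('g, 'm) monoid_scheme \<Rightarrow> bool" where
  "torsion_free A \<longleftrightarrow>
     (\<forall>x\<in>carrier A. \<forall>n::nat. n > 0 \<longrightarrow> x [^]\<^bsub>A\<^esub> n = \<one>\<^bsub>A\<^esub> \<longrightarrow> x = \<one>\<^bsub>A\<^esub>)"

definition prime_orders :: "('g, 'm) monoid_scheme \<Rightarrow> nat set" where
  "prime_orders A = {p. Factorial_Ring.prime p \<and> (\<exists>x\<in>carrier A. group.ord A x = p)}"

text \<open>
  An element of infinite order has \<open>group.ord\<close> equal to 0, which is not a power of a prime,
  so the following does force every element to have finite order.
\<close>

definition p_group :: "nat \<Rightarrow> ('g, 'm) monoid_scheme \<Rightarrow> bool" where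
  "p_group p A \<longleftrightarrow> group A \<and> (\<forall>x\<in>carrier A. \<exists>n::nat. group.ord A x = p ^ n)"

definition spectrum :: "('g, 'm) monoid_scheme \<Rightarrow> nat set" where
  "spectrum B =
     {p. Factorial_Ring.prime p \<and>
         (\<exists>H K. subgroup H B \<and> K \<lhd> (B\<lparr>carrier := H\<rparr>) \<and>
            infinite (carrier ((B\<lparr>carrier := H\<rparr>) Mod K)) \<and>
            p_group p ((B\<lparr>carrier := H\<rparr>) Mod K))}"


section \<open>Modules over the integral group ring\<close>

text \<open>
  A \<open>\<int>G\<close>-module is an abelian group (here written multiplicatively, since it will be a
  subgroup of \<open>G\<close>) with an action of \<open>G\<close> by automorphisms. Its submodules are the subgroups
  stable under the action.
\<close>

locale ZG_module = G: group G + A: comm_group A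
  for G :: "('g, 'm) monoid_scheme" and A :: "('a, 'n) monoid_scheme"
    and act :: "'g \<Rightarrow> 'a \<Rightarrow> 'a" +
  assumes act_closed: "\<lbrakk>g \<in> carrier G; x \<in> carrier A\<rbrakk> \<Longrightarrow> act g x \<in> carrier A"
    and act_mult: "\<lbrakk>g \<in> carrier G; x \<in> carrier A; y \<in> carrier A\<rbrakk> \<Longrightarrow>
          act g (x \<otimes>\<^bsub>A\<^esub> y) = act g x \<otimes>\<^bsub>A\<^esub> act g y"
    and act_one: "x \<in> carrier A \<Longrightarrow> act \<one>\<^bsub>G\<^esub> x = x"
    and act_comp: "\<lbrakk>g \<in> carrier G; h \<in> carrier G; x \<in> carrier A\<rbrakk> \<Longrightarrow>
          act (g \<otimes>\<^bsub>G\<^esub> h) x = act g (act h x)"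

definition ZG_submodule ::
  "'a set \<Rightarrow> ('g, 'm) monoid_scheme \<Rightarrow> ('a, 'n) monoid_scheme \<Rightarrow> ('g \<Rightarrow> 'a \<Rightarrow> 'a) \<Rightarrow> bool" where
  "ZG_submodule H G A act \<longleftrightarrow>
     subgroup H A \<and> (\<forall>g\<in>carrier G. \<forall>x\<in>H. act g x \<in> H)"

definition ZG_span ::
  "('g, 'm) monoid_scheme \<Rightarrow> ('a, 'n) monoid_scheme \<Rightarrow> ('g \<Rightarrow> 'a \<Rightarrow> 'a) \<Rightarrow> 'a set \<Rightarrow> 'a set" where
  "ZG_span G A act S = \<Inter>{H. ZG_submodule H G A act \<and> S \<subseteq> H}"

definition locally_cyclic_ZG_module ::
  "('g, 'm) monoid_scheme \<Rightarrow> ('a, 'n) monoid_scheme \<Rightarrow> ('g \<Rightarrow> 'a \<Rightarrow> 'a) \<Rightarrow> bool" where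
  "locally_cyclic_ZG_module G A act \<longleftrightarrow>
     ZG_module G A act \<and>
     (\<forall>S \<subseteq> carrier A. finite S \<longrightarrow>
        (\<exists>a\<in>carrier A. ZG_span G A act S = ZG_span G A act {a}))"

definition conj_by :: "('g, 'm) monoid_scheme \<Rightarrow> 'g \<Rightarrow> 'g \<Rightarrow> 'g" where
  "conj_by G g x = g \<otimes>\<^bsub>G\<^esub> x \<otimes>\<^bsub>G\<^esub> inv\<^bsub>G\<^esub> g"


section \<open>Fields\<close>

definition locally_finite_field :: "('k, 'm) ring_scheme \<Rightarrow> bool" where
  "locally_finite_field k \<longleftrightarrow>
     field k \<and> (\<forall>S \<subseteq> carrier k. finite S \<longrightarrow> finite (generate_field k S))"

text \<open>The additive order of 1; it is 0 when that order is infinite.\<close>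

definition characteristic :: "('k, 'm) ring_scheme \<Rightarrow> nat" where
  "characteristic k = group.ord (add_monoid k) \<one>\<^bsub>k\<^esub>"


section \<open>Representations\<close>

locale linear_rep =
  K: field k + V: module k V + act: group_action G "carrier V" \<rho>
  for k :: "('k, 'n) ring_scheme" and G :: "('g, 'm) monoid_scheme"
    and V :: "('k, 'v) module" and \<rho> :: "'g \<Rightarrow> 'v \<Rightarrow> 'v" +
  assumes rep_add: "\<lbrakk>g \<in> carrier G; x \<in> carrier V; y \<in> carrier V\<rbrakk> \<Longrightarrow>
          \<rho> g (x \<oplus>\<^bsub>V\<^esub> y) = \<rho> g x \<oplus>\<^bsub>V\<^esub> \<rho> g y"
    and rep_smult: "\<lbrakk>g \<in> carrier G; a \<in> carrier k; x \<in> carrier V\<rbrakk> \<Longrightarrow>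
          \<rho> g (a \<odot>\<^bsub>V\<^esub> x) = a \<odot>\<^bsub>V\<^esub> \<rho> g x"

definition irreducible_rep ::
  "('k, 'n) ring_scheme \<Rightarrow> ('g, 'm) monoid_scheme \<Rightarrow> ('k, 'v) module \<Rightarrow> ('g \<Rightarrow> 'v \<Rightarrow> 'v) \<Rightarrow> bool"
where
  "irreducible_rep k G V \<rho> \<longleftrightarrow>
     linear_rep k G V \<rho> \<and> carrier V \<noteq> {\<zero>\<^bsub>V\<^esub>} \<and>
     (\<forall>W. submodule W k V \<and> (\<forall>g\<in>carrier G. \<forall>w\<in>W. \<rho> g w \<in> W) \<longrightarrow>
          W = {\<zero>\<^bsub>V\<^esub>} \<or> W = carrier V)"

definition faithful_rep ::
  "('g, 'm) monoid_scheme \<Rightarrow> ('k, 'v) module \<Rightarrow> ('g \<Rightarrow> 'v \<Rightarrow> 'v) \<Rightarrow> bool" where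
  "faithful_rep G V \<rho> \<longleftrightarrow> kernel G (BijGroup (carrier V)) \<rho> = {\<one>\<^bsub>G\<^esub>}"

text \<open>
  HOL cannot quantify over the type of the vectors inside a formula, so the representation space
  is taken in the fixed type \<open>('k \<times> 'g) list\<close>. This is no restriction: a simple module is spanned
  by the \<open>G\<close>-orbit of any nonzero vector \<open>v\<close>, so each of its vectors is named by a list of
  coefficients and group elements, standing for a linear combination of translates of \<open>v\<close>. Lemma
  \<open>has_faithful_irreducible_repI\<close> shows that a faithful irreducible representation on
  vectors of an arbitrary type suffices.
\<close>

definition has_faithful_irreducible_rep ::
  "('k, 'n) ring_scheme \<Rightarrow> ('g, 'm) monoid_scheme \<Rightarrow> bool" where
  "has_faithful_irreducible_rep k G \<longleftrightarrow>
     (\<exists>(V :: ('k, ('k \<times> 'g) list) module) \<rho>. irreducible_rep k G V \<rho> \<and> faithful_rep G V \<rho>)"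

lemma transport_rep:
  fixes V :: "('k, 'v) module" and e :: "'v \<Rightarrow> 'w"
  assumes irr: "irreducible_rep k G V \<rho>" and faith: "faithful_rep G V \<rho>"
    and inj: "inj_on e (carrier V)"
  shows "\<exists>(V' :: ('k, 'w) module) \<rho>'. irreducible_rep k G V' \<rho>' \<and> faithful_rep G V' \<rho>'"
proof -
  interpret L: linear_rep k G V \<rho> using irr by (simp add: irreducible_rep_def)
  interpret GH: group_hom G "BijGroup (carrier V)" \<rho> by (rule L.act.group_hom)
  note GH.hom_mult [simp del] GH.hom_inv [simp del] GH.hom_one [simp del]
  define d where "d = inv_into (carrier V) e"
  have de [simp]: "d (e x) = x" if "x \<in> carrier V" for x
    using inj that by (simp add: d_def)
  have e_eq [simp]: "e x = e y \<longleftrightarrow> x = y" if "x \<in> carrier V" "y \<in> carrier V" for x y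
    using inj that by (simp add: inj_on_eq_iff)
  define V' :: "('k, 'w) module" where
    "V' = \<lparr>carrier = e ` carrier V, monoid.mult = (\<lambda>x y. x), one = e \<zero>\<^bsub>V\<^esub>, ring.zero = e \<zero>\<^bsub>V\<^esub>,
           ring.add = (\<lambda>x y. e (d x \<oplus>\<^bsub>V\<^esub> d y)), module.smult = (\<lambda>a x. e (a \<odot>\<^bsub>V\<^esub> d x))\<rparr>"
  define \<rho>' where "\<rho>' = (\<lambda>g. \<lambda>y\<in>e ` carrier V. e (\<rho> g (d y)))"
  have sel [simp]: "carrier V' = e ` carrier V" "ring.zero V' = e \<zero>\<^bsub>V\<^esub>"
    "ring.add V' = (\<lambda>x y. e (d x \<oplus>\<^bsub>V\<^esub> d y))" "module.smult V' = (\<lambda>a x. e (a \<odot>\<^bsub>V\<^esub> d x))"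
    by (simp_all add: V'_def)
  have rho_cl [simp]: "\<rho> g x \<in> carrier V" if "g \<in> carrier G" "x \<in> carrier V" for g x
    using L.act.element_image that by blast
  have rho_mult: "\<rho> (g \<otimes>\<^bsub>G\<^esub> h) x = \<rho> g (\<rho> h x)"
    if "g \<in> carrier G" "h \<in> carrier G" "x \<in> carrier V" for g h x
    using L.act.composition_rule that by blast
  have rho_one: "\<rho> \<one>\<^bsub>G\<^esub> x = x" if "x \<in> carrier V" for x
    using L.act.id_eq_one that by (metis restrict_apply')
  have ab: "abelian_group V'"
  proof (rule abelian_groupI)
    fix x assume "x \<in> carrier V'"
    then obtain u where "u \<in> carrier V" "x = e u" by auto
    then show "\<exists>y\<in>carrier V'. y \<oplus>\<^bsub>V'\<^esub> x = \<zero>\<^bsub>V'\<^esub>"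
      by (intro bexI[of _ "e (\<ominus>\<^bsub>V\<^esub> u)"]) (auto simp: L.V.M.l_neg)
  qed (auto simp: L.V.M.a_assoc intro!: arg_cong[of _ _ e] L.V.M.a_comm)
  have mod: "module k V'"
    by (rule moduleI)
      (auto simp: ab L.V.smult_l_distr L.V.smult_r_distr L.V.smult_assoc1 L.K.is_cring)
  have bij: "\<rho>' g \<in> Bij (carrier V')" if g: "g \<in> carrier G" for g
  proof -
    have "bij_betw (\<rho>' g) (e ` carrier V) (e ` carrier V)"
    proof (rule bij_betw_byWitness[where f' = "\<lambda>y. e (\<rho> (inv\<^bsub>G\<^esub> g) (d y))"])
      show "\<forall>a\<in>e ` carrier V. e (\<rho> (inv\<^bsub>G\<^esub> g) (d (\<rho>' g a))) = a"
        using g by (auto simp: \<rho>'_def rho_mult[symmetric] rho_one)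
      show "\<forall>a'\<in>e ` carrier V. \<rho>' g (e (\<rho> (inv\<^bsub>G\<^esub> g) (d a'))) = a'"
        using g by (auto simp: \<rho>'_def rho_mult[symmetric] rho_one)
      show "\<rho>' g ` e ` carrier V \<subseteq> e ` carrier V"
        using g by (auto simp: \<rho>'_def)
      show "(\<lambda>y. e (\<rho> (inv\<^bsub>G\<^esub> g) (d y))) ` e ` carrier V \<subseteq> e ` carrier V"
        using g by auto
    qed
    then show ?thesis by (simp add: Bij_def \<rho>'_def)
  qed
  have ga: "group_action G (carrier V') \<rho>'"
    unfolding group_action_def group_hom_def group_hom_axioms_def
  proof (intro conjI homI)
    show "group G" by (rule GH.G.is_group)
    show "group (BijGroup (carrier V'))" by (rule group_BijGroup)
    show "\<rho>' g \<in> carrier (BijGroup (carrier V'))" if "g \<in> carrier G" for g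
      using bij[OF that] by (simp add: BijGroup_def)
    show "\<rho>' (g \<otimes>\<^bsub>G\<^esub> h) = \<rho>' g \<otimes>\<^bsub>BijGroup (carrier V')\<^esub> \<rho>' h"
      if g: "g \<in> carrier G" and h: "h \<in> carrier G" for g h
    proof -
      have "\<rho>' (g \<otimes>\<^bsub>G\<^esub> h) = compose (carrier V') (\<rho>' g) (\<rho>' h)"
        using g h by (auto simp: \<rho>'_def compose_def rho_mult fun_eq_iff)
      then show ?thesis
        using bij[OF g] bij[OF h] by (simp add: BijGroup_def)
    qed
  qed
  have lin: "linear_rep k G V' \<rho>'"
    by (intro linear_rep.intro linear_rep_axioms.intro ga mod L.K.field_axioms)
      (auto simp: \<rho>'_def L.rep_add L.rep_smult)
  have irr': "irreducible_rep k G V' \<rho>'"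
    unfolding irreducible_rep_def
  proof (intro conjI allI impI lin)
    show "carrier V' \<noteq> {\<zero>\<^bsub>V'\<^esub>}"
    proof
      assume eq: "carrier V' = {\<zero>\<^bsub>V'\<^esub>}"
      have "x = \<zero>\<^bsub>V\<^esub>" if "x \<in> carrier V" for x
      proof -
        have "e x \<in> {e \<zero>\<^bsub>V\<^esub>}" using eq that by (metis imageI sel(1,2))
        then show ?thesis using that by simp
      qed
      then show False
        using irr by (auto simp: irreducible_rep_def)
    qed
  next
    fix W assume W: "submodule W k V' \<and> (\<forall>g\<in>carrier G. \<forall>w\<in>W. \<rho>' g w \<in> W)"
    interpret M': module k V' by (rule mod)
    note E = M'.submoduleE[OF conjunct1[OF W]]
    define U where "U = {x \<in> carrier V. e x \<in> W}"
    have WU: "W = e ` U" using E(1) by (auto simp: U_def)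
    have zW: "\<zero>\<^bsub>V'\<^esub> \<in> W"
    proof -
      obtain w where w: "w \<in> W" using E(2) by blast
      then have "w \<oplus>\<^bsub>V'\<^esub> \<ominus>\<^bsub>V'\<^esub> w \<in> W" using E(3,5) by blast
      moreover have "w \<in> carrier V'" using w E(1) by blast
      ultimately show ?thesis by (simp only: M'.M.r_neg)
    qed
    have add: "e (x \<oplus>\<^bsub>V\<^esub> y) \<in> W" if "x \<in> U" "y \<in> U" for x y
      using E(5)[of "e x" "e y"] that by (auto simp: U_def)
    have sm: "e (a \<odot>\<^bsub>V\<^esub> x) \<in> W" if "a \<in> carrier k" "x \<in> U" for a x
      using E(4)[of a "e x"] that by (auto simp: U_def)
    have subU: "submodule U k V"
    proof (rule L.V.submoduleI)
      show "U \<subseteq> carrier V" by (auto simp: U_def)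
      show "\<zero>\<^bsub>V\<^esub> \<in> U" using zW by (auto simp: U_def)
      show "a \<oplus>\<^bsub>V\<^esub> b \<in> U" if "a \<in> U" "b \<in> U" for a b
        using add[OF that] that by (auto simp: U_def)
      show sU: "a \<odot>\<^bsub>V\<^esub> x \<in> U" if "a \<in> carrier k" "x \<in> U" for a x
        using sm[OF that] that by (auto simp: U_def)
      show "\<ominus>\<^bsub>V\<^esub> a \<in> U" if "a \<in> U" for a
      proof -
        have "\<ominus>\<^bsub>V\<^esub> a = (\<ominus>\<^bsub>k\<^esub> \<one>\<^bsub>k\<^esub>) \<odot>\<^bsub>V\<^esub> a"
          using that by (simp add: U_def L.V.smult_l_minus)
        then show ?thesis using sU[of "\<ominus>\<^bsub>k\<^esub> \<one>\<^bsub>k\<^esub>" a] that by simp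
      qed
    qed
    moreover have "\<forall>g\<in>carrier G. \<forall>w\<in>U. \<rho> g w \<in> U"
    proof (intro ballI)
      fix g w assume g: "g \<in> carrier G" and w: "w \<in> U"
      then have "\<rho>' g (e w) \<in> W" using W by (auto simp: U_def)
      then show "\<rho> g w \<in> U" using g w by (auto simp: U_def \<rho>'_def)
    qed
    ultimately have "U = {\<zero>\<^bsub>V\<^esub>} \<or> U = carrier V"
      using irr by (auto simp: irreducible_rep_def)
    then show "W = {\<zero>\<^bsub>V'\<^esub>} \<or> W = carrier V'"
      by (auto simp: WU)
  qed
  have "g = \<one>\<^bsub>G\<^esub>" if g: "g \<in> carrier G" and eq: "\<rho>' g = \<one>\<^bsub>BijGroup (carrier V')\<^esub>" for g
  proof -
    have "\<rho> g x = x" if x: "x \<in> carrier V" for x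
    proof -
      have "\<rho>' g (e x) = e x" using eq x by (simp add: BijGroup_def)
      then have "e (\<rho> g x) = e x" using x by (simp add: \<rho>'_def)
      then show ?thesis using inj_onD[OF inj] g x rho_cl by blast
    qed
    moreover have "\<rho> g \<in> extensional (carrier V)"
      using L.act.bij_prop0[OF g] by (simp add: Bij_def)
    ultimately have "\<rho> g = (\<lambda>x\<in>carrier V. x)"
      by (intro extensionalityI[of _ "carrier V"]) auto
    then have "g \<in> kernel G (BijGroup (carrier V)) \<rho>"
      using g by (simp add: kernel_def BijGroup_def)
    then show ?thesis using faith by (simp add: faithful_rep_def)
  qed
  moreover interpret GH': group_hom G "BijGroup (carrier V')" \<rho>'
    using ga by (rule group_action.group_hom)
  have "\<rho>' \<one>\<^bsub>G\<^esub> = \<one>\<^bsub>BijGroup (carrier V')\<^esub>" by (rule GH'.hom_one)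
  ultimately have "faithful_rep G V' \<rho>'"
    by (auto simp: faithful_rep_def kernel_def)
  with irr' show ?thesis by blast
qed

lemma has_faithful_irreducible_repI:
  fixes V :: "('k, 'v) module"
  assumes irr: "irreducible_rep k G V \<rho>" and faith: "faithful_rep G V \<rho>"
  shows "has_faithful_irreducible_rep k G"
proof -
  interpret L: linear_rep k G V \<rho> using irr by (simp add: irreducible_rep_def)
  interpret GH: group_hom G "BijGroup (carrier V)" \<rho> by (rule L.act.group_hom)
  note GH.hom_mult [simp del] GH.hom_inv [simp del] GH.hom_one [simp del]
  have rho_cl [simp]: "\<rho> g x \<in> carrier V" if "g \<in> carrier G" "x \<in> carrier V" for g x
    using L.act.element_image that by blast
  have rho_zero: "\<rho> g \<zero>\<^bsub>V\<^esub> = \<zero>\<^bsub>V\<^esub>" if "g \<in> carrier G" for g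
    using L.rep_smult[of g "\<zero>\<^bsub>k\<^esub>" "\<zero>\<^bsub>V\<^esub>"] that by simp
  obtain v where v: "v \<in> carrier V" "v \<noteq> \<zero>\<^bsub>V\<^esub>"
    using irr L.V.M.zero_closed by (auto simp: irreducible_rep_def)
  define comb where
    "comb = (\<lambda>l. foldr (\<lambda>(a, g) y. a \<odot>\<^bsub>V\<^esub> \<rho> g v \<oplus>\<^bsub>V\<^esub> y) l \<zero>\<^bsub>V\<^esub>)"
  define words where "words = lists (carrier k \<times> carrier G)"
  have comb_Nil [simp]: "comb [] = \<zero>\<^bsub>V\<^esub>"
    and comb_Cons [simp]: "comb ((a, g) # l) = a \<odot>\<^bsub>V\<^esub> \<rho> g v \<oplus>\<^bsub>V\<^esub> comb l" for a g l
    by (simp_all add: comb_def)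
  have cl: "comb l \<in> carrier V" if "l \<in> words" for l
    using that unfolding words_def by (induction l) (use v in auto)
  have app: "comb (l @ m) = comb l \<oplus>\<^bsub>V\<^esub> comb m" if "l \<in> words" "m \<in> words" for l m
    using that(1) unfolding words_def
  proof (induction l)
    case (Cons p l)
    then have "comb l \<in> carrier V" by (intro cl) (simp add: words_def)
    with Cons that(2) v cl show ?case by (auto simp: L.V.M.a_assoc)
  qed (use cl that(2) in simp)
  have sm: "comb (map (map_prod (\<lambda>b. a \<otimes>\<^bsub>k\<^esub> b) id) l) = a \<odot>\<^bsub>V\<^esub> comb l"
    if a: "a \<in> carrier k" and "l \<in> words" for a l
    using that(2) unfolding words_def
  proof (induction l)
    case (Cons p l)
    then have "comb l \<in> carrier V" by (intro cl) (simp add: words_def)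
    with Cons a v show ?case by (auto simp: L.V.smult_r_distr L.V.smult_assoc1)
  qed (use a in simp)
  have act: "comb (map (map_prod id (\<lambda>h. g \<otimes>\<^bsub>G\<^esub> h)) l) = \<rho> g (comb l)"
    if g: "g \<in> carrier G" and "l \<in> words" for g l
    using that(2) unfolding words_def
  proof (induction l)
    case (Cons p l)
    then have "comb l \<in> carrier V" by (intro cl) (simp add: words_def)
    with Cons g v show ?case
      by (auto simp: L.rep_add L.rep_smult L.act.composition_rule)
  qed (use g rho_zero in simp)
  have sub: "submodule (comb ` words) k V"
  proof (rule L.V.submoduleI)
    show "comb ` words \<subseteq> carrier V" using cl by auto
    show "\<zero>\<^bsub>V\<^esub> \<in> comb ` words" by (rule image_eqI[of _ _ "[]"]) (auto simp: words_def)
    show "x \<oplus>\<^bsub>V\<^esub> y \<in> comb ` words" if "x \<in> comb ` words" "y \<in> comb ` words" for x y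
    proof -
      from that obtain l m where "l \<in> words" "m \<in> words" "x = comb l" "y = comb m" by auto
      then show ?thesis by (intro image_eqI[of _ _ "l @ m"]) (auto simp: app words_def)
    qed
    show smW: "a \<odot>\<^bsub>V\<^esub> x \<in> comb ` words" if "a \<in> carrier k" "x \<in> comb ` words" for a x
    proof -
      from that obtain l where "l \<in> words" "x = comb l" by auto
      moreover from \<open>l \<in> words\<close> that(1) have "map (map_prod (\<lambda>b. a \<otimes>\<^bsub>k\<^esub> b) id) l \<in> words"
        unfolding words_def by (induction l) auto
      ultimately show ?thesis using sm[OF that(1)] by (metis image_eqI)
    qed
    show "\<ominus>\<^bsub>V\<^esub> x \<in> comb ` words" if "x \<in> comb ` words" for x
    proof -
      have "x \<in> carrier V" using that cl by auto
      then have "\<ominus>\<^bsub>V\<^esub> x = (\<ominus>\<^bsub>k\<^esub> \<one>\<^bsub>k\<^esub>) \<odot>\<^bsub>V\<^esub> x"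
        by (simp add: L.V.smult_l_minus)
      then show ?thesis using smW[of "\<ominus>\<^bsub>k\<^esub> \<one>\<^bsub>k\<^esub>" x] that by simp
    qed
  qed
  have inv: "\<forall>g\<in>carrier G. \<forall>w\<in>comb ` words. \<rho> g w \<in> comb ` words"
  proof (intro ballI)
    fix g w assume g: "g \<in> carrier G" and "w \<in> comb ` words"
    then obtain l where "l \<in> words" "w = comb l" by auto
    moreover from \<open>l \<in> words\<close> g have "map (map_prod id (\<lambda>h. g \<otimes>\<^bsub>G\<^esub> h)) l \<in> words"
      unfolding words_def by (induction l) auto
    ultimately show "\<rho> g w \<in> comb ` words" using act[OF g] by (metis image_eqI)
  qed
  have "\<rho> \<one>\<^bsub>G\<^esub> v = v"
    using L.act.id_eq_one v(1) by (metis restrict_apply')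
  then have "comb [(\<one>\<^bsub>k\<^esub>, \<one>\<^bsub>G\<^esub>)] = v" using v by simp
  then have "v \<in> comb ` words"
    by (intro image_eqI[of _ _ "[(\<one>\<^bsub>k\<^esub>, \<one>\<^bsub>G\<^esub>)]"]) (auto simp: words_def)
  with v(2) sub inv irr have full: "comb ` words = carrier V"
    unfolding irreducible_rep_def by blast
  have "inj_on (inv_into words comb) (carrier V)"
    using inj_on_inv_into[of "carrier V" comb words] full by simp
  from transport_rep[OF irr faith this] show ?thesis
    by (simp add: has_faithful_irreducible_rep_def)
qed

text \<open>
  For soluble \<open>G\<close> the socle is a \<open>\<int>G\<close>-module under conjugation, so the corresponding conjunct of
  \<open>locally_cyclic_ZG_module\<close> is automatic there.
\<close>

lemma socle_ZG_module:
  assumes "group G" and solv: "solvable G"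
  shows "ZG_module G (G\<lparr>carrier := socle G\<rparr>) (conj_by G)"
proof -
  interpret group G by fact
  have comm_iff: "x \<otimes>\<^bsub>G\<^esub> y \<otimes>\<^bsub>G\<^esub> inv\<^bsub>G\<^esub> x \<otimes>\<^bsub>G\<^esub> inv\<^bsub>G\<^esub> y = \<one>\<^bsub>G\<^esub> \<longleftrightarrow> x \<otimes>\<^bsub>G\<^esub> y = y \<otimes>\<^bsub>G\<^esub> x"
    if "x \<in> carrier G" "y \<in> carrier G" for x y
  proof -
    have "x \<otimes>\<^bsub>G\<^esub> y \<otimes>\<^bsub>G\<^esub> inv\<^bsub>G\<^esub> x \<otimes>\<^bsub>G\<^esub> inv\<^bsub>G\<^esub> y = (x \<otimes>\<^bsub>G\<^esub> y) \<otimes>\<^bsub>G\<^esub> inv\<^bsub>G\<^esub> (y \<otimes>\<^bsub>G\<^esub> x)"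
      using that by (simp add: m_assoc inv_mult_group)
    then show ?thesis using that by (metis inv_closed inv_equality inv_inv m_closed r_inv)
  qed
  have nsub: "N \<subseteq> carrier G" if "minimal_normal N G" for N
    using that normal_imp_subgroup subgroup.subset by (fastforce simp: minimal_normal_def)
  have comm1: "x \<otimes>\<^bsub>G\<^esub> y = y \<otimes>\<^bsub>G\<^esub> x" if N: "minimal_normal N G" and xy: "x \<in> N" "y \<in> N" for N x y
  proof -
    have nN: "N \<lhd> G" and N1: "N \<noteq> {\<one>\<^bsub>G\<^esub>}" using N by (auto simp: minimal_normal_def)
    have sN: "subgroup N G" using nN by (rule normal_imp_subgroup)
    have car: "x \<in> carrier G" "y \<in> carrier G" using nsub[OF N] xy by auto
    have "derived G N \<noteq> N"
    proof
      assume "derived G N = N"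
      then have it: "(derived G ^^ n) N = N" for n by (induction n) auto
      obtain n where "(derived G ^^ n) (carrier G) = {\<one>\<^bsub>G\<^esub>}"
        using solv solvable_iff_trivial_derived_seq by blast
      then have "N \<subseteq> {\<one>\<^bsub>G\<^esub>}" using mono_exp_of_derived[OF nsub[OF N], of n] it by simp
      with N1 subgroup.one_closed[OF sN] show False by blast
    qed
    then have D: "derived G N = {\<one>\<^bsub>G\<^esub>}"
      using N derived_is_normal[OF nN] derived_incl[OF subset_refl sN]
      by (auto simp: minimal_normal_def)
    have "x \<otimes>\<^bsub>G\<^esub> y \<otimes>\<^bsub>G\<^esub> inv\<^bsub>G\<^esub> x \<otimes>\<^bsub>G\<^esub> inv\<^bsub>G\<^esub> y \<in> derived G N"
      unfolding derived_def by (rule generate.incl) (use xy in blast)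
    then show ?thesis using D comm_iff[OF car] by simp
  qed
  have comm2: "x \<otimes>\<^bsub>G\<^esub> y = y \<otimes>\<^bsub>G\<^esub> x"
    if N: "minimal_normal N G" and M: "minimal_normal M G" and "N \<noteq> M" and xy: "x \<in> N" "y \<in> M"
    for N M x y
  proof -
    have nN: "N \<lhd> G" and nM: "M \<lhd> G" using N M by (auto simp: minimal_normal_def)
    have car: "x \<in> carrier G" "y \<in> carrier G" using nsub[OF N] nsub[OF M] xy by auto
    have int: "N \<inter> M = {\<one>\<^bsub>G\<^esub>}"
    proof (rule ccontr)
      assume ne: "N \<inter> M \<noteq> {\<one>\<^bsub>G\<^esub>}"
      have nor: "N \<inter> M \<lhd> G" by (rule normal_subgroup_intersect[OF nN nM])
      have "N \<inter> M = N" "N \<inter> M = M"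
        using N M nor ne by (auto simp only: minimal_normal_def Int_lower1 Int_lower2)
      with \<open>N \<noteq> M\<close> show False by simp
    qed
    let ?c = "x \<otimes>\<^bsub>G\<^esub> y \<otimes>\<^bsub>G\<^esub> inv\<^bsub>G\<^esub> x \<otimes>\<^bsub>G\<^esub> inv\<^bsub>G\<^esub> y"
    have "y \<otimes>\<^bsub>G\<^esub> inv\<^bsub>G\<^esub> x \<otimes>\<^bsub>G\<^esub> inv\<^bsub>G\<^esub> y \<in> N"
      using normal.inv_op_closed2[OF nN] car subgroup.m_inv_closed[OF normal_imp_subgroup[OF nN]] xy
      by blast
    then have "x \<otimes>\<^bsub>G\<^esub> (y \<otimes>\<^bsub>G\<^esub> inv\<^bsub>G\<^esub> x \<otimes>\<^bsub>G\<^esub> inv\<^bsub>G\<^esub> y) \<in> N"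
      using subgroup.m_closed[OF normal_imp_subgroup[OF nN]] xy by blast
    then have "?c \<in> N" using car by (simp add: m_assoc)
    moreover have "?c \<in> M"
      using normal.inv_op_closed2[OF nM car(1) xy(2)]
        subgroup.m_closed[OF normal_imp_subgroup[OF nM]]
        subgroup.m_inv_closed[OF normal_imp_subgroup[OF nM] xy(2)] by blast
    ultimately have "?c = \<one>\<^bsub>G\<^esub>" using int by blast
    then show ?thesis using comm_iff[OF car] by simp
  qed
  define U where "U = \<Union>{N. minimal_normal N G}"
  have U: "U \<subseteq> carrier G" using nsub by (auto simp: U_def)
  have soc: "socle G = generate G U" by (simp add: socle_def U_def)
  have commU: "x \<otimes>\<^bsub>G\<^esub> y = y \<otimes>\<^bsub>G\<^esub> x" if "x \<in> U" "y \<in> U" for x y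
    using that comm1 comm2 unfolding U_def by blast
  have cent: "subgroup {z \<in> carrier G. \<forall>s\<in>S. z \<otimes>\<^bsub>G\<^esub> s = s \<otimes>\<^bsub>G\<^esub> z} G" if S: "S \<subseteq> carrier G" for S
  proof (rule subgroupI)
    show "{z \<in> carrier G. \<forall>s\<in>S. z \<otimes>\<^bsub>G\<^esub> s = s \<otimes>\<^bsub>G\<^esub> z} \<noteq> {}"
      using S by (auto intro!: exI[of _ "\<one>\<^bsub>G\<^esub>"] simp: subset_iff)
  next
    fix a assume a: "a \<in> {z \<in> carrier G. \<forall>s\<in>S. z \<otimes>\<^bsub>G\<^esub> s = s \<otimes>\<^bsub>G\<^esub> z}"
    have "inv\<^bsub>G\<^esub> a \<otimes>\<^bsub>G\<^esub> s = s \<otimes>\<^bsub>G\<^esub> inv\<^bsub>G\<^esub> a" if "s \<in> S" for s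
    proof -
      have car: "a \<in> carrier G" "s \<in> carrier G" "a \<otimes>\<^bsub>G\<^esub> s = s \<otimes>\<^bsub>G\<^esub> a"
        using a S that by auto
      then have "s = a \<otimes>\<^bsub>G\<^esub> (s \<otimes>\<^bsub>G\<^esub> inv\<^bsub>G\<^esub> a)"
        by (simp add: m_assoc[symmetric]) (simp add: m_assoc)
      then show ?thesis using car by (metis inv_closed inv_solve_left m_closed)
    qed
    then show "inv\<^bsub>G\<^esub> a \<in> {z \<in> carrier G. \<forall>s\<in>S. z \<otimes>\<^bsub>G\<^esub> s = s \<otimes>\<^bsub>G\<^esub> z}"
      using a by simp
  next
    fix a b
    assume ab: "a \<in> {z \<in> carrier G. \<forall>s\<in>S. z \<otimes>\<^bsub>G\<^esub> s = s \<otimes>\<^bsub>G\<^esub> z}"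
      "b \<in> {z \<in> carrier G. \<forall>s\<in>S. z \<otimes>\<^bsub>G\<^esub> s = s \<otimes>\<^bsub>G\<^esub> z}"
    have "a \<otimes>\<^bsub>G\<^esub> b \<otimes>\<^bsub>G\<^esub> s = s \<otimes>\<^bsub>G\<^esub> (a \<otimes>\<^bsub>G\<^esub> b)" if "s \<in> S" for s
    proof -
      have car: "s \<in> carrier G" "a \<in> carrier G" "b \<in> carrier G"
        and eqs: "a \<otimes>\<^bsub>G\<^esub> s = s \<otimes>\<^bsub>G\<^esub> a" "b \<otimes>\<^bsub>G\<^esub> s = s \<otimes>\<^bsub>G\<^esub> b"
        using S that ab by auto
      have "a \<otimes>\<^bsub>G\<^esub> b \<otimes>\<^bsub>G\<^esub> s = a \<otimes>\<^bsub>G\<^esub> (b \<otimes>\<^bsub>G\<^esub> s)" using car by (simp add: m_assoc)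
      also have "\<dots> = a \<otimes>\<^bsub>G\<^esub> s \<otimes>\<^bsub>G\<^esub> b" using car by (simp add: eqs(2) m_assoc)
      also have "\<dots> = s \<otimes>\<^bsub>G\<^esub> (a \<otimes>\<^bsub>G\<^esub> b)" using car by (simp add: eqs(1) m_assoc)
      finally show ?thesis .
    qed
    then show "a \<otimes>\<^bsub>G\<^esub> b \<in> {z \<in> carrier G. \<forall>s\<in>S. z \<otimes>\<^bsub>G\<^esub> s = s \<otimes>\<^bsub>G\<^esub> z}"
      using ab by simp
  qed auto
  have c1: "socle G \<subseteq> {z \<in> carrier G. \<forall>s\<in>U. z \<otimes>\<^bsub>G\<^esub> s = s \<otimes>\<^bsub>G\<^esub> z}"
    unfolding soc by (rule generate_subgroup_incl[OF _ cent[OF U]]) (use U commU in auto)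
  have socsub: "socle G \<subseteq> carrier G" unfolding soc by (rule generate_incl[OF U])
  have c2: "socle G \<subseteq> {z \<in> carrier G. \<forall>s\<in>socle G. z \<otimes>\<^bsub>G\<^esub> s = s \<otimes>\<^bsub>G\<^esub> z}"
    unfolding soc using c1 U
    by (intro generate_subgroup_incl[OF _ cent[OF generate_incl[OF U]]]) (auto simp: soc)
  have socG: "subgroup (socle G) G" unfolding soc by (rule generate_is_subgroup[OF U])
  have "socle G \<lhd> G"
    unfolding soc
  proof (rule normal_generateI[OF U])
    fix h g assume "h \<in> U" and g: "g \<in> carrier G"
    then obtain N where "minimal_normal N G" "h \<in> N" by (auto simp: U_def)
    with g show "g \<otimes>\<^bsub>G\<^esub> h \<otimes>\<^bsub>G\<^esub> inv\<^bsub>G\<^esub> g \<in> U"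
      unfolding U_def minimal_normal_def by (blast intro: normal.inv_op_closed2)
  qed
  then have conj: "conj_by G g x \<in> socle G" if "g \<in> carrier G" "x \<in> socle G" for g x
    using that by (simp add: conj_by_def normal.inv_op_closed2)
  interpret S: group "G\<lparr>carrier := socle G\<rparr>"
    by (rule subgroup.subgroup_is_group[OF socG is_group])
  show ?thesis
  proof (intro ZG_module.intro ZG_module_axioms.intro is_group)
    show "comm_group (G\<lparr>carrier := socle G\<rparr>)"
      by (rule S.group_comm_groupI) (use c2 in auto)
    fix g h x y
    assume gx: "g \<in> carrier G" "x \<in> carrier (G\<lparr>carrier := socle G\<rparr>)"
    then have x: "x \<in> carrier G" using socsub by auto
    show "conj_by G g x \<in> carrier (G\<lparr>carrier := socle G\<rparr>)" using gx conj by simp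
    show "conj_by G (g \<otimes>\<^bsub>G\<^esub> h) x = conj_by G g (conj_by G h x)" if "h \<in> carrier G"
      using that gx x by (simp add: conj_by_def m_assoc inv_mult_group)
    show "conj_by G g (x \<otimes>\<^bsub>G\<lparr>carrier := socle G\<rparr>\<^esub> y) =
        conj_by G g x \<otimes>\<^bsub>G\<lparr>carrier := socle G\<rparr>\<^esub> conj_by G g y"
      if "y \<in> carrier (G\<lparr>carrier := socle G\<rparr>)"
    proof -
      have y: "y \<in> carrier G" using that socsub by auto
      have "inv\<^bsub>G\<^esub> g \<otimes>\<^bsub>G\<^esub> (g \<otimes>\<^bsub>G\<^esub> z) = z" if "z \<in> carrier G" for z
        using gx(1) that by (simp add: m_assoc[symmetric])
      then show ?thesis using gx(1) x y by (simp add: conj_by_def m_assoc)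
    qed
  next
    fix x assume "x \<in> carrier (G\<lparr>carrier := socle G\<rparr>)"
    then show "conj_by G \<one>\<^bsub>G\<^esub> x = x" using socsub by (auto simp: conj_by_def)
  qed
qed

end

theory Submission
  imports Defs "HOL-Computational_Algebra.Computational_Algebra" "HOL-Library.Function_Algebras"
begin

text \<open>
  Write \<open>p\<close> for the characteristic of \<open>k\<close>.

  Suppose first that \<open>G\<close> has a faithful irreducible representation. The vectors fixed by a normal
  subgroup form a subrepresentation, so only the trivial normal subgroup fixes a nonzero vector.
  The elements of order dividing \<open>p\<close> in the socle form a finite normal subgroup that acts
  unipotently and therefore fixes a nonzero vector; so it is trivial
  (\<open>no_char_torsion_in_abelian_normal\<close>). For a prime \<open>q \<noteq> p\<close> let \<open>F\<close> be a finite normal subgroup of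
  exponent \<open>q\<close> in the socle, and \<open>K\<close> the stabiliser in \<open>F\<close> of a nonzero vector, as large as possible. Then \<open>K\<close>
  contains no nontrivial normal subgroup of \<open>G\<close> and \<open>F / K\<close> is cyclic
  (\<open>cyclic_core_free_quotient\<close>), which gives a complex character of \<open>F\<close> whose kernel contains no
  nontrivial normal subgroup of \<open>G\<close>. Since \<open>F\<close> is a semisimple module, such a character exists if and only
  if \<open>F\<close> is generated, as a normal subgroup, by one element. This duality is obtained by counting
  homomorphisms (\<open>cyclic_if_core_free_char\<close>, \<open>core_free_char_if_cyclic\<close>). Single generators for
  different primes combine to one generator.

  Conversely, the duality turns generators of the \<open>q\<close>-parts of the socle into characters, which are
  glued to a character of a torsion subgroup whose values are roots of unity of order prime to \<open>p\<close>.
  Let \<open>A\<close> be a maximal abelian normal subgroup; it meets every nontrivial normal subgroup. The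
  character is extended within \<open>A\<close> until it is nontrivial on every nontrivial torsion-free normal
  subgroup of \<open>G\<close> contained in \<open>A\<close>. Such a subgroup has an infinite \<open>r\<close>-section for a prime \<open>r \<noteq> p\<close>, so it
  contains an element to which the character may give a primitive \<open>r\<close>-th root of unity as value
  (\<open>extend_char_nontrivially\<close>). Extending the kernel as far as possible yields a subgroup \<open>K\<close> of \<open>A\<close>
  such that \<open>A / K\<close> behaves like a group of roots of unity of order prime to \<open>p\<close> and \<open>K\<close> contains no
  \<open>N \<inter> A\<close> with \<open>N \<noteq> 1\<close> normal (\<open>subgroup_cutting_out_kernel\<close>). This suffices for a
  faithful irreducible representation (\<open>faithful_irreducible_from_subgroup\<close>).

  Both directions use that minimal normal subgroups of a soluble group of finite rank have prime
  exponent (\<open>minimal_normal_finite_rank\<close>), so that the socle is a sum of finite semisimple parts.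
\<close>

section \<open>Abelian groups of finite rank\<close>

lemma (in comm_group) square_mult_int_pow:
  assumes "x \<in> carrier G" "w \<in> carrier G"
  shows "(x [^] (i::int) \<otimes> w) [^] (2::nat) = x [^] (2 * i) \<otimes> w [^] (2::nat)"
proof -
  have "x [^] (2 * i) = x [^] i \<otimes> x [^] i" using int_pow_mult[OF assms(1), of i i] by (simp only: mult_2)
  then have "(x [^] i) [^] (2::nat) = x [^] (2 * i)" using assms by (simp add: numeral_2_eq_2)
  then show ?thesis using assms by (simp add: nat_pow_distrib)
qed

lemma (in comm_group) generate_insert_mult:
  assumes Y: "Y \<subseteq> carrier G" "y \<in> carrier G" and x: "x \<in> generate G (insert y Y)"
  obtains i :: int and z where "z \<in> generate G Y" "x = y [^] i \<otimes> z"
proof -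
  let ?S = "{y [^] i \<otimes> z | (i::int) z. z \<in> generate G Y}"
  have gY: "generate G Y \<subseteq> carrier G" using generate_incl[OF Y(1)] .
  have sub: "subgroup ?S G"
  proof (rule subgroupI)
    show "?S \<subseteq> carrier G" using gY Y by auto
    show "?S \<noteq> {}" using generate.one by blast
    fix a assume "a \<in> ?S"
    then obtain i :: int and z where a: "z \<in> generate G Y" "a = y [^] i \<otimes> z" by blast
    have "inv a = y [^] (-i) \<otimes> inv z" using a gY Y
      by (simp add: inv_mult_group m_comm int_pow_neg subset_iff)
    moreover have "inv z \<in> generate G Y" using a generate_m_inv_closed[OF Y(1)] by blast
    ultimately show "inv a \<in> ?S" by blast
    fix b assume "b \<in> ?S"
    then obtain j :: int and w where b: "w \<in> generate G Y" "b = y [^] j \<otimes> w" by blast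
    have zw: "z \<in> carrier G" "w \<in> carrier G" using a b gY by auto
    have "a \<otimes> b = y [^] (i + j) \<otimes> (z \<otimes> w)" using a b zw Y by (simp add: int_pow_mult m_ac)
    moreover have "z \<otimes> w \<in> generate G Y" using generate.eng[OF a(1) b(1)] .
    ultimately show "a \<otimes> b \<in> ?S" by blast
  qed
  have "insert y Y \<subseteq> ?S"
  proof
    fix x assume x: "x \<in> insert y Y"
    then consider "x = y" | "x \<in> Y" by blast
    then show "x \<in> ?S"
    proof cases
      case 1
      then have "x = y [^] (1::int) \<otimes> \<one>" using Y by simp
      then show ?thesis using generate.one by blast
    next
      case 2
      then have "x = y [^] (0::int) \<otimes> x" using Y by auto
      then show ?thesis using generate.incl[OF 2] by blast
    qed
  qed
  then have "generate G (insert y Y) \<subseteq> ?S" by (rule generate_subgroup_incl[OF _ sub])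
  with x that show thesis by blast
qed

lemma (in comm_group) generate_card_le:
  assumes "finite Y" "Y \<subseteq> carrier G" "m > 0" "\<And>y. y \<in> Y ==> y [^] (m::nat) = \<one>"
  shows "finite (generate G Y) \<and> card (generate G Y) \<le> m ^ card Y"
  using assms
proof (induction Y rule: finite_induct)
  case empty
  then show ?case by (simp add: generate_empty)
next
  case (insert y Y)
  then have IH: "finite (generate G Y)" "card (generate G Y) \<le> m ^ card Y" by auto
  have y: "y \<in> carrier G" "Y \<subseteq> carrier G" "y [^] m = \<one>" using insert by auto
  have sub: "generate G (insert y Y) \<subseteq> (\<lambda>(i, z). y [^] (i::nat) \<otimes> z) ` ({..<m} \<times> generate G Y)"
  proof
    fix x assume "x \<in> generate G (insert y Y)"
    then obtain i :: int and z where iz: "z \<in> generate G Y" "x = y [^] i \<otimes> z"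
      using generate_insert_mult y by metis
    define j where "j = nat (i mod int m)"
    have j: "j < m" "int j = i mod int m" using insert.prems(2) by (auto simp: j_def nat_less_iff)
    have "y [^] i = y [^] (int m * (i div int m) + int j)" by (simp add: j(2))
    also have "\<dots> = (y [^] int m) [^] (i div int m) \<otimes> y [^] int j"
      using y by (simp add: int_pow_mult int_pow_pow)
    also have "\<dots> = y [^] j" using y by (simp add: int_pow_int)
    finally show "x \<in> (\<lambda>(i, z). y [^] (i::nat) \<otimes> z) ` ({..<m} \<times> generate G Y)"
      using iz j by auto
  qed
  have fin: "finite ({..<m} \<times> generate G Y)" using IH by simp
  have "card (generate G (insert y Y)) \<le> card ({..<m} \<times> generate G Y)"
    using surj_card_le[OF fin sub] .
  also have "\<dots> \<le> m * m ^ card Y" using IH by (simp add: card_cartesian_product)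
  finally show ?case using insert.hyps finite_subset[OF sub] fin by simp
qed

text \<open>A finite set of elements of exponent \<open>m\<close> lies in a group generated by \<open>r\<close> elements of exponent \<open>m\<close>,
  which has at most \<open>m ^ r\<close> elements.\<close>

lemma (in comm_group) finite_exponent_if_finite_rank:
  assumes "finite_rank G" "m > 0"
  shows "finite {x \<in> carrier G. x [^] (m::nat) = \<one>}"
proof -
  let ?O = "{x \<in> carrier G. x [^] m = \<one>}"
  obtain r where r: "\<And>S. S \<subseteq> carrier G ==> finite S ==>
      \<exists>T \<subseteq> carrier G. finite T \<and> card T \<le> r \<and> generate G T = generate G S"
    using assms(1) by (auto simp: finite_rank_def)
  have sub: "subgroup ?O G"
    by (rule subgroupI) (auto simp: nat_pow_distrib nat_pow_inv intro!: exI[of _ \<one>])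
  have "finite ?O \<and> card ?O \<le> m ^ r"
  proof (rule finite_if_finite_subsets_card_bdd)
    fix S assume S: "S \<subseteq> ?O" "finite S"
    obtain T where T: "T \<subseteq> carrier G" "finite T" "card T \<le> r" "generate G T = generate G S"
      using r[of S] S by blast
    have gO: "generate G S \<subseteq> ?O" using generate_subgroup_incl[OF S(1) sub] .
    have TO: "T \<subseteq> ?O" using T(4) gO generate.incl[of _ T G] by blast
    have "finite (generate G T) \<and> card (generate G T) \<le> m ^ card T"
      by (rule generate_card_le) (use T TO assms(2) in auto)
    moreover have "S \<subseteq> generate G T" unfolding T(4) by (auto intro: generate.incl)
    ultimately have "card S \<le> m ^ card T" by (meson card_mono order_trans)
    also have "\<dots> \<le> m ^ r" using T(3) assms(2) by (simp add: power_increasing)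
    finally show "card S \<le> m ^ r" .
  qed
  then show ?thesis ..
qed

text \<open>Otherwise elements of infinite order modulo the group generated so far can be adjoined forever.
  After \<open>s\<close> steps there are \<open>2 ^ s\<close> elements that are pairwise incongruent modulo squares, whereas
  a group with \<open>r\<close> generators has at most \<open>2 ^ r\<close> classes modulo squares.\<close>

lemma (in comm_group) torsion_over_finite_if_finite_rank:
  assumes "finite_rank G"
  shows "\<exists>Y \<subseteq> carrier G. finite Y \<and> (\<forall>x\<in>carrier G. \<exists>n::nat. n > 0 \<and> x [^] n \<in> generate G Y)"
proof (rule ccontr)
  assume neg: "\<not> ?thesis"
  obtain r where r: "\<And>S. S \<subseteq> carrier G ==> finite S ==>
      \<exists>T \<subseteq> carrier G. finite T \<and> card T \<le> r \<and> generate G T = generate G S"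
    using assms(1) by (auto simp: finite_rank_def)
  have big: "\<exists>Y E. Y \<subseteq> carrier G \<and> finite Y \<and> E \<subseteq> generate G Y \<and> finite E \<and> card E = 2 ^ s \<and>
      (\<forall>a\<in>E. \<forall>b\<in>E. \<forall>z\<in>generate G Y. a = b \<otimes> z [^] (2::nat) --> a = b)" for s :: nat
  proof (induction s)
    case 0
    then show ?case by (intro exI[of _ "{}"] exI[of _ "{\<one>}"]) (auto simp: generate_empty)
  next
    case (Suc s)
    then obtain Y E where Y: "Y \<subseteq> carrier G" "finite Y" and E: "E \<subseteq> generate G Y" "finite E" "card E = 2 ^ s"
      and dis: "\<And>a b z. a \<in> E ==> b \<in> E ==> z \<in> generate G Y ==> a = b \<otimes> z [^] (2::nat) ==> a = b"
      by metis
    have gY: "generate G Y \<subseteq> carrier G" using generate_incl[OF Y(1)] .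
    have EG: "E \<subseteq> carrier G" using E gY by blast
    have sY: "subgroup (generate G Y) G" using generate_is_subgroup[OF Y(1)] .
    obtain x where x: "x \<in> carrier G" "\<And>n::nat. n > 0 ==> x [^] n \<notin> generate G Y"
      using neg Y by blast
    have xi: "i = 0" if "x [^] (i::int) \<in> generate G Y" for i
    proof (rule ccontr)
      assume "i \<noteq> 0"
      have "x [^] (-i) \<in> generate G Y"
        using subgroup.m_inv_closed[OF sY that] x by (simp add: int_pow_neg)
      then have "x [^] \<bar>i\<bar> \<in> generate G Y" using that by (cases "i \<ge> 0") auto
      then have "x [^] (nat \<bar>i\<bar>) \<in> generate G Y" by (simp add: int_pow_int[symmetric])
      then show False using x(2)[of "nat \<bar>i\<bar>"] \<open>i \<noteq> 0\<close> by simp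
    qed
    let ?Y = "insert x Y" and ?E = "E \<union> (\<lambda>e. x \<otimes> e) ` E"
    have mono: "generate G Y \<subseteq> generate G ?Y" by (rule mono_generate) auto
    have xY: "x \<in> generate G ?Y" by (rule generate.incl) auto
    have key: "a = b" if h: "a = x [^] (k::int) \<otimes> e" "b = x [^] (l::int) \<otimes> f" "e \<in> E" "f \<in> E"
      "k \<in> {0, 1}" "l \<in> {0, 1}" "z \<in> generate G ?Y" "a = b \<otimes> z [^] (2::nat)" for a b e f k l z
    proof -
      obtain i :: int and w where w: "w \<in> generate G Y" "z = x [^] i \<otimes> w"
        using generate_insert_mult[OF Y(1) x(1) h(7)] by blast
      have car: "e \<in> carrier G" "f \<in> carrier G" "w \<in> carrier G" using h w EG gY by auto
      have z2: "z [^] (2::nat) = x [^] (2 * i) \<otimes> w [^] (2::nat)"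
        using w car x by (simp add: square_mult_int_pow)
      have "x [^] k \<otimes> e = x [^] (l + 2 * i) \<otimes> (f \<otimes> w [^] (2::nat))"
        using h(1,2,8) z2 car x by (simp add: int_pow_mult m_ac)
      then have "x [^] k = x [^] (l + 2 * i) \<otimes> (f \<otimes> w [^] (2::nat)) \<otimes> inv e"
        using car x by (simp add: inv_solve_right)
      then have "x [^] (k - (l + 2 * i)) = f \<otimes> w [^] (2::nat) \<otimes> inv e"
        using car x by (simp add: int_pow_diff m_ac)
      moreover have "f \<otimes> w [^] (2::nat) \<otimes> inv e \<in> generate G Y"
      proof -
        have "e \<in> generate G Y" "f \<in> generate G Y" using h(3,4) E(1) by auto
        moreover have "w [^] (2::nat) = w \<otimes> w" using car by (simp add: numeral_2_eq_2)
        ultimately show ?thesis using w(1) by (simp add: subgroup.m_closed[OF sY] subgroup.m_inv_closed[OF sY])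
      qed
      ultimately have "k - (l + 2 * i) = 0" by (intro xi) simp
      moreover have "k = 0 \<or> k = 1" "l = 0 \<or> l = 1" using h(5,6) by auto
      ultimately have "k = l \<and> i = 0" by presburger
      then have kl: "k = l" "i = 0" by auto
      then have "e = f \<otimes> w [^] (2::nat)"
        using \<open>x [^] k \<otimes> e = _\<close> car x by simp
      then have "e = f" using dis h w by blast
      then show "a = b" using h kl by simp
    qed
    have rep: "\<exists>k\<in>{0, 1::int}. \<exists>e\<in>E. a = x [^] k \<otimes> e" if "a \<in> ?E" for a
    proof -
      have "\<And>e. e \<in> E ==> e = x [^] (0::int) \<otimes> e" "\<And>e. x \<otimes> e = x [^] (1::int) \<otimes> e"
        using x EG by (auto simp: subset_iff)
      then show ?thesis using that by blast
    qed
    have "\<forall>a\<in>?E. \<forall>b\<in>?E. \<forall>z\<in>generate G ?Y. a = b \<otimes> z [^] (2::nat) --> a = b"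
    proof (intro ballI impI)
      fix a b z assume h: "a \<in> ?E" "b \<in> ?E" "z \<in> generate G ?Y" "a = b \<otimes> z [^] (2::nat)"
      obtain k e l f where "k \<in> {0, 1::int}" "e \<in> E" "a = x [^] k \<otimes> e" "l \<in> {0, 1::int}" "f \<in> E" "b = x [^] l \<otimes> f"
        using rep[OF h(1)] rep[OF h(2)] by blast
      then show "a = b" using key h by metis
    qed
    moreover have "card ?E = 2 ^ Suc s"
    proof -
      have "E \<inter> (\<lambda>e. x \<otimes> e) ` E = {}"
      proof (rule ccontr)
        assume "E \<inter> (\<lambda>e. x \<otimes> e) ` E \<noteq> {}"
        then obtain e f where ef: "e \<in> E" "f \<in> E" "e = x \<otimes> f" by blast
        then have "x = e \<otimes> inv f" using EG x by (auto simp: m_assoc subset_iff)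
        moreover have "e \<otimes> inv f \<in> generate G Y"
          using subsetD[OF E(1) ef(1)] subsetD[OF E(1) ef(2)]
          by (simp add: subgroup.m_closed[OF sY] subgroup.m_inv_closed[OF sY])
        ultimately show False using xi[of 1] x by simp
      qed
      moreover have "inj_on (\<lambda>e. x \<otimes> e) E" using x EG by (auto simp: inj_on_def subset_iff)
      ultimately show ?thesis using E by (simp add: card_Un_disjoint card_image)
    qed
    moreover have "?E \<subseteq> generate G ?Y" using E mono xY by (auto intro: generate.eng)
    ultimately show ?case using Y E x by (intro exI[of _ ?Y] exI[of _ ?E]) auto
  qed
  have small: "\<exists>D. finite D \<and> card D \<le> 2 ^ card T \<and> D \<subseteq> generate G T \<and> (\<forall>h\<in>generate G T. \<exists>d\<in>D. \<exists>z\<in>generate G T. h = d \<otimes> z [^] (2::nat))"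
    if "finite T" "T \<subseteq> carrier G" for T
    using that
  proof (induction T rule: finite_induct)
    case empty
    then show ?case by (intro exI[of _ "{\<one>}"]) (auto simp: generate_empty)
  next
    case (insert t T)
    then obtain D where D: "finite D" "card D \<le> 2 ^ card T" "D \<subseteq> generate G T"
      "\<And>h. h \<in> generate G T ==> \<exists>d\<in>D. \<exists>z\<in>generate G T. h = d \<otimes> z [^] (2::nat)" by auto
    have t: "t \<in> carrier G" "T \<subseteq> carrier G" using insert by auto
    have gT: "generate G T \<subseteq> carrier G" using generate_incl[OF t(2)] .
    have mono: "generate G T \<subseteq> generate G (insert t T)" by (rule mono_generate) auto
    have tT: "t \<in> generate G (insert t T)" by (rule generate.incl) auto
    have sT: "subgroup (generate G (insert t T)) G" using t by (intro generate_is_subgroup) auto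
    let ?D = "D \<union> (\<lambda>d. t \<otimes> d) ` D"
    have "\<exists>d\<in>?D. \<exists>z\<in>generate G (insert t T). h = d \<otimes> z [^] (2::nat)" if h: "h \<in> generate G (insert t T)" for h
    proof -
      obtain i :: int and y where y: "y \<in> generate G T" "h = t [^] i \<otimes> y"
        using generate_insert_mult[OF t(2,1) h] by blast
      obtain d z where d: "d \<in> D" "z \<in> generate G T" "y = d \<otimes> z [^] (2::nat)" using D(4)[OF y(1)] by blast
      have car: "d \<in> carrier G" "z \<in> carrier G" using d D gT by auto
      define j where "j = i div 2"
      have tj: "t [^] j \<in> generate G (insert t T)"
        using subgroup_int_pow_closed[OF sT tT] .
      let ?z = "t [^] j \<otimes> z"
      have zT: "?z \<in> generate G (insert t T)" using tj d mono by (auto intro: generate.eng)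
      have z2: "?z [^] (2::nat) = t [^] (2 * j) \<otimes> z [^] (2::nat)"
        using car t by (simp add: square_mult_int_pow)
      show ?thesis
      proof (cases "even i")
        case True
        then have "h = d \<otimes> ?z [^] (2::nat)" using y d z2 car t by (simp add: j_def m_ac)
        then show ?thesis using zT d by blast
      next
        case False
        then have "i = 2 * j + 1" by (simp add: j_def)
        then have "h = (t \<otimes> d) \<otimes> ?z [^] (2::nat)" using y d z2 car t by (simp add: int_pow_mult m_ac)
        then show ?thesis using zT d by blast
      qed
    qed
    moreover have "card ?D \<le> 2 ^ card (insert t T)"
    proof -
      have "card ?D \<le> card D + card ((\<lambda>d. t \<otimes> d) ` D)" by (rule card_Un_le)
      also have "\<dots> \<le> card D + card D" using card_image_le[OF D(1)] by simp
      finally show ?thesis using D insert.hyps by simp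
    qed
    moreover have "?D \<subseteq> generate G (insert t T)" using D mono tT by (auto intro: generate.eng)
    ultimately show ?case using D by (intro exI[of _ ?D]) auto
  qed
  obtain Y E where Y: "Y \<subseteq> carrier G" "finite Y" and E: "E \<subseteq> generate G Y" "finite E" "card E = 2 ^ Suc r"
    and dis: "\<And>a b z. a \<in> E ==> b \<in> E ==> z \<in> generate G Y ==> a = b \<otimes> z [^] (2::nat) ==> a = b"
    using big[of "Suc r"] by metis
  obtain T where T: "T \<subseteq> carrier G" "finite T" "card T \<le> r" "generate G T = generate G Y"
    using r[OF Y] by blast
  obtain D where D: "finite D" "card D \<le> 2 ^ card T" "D \<subseteq> generate G T"
      "\<And>h. h \<in> generate G T ==> \<exists>d\<in>D. \<exists>z\<in>generate G T. h = d \<otimes> z [^] (2::nat)"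
    using small[OF T(2,1)] by blast
  have sT: "subgroup (generate G T) G" using generate_is_subgroup[OF T(1)] .
  have gT: "generate G T \<subseteq> carrier G" using generate_incl[OF T(1)] .
  obtain d where d: "\<And>h. h \<in> generate G T ==> d h \<in> D \<and> (\<exists>z\<in>generate G T. h = d h \<otimes> z [^] (2::nat))"
    using D(4) by metis
  have "inj_on d E"
  proof (rule inj_onI)
    fix a b assume ab: "a \<in> E" "b \<in> E" "d a = d b"
    then obtain z w where zw: "z \<in> generate G T" "w \<in> generate G T" "a = d a \<otimes> z [^] (2::nat)" "b = d a \<otimes> w [^] (2::nat)"
      using d E T(4) by (metis subsetD)
    have car: "z \<in> carrier G" "w \<in> carrier G" "d a \<in> carrier G"
    proof -
      have "a \<in> generate G T" using ab(1) E(1) T(4) by blast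
      then have "d a \<in> D" using d by blast
      then show "z \<in> carrier G" "w \<in> carrier G" "d a \<in> carrier G" using zw(1,2) D(3) gT by auto
    qed
    have "b \<otimes> (z \<otimes> inv w) [^] (2::nat) = d a \<otimes> (w \<otimes> (z \<otimes> inv w)) [^] (2::nat)"
      unfolding zw(4) using car by (simp add: nat_pow_distrib m_assoc)
    also have "w \<otimes> (z \<otimes> inv w) = z" using car by (metis inv_closed l_inv m_assoc m_comm r_one)
    finally have "a = b \<otimes> (z \<otimes> inv w) [^] (2::nat)" using zw(3) by simp
    moreover have "z \<otimes> inv w \<in> generate G Y"
      using zw T(4) subgroup.m_closed[OF sT] subgroup.m_inv_closed[OF sT] by simp
    ultimately show "a = b" using dis ab by blast
  qed
  then have "card E \<le> card D" using d E T(4) D(1) by (intro card_inj_on_le[of d]) auto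
  also have "\<dots> \<le> 2 ^ r" using D(2) T(3) by (meson le_trans one_le_numeral power_increasing)
  finally show False using E by simp
qed

text \<open>Finitely generated abelian groups are countable, and \<open>x \<mapsto> x ^ n\<close> has finite fibres.\<close>

lemma (in comm_group) countable_if_finite_rank:
  assumes "finite_rank G"
  shows "countable (carrier G)"
proof -
  obtain Y where Y: "Y \<subseteq> carrier G" "finite Y" "\<And>x. x \<in> carrier G ==> \<exists>n::nat. n > 0 \<and> x [^] n \<in> generate G Y"
    using torsion_over_finite_if_finite_rank[OF assms] by blast
  have cY: "countable (generate G Y)" using Y(2,1)
  proof (induction Y rule: finite_induct)
    case (insert y Y)
    have "generate G (insert y Y) \<subseteq> (\<lambda>(i::int, z). y [^] i \<otimes> z) ` (UNIV \<times> generate G Y)"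
    proof
      fix x assume "x \<in> generate G (insert y Y)"
      then obtain i :: int and z where "z \<in> generate G Y" "x = y [^] i \<otimes> z"
        using generate_insert_mult insert.prems by (metis insert_subset)
      then show "x \<in> (\<lambda>(i::int, z). y [^] i \<otimes> z) ` (UNIV \<times> generate G Y)" by auto
    qed
    then show ?case using insert by (meson countable_SIGMA countable_image countable_subset countableI_type insert_subset)
  qed (simp add: generate_empty)
  have fib: "finite {x \<in> carrier G. x [^] n = y}" if n: "n > 0" for n :: nat and y
  proof (cases "{x \<in> carrier G. x [^] n = y} = {}")
    case False
    then obtain a where a: "a \<in> carrier G" "a [^] n = y" by blast
    have "{x \<in> carrier G. x [^] n = y} \<subseteq> (\<lambda>t. a \<otimes> t) ` {x \<in> carrier G. x [^] n = \<one>}"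
    proof
      fix x assume x: "x \<in> {x \<in> carrier G. x [^] n = y}"
      have "(inv a \<otimes> x) [^] n = \<one>" using x a(1) by (auto simp: a(2)[symmetric] nat_pow_distrib nat_pow_inv)
      moreover have "x = a \<otimes> (inv a \<otimes> x)" using x a by (simp add: m_assoc[symmetric])
      ultimately show "x \<in> (\<lambda>t. a \<otimes> t) ` {x \<in> carrier G. x [^] n = \<one>}" using x a by blast
    qed
    then show ?thesis using finite_exponent_if_finite_rank[OF assms n] by (meson finite_imageI finite_subset)
  next
    case True
    then show ?thesis by (simp only: finite.emptyI)
  qed
  have "carrier G \<subseteq> (\<Union>n\<in>{0<..}. \<Union>y\<in>generate G Y. {x \<in> carrier G. x [^] (n::nat) = y})"
    using Y(3) by fastforce
  moreover have "countable \<dots>" using fib by (intro countable_UN[OF countableI_type] countable_UN[OF cY] countable_finite) auto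
  ultimately show ?thesis by (rule countable_subset)
qed

section \<open>Valuation rings among the complex numbers\<close>

definition add_subgroup :: "complex set => bool" where
  "add_subgroup S \<longleftrightarrow> 0 \<in> S \<and> (\<forall>a\<in>S. \<forall>b\<in>S. a - b \<in> S)"

definition zspan :: "complex set => complex set" where
  "zspan Y = \<Inter>{S. add_subgroup S \<and> Y \<subseteq> S}"

lemma add_subgroupD:
  assumes "add_subgroup S"
  shows "0 \<in> S" "a \<in> S ==> b \<in> S ==> a - b \<in> S" "a \<in> S ==> -a \<in> S"
    "a \<in> S ==> b \<in> S ==> a + b \<in> S" "a \<in> S ==> of_nat n * a \<in> S" "a \<in> S ==> of_int i * a \<in> S"
proof -
  show z: "0 \<in> S" and d: "\<And>a b. a \<in> S ==> b \<in> S ==> a - b \<in> S"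
    using assms by (auto simp: add_subgroup_def)
  show m: "-a \<in> S" if "a \<in> S" for a using d[OF z that] by simp
  show p: "a + b \<in> S" if "a \<in> S" "b \<in> S" for a b using d[OF that(1) m[OF that(2)]] by simp
  show n: "of_nat n * a \<in> S" if "a \<in> S" for n a
    using that by (induction n) (auto simp: z ring_distribs intro: p)
  show "of_int i * a \<in> S" if "a \<in> S" for i a
    by (cases i rule: int_cases2) (use n[OF that] m in auto)
qed

lemma zspan_props: "add_subgroup (zspan Y)" "Y \<subseteq> zspan Y" "add_subgroup S ==> Y \<subseteq> S ==> zspan Y \<subseteq> S"
  by (auto simp: zspan_def add_subgroup_def)

lemma zspan_insert:
  assumes "x \<in> zspan (insert y Y)"
  obtains c z where "z \<in> zspan Y" "x = of_int c * y + z"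
proof -
  let ?S = "{of_int c * y + z | c z. z \<in> zspan Y}"
  have "add_subgroup ?S" unfolding add_subgroup_def
  proof (intro conjI ballI)
    have "0 = of_int 0 * y + 0" by simp
    then show "0 \<in> ?S" using add_subgroupD(1)[OF zspan_props(1)[of Y]] by blast
    fix a b assume "a \<in> ?S" "b \<in> ?S"
    then obtain c z c' z' where h: "z \<in> zspan Y" "a = of_int c * y + z" "z' \<in> zspan Y" "b = of_int c' * y + z'"
      by blast
    have "a - b = of_int (c - c') * y + (z - z')" using h by (simp add: algebra_simps)
    with add_subgroupD(2)[OF zspan_props(1) h(1,3)] show "a - b \<in> ?S" by blast
  qed
  moreover have "insert y Y \<subseteq> ?S"
  proof
    fix x assume "x \<in> insert y Y"
    moreover have "y = of_int 1 * y + 0" by simp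
    moreover have "x = of_int 0 * y + x" by simp
    ultimately show "x \<in> ?S"
      using add_subgroupD(1)[OF zspan_props(1)[of Y]] zspan_props(2)[of Y] by blast
  qed
  ultimately have "zspan (insert y Y) \<subseteq> ?S" by (rule zspan_props(3))
  with assms that show thesis by blast
qed

definition is_subring :: "complex set => bool" where
  "is_subring R \<longleftrightarrow> 1 \<in> R \<and> (\<forall>a\<in>R. \<forall>b\<in>R. a - b \<in> R \<and> a * b \<in> R)"

lemma is_subringD:
  assumes "is_subring R"
  shows "0 \<in> R" "1 \<in> R" "a \<in> R ==> b \<in> R ==> a - b \<in> R" "a \<in> R ==> -a \<in> R"
    "a \<in> R ==> b \<in> R ==> a + b \<in> R" "a \<in> R ==> b \<in> R ==> a * b \<in> R" "of_nat n \<in> R" "a \<in> R ==> a ^ n \<in> R"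
    "(\<And>i. i \<in> I ==> f i \<in> R) ==> sum f I \<in> R" "add_subgroup R"
proof -
  show o: "1 \<in> R" and d: "\<And>a b. a \<in> R ==> b \<in> R ==> a - b \<in> R"
    and t: "\<And>a b. a \<in> R ==> b \<in> R ==> a * b \<in> R"
    using assms by (auto simp: is_subring_def)
  show z: "0 \<in> R" using d[OF o o] by simp
  then show as: "add_subgroup R" using d by (simp add: add_subgroup_def)
  show "-a \<in> R" if "a \<in> R" for a using add_subgroupD(3)[OF as that] .
  show p: "a + b \<in> R" if "a \<in> R" "b \<in> R" for a b using add_subgroupD(4)[OF as that] .
  show "of_nat n \<in> R" using add_subgroupD(5)[OF as o, of n] by simp
  show "a ^ n \<in> R" if "a \<in> R" using that o t by (induction n) auto
  show "sum f I \<in> R" if "\<And>i. i \<in> I ==> f i \<in> R"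
    using that by (induction I rule: infinite_finite_induct) (auto intro: z p)
qed

definition coeffs_in :: "complex set => complex poly => bool" where
  "coeffs_in R f \<longleftrightarrow> (\<forall>i. Polynomial.coeff f i \<in> R)"

lemma adjoin_subring:
  assumes "is_subring R"
  shows "is_subring {poly f x | f. coeffs_in R f}" (is "is_subring ?P")
proof -
  note D = is_subringD[OF assms]
  have "coeffs_in R 1" using D by (simp add: coeffs_in_def)
  then have "1 \<in> ?P" by (metis (mono_tags, lifting) mem_Collect_eq poly_1)
  moreover have "coeffs_in R (f - g)" "coeffs_in R (f * g)" if "coeffs_in R f" "coeffs_in R g" for f g
    using that by (auto simp: coeffs_in_def coeff_mult intro!: D(3,6,9))
  ultimately show ?thesis unfolding is_subring_def
    by (smt (verit) mem_Collect_eq poly_diff poly_mult)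
qed

text \<open>Maximality among the subrings without \<open>1 / q\<close> makes \<open>R\<close> a valuation ring.\<close>

locale maximal_subring =
  fixes R :: "complex set" and q :: complex
  assumes ring: "is_subring R" and q_in: "q \<in> R" and q0: "q \<noteq> 0" and q_inv: "1 / q \<notin> R"
    and maxi: "\<And>S. is_subring S ==> R \<subseteq> S ==> 1 / q \<notin> S ==> S = R"
begin

lemmas D = is_subringD[OF ring]

text \<open>The localisation of \<open>R\<close> at the powers of \<open>1 - q b\<close>, which are congruent to 1 modulo \<open>q\<close>,
  does not contain \<open>1 / q\<close> either, so it is \<open>R\<close>.\<close>

lemma unit_near_one:
  assumes b: "b \<in> R"
  shows "1 - q * b \<noteq> 0" "1 / (1 - q * b) \<in> R"
proof -
  define t where "t = 1 - q * b"
  show t0: "1 - q * b \<noteq> 0"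
  proof
    assume "1 - q * b = 0"
    then have "1 / q = b" using q0 by (simp add: field_simps)
    then show False using b q_inv by simp
  qed
  then have t0: "t \<noteq> 0" by (simp add: t_def)
  have tR: "t \<in> R" using b q_in by (simp add: t_def D)
  have tp: "\<exists>b\<in>R. t ^ s = 1 - q * b" for s
  proof (induction s)
    case (Suc s)
    then obtain c where c: "c \<in> R" "t ^ s = 1 - q * c" by blast
    have "t ^ Suc s = (1 - q * b) * (1 - q * c)" using c by (simp add: t_def)
    then have "t ^ Suc s = 1 - q * (b + c - q * b * c)" by (simp add: algebra_simps)
    then show ?case using b c q_in by (intro bexI[of _ "b + c - q * b * c"]) (auto intro!: D)
  qed (auto intro!: bexI[of _ 0] D)
  let ?S = "{a / t ^ s | a s. a \<in> R}"
  have "is_subring ?S" unfolding is_subring_def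
  proof (intro conjI ballI)
    show "1 \<in> ?S" using D(2) by (metis (mono_tags, lifting) div_by_1 mem_Collect_eq power_0)
    fix x y assume "x \<in> ?S" "y \<in> ?S"
    then obtain a s c u where h: "a \<in> R" "x = a / t ^ s" "c \<in> R" "y = c / t ^ u" by blast
    have "x - y = (a * t ^ u - c * t ^ s) / t ^ (s + u)" "x * y = (a * c) / t ^ (s + u)"
      using t0 by (simp_all add: h(2,4) field_simps power_add)
    moreover have "a * t ^ u - c * t ^ s \<in> R" "a * c \<in> R" using h tR by (auto intro!: D)
    ultimately show "x - y \<in> ?S" "x * y \<in> ?S" by blast+
  qed
  moreover have "R \<subseteq> ?S"
  proof
    fix a assume "a \<in> R"
    moreover have "a = a / t ^ 0" by simp
    ultimately show "a \<in> ?S" by blast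
  qed
  moreover have "1 / q \<notin> ?S"
  proof
    assume "1 / q \<in> ?S"
    then obtain a s where a: "a \<in> R" "1 / q = a / t ^ s" by blast
    obtain c where c: "c \<in> R" "t ^ s = 1 - q * c" using tp by blast
    have "t ^ s = q * a" using a t0 q0 by (simp add: field_simps)
    then have "1 / q = a + c" using c q0 by (simp add: field_simps)
    then show False using a c q_inv D(5) by metis
  qed
  ultimately have "?S = R" by (rule maxi)
  moreover have "1 / t ^ 1 \<in> ?S" using D(2) by blast
  ultimately show "1 / (1 - q * b) \<in> R" by (simp add: t_def)
qed

lemma relation:
  assumes "x \<notin> R"
  shows "\<exists>f. coeffs_in R f \<and> q * poly f x = 1"
proof -
  let ?P = "{poly f x | f. coeffs_in R f}"
  have "R \<subseteq> ?P"
  proof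
    fix a assume "a \<in> R"
    then have "coeffs_in R [:a:]" by (auto simp: coeffs_in_def coeff_pCons D split: nat.split)
    then show "a \<in> ?P" by force
  qed
  moreover have "coeffs_in R [:0, 1:]" by (auto simp: coeffs_in_def coeff_pCons D split: nat.split)
  then have "x \<in> ?P" by force
  ultimately have "1 / q \<in> ?P" using maxi[OF adjoin_subring[OF ring]] assms by blast
  then show ?thesis using q0 by (auto simp: field_simps)
qed

text \<open>The relation for \<open>1 / x\<close>, multiplied by a power of \<open>x\<close>, has the unit \<open>1 - q b\<close> as coefficient of its top
  power, and so eliminates the leading term of the relation for \<open>x\<close>.\<close>

lemma reduce_degree:
  assumes x: "x \<noteq> 0" and f: "coeffs_in R f" "q * poly f x = 1"
    and g: "coeffs_in R g" "q * poly g (1 / x) = 1" and mn: "Polynomial.degree g \<le> Polynomial.degree f"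
  shows "\<exists>f'. coeffs_in R f' \<and> q * poly f' x = 1 \<and> Polynomial.degree f' < Polynomial.degree f"
proof -
  define m n b where "m = Polynomial.degree g" "n = Polynomial.degree f" "b = Polynomial.coeff g 0"
  have b: "b \<in> R" using g by (simp add: m_n_b_def coeffs_in_def)
  note u = unit_near_one[OF b]
  have m0: "m > 0"
  proof (rule ccontr)
    assume "\<not> m > 0"
    then have "g = [:b:]" by (simp add: m_n_b_def) (metis degree_0_id)
    then have "1 / q = b" using g(2) q0 by (simp add: field_simps)
    then show False using b q_inv by simp
  qed
  define D0 where "D0 = reflect_poly g - Polynomial.monom b m"
  have D0x: "q * poly D0 x = x ^ m * (1 - q * b)"
  proof -
    have "poly (reflect_poly g) x = x ^ m * poly g (1 / x)"
      using x by (simp add: poly_reflect_poly_nz m_n_b_def inverse_eq_divide)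
    then have "q * poly D0 x = x ^ m * (q * poly g (1 / x)) - q * b * x ^ m"
      by (simp add: D0_def poly_monom algebra_simps)
    then show ?thesis using g(2) by (simp add: algebra_simps)
  qed
  have D0R: "coeffs_in R D0"
    using g(1) b by (auto simp: coeffs_in_def D0_def coeff_reflect_poly intro!: D)
  have D0deg: "Polynomial.coeff D0 i = 0" if "i \<ge> m" for i
    using that by (auto simp: D0_def coeff_reflect_poly m_n_b_def)
  define c where "c = Polynomial.coeff f n * q * (1 / (1 - q * b))"
  have cR: "c \<in> R" using f(1) q_in u(2) unfolding c_def coeffs_in_def by (intro D(6)) auto
  define f' where "f' = f - Polynomial.monom (Polynomial.coeff f n) n + Polynomial.smult c (Polynomial.monom 1 (n - m) * D0)"
  have "coeffs_in R f'"
    using f(1) cR D0R by (auto simp: coeffs_in_def f'_def coeff_monom_mult intro!: D)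
  moreover have "poly f' x = poly f x"
  proof -
    have "c * (x ^ (n - m) * poly D0 x) = Polynomial.coeff f n * x ^ (n - m) * ((q * poly D0 x) / (1 - q * b))"
      by (simp add: c_def)
    also have "\<dots> = Polynomial.coeff f n * (x ^ (n - m) * x ^ m)" using D0x u(1) by simp
    also have "\<dots> = Polynomial.coeff f n * x ^ n" using mn by (simp add: m_n_b_def power_add[symmetric])
    finally show ?thesis by (simp add: f'_def poly_monom)
  qed
  moreover have "Polynomial.degree f' < n"
  proof -
    have n0: "n > 0" using m0 mn by (simp add: m_n_b_def)
    have "Polynomial.coeff f' i = 0" if "i > n - 1" for i
      using that mn n0 D0deg[of "i - (n - m)"]
      by (auto simp: f'_def coeff_monom_mult m_n_b_def coeff_eq_0)
    then have "Polynomial.degree f' \<le> n - 1" by (intro degree_le) auto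
    with n0 show ?thesis by simp
  qed
  ultimately show ?thesis using f(2) by (auto simp: m_n_b_def)
qed

text \<open>If neither \<open>x\<close> nor \<open>1 / x\<close> were in \<open>R\<close>, relations of least degree for both would contradict
  \<open>reduce_degree\<close>.\<close>

lemma valuation: "x = 0 \<or> x \<in> R \<or> 1 / x \<in> R"
proof (rule ccontr)
  assume "\<not> ?thesis"
  then have x: "x \<noteq> 0" "x \<notin> R" "1 / x \<notin> R" by auto
  define P where "P = (\<lambda>x n. \<exists>f. coeffs_in R f \<and> q * poly f x = 1 \<and> Polynomial.degree f = n)"
  define n m where "n = (LEAST n. P x n)" "m = (LEAST n. P (1 / x) n)"
  have "\<exists>n. P x n" "\<exists>n. P (1 / x) n" using relation x by (auto simp: P_def)
  then have "P x n" "P (1 / x) m" unfolding n_m_def by (auto intro: LeastI_ex)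
  then obtain f g where f: "coeffs_in R f" "q * poly f x = 1" "Polynomial.degree f = n"
    and g: "coeffs_in R g" "q * poly g (1 / x) = 1" "Polynomial.degree g = m" by (auto simp: P_def)
  show False
  proof (cases "m \<le> n")
    case True
    then obtain f' where "coeffs_in R f'" "q * poly f' x = 1" "Polynomial.degree f' < n"
      using reduce_degree[OF x(1) f(1,2) g(1,2)] f g by auto
    then show False using not_less_Least[of "Polynomial.degree f'" "P x"] by (auto simp: P_def n_m_def)
  next
    case False
    then obtain f' where "coeffs_in R f'" "q * poly f' (1 / x) = 1" "Polynomial.degree f' < m"
      using reduce_degree[of "1 / x" g f] x(1) f g by auto
    then show False using not_less_Least[of "Polynomial.degree f'" "P (1 / x)"] by (auto simp: P_def n_m_def)
  qed
qed

lemma root_closed: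
  assumes "x ^ n \<in> R" "n > 0"
  shows "x \<in> R"
proof (rule ccontr)
  assume "x \<notin> R"
  then have x: "x \<noteq> 0" "1 / x \<in> R" using valuation[of x] D(1) by auto
  have "x = x ^ n * (1 / x) ^ (n - 1)"
    using x assms(2) by (cases n) (auto simp: field_simps)
  then have "x \<in> R" using assms x by (metis D(6) D(8))
  with \<open>x \<notin> R\<close> show False by simp
qed

lemma principal:
  assumes "finite E" "E \<noteq> {}"
  shows "\<exists>e\<in>E. \<forall>a\<in>E. \<exists>r\<in>R. a = r * e"
  using assms
proof (induction E rule: finite_ne_induct)
  case (singleton x)
  then show ?case using D(2) by (auto intro!: bexI[of _ 1])
next
  case (insert x E)
  then obtain e where e: "e \<in> E" "\<forall>a\<in>E. \<exists>r\<in>R. a = r * e" by blast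
  show ?case
  proof (cases "\<exists>r\<in>R. x = r * e")
    case True
    then show ?thesis using e by blast
  next
    case False
    then have x0: "x \<noteq> 0" using D(1) by force
    have r: "e / x \<in> R"
    proof (cases "e = 0")
      case False
      then have "x = (x / e) * e" "x / e \<noteq> 0" "1 / (x / e) = e / x" using x0 by auto
      then show ?thesis using \<open>\<not> (\<exists>r\<in>R. x = r * e)\<close> valuation[of "x / e"] by metis
    qed (simp add: D)
    have "\<exists>r\<in>R. a = r * x" if "a \<in> insert x E" for a
    proof (cases "a = x")
      case True
      then show ?thesis using D(2) by (intro bexI[of _ 1]) auto
    next
      case False
      then have "a \<in> E" using that by simp
      with e(2) obtain s where s: "s \<in> R" "a = s * e" by metis
      then have "a = (s * (e / x)) * x" using x0 by simp
      then show ?thesis using D(6)[OF s(1) r] by metis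
    qed
    then show ?thesis by blast
  qed
qed

end

lemma exists_maximal_subring:
  assumes "is_subring R0" "q \<in> R0" "q \<noteq> 0" "1 / q \<notin> R0"
  shows "\<exists>R. R0 \<subseteq> R \<and> maximal_subring R q"
proof -
  let ?A = "{S. is_subring S \<and> R0 \<subseteq> S \<and> 1 / q \<notin> S}"
  have "\<exists>M\<in>?A. \<forall>T\<in>?A. M \<subseteq> T --> T = M"
  proof (rule subset_Zorn_nonempty)
    show "?A \<noteq> {}" using assms by blast
    fix C assume C: "C \<noteq> {}" "subset.chain ?A C"
    then have sub: "C \<subseteq> ?A" and lin: "\<And>T Y. T \<in> C ==> Y \<in> C ==> T \<subseteq> Y \<or> Y \<subseteq> T"
      by (auto simp: subset.chain_def)
    have "is_subring (\<Union>C)" unfolding is_subring_def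
    proof (intro conjI ballI)
      show "1 \<in> \<Union>C" using C(1) sub is_subringD(2) by blast
      fix a b assume "a \<in> \<Union>C" "b \<in> \<Union>C"
      then obtain T where "T \<in> C" "a \<in> T" "b \<in> T" using lin by blast
      then show "a - b \<in> \<Union>C" "a * b \<in> \<Union>C" using sub is_subringD(3,6)[of T a b] by blast+
    qed
    then show "\<Union>C \<in> ?A" using C(1) sub by blast
  qed
  then obtain R where R: "R \<in> ?A" "\<forall>T\<in>?A. R \<subseteq> T --> T = R" by blast
  have "maximal_subring R q"
    by unfold_locales (use R assms in auto)
  then show ?thesis using R by blast
qed

text \<open>Choose a maximal independent subset \<open>Z\<close> of \<open>M\<close>. Up to powers of a common denominator \<open>m\<close>, the
  generators \<open>U\<close> of \<open>C\<close> map the span of \<open>Z\<close> to itself; the complex numbers with this property form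
  a ring that does not contain \<open>1 / p\<close> for a prime \<open>p > m\<close>. A valuation ring \<open>R\<close> above it,
  still without \<open>1 / p\<close>, is closed under roots and so contains \<open>C\<close>. Hence \<open>M \<subseteq> R e\<close>
  for one of the finitely many generators \<open>e\<close> of \<open>M\<close>, although \<open>e / p \<in> M\<close>.\<close>

theorem no_divisible_finitely_generated:
  fixes M C U Y E :: "complex set"
  assumes M: "add_subgroup M" "M \<noteq> {0}"
    and divi: "\<And>n x. n > 0 ==> x \<in> M ==> x / of_nat n \<in> M"
    and Y: "finite Y" "Y \<subseteq> M" "\<And>x. x \<in> M ==> \<exists>n>0. of_nat n * x \<in> zspan Y"
    and U: "finite U" "U \<subseteq> C"
      "\<And>x R. x \<in> C ==> is_subring R ==> U \<subseteq> R ==> inverse ` U \<subseteq> R ==> \<exists>n>0. x ^ n \<in> R"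
    and XM: "\<And>x m. x \<in> C ==> m \<in> M ==> x * m \<in> M \<and> inverse x * m \<in> M"
    and E: "finite E" "E \<subseteq> M" "\<And>S. add_subgroup S ==> (\<And>x e. x \<in> C ==> e \<in> E ==> x * e \<in> S) ==> M \<subseteq> S"
  shows False
proof -
  define good where "good = (\<lambda>Y. finite Y \<and> Y \<subseteq> M \<and> (\<forall>x\<in>M. \<exists>n>0::nat. of_nat n * x \<in> zspan Y))"
  obtain Z where Z: "good Z" "\<And>Z'. good Z' ==> card Z \<le> card Z'"
    using ex_has_least_nat[of good Y card] Y by (auto simp: good_def)
  have Z': "finite Z" "Z \<subseteq> M" "\<And>x. x \<in> M ==> \<exists>n>0::nat. of_nat n * x \<in> zspan Z"
    using Z(1) by (auto simp: good_def)
  have "Z \<noteq> {}"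
  proof
    assume "Z = {}"
    moreover have "zspan {} \<subseteq> {0}" by (rule zspan_props) (auto simp: add_subgroup_def)
    moreover obtain x where "x \<in> M" "x \<noteq> 0" using M add_subgroupD(1)[OF M(1)] by blast
    ultimately show False using Z'(3)[of x] by auto
  qed
  then obtain y where y: "y \<in> Z" by blast
  define Y' where "Y' = Z - {y}"
  have ZY: "Z = insert y Y'" using y by (auto simp: Y'_def)
  have indep: "c = 0" if c: "of_int c * y \<in> zspan Y'" for c
  proof (rule ccontr)
    assume c0: "c \<noteq> 0"
    have "good Y'" unfolding good_def
    proof (intro conjI ballI)
      show "finite Y'" "Y' \<subseteq> M" using Z' by (auto simp: Y'_def)
      fix x assume "x \<in> M"
      then obtain n :: nat where n: "n > 0" "of_nat n * x \<in> zspan Z" using Z'(3) by blast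
      then obtain d z where d: "z \<in> zspan Y'" "of_nat n * x = of_int d * y + z"
        using zspan_insert ZY by metis
      have "of_int c * (of_nat n * x) = of_int d * (of_int c * y) + of_int c * z"
        using d by (simp add: algebra_simps)
      also have "\<dots> \<in> zspan Y'" using c d
        by (intro add_subgroupD(4)[OF zspan_props(1)]) (auto intro: add_subgroupD(6)[OF zspan_props(1)])
      finally have "of_int (sgn c) * (of_int c * (of_nat n * x)) \<in> zspan Y'"
        by (rule add_subgroupD(6)[OF zspan_props(1)])
      moreover have "of_int (sgn c) * (of_int c * (of_nat n * x)) = of_nat (nat \<bar>c\<bar> * n) * x"
      proof -
        have "(of_int (sgn c) * of_int c :: complex) = of_int (\<bar>c\<bar>)"
          by (simp only: of_int_mult[symmetric] abs_sgn) (simp add: mult.commute)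
        then show ?thesis by (simp add: mult.assoc[symmetric])
      qed
      ultimately show "\<exists>n>0::nat. of_nat n * x \<in> zspan Y'"
        using n c0 by (intro exI[of _ "nat \<bar>c\<bar> * n"]) auto
    qed
    then have "card Z \<le> card Y'" by (rule Z(2))
    then show False using y Z'(1) by (metis Y'_def card_Diff1_less leD)
  qed
  define W where "W = U \<union> inverse ` U"
  have "\<exists>n::nat. n > 0 \<and> of_nat n * (fst a * snd a) \<in> zspan Z" if "a \<in> W \<times> Z" for a
  proof -
    have "fst a * snd a \<in> M"
      using XM U(2) Z'(2) that unfolding W_def by (auto simp: subset_iff)
    then show ?thesis using Z'(3) by blast
  qed
  then obtain N where N0: "\<And>a. a \<in> W \<times> Z ==> N a > (0::nat) \<and> of_nat (N a) * (fst a * snd a) \<in> zspan Z"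
    by metis
  have N: "N (u, z) > 0 \<and> of_nat (N (u, z)) * (u * z) \<in> zspan Z" if "u \<in> W" "z \<in> Z" for u z
    using N0[of "(u, z)"] that by simp
  define m where "m = (\<Prod>a\<in>W \<times> Z. N a)"
  have finW: "finite (W \<times> Z)" using U Z' by (auto simp: W_def)
  have m0: "m > 0" unfolding m_def using N by (intro prod_pos) auto
  have mW: "of_nat m * (u * z) \<in> zspan Z" if "u \<in> W" "z \<in> zspan Z" for u z
  proof -
    let ?S = "{z. of_nat m * (u * z) \<in> zspan Z}"
    have "add_subgroup ?S"
      using add_subgroupD(1,2)[OF zspan_props(1)[of Z]] by (auto simp: add_subgroup_def right_diff_distrib)
    moreover have "Z \<subseteq> ?S"
    proof clarify
      fix z assume z: "z \<in> Z"
      have "m = N (u, z) * (\<Prod>a\<in>W \<times> Z - {(u, z)}. N a)"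
        unfolding m_def using finW that z by (intro prod.remove) auto
      then have "of_nat m * (u * z) = of_nat (\<Prod>a\<in>W \<times> Z - {(u, z)}. N a) * (of_nat (N (u, z)) * (u * z))"
        by simp
      then show "of_nat m * (u * z) \<in> zspan Z"
        using add_subgroupD(5)[OF zspan_props(1)] N that z by metis
    qed
    ultimately show ?thesis using zspan_props(3) that by blast
  qed
  \<comment> \<open>The number \<open>m\<close> is a common denominator for the action of \<open>U\<close> and its inverses on \<open>Z\<close>.\<close>
  define R0 where "R0 = {a::complex. \<exists>j. \<forall>z\<in>zspan Z. of_nat m ^ j * a * z \<in> zspan Z}"
  have up: "of_nat m ^ (j + i) * a * z \<in> zspan Z" if "of_nat m ^ j * a * z \<in> zspan Z" for a z i j
    using add_subgroupD(5)[OF zspan_props(1) that, of "m ^ i"] by (simp add: power_add mult_ac)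
  have R0: "is_subring R0" unfolding is_subring_def
  proof (intro conjI ballI)
    show "1 \<in> R0" by (auto simp: R0_def intro!: exI[of _ 0])
    fix a b assume "a \<in> R0" "b \<in> R0"
    then obtain i j where a: "\<forall>z\<in>zspan Z. of_nat m ^ i * a * z \<in> zspan Z"
      and b: "\<forall>z\<in>zspan Z. of_nat m ^ j * b * z \<in> zspan Z" by (auto simp: R0_def)
    have "of_nat m ^ (i + j) * (a - b) * z \<in> zspan Z" if "z \<in> zspan Z" for z
    proof -
      have "of_nat m ^ (i + j) * (a - b) * z = of_nat m ^ (i + j) * a * z - of_nat m ^ (j + i) * b * z"
        by (simp add: algebra_simps)
      then show ?thesis using up a b that add_subgroupD(2)[OF zspan_props(1)] by metis
    qed
    then show "a - b \<in> R0" unfolding R0_def by blast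
    have "of_nat m ^ (i + j) * (a * b) * z \<in> zspan Z" if "z \<in> zspan Z" for z
    proof -
      have "of_nat m ^ (i + j) * (a * b) * z = of_nat m ^ i * a * (of_nat m ^ j * b * z)"
        by (simp add: power_add mult_ac)
      then show ?thesis using a b that by metis
    qed
    then show "a * b \<in> R0" unfolding R0_def by blast
  qed
  have WR0: "W \<subseteq> R0" using mW by (auto simp: R0_def mult.assoc intro!: exI[of _ 1])
  obtain p :: nat where p: "Factorial_Ring.prime p" "p > m" using bigger_prime by blast
  have "1 / of_nat p \<notin> R0"
  proof
    assume "1 / of_nat p \<in> R0"
    then obtain j where j: "of_nat m ^ j * (1 / of_nat p) * y \<in> zspan Z"
      using y zspan_props(2) by (fastforce simp: R0_def)
    have "\<not> p dvd m" using p m0 by (auto dest: dvd_imp_le)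
    then have "coprime (int (m ^ j)) (int p)"
      using p prime_imp_coprime[of p "m ^ j"] prime_dvd_power by (auto simp: coprime_commute simp del: of_nat_power)
    then obtain u v where uv: "u * int (m ^ j) + v * int p = 1"
      by (metis bezout_int coprime_iff_gcd_eq_1)
    have "of_int (u * int (m ^ j) + v * int p) = (1 :: complex)" by (simp only: uv of_int_1)
    then have uv': "of_int u * of_nat m ^ j + of_int v * of_nat p = (1 :: complex)" by simp
    have p0: "(of_nat p :: complex) \<noteq> 0" using p by auto
    have "y / of_nat p = (of_int u * of_nat m ^ j + of_int v * of_nat p) * (y / of_nat p)"
      by (simp only: uv' mult_1)
    also have "\<dots> = of_int u * (of_nat m ^ j * (1 / of_nat p) * y) + of_int v * y"
      using p0 by (simp only: distrib_right) simp
    also have "\<dots> \<in> zspan Z"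
    proof (rule add_subgroupD(4)[OF zspan_props(1)])
      show "of_int u * (of_nat m ^ j * (1 / of_nat p) * y) \<in> zspan Z"
        using j by (rule add_subgroupD(6)[OF zspan_props(1)])
      show "of_int v * y \<in> zspan Z"
        using y zspan_props(2) by (intro add_subgroupD(6)[OF zspan_props(1)]) auto
    qed
    finally have "y / of_nat p \<in> zspan (insert y Y')" by (simp add: ZY)
    then obtain c z where c: "z \<in> zspan Y'" "y / of_nat p = of_int c * y + z"
      by (rule zspan_insert)
    have "of_int (1 - int p * c) * y = of_nat p * z"
    proof -
      have "y = of_nat p * (of_int c * y + z)" using p0 by (simp add: c(2)[symmetric])
      then show ?thesis by (simp add: algebra_simps)
    qed
    then have "of_int (1 - int p * c) * y \<in> zspan Y'"
      using c(1) add_subgroupD(5)[OF zspan_props(1)] by metis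
    then have "1 - int p * c = 0" by (rule indep)
    then have "int p * c = 1" by simp
    then have "int p dvd 1" by (metis dvd_triv_left)
    then show False using p by auto
  qed
  then obtain R where R: "R0 \<subseteq> R" "maximal_subring R (of_nat p)"
    using exists_maximal_subring[OF R0, of "of_nat p"] is_subringD(7)[OF R0] p by (auto simp: prime_gt_0_nat)
  interpret maximal_subring R "of_nat p" by (rule R)
  have XR: "C \<subseteq> R"
  proof
    fix x assume "x \<in> C"
    then obtain n where "n > 0" "x ^ n \<in> R" using U(3)[of x R] ring WR0 R(1) unfolding W_def by blast
    then show "x \<in> R" by (rule root_closed[rotated])
  qed
  have "E \<noteq> {}"
  proof
    assume "E = {}"
    then have "M \<subseteq> {0}" using E(3)[of "{0}"] by (auto simp: add_subgroup_def)
    then show False using M add_subgroupD(1)[OF M(1)] by blast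
  qed
  then obtain e where e: "e \<in> E" "\<And>a. a \<in> E ==> \<exists>r\<in>R. a = r * e" using principal[OF E(1)] by blast
  have ME: "M \<subseteq> {r * e | r. r \<in> R}"
  proof (rule E(3))
    show "add_subgroup {r * e | r. r \<in> R}"
      unfolding add_subgroup_def
    proof (intro conjI ballI)
      show "0 \<in> {r * e | r. r \<in> R}" using D(1) by force
      fix a b assume "a \<in> {r * e | r. r \<in> R}" "b \<in> {r * e | r. r \<in> R}"
      then obtain r s where "r \<in> R" "a = r * e" "s \<in> R" "b = s * e" by blast
      then show "a - b \<in> {r * e | r. r \<in> R}"
        using D(3)[of r s] by (auto simp: left_diff_distrib[symmetric])
    qed
    fix x a assume x: "x \<in> C" "a \<in> E"
    then obtain r where "r \<in> R" "a = r * e" using e by blast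
    then have "x * a = (x * r) * e" "x * r \<in> R" using XR x D(6) by auto
    then show "x * a \<in> {r * e | r. r \<in> R}" by blast
  qed
  obtain a where a: "a \<in> M" "a \<noteq> 0" using M add_subgroupD(1)[OF M(1)] by blast
  then have e0: "e \<noteq> 0" using ME by auto
  have "e / of_nat p \<in> M" using divi[of p e] e E(2) p by (auto simp: prime_gt_0_nat)
  then obtain r where "r \<in> R" "e / of_nat p = r * e" using ME by blast
  moreover have "1 / of_nat p = (e / of_nat p) / e" using e0 by simp
  ultimately show False using e0 q_inv by simp
qed

section \<open>Soluble groups of linear maps\<close>

lemma (in group) inv_cancel:
  assumes "g \<in> carrier G" "x \<in> carrier G"
  shows "inv g \<otimes> (g \<otimes> x) = x" "g \<otimes> (inv g \<otimes> x) = x"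
  using assms by (simp_all add: m_assoc[symmetric])

locale complex_space = vector_space scale
  for scale :: "complex => 'v::ab_group_add => 'v" (infixr \<open>*s\<close> 75)
begin

definition fin_dim :: "'v set => bool" where
  "fin_dim W \<longleftrightarrow> (\<exists>B. finite B \<and> W \<subseteq> span B)"

definition rk :: "'v set => nat" where
  "rk W = (LEAST n. \<exists>B. finite B \<and> card B = n \<and> W \<subseteq> span B)"

lemma rk_witness:
  assumes "fin_dim W"
  obtains B where "finite B" "card B = rk W" "W \<subseteq> span B"
  using assms LeastI_ex[of "\<lambda>n. \<exists>B. finite B \<and> card B = n \<and> W \<subseteq> span B"]
  by (auto simp: fin_dim_def rk_def)

lemma rk_less:
  assumes W: "fin_dim W" and U: "subspace U" "U \<subseteq> W" "U \<noteq> W"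
  shows "rk U < rk W"
proof -
  obtain B where B: "finite B" "card B = rk W" "W \<subseteq> span B" by (rule rk_witness[OF W])
  obtain C where C: "C \<subseteq> U" "independent C" "U \<subseteq> span C"
    by (rule maximal_independent_subset)
  have CU: "span C = U" using C U(1) by (metis span_minimal subset_antisym)
  obtain w where w: "w \<in> W" "w \<notin> U" using U by blast
  have "independent (insert w C)" using C(2) w CU by (simp add: independent_insert)
  moreover have "insert w C \<subseteq> span B" using w C U B by auto
  ultimately have "finite (insert w C) \<and> card (insert w C) \<le> card B"
    by (rule independent_span_bound[OF B(1)])
  then have "finite (insert w C)" "card (insert w C) \<le> card B" by auto
  moreover have "w \<notin> C" using w C by auto
  ultimately have fc: "finite C" "card C < card B" by auto
  have "rk U \<le> card C" unfolding rk_def by (rule Least_le) (use fc C in auto)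
  then show ?thesis using fc B by simp
qed

lemma fin_dim_mono: "fin_dim W ==> U \<subseteq> W ==> fin_dim U"
  unfolding fin_dim_def by blast

definition lin_on :: "'v set => ('v => 'v) => bool" where
  "lin_on W f \<longleftrightarrow> (\<forall>w\<in>W. f w \<in> W) \<and> (\<forall>v\<in>W. \<forall>w\<in>W. f (v + w) = f v + f w) \<and>
     (\<forall>c. \<forall>w\<in>W. f (c *s w) = c *s f w)"

lemma lin_onD:
  assumes "subspace W" "lin_on W f"
  shows "w \<in> W ==> f w \<in> W" "v \<in> W ==> w \<in> W ==> f (v + w) = f v + f w"
    "w \<in> W ==> f (c *s w) = c *s f w" "f 0 = 0"
    "(\<And>i. i \<in> I ==> g i \<in> W) ==> f (sum g I) = (\<Sum>i\<in>I. f (g i))"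
proof -
  show 1: "\<And>w. w \<in> W ==> f w \<in> W" and 2: "\<And>v w. v \<in> W ==> w \<in> W ==> f (v + w) = f v + f w"
    and 3: "\<And>c w. w \<in> W ==> f (c *s w) = c *s f w"
    using assms(2) by (auto simp: lin_on_def)
  have z: "0 \<in> W" using assms(1) by (rule subspace_0)
  show 4: "f 0 = 0" using 3[OF z, of 0] by simp
  show "f (sum g I) = (\<Sum>i\<in>I. f (g i))" if "\<And>i. i \<in> I ==> g i \<in> W"
    using that
  proof (induction I rule: infinite_finite_induct)
    case (insert i I)
    then have "sum g I \<in> W" using assms(1) by (intro subspace_sum) auto
    with insert show ?case by (simp add: 2)
  qed (simp_all add: 4)
qed

text \<open>The iterates of \<open>f\<close> on a vector are dependent, so a polynomial in \<open>f\<close> kills it; a linear factor of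
  one of least degree provides the eigenvalue.\<close>

lemma eigenvalue_exists:
  assumes W: "fin_dim W" "subspace W" "W \<noteq> {0}" and f: "lin_on W f"
  shows "\<exists>\<alpha>. \<exists>w\<in>W. w \<noteq> 0 \<and> f w = \<alpha> *s w"
proof -
  note L = lin_onD[OF W(2) f]
  obtain w where w: "w \<in> W" "w \<noteq> 0" using W subspace_0[OF W(2)] by blast
  define ev where "ev = (\<lambda>p. fold_coeffs (\<lambda>a v. a *s w + f v) p 0)"
  have ev0: "ev 0 = 0" by (simp add: ev_def)
  have evC: "ev (pCons a p) = a *s w + f (ev p)" for a p
    by (cases "p = 0 \<and> a = 0") (auto simp: ev_def L(4))
  have evW: "ev p \<in> W" for p
    by (induction p) (auto simp: ev0 evC w L subspace_0 W intro!: subspace_add[OF W(2)] subspace_scale[OF W(2)])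
  have evadd: "ev (p + q) = ev p + ev q" for p q
    by (induction p q rule: poly_induct2) (auto simp: ev0 evC L evW algebra_simps)
  have evsm: "ev (Polynomial.smult c p) = c *s ev p" for c p
    by (induction p) (auto simp: ev0 evC L evW algebra_simps scale_right_distrib)
  have evsum: "ev (sum g I) = (\<Sum>i\<in>I. ev (g i))" for g :: "nat => complex poly" and I
    by (induction I rule: infinite_finite_induct) (auto simp: ev0 evadd)
  have "\<exists>p. p \<noteq> 0 \<and> ev p = 0"
  proof (rule ccontr)
    assume "\<not> ?thesis"
    then have nz: "ev p = 0 ==> p = 0" for p by blast
    obtain B where B: "finite B" "W \<subseteq> span B" using W(1) by (auto simp: fin_dim_def)
    define n where "n = Suc (card B)"
    define e where "e = (\<lambda>i. ev (Polynomial.monom 1 i))"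
    have comb: "(\<Sum>i<n. c i *s e i) = 0 ==> i < n ==> c i = 0" for c :: "nat => complex" and i
    proof -
      assume s: "(\<Sum>i<n. c i *s e i) = 0" and i: "i < n"
      have "(\<Sum>i<n. c i *s e i) = ev (\<Sum>i<n. Polynomial.smult (c i) (Polynomial.monom 1 i))"
        by (simp only: evsum evsm e_def)
      with s have "(\<Sum>i<n. Polynomial.smult (c i) (Polynomial.monom 1 i)) = 0" using nz by metis
      then have "Polynomial.coeff (\<Sum>i<n. Polynomial.monom (c i) i) i = 0" by (simp add: smult_monom)
      then show "c i = 0" using i by (simp add: Polynomial.coeff_sum if_distrib sum.delta' cong: if_cong)
    qed
    have inj: "inj_on e {..<n}"
    proof (rule inj_onI)
      fix i j assume ij: "i \<in> {..<n}" "j \<in> {..<n}" "e i = e j"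
      show "i = j"
      proof (rule ccontr)
        assume "i \<noteq> j"
        define c where "c = (\<lambda>k. if k = i then 1 else if k = j then -1 else 0 :: complex)"
        have "(\<Sum>k<n. c k *s e k) = (\<Sum>k\<in>{i, j}. c k *s e k)"
          by (rule sum.mono_neutral_right) (use ij in \<open>auto simp: c_def\<close>)
        also have "\<dots> = 0" using \<open>i \<noteq> j\<close> ij(3) by (simp add: c_def)
        finally have "c i = 0" using comb ij by blast
        then show False by (simp add: c_def)
      qed
    qed
    have "independent (e ` {..<n})"
    proof (rule independent_if_scalars_zero)
      fix g x assume s: "(\<Sum>x\<in>e ` {..<n}. g x *s x) = 0" and x: "x \<in> e ` {..<n}"
      have "(\<Sum>i<n. g (e i) *s e i) = 0" using s by (simp add: sum.reindex[OF inj])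
      then show "g x = 0" using comb[of "\<lambda>i. g (e i)"] x by auto
    qed simp
    moreover have "e ` {..<n} \<subseteq> span B" using evW B by (auto simp: e_def)
    ultimately have "card (e ` {..<n}) \<le> card B" using independent_span_bound[OF B(1)] by blast
    then show False using card_image[OF inj] by (simp add: n_def)
  qed
  then obtain p where p: "p \<noteq> 0 \<and> ev p = 0"
    and least: "\<And>r. r \<noteq> 0 \<and> ev r = 0 ==> Polynomial.degree p \<le> Polynomial.degree r"
    using ex_has_least_nat[of "\<lambda>p. p \<noteq> 0 \<and> ev p = 0" _ Polynomial.degree] by metis
  have "Polynomial.degree p \<noteq> 0"
  proof
    assume "Polynomial.degree p = 0"
    then obtain c where "p = [:c:]" by (metis degree_eq_zeroE)
    then show False using p w by (simp add: evC ev0 L)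
  qed
  then have "\<not> constant (poly p)" by (simp add: constant_degree)
  then obtain z where "poly p z = 0" using fundamental_theorem_of_algebra by blast
  then obtain r where r: "p = [:-z, 1:] * r" by (metis poly_eq_0_iff_dvd dvdE)
  have r0: "r \<noteq> 0" using p r by auto
  have "Polynomial.degree p = Suc (Polynomial.degree r)"
    using r0 unfolding r by (subst degree_mult_eq) auto
  then have "ev r \<noteq> 0" using least[of r] r0 by auto
  moreover have "ev p = f (ev r) - z *s ev r"
  proof -
    have "p = Polynomial.smult (-z) r + pCons 0 r" using r by simp
    then show ?thesis by (simp only: evadd evsm evC) simp
  qed
  then have "f (ev r) = z *s ev r" using p by simp
  ultimately show ?thesis using evW by blast
qed

text \<open>Eigenvectors for distinct weights are independent.\<close>

lemma finite_weights:
  assumes W: "fin_dim W" "subspace W" and T: "\<And>z. z \<in> Z ==> lin_on W (T z)"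
  shows "finite {\<alpha> \<in> extensional Z. \<exists>w\<in>W. w \<noteq> 0 \<and> (\<forall>z\<in>Z. T z w = \<alpha> z *s w)}" (is "finite ?L")
proof -
  obtain B where B: "finite B" "W \<subseteq> span B" using W(1) by (auto simp: fin_dim_def)
  have "\<exists>v. \<forall>\<alpha>\<in>?L. v \<alpha> \<in> W \<and> v \<alpha> \<noteq> 0 \<and> (\<forall>z\<in>Z. T z (v \<alpha>) = \<alpha> z *s v \<alpha>)"
    by (rule bchoice) blast
  then obtain v where v: "\<And>\<alpha>. \<alpha> \<in> ?L ==> v \<alpha> \<in> W \<and> v \<alpha> \<noteq> 0 \<and> (\<forall>z\<in>Z. T z (v \<alpha>) = \<alpha> z *s v \<alpha>)"
    by blast
  have indep: "\<forall>\<alpha>\<in>K. c \<alpha> = 0" if "finite K" "K \<subseteq> ?L" "(\<Sum>\<alpha>\<in>K. c \<alpha> *s v \<alpha>) = 0" for K c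
    using that
  proof (induction K arbitrary: c rule: finite_induct)
    case (insert \<beta> K)
    have K0: "c \<alpha> = 0" if l: "\<alpha> \<in> K" for \<alpha>
    proof -
      have "\<alpha> \<noteq> \<beta>" "\<alpha> \<in> extensional Z" "\<beta> \<in> extensional Z" using insert l by auto
      then obtain z where z: "z \<in> Z" "\<alpha> z \<noteq> \<beta> z" by (meson extensionalityI)
      note L = lin_onD[OF W(2) T[OF z(1)]]
      have vW: "c \<nu> *s v \<nu> \<in> W" if "\<nu> \<in> insert \<beta> K" for \<nu>
        using v insert.prems(1) that by (intro subspace_scale[OF W(2)]) blast
      have "0 = T z (\<Sum>\<nu>\<in>insert \<beta> K. c \<nu> *s v \<nu>) - \<beta> z *s (\<Sum>\<nu>\<in>insert \<beta> K. c \<nu> *s v \<nu>)"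
        using insert.prems(2) by (simp only: L(4)) simp
      also have "T z (\<Sum>\<nu>\<in>insert \<beta> K. c \<nu> *s v \<nu>) = (\<Sum>\<nu>\<in>insert \<beta> K. T z (c \<nu> *s v \<nu>))"
        by (rule L(5)) (use vW in blast)
      also have "\<dots> = (\<Sum>\<nu>\<in>insert \<beta> K. (c \<nu> * \<nu> z) *s v \<nu>)"
      proof (rule sum.cong[OF refl])
        fix \<nu> assume "\<nu> \<in> insert \<beta> K"
        then have "\<nu> \<in> ?L" using insert.prems(1) by blast
        then show "T z (c \<nu> *s v \<nu>) = (c \<nu> * \<nu> z) *s v \<nu>" using v z L(3) by simp
      qed
      also have "\<dots> - \<beta> z *s (\<Sum>\<nu>\<in>insert \<beta> K. c \<nu> *s v \<nu>)
          = (\<Sum>\<nu>\<in>insert \<beta> K. (c \<nu> * (\<nu> z - \<beta> z)) *s v \<nu>)"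
        unfolding scale_sum_right sum_subtractf[symmetric]
        by (rule sum.cong) (auto simp: algebra_simps)
      also have "\<dots> = (\<Sum>\<nu>\<in>K. (c \<nu> * (\<nu> z - \<beta> z)) *s v \<nu>)"
        using insert.hyps by simp
      finally have "(\<Sum>\<nu>\<in>K. (c \<nu> * (\<nu> z - \<beta> z)) *s v \<nu>) = 0" by simp
      then have "c \<alpha> * (\<alpha> z - \<beta> z) = 0"
        using insert.IH[of "\<lambda>\<nu>. c \<nu> * (\<nu> z - \<beta> z)"] insert.prems(1) l by blast
      then show ?thesis using z by simp
    qed
    then have "c \<beta> *s v \<beta> = 0" using insert by simp
    then have "c \<beta> = 0" using v[of \<beta>] insert.prems(1) by simp
    then show ?case using K0 by blast
  qed simp
  have "finite ?L \<and> card ?L \<le> card B"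
  proof (rule finite_if_finite_subsets_card_bdd)
    fix K assume K: "K \<subseteq> ?L" "finite K"
    have inj: "inj_on v K"
    proof (rule inj_onI)
      fix \<alpha> \<beta> assume l: "\<alpha> \<in> K" "\<beta> \<in> K" "v \<alpha> = v \<beta>"
      show "\<alpha> = \<beta>"
      proof (rule extensionalityI[where A = Z])
        show "\<alpha> \<in> extensional Z" "\<beta> \<in> extensional Z" using l K by auto
        fix z assume "z \<in> Z"
        then have "\<alpha> z *s v \<alpha> = \<beta> z *s v \<alpha>"
          using v[OF subsetD[OF K(1) l(1)]] v[OF subsetD[OF K(1) l(2)]] l(3) by metis
        then show "\<alpha> z = \<beta> z" using v[OF subsetD[OF K(1) l(1)]] by auto
      qed
    qed
    have "independent (v ` K)"
    proof (rule independent_if_scalars_zero)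
      fix g x assume s: "(\<Sum>x\<in>v ` K. g x *s x) = 0" and x: "x \<in> v ` K"
      have "(\<Sum>\<alpha>\<in>K. g (v \<alpha>) *s v \<alpha>) = 0" using s by (simp add: sum.reindex[OF inj])
      then show "g x = 0" using indep[OF K(2,1), of "\<lambda>\<alpha>. g (v \<alpha>)"] x by auto
    qed (use K in simp)
    moreover have "v ` K \<subseteq> span B" using v K B by blast
    ultimately have "card (v ` K) \<le> card B" using independent_span_bound[OF B(1)] by blast
    then show "card K \<le> card B" using card_image[OF inj] by simp
  qed
  then show ?thesis ..
qed

end

definition fin_index :: "('g, 'm) monoid_scheme => 'g set => bool" where
  "fin_index G K \<longleftrightarrow> subgroup K G \<and>
     (\<exists>R. finite R \<and> R \<subseteq> carrier G \<and> (\<forall>g\<in>carrier G. \<exists>r\<in>R. inv\<^bsub>G\<^esub> r \<otimes>\<^bsub>G\<^esub> g \<in> K))"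

lemma fin_indexI:
  assumes "subgroup K G" "finite (f ` carrier G)"
    "\<And>g h. g \<in> carrier G ==> h \<in> carrier G ==> f g = f h ==> inv\<^bsub>G\<^esub> g \<otimes>\<^bsub>G\<^esub> h \<in> K"
  shows "fin_index G K"
  unfolding fin_index_def
proof (intro conjI exI ballI)
  let ?R = "inv_into (carrier G) f ` f ` carrier G"
  show "finite ?R" using assms(2) by simp
  show "?R \<subseteq> carrier G" by (auto intro: inv_into_into)
  fix g assume g: "g \<in> carrier G"
  then have "inv_into (carrier G) f (f g) \<in> carrier G" "f (inv_into (carrier G) f (f g)) = f g"
    by (auto intro: inv_into_into f_inv_into_f)
  then show "\<exists>r\<in>?R. inv\<^bsub>G\<^esub> r \<otimes>\<^bsub>G\<^esub> g \<in> K" using assms(3) g by blast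
qed fact

locale lin_action = complex_space scale + group G
  for scale :: "complex => 'v::ab_group_add => 'v" (infixr \<open>*s\<close> 75)
    and G :: "('g, 'm) monoid_scheme" (structure) +
  fixes T :: "'g => 'v => 'v" and W :: "'v set"
  assumes fdW: "fin_dim W" and subW: "subspace W"
    and lin: "g \<in> carrier G ==> lin_on W (T g)"
    and T_mult: "g \<in> carrier G ==> h \<in> carrier G ==> w \<in> W ==> T (g \<otimes> h) w = T g (T h w)"
    and T_one: "w \<in> W ==> T \<one> w = w"
begin

lemmas T_lin = lin_onD[OF subW lin]

lemma T_inv:
  assumes "g \<in> carrier G" "w \<in> W"
  shows "T (inv g) (T g w) = w" "T g (T (inv g) w) = w"
  using assms T_mult[of "inv g" g w] T_mult[of g "inv g" w] T_one by auto

lemma T_eq_0: "g \<in> carrier G ==> w \<in> W ==> T g w = 0 ==> w = 0"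
  using T_inv(1)[of g w] T_lin(4)[of "inv g"] by simp

definition scal :: "'g => bool" where "scal m \<longleftrightarrow> (\<exists>c. \<forall>w\<in>W. T m w = c *s w)"

definition comm :: "'g => 'g => bool" where "comm g h \<longleftrightarrow> (\<forall>w\<in>W. T (g \<otimes> h) w = T (h \<otimes> g) w)"

lemma centralizer_subgroup:
  assumes m: "m \<in> carrier G"
  shows "subgroup {g \<in> carrier G. comm g m} G"
proof (rule subgroupI)
  show "{g \<in> carrier G. comm g m} \<noteq> {}" using m by (auto simp: comm_def intro!: exI[of _ \<one>])
next
  fix g assume g: "g \<in> {g \<in> carrier G. comm g m}"
  have "T (inv g \<otimes> m) w = T (m \<otimes> inv g) w" if w: "w \<in> W" for w
  proof -
    define w' where "w' = T (inv g) w"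
    have w': "w' \<in> W" using g w T_lin(1) by (simp add: w'_def)
    have "T g (T m w') = T m (T g w')" using g w' m by (auto simp: comm_def T_mult)
    then have "T m w' = T (inv g) (T m w)"
      using g w w' m T_inv T_lin(1) by (metis (no_types, lifting) mem_Collect_eq w'_def)
    then show ?thesis using g w m by (simp add: T_mult w'_def)
  qed
  then show "inv g \<in> {g \<in> carrier G. comm g m}" using g by (simp add: comm_def)
next
  fix g h assume gh: "g \<in> {g \<in> carrier G. comm g m}" "h \<in> {g \<in> carrier G. comm g m}"
  then have gh': "g \<in> carrier G" "h \<in> carrier G" by auto
  have "T (g \<otimes> h \<otimes> m) w = T (m \<otimes> (g \<otimes> h)) w" if w: "w \<in> W" for w
  proof -
    have "T g (T h (T m w)) = T g (T m (T h w))" using gh w m by (auto simp: comm_def T_mult)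
    also have "\<dots> = T m (T g (T h w))" using gh w m T_lin(1) by (auto simp: comm_def T_mult)
    finally show ?thesis using gh' w m T_lin(1) by (simp add: T_mult)
  qed
  then show "g \<otimes> h \<in> {g \<in> carrier G. comm g m}" using gh by (simp add: comm_def)
qed auto

definition spec :: "'g => complex set" where
  "spec m = {c. \<exists>w\<in>W. w \<noteq> 0 \<and> T m w = c *s w}"

lemma finite_spec:
  assumes "m \<in> carrier G"
  shows "finite (spec m)"
proof -
  let ?L = "{\<alpha> \<in> extensional {m}. \<exists>w\<in>W. w \<noteq> 0 \<and> (\<forall>z\<in>{m}. T z w = \<alpha> z *s w)}"
  have "finite ?L" by (rule finite_weights[OF fdW subW]) (use assms lin in auto)
  moreover have "spec m \<subseteq> (\<lambda>\<alpha>. \<alpha> m) ` ?L"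
  proof
    fix c assume "c \<in> spec m"
    then have "(\<lambda>z\<in>{m}. c) \<in> ?L" by (auto simp: spec_def)
    then show "c \<in> (\<lambda>\<alpha>. \<alpha> m) ` ?L" by (rule rev_image_eqI) simp
  qed
  ultimately show ?thesis by (meson finite_imageI finite_subset)
qed

end

text \<open>Irreducibility is required of every subgroup of finite index.\<close>

locale strongly_irreducible = lin_action scale G T W
  for scale :: "complex => 'v::ab_group_add => 'v" (infixr \<open>*s\<close> 75)
    and G :: "('g, 'm) monoid_scheme" (structure) and T W +
  assumes W0: "W \<noteq> {0}"
    and irr: "\<And>K U. fin_index G K ==> subspace U ==> U \<subseteq> W ==> (\<forall>k\<in>K. \<forall>u\<in>U. T k u \<in> U) ==> U = {0} \<or> U = W"
begin

text \<open>The centraliser of \<open>m\<close> preserves the eigenspaces of \<open>m\<close>.\<close>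

lemma scal_if_centralizer_fin_index:
  assumes m: "m \<in> carrier G" and fi: "fin_index G {g \<in> carrier G. comm g m}"
  shows "scal m"
proof -
  obtain c w where w: "w \<in> W" "w \<noteq> 0" "T m w = c *s w"
    using eigenvalue_exists[OF fdW subW W0 lin[OF m]] by blast
  let ?U = "{u \<in> W. T m u = c *s u}"
  have "subspace ?U"
    using subspace_0[OF subW] subspace_add[OF subW] subspace_scale[OF subW] m
    by (intro subspaceI) (auto simp: T_lin scale_right_distrib mult.commute)
  moreover have "T k u \<in> ?U" if "k \<in> {g \<in> carrier G. comm g m}" "u \<in> ?U" for k u
  proof -
    have "T m (T k u) = T k (T m u)" using that m by (auto simp: comm_def T_mult)
    then show ?thesis using that T_lin by simp
  qed
  ultimately have "?U = {0} \<or> ?U = W" by (intro irr[OF fi]) auto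
  then have "?U = W" using w by blast
  then show ?thesis unfolding scal_def by blast
qed

text \<open>A minimal subspace invariant under \<open>Z\<close> consists of common eigenvectors, and \<open>G\<close> permutes the
  finitely many weights of \<open>Z\<close>. The stabiliser of one weight has finite index and preserves
  its weight space, which is therefore everything.\<close>

lemma center_scal:
  assumes M: "M \<lhd> G"
  defines "Z \<equiv> {z \<in> M. \<forall>m\<in>M. comm z m}"
  assumes z: "z \<in> Z"
  shows "scal z"
proof -
  interpret M: normal M G by (rule M)
  have ZG: "Z \<subseteq> carrier G" using M.subset by (auto simp: Z_def)
  have conjZ: "inv g \<otimes> z \<otimes> g \<in> Z" if g: "g \<in> carrier G" and z: "z \<in> Z" for g z
  proof -
    have zG: "z \<in> carrier G" using z ZG by blast
    have "comm (inv g \<otimes> z \<otimes> g) m" if m: "m \<in> M" for m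
      unfolding comm_def
    proof
      fix w assume w: "w \<in> W"
      have mG: "m \<in> carrier G" using m M.subset by blast
      let ?n = "g \<otimes> m \<otimes> inv g"
      have n: "?n \<in> M" using M.inv_op_closed2[OF g m] .
      have e: "inv g \<otimes> z \<otimes> g \<otimes> m = inv g \<otimes> ((z \<otimes> ?n) \<otimes> g)" "m \<otimes> (inv g \<otimes> z \<otimes> g) = inv g \<otimes> ((?n \<otimes> z) \<otimes> g)"
        using g zG mG by (simp_all add: m_assoc inv_cancel)
      have "T (z \<otimes> ?n) (T g w) = T (?n \<otimes> z) (T g w)"
        using z n w g T_lin(1) by (simp add: Z_def comm_def)
      then show "T (inv g \<otimes> z \<otimes> g \<otimes> m) w = T (m \<otimes> (inv g \<otimes> z \<otimes> g)) w"
        unfolding e using g zG mG w by (simp add: T_mult T_lin(1))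
    qed
    then show ?thesis using M.inv_op_closed1[OF g] z by (auto simp: Z_def)
  qed
  let ?P = "\<lambda>U. subspace U \<and> U \<subseteq> W \<and> U \<noteq> {0} \<and> (\<forall>z\<in>Z. \<forall>u\<in>U. T z u \<in> U)"
  have "?P W" using subW W0 ZG T_lin(1) by blast
  then obtain U where U: "?P U" and least: "\<And>U'. ?P U' ==> rk U \<le> rk U'"
    using ex_has_least_nat[of ?P W rk] by blast
  have fdU: "fin_dim U" using fin_dim_mono[OF fdW] U by blast
  have linU: "lin_on U (T z)" if "z \<in> Z" for z
    using U lin[of z] ZG that by (auto simp: lin_on_def subset_iff)
  have "\<exists>c. \<forall>u\<in>U. T z u = c *s u" if z: "z \<in> Z" for z
  proof -
    obtain c w where w: "w \<in> U" "w \<noteq> 0" "T z w = c *s w"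
      using eigenvalue_exists[OF fdU _ _ linU[OF z]] U by blast
    let ?U = "{u \<in> U. T z u = c *s u}"
    have sU: "subspace U" using U by blast
    note L = lin_onD[OF sU linU]
    have "subspace ?U"
      using subspace_0[OF sU] subspace_add[OF sU] subspace_scale[OF sU] z
      by (intro subspaceI) (auto simp: L scale_right_distrib mult.commute)
    moreover have "T y u \<in> ?U" if y: "y \<in> Z" and u: "u \<in> ?U" for y u
    proof -
      have "T z (T y u) = T y (T z u)"
        using y z u U ZG by (auto simp: Z_def comm_def T_mult subset_iff)
      then show ?thesis using y u U L(3)[OF y] by auto
    qed
    ultimately have PU: "?P ?U" using w U by blast
    have "?U = U"
    proof (rule ccontr)
      assume "?U \<noteq> U"
      then have "rk ?U < rk U" using PU by (intro rk_less[OF fdU]) auto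
      with least[OF PU] show False by simp
    qed
    then show ?thesis by blast
  qed
  then obtain a where a: "\<And>z u. z \<in> Z ==> u \<in> U ==> T z u = a z *s u" by metis
  obtain u where u: "u \<in> U" "u \<noteq> 0" using U subspace_0 by blast
  have uW: "u \<in> W" using u U by blast
  have Tconj: "T z (T g w) = T g (T (inv g \<otimes> z \<otimes> g) w)"
    if "z \<in> Z" "g \<in> carrier G" "w \<in> W" for z g w
  proof -
    have zG: "z \<in> carrier G" using that ZG by blast
    have e: "g \<otimes> (inv g \<otimes> z \<otimes> g) = z \<otimes> g" using that zG by (simp add: m_assoc[symmetric])
    have "T z (T g w) = T (g \<otimes> (inv g \<otimes> z \<otimes> g)) w" unfolding e using that zG by (simp add: T_mult)
    also have "\<dots> = T g (T (inv g \<otimes> z \<otimes> g) w)" using that zG by (intro T_mult) auto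
    finally show ?thesis .
  qed
  define f where "f = (\<lambda>g. \<lambda>z\<in>Z. a (inv g \<otimes> z \<otimes> g))"
  define K where "K = {g \<in> carrier G. \<forall>z\<in>Z. a (inv g \<otimes> z \<otimes> g) = a z}"
  have fi: "fin_index G K"
  proof (rule fin_indexI[where f = f])
    show "subgroup K G"
    proof (rule subgroupI)
      show "K \<noteq> {}" using ZG by (auto simp: K_def intro!: exI[of _ \<one>])
      show "K \<subseteq> carrier G" by (auto simp: K_def)
      fix g assume g: "g \<in> K"
      have "a (inv (inv g) \<otimes> z \<otimes> inv g) = a z" if z: "z \<in> Z" for z
      proof -
        have "g \<otimes> z \<otimes> inv g \<in> Z" using conjZ[of "inv g" z] g z by (simp add: K_def)
        then have "a (inv g \<otimes> (g \<otimes> z \<otimes> inv g) \<otimes> g) = a (g \<otimes> z \<otimes> inv g)"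
          using g by (simp add: K_def)
        moreover have "inv g \<otimes> (g \<otimes> z \<otimes> inv g) \<otimes> g = z"
          using g z ZG by (simp add: K_def m_assoc subset_iff inv_cancel)
        ultimately show ?thesis using g by (simp add: K_def)
      qed
      then show "inv g \<in> K" using g by (simp add: K_def)
      fix h assume h: "h \<in> K"
      have "a (inv (g \<otimes> h) \<otimes> z \<otimes> (g \<otimes> h)) = a z" if z: "z \<in> Z" for z
      proof -
        have "inv (g \<otimes> h) \<otimes> z \<otimes> (g \<otimes> h) = inv h \<otimes> (inv g \<otimes> z \<otimes> g) \<otimes> h"
          using g h z ZG by (simp add: K_def inv_mult_group m_assoc subset_iff)
        then show ?thesis using conjZ[of g z] g h z by (simp add: K_def)
      qed
      then show "g \<otimes> h \<in> K" using g h by (simp add: K_def)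
    qed
    have "f g \<in> {\<alpha> \<in> extensional Z. \<exists>w\<in>W. w \<noteq> 0 \<and> (\<forall>z\<in>Z. T z w = \<alpha> z *s w)}" if g: "g \<in> carrier G" for g
    proof -
      have "T z (T g u) = f g z *s T g u" if "z \<in> Z" for z
        using that g u uW Tconj[OF that g uW] a[OF conjZ[OF g that] u(1)] T_lin(3)[OF g uW]
        by (simp add: f_def)
      moreover have "T g u \<in> W" "T g u \<noteq> 0" using g u uW T_lin(1) T_eq_0 by auto
      ultimately show ?thesis by (auto simp: f_def)
    qed
    moreover have "finite {\<alpha> \<in> extensional Z. \<exists>w\<in>W. w \<noteq> 0 \<and> (\<forall>z\<in>Z. T z w = \<alpha> z *s w)}"
      by (rule finite_weights[OF fdW subW]) (use ZG lin in blast)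
    ultimately show "finite (f ` carrier G)" by (meson finite_subset image_subsetI)
    fix g h assume gh: "g \<in> carrier G" "h \<in> carrier G" "f g = f h"
    have "a (inv (inv g \<otimes> h) \<otimes> z \<otimes> (inv g \<otimes> h)) = a z" if z: "z \<in> Z" for z
    proof -
      have zG: "z \<in> carrier G" using z ZG by blast
      let ?y = "g \<otimes> z \<otimes> inv g"
      have y: "?y \<in> Z" using conjZ[of "inv g" z] gh z by simp
      have "a (inv h \<otimes> ?y \<otimes> h) = a (inv g \<otimes> ?y \<otimes> g)"
        using fun_cong[OF gh(3), of ?y] y by (simp add: f_def)
      moreover have "inv (inv g \<otimes> h) \<otimes> z \<otimes> (inv g \<otimes> h) = inv h \<otimes> ?y \<otimes> h" "inv g \<otimes> ?y \<otimes> g = z"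
        using gh zG by (simp_all add: inv_mult_group m_assoc inv_cancel)
      ultimately show ?thesis by simp
    qed
    then show "inv g \<otimes> h \<in> K" using gh by (simp add: K_def)
  qed
  let ?U = "{w \<in> W. \<forall>z\<in>Z. T z w = a z *s w}"
  have "subspace ?U"
    using subspace_0[OF subW] subspace_add[OF subW] subspace_scale[OF subW] ZG
    by (intro subspaceI) (auto simp: T_lin scale_right_distrib mult.commute subset_iff)
  moreover have "T k w \<in> ?U" if k: "k \<in> K" and w: "w \<in> ?U" for k w
  proof -
    have kG: "k \<in> carrier G" and wW: "w \<in> W" using k w by (auto simp: K_def)
    have "T z (T k w) = a z *s T k w" if z: "z \<in> Z" for z
      using Tconj[OF z kG wW] w conjZ[OF kG z] k z T_lin(3)[OF kG wW] by (simp add: K_def)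
    then show ?thesis using T_lin(1)[OF kG wW] by simp
  qed
  ultimately have "?U = {0} \<or> ?U = W" by (intro irr[OF fi]) auto
  moreover have "u \<in> ?U" using u uW a by blast
  ultimately have "?U = W" using u by blast
  then show ?thesis using z unfolding scal_def by blast
qed

text \<open>Restricted to a basis of \<open>W\<close>, the operators lie in a finite-dimensional space of functions.\<close>

lemma finite_spanning_operators:
  assumes M: "M \<subseteq> carrier G"
  obtains F where "finite F" "F \<subseteq> M"
    "\<And>m. m \<in> M ==> \<exists>c. \<forall>w\<in>W. T m w = (\<Sum>f\<in>F. c f *s T f w)"
proof -
  interpret F: vector_space "\<lambda>c (f :: 'v => 'v) v. c *s f v"
    by unfold_locales (auto simp: fun_eq_iff algebra_simps scale_left_distrib scale_right_distrib)
  obtain B where B: "finite B" "W \<subseteq> span B" using fdW by (auto simp: fin_dim_def)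
  obtain C where C: "C \<subseteq> W" "independent C" "W \<subseteq> span C" by (rule maximal_independent_subset)
  have fC: "finite C" using independent_span_bound[OF B(1) C(2)] C(1) B(2) by blast
  define pt where "pt = (\<lambda>(b::'v) d x. if x = b then d else 0 :: 'v)"
  define opr where "opr = (\<lambda>m x. if x \<in> C then T m x else 0)"
  define E where "E = (\<lambda>(b, d). pt b d) ` (C \<times> C)"
  have pt_span: "pt b v \<in> F.span E" if b: "b \<in> C" and v: "v \<in> W" for b v
  proof -
    have "v \<in> span C" using v C by blast
    then show ?thesis
    proof (induction rule: span_induct)
      show "subspace {v. pt b v \<in> F.span E}"
      proof (rule subspaceI)
        have "pt b 0 = 0" by (simp add: pt_def fun_eq_iff)
        then show "0 \<in> {v. pt b v \<in> F.span E}" using F.span_zero by simp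
        fix x y c assume "x \<in> {v. pt b v \<in> F.span E}"
        then have x: "pt b x \<in> F.span E" by simp
        have "pt b (c *s x) = (\<lambda>v. c *s pt b x v)" by (simp add: pt_def fun_eq_iff)
        then show "c *s x \<in> {v. pt b v \<in> F.span E}" using F.span_scale[OF x, of c] by simp
        assume "y \<in> {v. pt b v \<in> F.span E}"
        moreover have "pt b (x + y) = pt b x + pt b y" by (simp add: pt_def fun_eq_iff)
        ultimately show "x + y \<in> {v. pt b v \<in> F.span E}" using F.span_add[OF x] by simp
      qed
      fix x assume "x \<in> C"
      then have "pt b x \<in> E" using b by (auto simp: E_def)
      then show "pt b x \<in> F.span E" by (rule F.span_base)
    qed
  qed
  have opE: "opr m \<in> F.span E" if "m \<in> M" for m
  proof -
    have "opr m = (\<Sum>b\<in>C. pt b (T m b))"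
    proof
      fix x
      have "(\<Sum>b\<in>C. pt b (T m b)) x = (\<Sum>b\<in>C. pt b (T m b) x)"
        by (induction C rule: infinite_finite_induct) auto
      also have "\<dots> = opr m x" using fC by (simp add: pt_def opr_def)
      finally show "opr m x = (\<Sum>b\<in>C. pt b (T m b)) x" by simp
    qed
    moreover have "pt b (T m b) \<in> F.span E" if "b \<in> C" for b
      using that \<open>m \<in> M\<close> M C by (intro pt_span T_lin(1)) auto
    ultimately show ?thesis by (simp add: F.span_sum)
  qed
  obtain D where D: "D \<subseteq> opr ` M" "F.independent D" "opr ` M \<subseteq> F.span D"
    by (rule F.maximal_independent_subset)
  have "finite E" using fC by (simp add: E_def)
  then have fD: "finite D" using F.independent_span_bound[OF _ D(2)] D(1) opE by blast
  obtain F where F: "F \<subseteq> M" "inj_on opr F" "D = opr ` F"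
    using D(1) by (auto simp: subset_image_inj)
  have fF: "finite F" using F fD by (simp add: finite_image_iff)
  have "\<exists>c. \<forall>w\<in>W. T m w = (\<Sum>f\<in>F. c f *s T f w)" if m: "m \<in> M" for m
  proof -
    have "opr m \<in> F.span D" using D m by blast
    then obtain u where u: "opr m = (\<Sum>d\<in>D. (\<lambda>v. u d *s d v))" using F.span_finite[OF fD] by auto
    have sumapp: "(\<Sum>d\<in>A. g d) x = (\<Sum>d\<in>A. g d x)" for g :: "('v => 'v) => 'v => 'v" and A x
      by (induction A rule: infinite_finite_induct) auto
    define c where "c = (\<lambda>f. u (opr f))"
    have onC: "T m b = (\<Sum>f\<in>F. c f *s T f b)" if "b \<in> C" for b
    proof -
      have "T m b = opr m b" using that by (simp add: opr_def)
      also have "\<dots> = (\<Sum>d\<in>D. u d *s d b)" unfolding u by (rule sumapp)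
      also have "\<dots> = (\<Sum>f\<in>F. c f *s opr f b)" unfolding F(3) c_def by (simp add: sum.reindex[OF F(2)])
      finally show ?thesis using that by (simp add: opr_def)
    qed
    have "T m w = (\<Sum>f\<in>F. c f *s T f w)" if w: "w \<in> W" for w
    proof -
      let ?S = "{w \<in> W. T m w = (\<Sum>f\<in>F. c f *s T f w)}"
      have FG: "\<And>f. f \<in> F ==> f \<in> carrier G" "m \<in> carrier G" using F M m by auto
      have "subspace ?S"
      proof (rule subspaceI)
        show "0 \<in> ?S" using subspace_0[OF subW] FG by (simp add: T_lin)
        fix x y k assume x: "x \<in> ?S"
        then show "k *s x \<in> ?S" using subspace_scale[OF subW] FG
          by (simp add: T_lin scale_sum_right mult.commute)
        assume "y \<in> ?S"
        then show "x + y \<in> ?S" using x subspace_add[OF subW] FG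
          by (simp add: T_lin scale_right_distrib sum.distrib)
      qed
      moreover have "C \<subseteq> ?S" using onC C by blast
      ultimately have "span C \<subseteq> ?S" by (rule span_minimal[rotated])
      then show ?thesis using w C by blast
    qed
    then show ?thesis by blast
  qed
  with that fF F show thesis by blast
qed

text \<open>The commutators with a finite set \<open>F\<close> spanning the operators of \<open>M\<close> are quotients of eigenvalues, so
  they take finitely many values; elements with the same commutators differ by a central, hence
  scalar element. So up to scalars \<open>m\<close> has finitely many conjugates. The scalars are quotients of
  eigenvalues of \<open>m\<close>, so the operator has finitely many conjugates, and its centraliser has finite index.\<close>

lemma scal_if_commutators_scal:
  assumes M: "M \<lhd> G"
    and cs: "\<And>a b. a \<in> M ==> b \<in> M ==> \<exists>c. \<forall>w\<in>W. T a (T b w) = c *s T b (T a w)"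
    and m: "m \<in> M"
  shows "scal m"
proof -
  interpret M: normal M G by (rule M)
  have MG: "\<And>x. x \<in> M ==> x \<in> carrier G" using M.subset by blast
  have TW: "\<And>x w. x \<in> M ==> w \<in> W ==> T x w \<in> W" using MG T_lin(1) by blast
  obtain w0 where w0: "w0 \<in> W" "w0 \<noteq> 0" using W0 subspace_0[OF subW] by blast
  obtain c where c: "\<And>a b w. a \<in> M ==> b \<in> M ==> w \<in> W ==> T a (T b w) = c a b *s T b (T a w)"
    using cs by metis
  define Q where "Q = (\<lambda>b b'. (\<lambda>(x, y). x / y) ` (spec b' \<times> spec b))"
  have finQ: "finite (Q b b')" if "b \<in> carrier G" "b' \<in> carrier G" for b b'
    using finite_spec that by (simp add: Q_def)
  have quot: "k \<in> Q b b'" "k \<noteq> 0"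
    if h: "a \<in> carrier G" "b \<in> carrier G" "b' \<in> carrier G" "\<And>w. w \<in> W ==> T b' (T a w) = k *s T a (T b w)" for a b b' k
  proof -
    obtain x w where w: "w \<in> W" "w \<noteq> 0" "T b w = x *s w"
      using eigenvalue_exists[OF fdW subW W0 lin[OF h(2)]] by blast
    have aw: "T a w \<in> W" "T a w \<noteq> 0" using w h T_lin(1) T_eq_0 by blast+
    have e: "T b' (T a w) = (k * x) *s T a w" using h(4)[OF w(1)] w h(1) by (simp add: T_lin)
    have "x \<noteq> 0" using T_eq_0[OF h(2) w(1)] w by auto
    moreover have "k * x \<noteq> 0" using T_eq_0[OF h(3) aw(1)] e aw by auto
    moreover have "k * x \<in> spec b'" "x \<in> spec b" using e aw w by (auto simp: spec_def)
    ultimately show "k \<in> Q b b'" "k \<noteq> 0" by (force simp: Q_def)+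
  qed
  obtain F where F: "finite F" "F \<subseteq> M"
    "\<And>m. m \<in> M ==> \<exists>c. \<forall>w\<in>W. T m w = (\<Sum>f\<in>F. c f *s T f w)"
    by (rule finite_spanning_operators[of M]) (use MG in auto)
  define \<kappa> where "\<kappa> = (\<lambda>a. \<lambda>f\<in>F. c f a)"
  have \<kappa>_in: "\<kappa> a \<in> (\<Pi>\<^sub>E f\<in>F. Q f f)" if "a \<in> M" for a
  proof -
    have "c f a \<in> Q f f" if "f \<in> F" for f
    proof -
      have fM: "f \<in> M" using that F(2) by blast
      show ?thesis by (rule quot(1)[OF MG[OF \<open>a \<in> M\<close>] MG[OF fM] MG[OF fM] c[OF fM \<open>a \<in> M\<close>]])
    qed
    then show ?thesis by (auto simp: \<kappa>_def)
  qed
  have scal_quot: "scal (inv a \<otimes> b)" if a: "a \<in> M" and b: "b \<in> M" and e: "\<kappa> a = \<kappa> b" for a b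
  proof -
    define z where "z = inv a \<otimes> b"
    have zM: "z \<in> M" using a b M.m_closed M.m_inv_closed by (simp add: z_def)
    have zw: "T a (T z w) = T b w" if "w \<in> W" for w
      using a b that MG T_inv(2)[of a "T b w"] T_lin(1) by (simp add: z_def T_mult)
    have F_comm: "T f (T z w) = T z (T f w)" if f: "f \<in> F" and w: "w \<in> W" for f w
    proof -
      have fM: "f \<in> M" using f F by blast
      have k: "c f a = c f b" using fun_cong[OF e, of f] f by (simp add: \<kappa>_def)
      have k0: "c f a \<noteq> 0" by (rule quot(2)[OF MG[OF a] MG[OF fM] MG[OF fM] c[OF fM a]])
      have "c f a *s T a (T f (T z w)) = T f (T a (T z w))" using c[OF fM a] TW zM w by simp
      also have "\<dots> = c f a *s T b (T f w)" using zw c[OF fM b] w k by simp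
      also have "\<dots> = c f a *s T a (T z (T f w))" using zw TW fM w by simp
      finally have "T a (T f (T z w)) = T a (T z (T f w))" using k0 by simp
      then show ?thesis using a MG TW fM zM w T_inv(1) by metis
    qed
    have "comm z x" if x: "x \<in> M" for x
      unfolding comm_def
    proof
      fix w assume w: "w \<in> W"
      obtain u where u: "\<And>w. w \<in> W ==> T x w = (\<Sum>f\<in>F. u f *s T f w)" using F(3)[OF x] by blast
      have fW: "\<And>f. f \<in> F ==> T f w \<in> W" using TW F w by blast
      have "T z (T x w) = (\<Sum>f\<in>F. T z (u f *s T f w))"
        using u[OF w] fW subspace_scale[OF subW] MG[OF zM] by (simp add: T_lin(5))
      also have "\<dots> = (\<Sum>f\<in>F. u f *s T f (T z w))"
        using fW MG[OF zM] F_comm[OF _ w] by (intro sum.cong) (auto simp: T_lin)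
      also have "\<dots> = T x (T z w)" using u TW zM w by simp
      finally show "T (z \<otimes> x) w = T (x \<otimes> z) w" using MG zM x w by (simp add: T_mult)
    qed
    then show ?thesis unfolding z_def[symmetric] using center_scal[OF M] zM by blast
  qed
  define cj where "cj = (\<lambda>g. g \<otimes> m \<otimes> inv g)"
  have cjM: "cj g \<in> M" if "g \<in> carrier G" for g using M.inv_op_closed2[OF that m] by (simp add: cj_def)
  define rep where "rep = (\<lambda>g. inv_into (carrier G) (\<lambda>g. \<kappa> (cj g)) (\<kappa> (cj g)))"
  have rep: "rep g \<in> carrier G" "\<kappa> (cj (rep g)) = \<kappa> (cj g)" if "g \<in> carrier G" for g
    using inv_into_into[of "\<kappa> (cj g)" "\<lambda>g. \<kappa> (cj g)" "carrier G"]
      f_inv_into_f[of "\<kappa> (cj g)" "\<lambda>g. \<kappa> (cj g)" "carrier G"] that by (auto simp: rep_def)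
  have "\<exists>k. \<forall>w\<in>W. T (cj g) w = k *s T (cj (rep g)) w" if g: "g \<in> carrier G" for g
  proof -
    let ?a = "cj (rep g)"
    obtain k where k: "\<And>w. w \<in> W ==> T (inv ?a \<otimes> cj g) w = k *s w"
      using scal_quot[OF cjM cjM rep(2)] rep(1) g unfolding scal_def by blast
    have aG: "?a \<in> carrier G" "cj g \<in> carrier G" using cjM rep(1) g MG by auto
    have "T (cj g) w = k *s T ?a w" if w: "w \<in> W" for w
    proof -
      have "T (cj g) w = T (?a \<otimes> (inv ?a \<otimes> cj g)) w" using aG by (simp add: inv_cancel)
      also have "\<dots> = T ?a (k *s w)" using aG w k by (subst T_mult) auto
      finally show ?thesis using aG w by (simp add: T_lin)
    qed
    then show ?thesis by blast
  qed
  then obtain k where k: "\<And>g w. g \<in> carrier G ==> w \<in> W ==> T (cj g) w = k g *s T (cj (rep g)) w" by metis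
  have cjw: "T (cj g) (T g w) = T g (T m w)" if "g \<in> carrier G" "w \<in> W" for g w
  proof -
    have "cj g \<otimes> g = g \<otimes> m" using that MG[OF m] by (simp add: cj_def m_assoc)
    then show ?thesis using that MG[OF m] MG[OF cjM] by (metis T_mult)
  qed
  have kQ: "k g \<in> Q m m" if g: "g \<in> carrier G" for g
  proof (rule quot)
    let ?h = "rep g"
    have h: "?h \<in> carrier G" using rep(1)[OF g] .
    show "inv g \<otimes> ?h \<in> carrier G" "m \<in> carrier G" "m \<in> carrier G" using g h MG[OF m] by auto
    fix w assume w: "w \<in> W"
    have hw: "T ?h w \<in> W" using h w T_lin(1) by blast
    have "T m (T (inv g) (T ?h w)) = T (inv g) (T g (T m (T (inv g) (T ?h w))))"
      using g hw MG[OF m] T_lin(1) T_inv(1) by simp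
    also have "\<dots> = T (inv g) (T (cj g) (T ?h w))"
      using cjw[OF g, of "T (inv g) (T ?h w)"] g hw T_lin(1) T_inv(2) by simp
    also have "\<dots> = T (inv g) (k g *s T ?h (T m w))"
      using k[OF g hw] cjw[OF h w] by simp
    also have "\<dots> = k g *s T (inv g) (T ?h (T m w))"
      using g h w MG[OF m] T_lin(1) by (simp add: T_lin(3))
    finally show "T m (T (inv g \<otimes> ?h) w) = k g *s T (inv g \<otimes> ?h) (T m w)"
      using g h w MG[OF m] T_lin(1) by (simp add: T_mult)
  qed
  have "fin_index G {g \<in> carrier G. comm g m}"
  proof (rule fin_indexI[where f = "\<lambda>g. (\<kappa> (cj g), k g)"])
    show "subgroup {g \<in> carrier G. comm g m} G" by (rule centralizer_subgroup[OF MG[OF m]])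
    have "finite ((\<Pi>\<^sub>E f\<in>F. Q f f) \<times> Q m m)"
      using F finQ MG m by (intro finite_cartesian_product finite_PiE) auto
    moreover have "(\<lambda>g. (\<kappa> (cj g), k g)) ` carrier G \<subseteq> (\<Pi>\<^sub>E f\<in>F. Q f f) \<times> Q m m"
      using \<kappa>_in cjM kQ by blast
    ultimately show "finite ((\<lambda>g. (\<kappa> (cj g), k g)) ` carrier G)" by (rule finite_subset[rotated])
    fix g h assume gh: "g \<in> carrier G" "h \<in> carrier G" "(\<kappa> (cj g), k g) = (\<kappa> (cj h), k h)"
    then have "rep g = rep h" by (simp add: rep_def)
    then have same: "T (cj g) w = T (cj h) w" if "w \<in> W" for w using k gh that by simp
    have "comm (inv g \<otimes> h) m"
      unfolding comm_def
    proof
      fix w assume w: "w \<in> W"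
      define v where "v = T (inv g) (T h w)"
      have vW: "v \<in> W" "T h w \<in> W" using gh w T_lin(1) by (auto simp: v_def)
      have gv: "T g v = T h w" using gh vW by (simp add: v_def T_inv)
      have "T g (T m v) = T h (T m w)"
        using cjw[OF gh(1) vW(1)] cjw[OF gh(2) w] same[OF vW(2)] gv by simp
      then have "T m v = T (inv g) (T h (T m w))"
        using T_inv(1)[OF gh(1), of "T m v"] T_lin(1)[OF MG[OF m] vW(1)] by simp
      then show "T (inv g \<otimes> h \<otimes> m) w = T (m \<otimes> (inv g \<otimes> h)) w"
        using gh w MG[OF m] T_lin(1) by (simp add: T_mult v_def)
    qed
    then show "inv g \<otimes> h \<in> {g \<in> carrier G. comm g m}" using gh by simp
  qed
  then show ?thesis by (rule scal_if_centralizer_fin_index[OF MG[OF m]])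
qed

text \<open>Induction along the derived series, from the trivial group upwards.\<close>

lemma solvable_scal:
  assumes "solvable G" "g \<in> carrier G"
  shows "scal g"
proof -
  define D where "D = (\<lambda>n. (derived G ^^ n) (carrier G))"
  have norm: "D n \<lhd> G" for n
  proof (induction n)
    case 0
    then show ?case by (auto simp: D_def normal_inv_iff subgroup_self)
  next
    case (Suc n)
    then show ?case using derived_is_normal by (simp add: D_def)
  qed
  obtain n where n: "D n = {\<one>}"
    using assms(1) solvable_iff_trivial_derived_seq by (auto simp: D_def)
  have "\<forall>x\<in>D (n - i). scal x" if "i \<le> n" for i
    using that
  proof (induction i)
    case 0
    then show ?case using n T_one by (auto simp: scal_def intro!: exI[of _ 1])
  next
    case (Suc i)
    have DG: "D (n - Suc i) \<subseteq> carrier G" using norm normal_imp_subgroup subgroup.subset by blast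
    have "n - i = Suc (n - Suc i)" using Suc(2) by simp
    then have Dn: "D (n - i) = derived G (D (n - Suc i))" by (simp add: D_def)
    show ?case
    proof
      fix x assume "x \<in> D (n - Suc i)"
      then show "scal x"
      proof (rule scal_if_commutators_scal[OF norm, rotated])
        fix a b assume ab: "a \<in> D (n - Suc i)" "b \<in> D (n - Suc i)"
        have abG: "a \<in> carrier G" "b \<in> carrier G" using ab DG by auto
        have "a \<otimes> b \<otimes> inv a \<otimes> inv b \<in> D (n - i)"
          unfolding Dn derived_def by (rule generate.incl) (use ab in blast)
        then have "scal (a \<otimes> b \<otimes> inv a \<otimes> inv b)" using Suc by simp
        then obtain c where c: "\<And>w. w \<in> W ==> T (a \<otimes> b \<otimes> inv a \<otimes> inv b) w = c *s w"
          unfolding scal_def by blast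
        have "T a (T b w) = c *s T b (T a w)" if w: "w \<in> W" for w
        proof -
          have "(a \<otimes> b \<otimes> inv a \<otimes> inv b) \<otimes> (b \<otimes> a) = a \<otimes> b"
            using abG by (simp add: m_assoc inv_cancel)
          then have "T a (T b w) = T ((a \<otimes> b \<otimes> inv a \<otimes> inv b) \<otimes> (b \<otimes> a)) w"
            using abG w by (simp add: T_mult)
          also have "\<dots> = c *s T (b \<otimes> a) w" using abG w c T_lin(1) by (subst T_mult) auto
          finally show ?thesis using abG w by (simp add: T_mult)
        qed
        then show "\<exists>c. \<forall>w\<in>W. T a (T b w) = c *s T b (T a w)" by blast
      qed
    qed
  qed
  from this[of n] show ?thesis using assms(2) by (simp add: D_def)
qed

end

lemma (in group) fin_index_trans:
  assumes "fin_index G H" "fin_index (G\<lparr>carrier := H\<rparr>) K"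
  shows "fin_index G K"
proof -
  obtain R where H: "subgroup H G" and R: "finite R" "R \<subseteq> carrier G" "\<And>g. g \<in> carrier G ==> \<exists>r\<in>R. inv r \<otimes> g \<in> H"
    using assms(1) by (auto simp: fin_index_def)
  obtain S where K: "subgroup K (G\<lparr>carrier := H\<rparr>)" and S: "finite S" "S \<subseteq> H"
    "\<And>g. g \<in> H ==> \<exists>r\<in>S. inv\<^bsub>G\<lparr>carrier := H\<rparr>\<^esub> r \<otimes> g \<in> K"
    using assms(2) by (auto simp: fin_index_def)
  have HG: "H \<subseteq> carrier G" using H by (rule subgroup.subset)
  show ?thesis unfolding fin_index_def
  proof (intro conjI exI ballI)
    show "subgroup K G" using incl_subgroup[OF H K] .
    let ?R = "(\<lambda>(r, s). r \<otimes> s) ` (R \<times> S)"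
    show "finite ?R" using R S by simp
    show "?R \<subseteq> carrier G" using R(2) S(2) HG by (auto simp: subset_iff)
    fix g assume g: "g \<in> carrier G"
    then obtain r where r: "r \<in> R" "inv r \<otimes> g \<in> H" using R by blast
    then obtain s where s: "s \<in> S" "inv\<^bsub>G\<lparr>carrier := H\<rparr>\<^esub> s \<otimes> (inv r \<otimes> g) \<in> K" using S by blast
    have "r \<in> carrier G" "s \<in> carrier G" using r s R S HG by auto
    then have "inv (r \<otimes> s) \<otimes> g \<in> K"
      using s m_inv_consistent[OF H] S g by (simp add: inv_mult_group m_assoc subset_iff)
    then show "\<exists>r\<in>?R. inv r \<otimes> g \<in> K" using r s by blast
  qed
qed

text \<open>A form of Malcev's theorem. Among all nonzero subspaces invariant under some subgroup of finite
  index take one of least dimension; there the subgroup is strongly irreducible and acts by scalars.\<close>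

theorem (in lin_action) virtual_eigenvector:
  assumes "solvable G" "W \<noteq> {0}"
  shows "\<exists>H w c. fin_index G H \<and> w \<in> W \<and> w \<noteq> 0 \<and> (\<forall>h\<in>H. T h w = c h *s w)"
proof -
  define P where "P = (\<lambda>(H, U). fin_index G H \<and> subspace U \<and> U \<subseteq> W \<and> U \<noteq> {0} \<and> (\<forall>h\<in>H. \<forall>u\<in>U. T h u \<in> U))"
  have "fin_index G (carrier G)"
    unfolding fin_index_def by (intro conjI exI[of _ "{\<one>}"]) (auto simp: subgroup_self)
  then have "P (carrier G, W)" using subW assms T_lin(1) by (auto simp: P_def)
  then obtain p where p: "P p" "\<And>p'. P p' ==> rk (snd p) \<le> rk (snd p')"
    using ex_has_least_nat[of P "(carrier G, W)" "\<lambda>p. rk (snd p)"] by blast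
  obtain H U where HU: "p = (H, U)" by (cases p)
  have fi: "fin_index G H" and U: "subspace U" "U \<subseteq> W" "U \<noteq> {0}" "\<And>h u. h \<in> H ==> u \<in> U ==> T h u \<in> U"
    using p(1) by (auto simp: HU P_def)
  have H: "subgroup H G" using fi by (simp add: fin_index_def)
  then have HG: "H \<subseteq> carrier G" by (rule subgroup.subset)
  interpret H: group "G\<lparr>carrier := H\<rparr>" by (rule subgroup.subgroup_is_group[OF H is_group])
  interpret S: strongly_irreducible scale "G\<lparr>carrier := H\<rparr>" T U
  proof unfold_locales
    show fdU: "fin_dim U" using fin_dim_mono[OF fdW U(2)] .
    show "subspace U" "U \<noteq> {0}" by fact+
    show "lin_on U (T g)" if "g \<in> carrier (G\<lparr>carrier := H\<rparr>)" for g
      using that lin[of g] HG U by (auto simp: lin_on_def subset_iff)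
    show "T (g \<otimes>\<^bsub>G\<lparr>carrier := H\<rparr>\<^esub> h) w = T g (T h w)"
      if "g \<in> carrier (G\<lparr>carrier := H\<rparr>)" "h \<in> carrier (G\<lparr>carrier := H\<rparr>)" "w \<in> U" for g h w
      using that HG U(2) T_mult by (auto simp: subset_iff)
    show "T \<one>\<^bsub>G\<lparr>carrier := H\<rparr>\<^esub> w = w" if "w \<in> U" for w
      using that U(2) T_one by auto
    fix K V assume K: "fin_index (G\<lparr>carrier := H\<rparr>) K" and V: "subspace V" "V \<subseteq> U" "\<forall>k\<in>K. \<forall>u\<in>V. T k u \<in> V"
    show "V = {0} \<or> V = U"
    proof (rule ccontr)
      assume c: "\<not> ?thesis"
      then have "P (K, V)" using fin_index_trans[OF fi K] V U by (auto simp: P_def)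
      then have "rk U \<le> rk V" using p(2)[of "(K, V)"] by (simp add: HU)
      moreover have "rk V < rk U" using c V by (intro rk_less[OF fdU]) auto
      ultimately show False by simp
    qed
  qed
  have solv: "solvable (G\<lparr>carrier := H\<rparr>)"
    by (rule group_hom.inj_hom_imp_solvable[OF canonical_inj_is_hom[OF H]]) (use assms(1) in auto)
  obtain w where w: "w \<in> U" "w \<noteq> 0" using U subspace_0 by blast
  have "\<exists>c. T h w = c *s w" if "h \<in> H" for h
    using S.solvable_scal[OF solv, of h] that w by (auto simp: S.scal_def)
  then obtain c where "\<And>h. h \<in> H ==> T h w = c h *s w" by metis
  then show ?thesis using fi w U by blast
qed

section \<open>Minimal normal subgroups of soluble groups of finite rank\<close>

lemma (in group) normal_nat_pow: "N \<lhd> G ==> x \<in> N ==> x [^] (n::nat) \<in> N"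
  using subgroup_int_pow_closed[OF normal_imp_subgroup, of N x "int n"] by (simp add: int_pow_int)

lemma (in group) normal_mem: "N \<lhd> G ==> x \<in> N ==> x \<in> carrier G"
  by (rule subgroup.mem_carrier[OF normal_imp_subgroup])

lemma (in group) normalI_conj:
  assumes "N \<subseteq> carrier G" "\<one> \<in> N" "\<And>x y. x \<in> N ==> y \<in> N ==> x \<otimes> y \<in> N" "\<And>x. x \<in> N ==> inv x \<in> N"
    "\<And>g x. g \<in> carrier G ==> x \<in> N ==> g \<otimes> x \<otimes> inv g \<in> N"
  shows "N \<lhd> G"
proof -
  have "subgroup N G" using assms by (intro subgroupI) auto
  then show ?thesis using assms by (simp add: normal_inv_iff)
qed

lemma (in group) coprime_pow_mem:
  assumes N: "subgroup N G" and x: "x \<in> carrier G" and m: "x [^] (m::nat) \<in> N" "x [^] (n::nat) \<in> N" "coprime m n" "m > 0"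
  shows "x \<in> N"
proof -
  obtain a b where "m * a = n * b + gcd m n" using bezout_nat[of m n] m(4) by auto
  then have e: "m * a = n * b + 1" using m(3) by simp
  have pw: "y [^] (i::nat) \<in> N" if "y \<in> N" for y i
    using subgroup_int_pow_closed[OF N that, of "int i"] by (simp add: int_pow_int)
  have "x [^] (m * a) = x [^] (n * b) \<otimes> x" unfolding e using x by (simp add: nat_pow_mult[symmetric])
  moreover have "x [^] (m * a) \<in> N" "x [^] (n * b) \<in> N" using pw[OF m(1)] pw[OF m(2)] x by (simp_all add: nat_pow_pow)
  ultimately have "inv (x [^] (n * b)) \<otimes> (x [^] (n * b) \<otimes> x) \<in> N"
    using subgroup.m_closed[OF N subgroup.m_inv_closed[OF N]] by metis
  then show ?thesis using x by (simp add: inv_cancel)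
qed

lemma (in group) commutator_in_derived:
  assumes "x \<in> H" "y \<in> H"
  shows "x \<otimes> y \<otimes> inv x \<otimes> inv y \<in> derived G H"
  unfolding derived_def by (rule generate.incl) (use assms in blast)

lemma (in group) subgroup_Union_chain:
  assumes C: "C \<noteq> {}" "subset.chain F C" and sg: "\<And>K. K \<in> C ==> subgroup K G"
  shows "subgroup (\<Union>C) G" "x \<in> \<Union>C ==> y \<in> \<Union>C ==> \<exists>K\<in>C. x \<in> K \<and> y \<in> K"
proof -
  show two: "\<exists>K\<in>C. x \<in> K \<and> y \<in> K" if xy: "x \<in> \<Union>C" "y \<in> \<Union>C" for x y
  proof -
    obtain K L where KL: "K \<in> C" "L \<in> C" "x \<in> K" "y \<in> L" using xy by blast
    have "K \<subseteq> L \<or> L \<subseteq> K" using C(2) KL(1,2) by (auto simp: subset_chain_def)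
    then show ?thesis using KL by blast
  qed
  show "subgroup (\<Union>C) G"
  proof (rule subgroupI)
    show "\<Union>C \<subseteq> carrier G" using subgroup.subset[OF sg] by blast
    show "\<Union>C \<noteq> {}" using C(1) subgroup.one_closed[OF sg] by blast
    show "inv a \<in> \<Union>C" if "a \<in> \<Union>C" for a using that subgroup.m_inv_closed[OF sg] by blast
    show "a \<otimes> b \<in> \<Union>C" if "a \<in> \<Union>C" "b \<in> \<Union>C" for a b using two[OF that] subgroup.m_closed[OF sg] by blast
  qed
qed

definition normal_closure :: "('g, 'm) monoid_scheme => 'g set => 'g set" where
  "normal_closure G S = \<Inter>{N. N \<lhd> G \<and> S \<subseteq> N}"

lemma (in group) normal_closure_facts:
  assumes S: "S \<subseteq> carrier G"
  shows "normal_closure G S \<lhd> G" "S \<subseteq> normal_closure G S" "N \<lhd> G ==> S \<subseteq> N ==> normal_closure G S \<subseteq> N"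
proof -
  let ?L = "normal_closure G S"
  have LI: "y \<in> ?L" if "\<And>H. H \<lhd> G ==> S \<subseteq> H ==> y \<in> H" for y unfolding normal_closure_def using that by simp
  have LD: "y \<in> H" if "y \<in> ?L" "H \<lhd> G" "S \<subseteq> H" for y H using that unfolding normal_closure_def by simp
  have G: "carrier G \<lhd> G" by (rule normalI_conj) auto
  show "S \<subseteq> ?L" using LI by blast
  show "N \<lhd> G ==> S \<subseteq> N ==> ?L \<subseteq> N" using LD by (meson subsetI)
  show "?L \<lhd> G"
  proof (rule normalI_conj)
    show "?L \<subseteq> carrier G" using LD[OF _ G S] by (rule subsetI)
    show "\<one> \<in> ?L" by (rule LI, rule subgroup.one_closed[OF normal_imp_subgroup])
    show "a \<otimes> b \<in> ?L" if "a \<in> ?L" "b \<in> ?L" for a b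
      by (rule LI) (rule subgroup.m_closed[OF normal_imp_subgroup]; use LD that in simp)
    show "inv a \<in> ?L" if "a \<in> ?L" for a
      by (rule LI) (rule subgroup.m_inv_closed[OF normal_imp_subgroup]; use LD that in simp)
    show "g \<otimes> a \<otimes> inv g \<in> ?L" if "g \<in> carrier G" "a \<in> ?L" for g a
      by (rule LI) (rule normal.inv_op_closed2; use LD that in simp)
  qed
qed

lemma (in group) torsion_prime_element:
  assumes N: "N \<lhd> G" and x: "x \<in> N" "x \<noteq> \<one>" "x [^] (n::nat) = \<one>" "n > 0"
  obtains q y where "Factorial_Ring.prime (q::nat)" "y \<in> N" "y \<noteq> \<one>" "y [^] q = \<one>"
proof -
  define d where "d = (LEAST d::nat. d > 0 \<and> x [^] d = \<one>)"
  have d: "d > 0 \<and> x [^] d = \<one>" unfolding d_def by (rule LeastI[of "\<lambda>d. d > 0 \<and> x [^] d = \<one>" n]) (use x in simp)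
  have xc: "x \<in> carrier G" by (rule normal_mem[OF N x(1)])
  have "d \<noteq> 1" using d x(2) xc by (metis nat_pow_eone)
  then obtain q where q: "Factorial_Ring.prime q" "q dvd d" using prime_factor_nat by blast
  then obtain e where e: "d = q * e" by blast
  have e0: "0 < e" "e < d" using e d prime_gt_1_nat[OF q(1)] by (auto intro: gr0I)
  have "x [^] e \<noteq> \<one>"
  proof
    assume "x [^] e = \<one>"
    then have "d \<le> e" unfolding d_def using e0 by (intro Least_le) simp
    then show False using e0 by simp
  qed
  moreover have "(x [^] e) [^] q = \<one>" using d e xc by (simp add: nat_pow_pow mult.commute)
  ultimately show thesis using that[OF q(1) normal_nat_pow[OF N x(1)]] by blast
qed

lemma (in group) finite_normal_contains_minimal:
  assumes M: "M \<lhd> G" "finite M" "M \<noteq> {\<one>}"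
  obtains N where "minimal_normal N G" "N \<subseteq> M"
proof -
  let ?P = "\<lambda>N. N \<lhd> G \<and> N \<subseteq> M \<and> N \<noteq> {\<one>}"
  obtain N where N: "?P N" "\<And>L. ?P L ==> card N \<le> card L" using ex_has_least_nat[of ?P M card] M by blast
  have fN: "finite N" using N(1) M(2) finite_subset by blast
  have "minimal_normal N G"
    unfolding minimal_normal_def
  proof (intro conjI allI impI)
    fix L assume L: "L \<lhd> G \<and> L \<subseteq> N \<and> L \<noteq> {\<one>}"
    then have "card N \<le> card L" using N by blast
    then show "L = N" using L fN by (meson card_seteq)
  qed (use N in blast)+
  with N that show thesis by blast
qed

lemma (in group_hom) finite_rank_image:
  assumes "finite_rank G" and surj: "carrier H = h ` carrier G"
  shows "finite_rank H"
proof -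
  obtain r where r: "\<And>S. S \<subseteq> carrier G ==> finite S ==> \<exists>T\<subseteq>carrier G. finite T \<and> card T \<le> r \<and> generate G T = generate G S"
    using assms(1) unfolding finite_rank_def by blast
  show ?thesis
    unfolding finite_rank_def
  proof (intro exI[of _ r] allI impI)
    fix S assume S: "S \<subseteq> carrier H" "finite S"
    obtain S0 where S0: "S0 \<subseteq> carrier G" "finite S0" "S = h ` S0"
      using finite_subset_image[OF S(2) S(1)[unfolded surj]] by (elim exE conjE) (rule that)
    obtain T where T: "T \<subseteq> carrier G" "finite T" "card T \<le> r" "generate G T = generate G S0" using r[OF S0(1,2)] by blast
    have "generate H (h ` T) = generate H S" using generate_img[OF T(1)] generate_img[OF S0(1)] T(4) S0(3) by simp
    moreover have "card (h ` T) \<le> r" using card_image_le[OF T(2), of h] T(3) by linarith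
    moreover have "h ` T \<subseteq> carrier H" unfolding surj by (rule image_mono[OF T(1)])
    ultimately show "\<exists>T\<subseteq>carrier H. finite T \<and> card T \<le> r \<and> generate H T = generate H S" using T(2) by blast
  qed
qed

lemma (in group) abelian_subgroup_comm_group:
  assumes "subgroup B G" "\<And>x y. x \<in> B ==> y \<in> B ==> x \<otimes> y = y \<otimes> x"
  shows "comm_group (G\<lparr>carrier := B\<rparr>)"
proof -
  interpret B: group "G\<lparr>carrier := B\<rparr>" by (rule subgroup.subgroup_is_group[OF assms(1) is_group])
  show ?thesis by (rule B.group_comm_groupI) (use assms(2) in auto)
qed

lemma (in group) finite_rank_subgroup:
  assumes "finite_rank G" "subgroup B G"
  shows "finite_rank (G\<lparr>carrier := B\<rparr>)"
proof -
  obtain r where r: "\<And>S. S \<subseteq> carrier G ==> finite S ==>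
      \<exists>T \<subseteq> carrier G. finite T \<and> card T \<le> r \<and> generate G T = generate G S"
    using assms(1) by (auto simp: finite_rank_def)
  have "\<exists>T\<subseteq>B. finite T \<and> card T \<le> r \<and> generate (G\<lparr>carrier := B\<rparr>) T = generate (G\<lparr>carrier := B\<rparr>) S"
    if S: "S \<subseteq> B" "finite S" for S
  proof -
    have BG: "B \<subseteq> carrier G" using assms(2) by (rule subgroup.subset)
    obtain T where T: "T \<subseteq> carrier G" "finite T" "card T \<le> r" "generate G T = generate G S"
      using r[of S] S BG by blast
    have "generate G S \<subseteq> B" using generate_subgroup_incl[OF S(1) assms(2)] .
    then have "T \<subseteq> B" using T(4) generate.incl[of _ T G] by blast
    then show ?thesis
      using T S generate_consistent[OF _ assms(2)] by (intro exI[of _ T]) auto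
  qed
  then show ?thesis unfolding finite_rank_def by auto
qed

lemma (in group) conj_nat_pow:
  assumes "g \<in> carrier G" "x \<in> carrier G"
  shows "g \<otimes> x [^] (n::nat) \<otimes> inv g = (g \<otimes> x \<otimes> inv g) [^] n"
proof (induction n)
  case (Suc n)
  have "g \<otimes> (x [^] n \<otimes> x) \<otimes> inv g = (g \<otimes> x [^] n \<otimes> inv g) \<otimes> (g \<otimes> x \<otimes> inv g)"
    using assms by (simp add: m_assoc inv_cancel)
  then show ?case using Suc by simp
qed (use assms in simp)

lemma (in group) normal_torsion_and_powers:
  assumes N: "N \<lhd> G" and comm: "\<And>x y. x \<in> N ==> y \<in> N ==> x \<otimes> y = y \<otimes> x"
  shows "{x \<in> N. x [^] (n::nat) = \<one>} \<lhd> G" "(\<lambda>x. x [^] n) ` N \<lhd> G"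
proof -
  interpret N: normal N G by (rule N)
  have NG: "\<And>x. x \<in> N ==> x \<in> carrier G" using N.subset by blast
  have dist: "(x \<otimes> y) [^] n = x [^] n \<otimes> y [^] n" if "x \<in> N" "y \<in> N" for x y
    by (rule pow_mult_distrib) (use that comm NG in auto)
  have "subgroup {x \<in> N. x [^] n = \<one>} G"
    by (rule subgroupI) (auto simp: NG dist nat_pow_inv intro!: exI[of _ \<one>])
  moreover have "g \<otimes> x \<otimes> inv g \<in> {x \<in> N. x [^] n = \<one>}" if "g \<in> carrier G" "x \<in> {x \<in> N. x [^] n = \<one>}" for g x
    using that conj_nat_pow[of g x n] N.inv_op_closed2 NG by auto
  ultimately show "{x \<in> N. x [^] n = \<one>} \<lhd> G" unfolding normal_inv_iff by blast
  have "subgroup ((\<lambda>x. x [^] n) ` N) G"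
  proof (rule subgroupI)
    show "(\<lambda>x. x [^] n) ` N \<subseteq> carrier G" "(\<lambda>x. x [^] n) ` N \<noteq> {}" using NG N.one_closed by blast+
    fix a assume "a \<in> (\<lambda>x. x [^] n) ` N"
    then obtain x where x: "x \<in> N" "a = x [^] n" by blast
    then have "inv a = (inv x) [^] n" using NG by (simp add: nat_pow_inv)
    then show "inv a \<in> (\<lambda>x. x [^] n) ` N" using x by blast
    fix b assume "b \<in> (\<lambda>x. x [^] n) ` N"
    then obtain y where "y \<in> N" "b = y [^] n" by blast
    then have "a \<otimes> b = (x \<otimes> y) [^] n" "x \<otimes> y \<in> N" using x dist by auto
    then show "a \<otimes> b \<in> (\<lambda>x. x [^] n) ` N" by blast
  qed
  moreover have "g \<otimes> a \<otimes> inv g \<in> (\<lambda>x. x [^] n) ` N" if "g \<in> carrier G" "a \<in> (\<lambda>x. x [^] n) ` N" for g a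
    using that conj_nat_pow[of g _ n] N.inv_op_closed2 NG by fastforce
  ultimately show "(\<lambda>x. x [^] n) ` N \<lhd> G" unfolding normal_inv_iff by blast
qed

lemma (in group) socle_facts:
  assumes "solvable G"
  shows "socle G \<lhd> G" "\<And>N. minimal_normal N G ==> N \<subseteq> socle G"
    "\<And>x y. x \<in> socle G ==> y \<in> socle G ==> x \<otimes> y = y \<otimes> x"
proof -
  have sub: "\<Union>{N. minimal_normal N G} \<subseteq> carrier G"
    by (auto simp: minimal_normal_def dest!: normal_imp_subgroup subgroup.subset)
  show incl: "\<And>N. minimal_normal N G ==> N \<subseteq> socle G"
    unfolding socle_def by (auto intro: generate.incl)
  show "socle G \<lhd> G"
    unfolding socle_def
  proof (rule normal_generateI[OF sub])
    fix h g assume "h \<in> \<Union>{N. minimal_normal N G}" and g: "g \<in> carrier G"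
    then obtain N where "minimal_normal N G" "h \<in> N" by auto
    with g show "g \<otimes> h \<otimes> inv g \<in> \<Union>{N. minimal_normal N G}"
      unfolding minimal_normal_def by (blast intro: normal.inv_op_closed2)
  qed
  interpret S: ZG_module G "G\<lparr>carrier := socle G\<rparr>" "conj_by G"
    by (rule socle_ZG_module[OF is_group assms])
  show "\<And>x y. x \<in> socle G ==> y \<in> socle G ==> x \<otimes> y = y \<otimes> x"
    using S.A.m_comm by simp
qed

interpretation cfun: complex_space "\<lambda>c (f :: 'x => complex) x. c * f x"
  by unfold_locales (auto simp: fun_eq_iff algebra_simps)

lemma fin_dim_if_determined:
  assumes "finite Y" "cfun.subspace W" "\<And>f. f \<in> W ==> \<forall>y\<in>Y. f y = 0 ==> f = 0"
  shows "cfun.fin_dim (W :: ('x => complex) set)"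
  using assms
proof (induction Y arbitrary: W rule: finite_induct)
  case empty
  then have "W \<subseteq> cfun.span {}" unfolding cfun.span_empty by blast
  then show ?case unfolding cfun.fin_dim_def by blast
next
  case (insert y Y)
  let ?V = "{f \<in> W. f y = 0}"
  have sV: "cfun.subspace ?V"
    using cfun.subspace_0 cfun.subspace_add cfun.subspace_scale insert.prems(1)
    by (intro cfun.subspaceI) auto
  have "cfun.fin_dim ?V" by (rule insert.IH[OF sV]) (use insert.prems(2) in auto)
  then obtain B where B: "finite B" "?V \<subseteq> cfun.span B" by (auto simp: cfun.fin_dim_def)
  show ?case
  proof (cases "\<exists>f\<in>W. f y \<noteq> 0")
    case False
    then have "W = ?V" by auto
    then show ?thesis using B unfolding cfun.fin_dim_def by metis
  next
    case True
    then obtain f where f: "f \<in> W" "f y \<noteq> 0" by blast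
    have "g \<in> cfun.span (insert f B)" if g: "g \<in> W" for g
    proof -
      let ?c = "g y / f y"
      have "g - (\<lambda>x. ?c * f x) \<in> W" using cfun.subspace_diff[OF insert.prems(1) g] cfun.subspace_scale[OF insert.prems(1) f(1)] by blast
      moreover have "(g - (\<lambda>x. ?c * f x)) y = 0" using f by simp
      ultimately have "g - (\<lambda>x. ?c * f x) \<in> cfun.span B" using B by blast
      then have "g - (\<lambda>x. ?c * f x) \<in> cfun.span (insert f B)" using cfun.span_mono[of B "insert f B"] by blast
      moreover have "(\<lambda>x. ?c * f x) \<in> cfun.span (insert f B)" by (intro cfun.span_scale cfun.span_base) simp
      ultimately have "(g - (\<lambda>x. ?c * f x)) + (\<lambda>x. ?c * f x) \<in> cfun.span (insert f B)" by (rule cfun.span_add)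
      then show ?thesis by simp
    qed
    then show ?thesis using B(1) unfolding cfun.fin_dim_def by (intro exI[of _ "insert f B"]) auto
  qed
qed

lemma (in comm_group) pow_repr:
  assumes "x \<in> carrier G" "y \<in> carrier G" "z \<in> carrier G" "x [^] (n::nat) = y [^] (j::int) \<otimes> z"
  shows "x [^] (n * k) = y [^] (j * int k) \<otimes> z [^] (k::nat)"
proof -
  have "x [^] (n * k) = (x [^] n) [^] k" using assms(1) by (simp only: nat_pow_pow)
  also have "\<dots> = (y [^] j) [^] k \<otimes> z [^] k" unfolding assms(4) using assms by (simp add: nat_pow_distrib)
  also have "(y [^] j) [^] k = (y [^] j) [^] int k" by (simp only: int_pow_int)
  also have "\<dots> = y [^] (j * int k)" using assms(2) by (rule int_pow_pow)
  finally show ?thesis .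
qed

text \<open>For a minimal finite \<open>Y\<close> modulo which the group is torsion, the map reads off the rational
  coordinate at one element of \<open>Y\<close>.\<close>

lemma (in comm_group) nonzero_additive_map:
  assumes fr: "finite_rank G" and tf: "torsion_free G" and nt: "carrier G \<noteq> {\<one>}"
  shows "\<exists>Y l. finite Y \<and> Y \<subseteq> carrier G \<and> (\<forall>x\<in>carrier G. \<exists>n::nat. n > 0 \<and> x [^] n \<in> generate G Y) \<and>
    (\<forall>x\<in>carrier G. \<forall>y\<in>carrier G. l (x \<otimes> y) = l x + (l y :: complex)) \<and> (\<exists>x\<in>carrier G. l x \<noteq> 0)"
proof -
  define good where "good = (\<lambda>Y. finite Y \<and> Y \<subseteq> carrier G \<and> (\<forall>x\<in>carrier G. \<exists>n::nat. n > 0 \<and> x [^] n \<in> generate G Y))"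
  obtain Y0 where "good Y0" using torsion_over_finite_if_finite_rank[OF fr] by (auto simp: good_def)
  then obtain Y where Y: "good Y" "\<And>Z. good Z ==> card Y \<le> card Z"
    using ex_has_least_nat[of good Y0 card] by blast
  have Y': "finite Y" "Y \<subseteq> carrier G" "\<And>x. x \<in> carrier G ==> \<exists>n::nat. n > 0 \<and> x [^] n \<in> generate G Y"
    using Y(1) by (auto simp: good_def)
  have "Y \<noteq> {}"
  proof
    assume "Y = {}"
    moreover obtain x where x: "x \<in> carrier G" "x \<noteq> \<one>" using nt by blast
    ultimately obtain n :: nat where "n > 0" "x [^] n = \<one>" using Y'(3)[OF x(1)] by (auto simp: generate_empty)
    then show False using x tf by (auto simp: torsion_free_def)
  qed
  then obtain y where y: "y \<in> Y" by blast
  define Z where "Z = Y - {y}"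
  have YZ: "Y = insert y Z" "y \<in> carrier G" "Z \<subseteq> carrier G" "finite Z" using y Y' by (auto simp: Z_def)
  have sZ: "subgroup (generate G Z) G" by (rule generate_is_subgroup[OF YZ(3)])
  have gZ: "generate G Z \<subseteq> carrier G" by (rule generate_incl[OF YZ(3)])
  have rep: "\<exists>n::nat. n > 0 \<and> (\<exists>i::int. \<exists>h\<in>generate G Z. x [^] n = y [^] i \<otimes> h)" if x: "x \<in> carrier G" for x
  proof -
    obtain n :: nat where n: "n > 0" "x [^] n \<in> generate G (insert y Z)" using Y'(3)[OF x] YZ(1) by auto
    then obtain i :: int and h where "h \<in> generate G Z" "x [^] n = y [^] i \<otimes> h"
      using generate_insert_mult[OF YZ(3,2) n(2)] by metis
    then show ?thesis using n by blast
  qed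
  have indep: "i = 0" if i: "y [^] (i::int) \<in> generate G Z" for i
  proof (rule ccontr)
    assume i0: "i \<noteq> 0"
    define k where "k = nat \<bar>i\<bar>"
    have k0: "k > 0" using i0 by (simp add: k_def)
    have "y [^] (-i) \<in> generate G Z" using subgroup.m_inv_closed[OF sZ i] YZ by (simp add: int_pow_neg)
    then have "y [^] \<bar>i\<bar> \<in> generate G Z" using i by (cases "i \<ge> 0") auto
    then have k: "y [^] int k \<in> generate G Z" by (simp add: k_def)
    have "good Z" unfolding good_def
    proof (intro conjI ballI YZ)
      fix x assume x: "x \<in> carrier G"
      then obtain n :: nat and j :: int and h where n: "n > 0" "h \<in> generate G Z" "x [^] n = y [^] j \<otimes> h"
        using rep by metis
      have hG: "h \<in> carrier G" using n gZ by blast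
      have "x [^] (n * k) = y [^] (j * int k) \<otimes> h [^] k" by (rule pow_repr[OF x YZ(2) hG n(3)])
      also have "y [^] (j * int k) = (y [^] int k) [^] j" using YZ by (simp only: int_pow_pow mult.commute)
      finally have "x [^] (n * k) \<in> generate G Z"
        using subgroup.m_closed[OF sZ subgroup_int_pow_closed[OF sZ k] subgroup_int_pow_closed[OF sZ n(2)], of j "int k"]
        by (simp add: int_pow_int)
      then show "\<exists>n::nat. n > 0 \<and> x [^] n \<in> generate G Z" using n k0 by (intro exI[of _ "n * k"]) auto
    qed
    then have "card Y \<le> card Z" by (rule Y(2))
    then show False using y Y'(1) by (metis Z_def card_Diff1_less leD)
  qed
  obtain n i h where nih: "\<And>x. x \<in> carrier G ==> n x > (0::nat) \<and> h x \<in> generate G Z \<and> x [^] n x = y [^] (i x::int) \<otimes> h x"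
    using rep by metis
  define l :: "'a => complex" where "l = (\<lambda>x. of_int (i x) / of_nat (n x))"
  have l_eq: "l x = of_int j / of_nat m" if h: "x \<in> carrier G" "m > 0" "z \<in> generate G Z" "x [^] (m::nat) = y [^] (j::int) \<otimes> z" for x m j z
  proof -
    note N = nih[OF h(1)]
    have car: "z \<in> carrier G" "h x \<in> carrier G" using h N gZ by auto
    have "x [^] (m * n x) = y [^] (j * int (n x)) \<otimes> z [^] n x"
      by (rule pow_repr[OF h(1) YZ(2) car(1) h(4)])
    moreover have "x [^] (n x * m) = y [^] (i x * int m) \<otimes> h x [^] m"
      using pow_repr[OF h(1) YZ(2) car(2)] N by blast
    ultimately have e: "y [^] (j * int (n x)) \<otimes> z [^] n x = y [^] (i x * int m) \<otimes> h x [^] m"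
      by (simp add: mult.commute)
    have "y [^] (j * int (n x) - i x * int m) = h x [^] m \<otimes> inv (z [^] n x)"
    proof -
      have "y [^] (j * int (n x)) = (y [^] (i x * int m) \<otimes> h x [^] m) \<otimes> inv (z [^] n x)"
        using e car YZ by (simp add: inv_solve_right)
      then show ?thesis using car YZ by (simp add: int_pow_diff m_ac)
    qed
    moreover have "h x [^] m \<otimes> inv (z [^] n x) \<in> generate G Z"
      using subgroup_int_pow_closed[OF sZ, of "h x" "int m"] subgroup_int_pow_closed[OF sZ, of z "int (n x)"] N h
      by (simp add: int_pow_int subgroup.m_closed[OF sZ] subgroup.m_inv_closed[OF sZ])
    ultimately have "j * int (n x) - i x * int m = 0" by (intro indep) simp
    then have "j * int (n x) = i x * int m" by simp
    then have "of_int j * of_nat (n x) = (of_int (i x) * of_nat m :: complex)"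
      by (metis of_int_mult of_int_of_nat_eq)
    then show ?thesis using N h by (simp add: l_def field_simps)
  qed
  have add: "l (x \<otimes> w) = l x + l w" if x: "x \<in> carrier G" and w: "w \<in> carrier G" for x w
  proof -
    note N = nih[OF x] and M = nih[OF w]
    have car: "h x \<in> carrier G" "h w \<in> carrier G" using N M gZ by auto
    have 1: "x [^] (n x * n w) = y [^] (i x * int (n w)) \<otimes> h x [^] n w"
      using pow_repr[OF x YZ(2) car(1)] N by blast
    have 2: "w [^] (n w * n x) = y [^] (i w * int (n x)) \<otimes> h w [^] n x"
      using pow_repr[OF w YZ(2) car(2)] M by blast
    have 3: "(x \<otimes> w) [^] (n x * n w) = y [^] (i x * int (n w) + i w * int (n x)) \<otimes> (h x [^] n w \<otimes> h w [^] n x)"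
      using 1 2 x w car YZ by (simp add: nat_pow_distrib mult.commute int_pow_mult m_ac)
    have 4: "h x [^] n w \<otimes> h w [^] n x \<in> generate G Z"
      using subgroup_int_pow_closed[OF sZ, of "h x" "int (n w)"] subgroup_int_pow_closed[OF sZ, of "h w" "int (n x)"] N M
      by (simp add: int_pow_int subgroup.m_closed[OF sZ])
    have "l (x \<otimes> w) = of_int (i x * int (n w) + i w * int (n x)) / of_nat (n x * n w)"
      by (rule l_eq[OF _ _ 4 3]) (use x w N M in auto)
    also have "\<dots> = l x + l w" using N M by (simp add: l_def field_simps)
    finally show ?thesis .
  qed
  have "l y = 1" using l_eq[OF YZ(2), of 1 \<one> 1] YZ generate.one[of G Z] by simp
  then show ?thesis using Y' add YZ by (intro exI[of _ Y] exI[of _ l]) (auto intro!: bexI[of _ y])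
qed

text \<open>As an irreducible module \<open>N\<close> is divisible. The space of additive maps \<open>N \<rightarrow> \<complex>\<close> has
  finite dimension, so it contains a common eigenvector \<open>l\<close> of a subgroup \<open>H\<close> of finite index, which acts on
  \<open>l(N)\<close> through complex multipliers \<open>c h\<close>. Since \<open>N\<close> is generated by the conjugates of one element,
  \<open>l(N)\<close> is finitely generated over the ring of the multipliers, contradicting
  \<open>no_divisible_finitely_generated\<close>.\<close>

lemma (in group) torsion_free_not_minimal_normal:
  assumes solv: "solvable G" and fr: "finite_rank G" and min: "minimal_normal N G"
    and tf: "torsion_free (G\<lparr>carrier := N\<rparr>)"
  shows False
proof -
  have nN: "N \<lhd> G" and N1: "N \<noteq> {\<one>}"
    and minN: "\<And>M. M \<lhd> G ==> M \<subseteq> N ==> M \<noteq> {\<one>} ==> M = N"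
    using min by (auto simp: minimal_normal_def)
  interpret N: normal N G by (rule nN)
  have NG: "\<And>x. x \<in> N ==> x \<in> carrier G" using N.subset by blast
  have comm: "x \<otimes> y = y \<otimes> x" if "x \<in> N" "y \<in> N" for x y
    using socle_facts(2)[OF solv min] socle_facts(3)[OF solv, of x y] that by blast
  interpret NC: comm_group "G\<lparr>carrier := N\<rparr>"
    by (rule abelian_subgroup_comm_group[OF N.subgroup_axioms comm])
  have npow: "x [^]\<^bsub>G\<lparr>carrier := N\<rparr>\<^esub> (n::nat) = x [^] n" for x n by (rule nat_pow_consistent[symmetric])
  have gen: "generate (G\<lparr>carrier := N\<rparr>) S = generate G S" if "S \<subseteq> N" for S
    by (rule generate_consistent[OF that N.subgroup_axioms])
  have tf': "x = \<one>" if "x \<in> N" "n > 0" "x [^] (n::nat) = \<one>" for x n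
    using tf that by (auto simp: torsion_free_def npow)
  have cj: "inv g \<otimes> x \<otimes> g \<in> N" if "g \<in> carrier G" "x \<in> N" for g x
    using N.inv_op_closed1[OF that] .
  obtain Y l0 where Y: "finite Y" "Y \<subseteq> N" "\<And>x. x \<in> N ==> \<exists>n::nat. n > 0 \<and> x [^] n \<in> generate G Y"
    and l0: "\<And>x y. x \<in> N ==> y \<in> N ==> l0 (x \<otimes> y) = l0 x + (l0 y :: complex)" "\<exists>x\<in>N. l0 x \<noteq> 0"
  proof -
    have "carrier (G\<lparr>carrier := N\<rparr>) \<noteq> {\<one>\<^bsub>G\<lparr>carrier := N\<rparr>\<^esub>}" using N1 by simp
    from NC.nonzero_additive_map[OF finite_rank_subgroup[OF fr N.subgroup_axioms] tf this]
    obtain Y l where Yl: "finite Y" "Y \<subseteq> N" "\<forall>x\<in>N. \<exists>n::nat. n > 0 \<and> x [^] n \<in> generate (G\<lparr>carrier := N\<rparr>) Y"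
      "\<forall>x\<in>N. \<forall>y\<in>N. l (x \<otimes> y) = l x + (l y :: complex)" "\<exists>x\<in>N. l x \<noteq> 0"
      by (auto simp: npow)
    show thesis by (rule that[of Y l]) (use Yl gen in auto)
  qed
  define W where "W = {f :: 'a => complex. (\<forall>x\<in>N. \<forall>y\<in>N. f (x \<otimes> y) = f x + f y) \<and> (\<forall>x. x \<notin> N --> f x = 0)}"
  define T where "T = (\<lambda>g (f :: 'a => complex) x. if x \<in> N then f (inv g \<otimes> x \<otimes> g) else 0)"
  have W_add: "f (x \<otimes> y) = f x + f y" if "f \<in> W" "x \<in> N" "y \<in> N" for f x y using that by (simp add: W_def)
  have W_one: "f \<one> = 0" if "f \<in> W" for f using W_add[OF that N.one_closed N.one_closed] by simp
  have W_inv: "f (inv x) = - f x" if "f \<in> W" "x \<in> N" for f x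
    using W_add[OF that(1) that(2), of "inv x"] that W_one[OF that(1)] NG by (simp add: eq_neg_iff_add_eq_0 add.commute)
  have W_pow: "f (x [^] (n::nat)) = of_nat n * f x" if "f \<in> W" "x \<in> N" for f x n
  proof (induction n)
    case (Suc n)
    have "x [^] n \<in> N" using NC.nat_pow_closed[of x n] that by (simp add: npow)
    then show ?case using Suc that by (simp add: W_add algebra_simps)
  qed (use that W_one in simp)
  have subW: "cfun.subspace W" by (rule cfun.subspaceI) (auto simp: W_def algebra_simps)
  have fdW: "cfun.fin_dim W"
  proof (rule fin_dim_if_determined[OF Y(1) subW])
    fix f assume f: "f \<in> W" "\<forall>y\<in>Y. f y = 0"
    have "subgroup {x \<in> N. f x = 0} G"
      by (rule subgroupI) (auto simp: NG W_add[OF f(1)] W_inv[OF f(1)] W_one[OF f(1)] intro!: exI[of _ \<one>])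
    then have "generate G Y \<subseteq> {x \<in> N. f x = 0}" by (rule generate_subgroup_incl[rotated]) (use f Y in auto)
    then have "f x = 0" if "x \<in> N" for x
      using Y(3)[OF that] W_pow[OF f(1) that] by force
    then show "f = 0" using f by (auto simp: W_def fun_eq_iff)
  qed
  interpret L: lin_action "\<lambda>c (f :: 'a => complex) x. c * f x" G T W
  proof (unfold_locales)
    show "cfun.fin_dim W" "cfun.subspace W" by fact+
    fix g assume g: "g \<in> carrier G"
    have "T g f \<in> W" if "f \<in> W" for f
    proof -
      have "T g f (x \<otimes> y) = T g f x + T g f y" if xy: "x \<in> N" "y \<in> N" for x y
      proof -
        have "inv g \<otimes> (x \<otimes> y) \<otimes> g = (inv g \<otimes> x \<otimes> g) \<otimes> (inv g \<otimes> y \<otimes> g)"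
          using g xy NG by (simp add: m_assoc inv_cancel)
        then show ?thesis using W_add[OF \<open>f \<in> W\<close>] xy cj g by (simp add: T_def)
      qed
      then show ?thesis by (simp add: W_def T_def)
    qed
    then show "cfun.lin_on W (T g)" by (auto simp: cfun.lin_on_def T_def fun_eq_iff)
    fix h w assume h: "h \<in> carrier G"
    have "inv (g \<otimes> h) \<otimes> x \<otimes> (g \<otimes> h) = inv h \<otimes> (inv g \<otimes> x \<otimes> g) \<otimes> h" if "x \<in> N" for x
      using g h NG[OF that] by (simp add: inv_mult_group m_assoc)
    then show "T (g \<otimes> h) w = T g (T h w)" using cj[OF g] by (auto simp: T_def fun_eq_iff)
  next
    fix w assume "w \<in> W"
    then show "T \<one> w = w" using NG by (auto simp: T_def W_def fun_eq_iff)
  qed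
  have "W \<noteq> {0}"
  proof -
    let ?f = "\<lambda>x. if x \<in> N then l0 x else 0"
    have "?f \<in> W" using l0(1) by (simp add: W_def)
    moreover have "?f \<noteq> 0" using l0(2) by (auto simp: fun_eq_iff)
    ultimately show ?thesis by blast
  qed
  then obtain H l c where fi: "fin_index G H" and l: "l \<in> W" "l \<noteq> 0" and c: "\<And>h. h \<in> H ==> T h l = (\<lambda>x. c h * l x)"
    using L.virtual_eigenvector[OF solv] by blast
  have H: "subgroup H G" using fi by (simp add: fin_index_def)
  interpret H: subgroup H G by (rule H)
  have HG: "\<And>h. h \<in> H ==> h \<in> carrier G" using H.subset by blast
  have lc: "l (inv h \<otimes> x \<otimes> h) = c h * l x" if "h \<in> H" "x \<in> N" for h x
    using fun_cong[OF c[OF that(1)], of x] that by (simp add: T_def)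
  obtain x1 where x1: "x1 \<in> N" "l x1 \<noteq> 0" using l by (auto simp: W_def fun_eq_iff)
  have c_mult: "c (g \<otimes> h) = c g * c h" if "g \<in> H" "h \<in> H" for g h
  proof -
    have "T (g \<otimes> h) l = T g (T h l)" using L.T_mult that HG l(1) by blast
    then have "c (g \<otimes> h) * l x1 = T g (\<lambda>x. c h * l x) x1" using c that by (simp add: fun_eq_iff)
    also have "\<dots> = c h * (c g * l x1)" using lc that x1 by (simp add: T_def)
    finally show ?thesis using x1 by simp
  qed
  have c_one: "c \<one> = 1" using lc[of \<one> x1] x1 NG by simp
  have c_inv: "c h * c (inv h) = 1" if "h \<in> H" for h
    using c_mult[of h "inv h"] that HG c_one by simp
  then have c0: "c h \<noteq> 0" "inverse (c h) = c (inv h)" if "h \<in> H" for h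
  proof -
    note e = c_inv[OF that]
    show "c h \<noteq> 0" using e by (metis mult_zero_left zero_neq_one)
    show "inverse (c h) = c (inv h)" using e by (rule inverse_unique)
  qed
  define CC :: "complex monoid" where "CC = \<lparr>carrier = c ` H, monoid.mult = (*), one = 1\<rparr>"
  have sel: "carrier CC = c ` H" "monoid.mult CC = (*)" "one CC = 1" by (auto simp: CC_def)
  interpret CC: comm_group CC
  proof (rule comm_groupI)
    show "x \<otimes>\<^bsub>CC\<^esub> y \<in> carrier CC" if xy: "x \<in> carrier CC" "y \<in> carrier CC" for x y
    proof -
      obtain g h where "g \<in> H" "h \<in> H" "x = c g" "y = c h" using xy by (auto simp: sel)
      then have "x \<otimes>\<^bsub>CC\<^esub> y = c (g \<otimes> h)" "g \<otimes> h \<in> H" using c_mult[of g h] H.m_closed[of g h] by (simp_all add: sel)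
      then show ?thesis by (simp add: sel)
    qed
    show "\<one>\<^bsub>CC\<^esub> \<in> carrier CC" using c_one H.one_closed by (force simp: sel)
    show "\<exists>y\<in>carrier CC. y \<otimes>\<^bsub>CC\<^esub> x = \<one>\<^bsub>CC\<^esub>" if xx: "x \<in> carrier CC" for x
    proof -
      obtain g where "g \<in> H" "x = c g" using xx by (auto simp: sel)
      then show ?thesis using c_inv[of g] H.m_inv_closed[of g] by (auto simp: sel mult.commute)
    qed
  qed (auto simp: sel)
  interpret HH: group "G\<lparr>carrier := H\<rparr>" by (rule subgroup.subgroup_is_group[OF H is_group])
  interpret ch: group_hom "G\<lparr>carrier := H\<rparr>" CC c
    by unfold_locales (auto simp: hom_def sel c_mult)
  have "finite_rank CC"
    by (rule ch.finite_rank_image[OF finite_rank_subgroup[OF fr H]]) (simp add: sel)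
  then obtain U where U: "U \<subseteq> carrier CC" "finite U" "\<forall>x\<in>carrier CC. \<exists>n::nat. n > 0 \<and> x [^]\<^bsub>CC\<^esub> n \<in> generate CC U"
    using CC.torsion_over_finite_if_finite_rank by blast
  have CCpow: "x [^]\<^bsub>CC\<^esub> (n::nat) = x ^ n" for x n by (induction n) (auto simp: sel)
  obtain R where R: "finite R" "R \<subseteq> carrier G" "\<And>g. g \<in> carrier G ==> \<exists>r\<in>R. inv r \<otimes> g \<in> H"
    using fi by (auto simp: fin_index_def)
  obtain x0 where x0: "x0 \<in> N" "x0 \<noteq> \<one>" using N1 N.one_closed by blast
  define E where "E = (\<lambda>r. l (inv r \<otimes> x0 \<otimes> r)) ` R"
  show False
  proof (rule no_divisible_finitely_generated[of "l ` N" "l ` Y" U "c ` H" E])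
    have diff: "l x - l y = l (x \<otimes> inv y)" if "x \<in> N" "y \<in> N" for x y
      using W_add[OF l(1) that(1), of "inv y"] W_inv[OF l(1) that(2)] that by simp
    show "add_subgroup (l ` N)" unfolding add_subgroup_def
      using W_one[OF l(1)] N.one_closed diff by force
    show "l ` N \<noteq> {0}" using x1 by blast
    show "x / of_nat n \<in> l ` N" if n: "n > 0" and x: "x \<in> l ` N" for n x
    proof -
      have "(\<lambda>x. x [^] n) ` N = N"
      proof (rule minN)
        show "(\<lambda>x. x [^] n) ` N \<lhd> G" by (rule normal_torsion_and_powers(2)[OF nN comm])
        show "(\<lambda>x. x [^] n) ` N \<subseteq> N" using NC.nat_pow_closed[of _ n] by (auto simp: npow)
        have "x0 [^] n \<noteq> \<one>" using tf'[OF x0(1) n] x0(2) by blast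
        then show "(\<lambda>x. x [^] n) ` N \<noteq> {\<one>}" using x0(1) by blast
      qed
      moreover obtain z where z: "z \<in> N" "x = l z" using x by blast
      ultimately obtain w where w: "w \<in> N" "z = w [^] n" by blast
      then have "x / of_nat n = l w" using W_pow[OF l(1) w(1), of n] z n by simp
      then show ?thesis using w by blast
    qed
    show "finite (l ` Y)" "l ` Y \<subseteq> l ` N" using Y by auto
    show "\<exists>n>0. of_nat n * x \<in> zspan (l ` Y)" if x: "x \<in> l ` N" for x
    proof -
      obtain z where z: "z \<in> N" "x = l z" using x by blast
      obtain n :: nat where n: "n > 0" "z [^] n \<in> generate G Y" using Y(3)[OF z(1)] by blast
      let ?S = "{x \<in> N. l x \<in> zspan (l ` Y)}"
      note zs = add_subgroupD[OF zspan_props(1)[of "l ` Y"]]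
      have "subgroup ?S G"
        by (rule subgroupI) (auto simp: NG W_add[OF l(1)] W_inv[OF l(1)] W_one[OF l(1)] zs(1,3,4) intro!: exI[of _ \<one>])
      then have "generate G Y \<subseteq> ?S"
        by (rule generate_subgroup_incl[rotated]) (use Y zspan_props(2)[of "l ` Y"] in auto)
      then have "l (z [^] n) \<in> zspan (l ` Y)" using n by blast
      then show ?thesis using W_pow[OF l(1) z(1)] z n by auto
    qed
    show "finite U" "U \<subseteq> c ` H" using U by (auto simp: sel)
    show "\<exists>n>0. x ^ n \<in> R" if x: "x \<in> c ` H" and R: "is_subring R" "U \<subseteq> R" "inverse ` U \<subseteq> R" for x R
    proof -
      have "y \<in> R" if "y \<in> generate CC U" for y
        using that
      proof (induction rule: generate.induct)
        case (inv h)
        then obtain g where g: "g \<in> H" "h = c g" using U by (auto simp: sel)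
        have "inv\<^bsub>CC\<^esub> h = inverse h"
          by (rule CC.inv_equality) (use g c0 c_inv in \<open>auto simp: sel mult.commute\<close>)
        then show ?case using R inv by auto
      next
        case one
        then show ?case using is_subringD(2)[OF R(1)] by (simp add: sel)
      next
        case (eng h1 h2)
        then show ?case using is_subringD(6)[OF R(1)] by (simp add: sel)
      qed (use R(2) in blast)
      moreover obtain n :: nat where "n > 0" "x ^ n \<in> generate CC U" using U(3) x by (auto simp: sel CCpow)
      ultimately show ?thesis by blast
    qed
    show "x * m \<in> l ` N \<and> inverse x * m \<in> l ` N" if xm: "x \<in> c ` H" "m \<in> l ` N" for x m
    proof -
      obtain h z where h: "h \<in> H" "x = c h" "z \<in> N" "m = l z" using xm by blast
      have "x * m = l (inv h \<otimes> z \<otimes> h)" "inverse x * m = l (inv (inv h) \<otimes> z \<otimes> inv h)"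
        using h lc[of h z] lc[of "inv h" z] c0(2)[of h] by simp_all
      moreover have "inv h \<otimes> z \<otimes> h \<in> N" "inv (inv h) \<otimes> z \<otimes> inv h \<in> N"
        using cj[of h z] cj[of "inv h" z] h HG by simp_all
      ultimately show ?thesis by simp
    qed
    show "finite E" "E \<subseteq> l ` N" using R cj x0 by (auto simp: E_def)
    show "l ` N \<subseteq> S" if S: "add_subgroup S" "\<And>x e. x \<in> c ` H ==> e \<in> E ==> x * e \<in> S" for S
    proof -
      let ?M = "{z \<in> N. \<forall>g\<in>carrier G. l (inv g \<otimes> z \<otimes> g) \<in> S}"
      note as = add_subgroupD[OF S(1)]
      have "subgroup ?M G"
      proof (rule subgroupI)
        show "?M \<subseteq> carrier G" using NG by auto
        show "?M \<noteq> {}" using N.one_closed W_one[OF l(1)] as(1) by (auto intro!: exI[of _ \<one>])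
        fix a assume a: "a \<in> ?M"
        have "l (inv g \<otimes> inv a \<otimes> g) = - l (inv g \<otimes> a \<otimes> g)" if "g \<in> carrier G" for g
        proof -
          have "inv g \<otimes> inv a \<otimes> g = inv (inv g \<otimes> a \<otimes> g)" using a NG that by (simp add: inv_mult_group m_assoc)
          then show ?thesis using W_inv[OF l(1)] cj that a by simp
        qed
        then show "inv a \<in> ?M" using a as(3) by simp
        fix b assume b: "b \<in> ?M"
        have "l (inv g \<otimes> (a \<otimes> b) \<otimes> g) = l (inv g \<otimes> a \<otimes> g) + l (inv g \<otimes> b \<otimes> g)" if "g \<in> carrier G" for g
        proof -
          have "inv g \<otimes> (a \<otimes> b) \<otimes> g = (inv g \<otimes> a \<otimes> g) \<otimes> (inv g \<otimes> b \<otimes> g)"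
            using a b NG that by (simp add: m_assoc inv_cancel)
          then show ?thesis using W_add[OF l(1)] cj that a b by simp
        qed
        then show "a \<otimes> b \<in> ?M" using a b as(4) by simp
      qed
      moreover have "g \<otimes> z \<otimes> inv g \<in> ?M" if g: "g \<in> carrier G" and z: "z \<in> ?M" for g z
      proof -
        have "inv h \<otimes> (g \<otimes> z \<otimes> inv g) \<otimes> h = inv (inv g \<otimes> h) \<otimes> z \<otimes> (inv g \<otimes> h)" if "h \<in> carrier G" for h
          using g z NG that by (simp add: inv_mult_group m_assoc)
        then show ?thesis using z g N.inv_op_closed2 by simp
      qed
      ultimately have "?M \<lhd> G" unfolding normal_inv_iff by blast
      moreover have "x0 \<in> ?M"
      proof -
        have "l (inv g \<otimes> x0 \<otimes> g) \<in> S" if g: "g \<in> carrier G" for g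
        proof -
          obtain r where r: "r \<in> R" "inv r \<otimes> g \<in> H" using R(3)[OF g] by blast
          have rG: "r \<in> carrier G" using r R by blast
          have "inv g \<otimes> x0 \<otimes> g = inv (inv r \<otimes> g) \<otimes> (inv r \<otimes> x0 \<otimes> r) \<otimes> (inv r \<otimes> g)"
            using rG g NG[OF x0(1)] by (simp add: inv_mult_group m_assoc inv_cancel)
          then have "l (inv g \<otimes> x0 \<otimes> g) = c (inv r \<otimes> g) * l (inv r \<otimes> x0 \<otimes> r)"
            using lc[OF r(2) cj[OF rG x0(1)]] by simp
          then show ?thesis using S(2) r by (simp add: E_def)
        qed
        then show ?thesis using x0 by simp
      qed
      ultimately have "?M = N" using minN[of ?M] x0 by blast
      have "l z \<in> S" if "z \<in> N" for z
      proof -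
        have "z \<in> ?M" using that \<open>?M = N\<close> by simp
        then have "l (inv \<one> \<otimes> z \<otimes> \<one>) \<in> S" by blast
        then show ?thesis using NG[OF that] by simp
      qed
      then show ?thesis by blast
    qed
  qed
qed

theorem (in group) minimal_normal_finite_rank:
  assumes solv: "solvable G" and fr: "finite_rank G" and min: "minimal_normal N G"
  shows "\<exists>q. Factorial_Ring.prime q \<and> (\<forall>x\<in>N. x [^] (q::nat) = \<one>)"
proof (rule ccontr)
  assume neg: "\<not> ?thesis"
  have nN: "N \<lhd> G" and minN: "\<And>M. M \<lhd> G ==> M \<subseteq> N ==> M \<noteq> {\<one>} ==> M = N"
    using min by (auto simp: minimal_normal_def)
  have comm: "x \<otimes> y = y \<otimes> x" if "x \<in> N" "y \<in> N" for x y
    using socle_facts(2)[OF solv min] socle_facts(3)[OF solv, of x y] that by blast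
  have q: "x = \<one>" if "Factorial_Ring.prime q" "x \<in> N" "x [^] (q::nat) = \<one>" for q x
  proof (rule ccontr)
    assume "x \<noteq> \<one>"
    then have "{x \<in> N. x [^] q = \<one>} \<noteq> {\<one>}" using that by blast
    then have "{x \<in> N. x [^] q = \<one>} = N"
      using minN[OF normal_torsion_and_powers(1)[OF nN comm]] by blast
    then show False using neg that(1) by blast
  qed
  have "x = \<one>" if x: "x \<in> N" "n > 0" "x [^] (n::nat) = \<one>" for x n
  proof (rule ccontr)
    assume "x \<noteq> \<one>"
    then obtain p y where "Factorial_Ring.prime (p::nat)" "y \<in> N" "y \<noteq> \<one>" "y [^] p = \<one>"
      using torsion_prime_element[OF nN x(1) _ x(3,2)] by metis
    then show False using q by blast
  qed
  then have "torsion_free (G\<lparr>carrier := N\<rparr>)"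
    by (auto simp: torsion_free_def nat_pow_consistent[symmetric])
  then show False using torsion_free_not_minimal_normal[OF solv fr min] by blast
qed

section \<open>Complex characters of abelian groups\<close>

definition is_char :: "('g, 'm) monoid_scheme => 'g set => ('g => complex) => bool" where
  "is_char G H \<chi> \<longleftrightarrow> (\<forall>x\<in>H. \<chi> x \<noteq> 0) \<and> (\<forall>x\<in>H. \<forall>y\<in>H. \<chi> (x \<otimes>\<^bsub>G\<^esub> y) = \<chi> x * \<chi> y)"

lemma (in group) is_charD:
  assumes H: "subgroup H G" and c: "is_char G H \<chi>"
  shows "x \<in> H ==> \<chi> x \<noteq> 0" "x \<in> H ==> y \<in> H ==> \<chi> (x \<otimes> y) = \<chi> x * \<chi> y" "\<chi> \<one> = 1"
    "x \<in> H ==> \<chi> (inv x) = inverse (\<chi> x)" "x \<in> H ==> \<chi> (x [^] (n::nat)) = \<chi> x ^ n"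
    "x \<in> H ==> \<chi> (x [^] (i::int)) = \<chi> x powi i"
proof -
  interpret H: subgroup H G by fact
  show nz: "x \<in> H ==> \<chi> x \<noteq> 0" and m: "x \<in> H ==> y \<in> H ==> \<chi> (x \<otimes> y) = \<chi> x * \<chi> y" for x y
    using c by (auto simp: is_char_def)
  have "\<chi> \<one> * \<chi> \<one> = \<chi> \<one>" using m[OF H.one_closed H.one_closed] by simp
  then show o: "\<chi> \<one> = 1" using nz[OF H.one_closed] by simp
  have inv: "\<chi> (inv x) = inverse (\<chi> x)" if "x \<in> H" for x
  proof -
    have "\<chi> x * \<chi> (inv x) = 1" using m[of x "inv x"] that o by simp
    then show ?thesis by (rule inverse_unique[symmetric])
  qed
  from inv show "x \<in> H ==> \<chi> (inv x) = inverse (\<chi> x)" .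
  have Hp: "x [^] (n::nat) \<in> H" if "x \<in> H" for x n
    by (induction n) (simp_all add: that H.one_closed H.m_closed)
  have p: "\<chi> (x [^] (n::nat)) = \<chi> x ^ n" if "x \<in> H" for x n
    by (induction n) (simp_all add: that o m[OF Hp] mult.commute)
  from p show "x \<in> H ==> \<chi> (x [^] (n::nat)) = \<chi> x ^ n" .
  have pi: "\<chi> (x [^] (i::int)) = \<chi> x powi i" if x: "x \<in> H" for i x
  proof (cases i rule: int_cases2)
    case (nonneg n)
    show ?thesis unfolding nonneg int_pow_int power_int_of_nat by (rule p[OF x])
  next
    case (nonpos n)
    have "\<chi> (x [^] i) = \<chi> (inv (x [^] n))" unfolding nonpos using H.subset x by (simp only: int_pow_neg_int subsetD)
    also have "\<dots> = inverse (\<chi> x ^ n)" using inv[OF Hp[OF x]] p[OF x] by simp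
    finally show ?thesis unfolding nonpos by (simp add: power_int_minus)
  qed
  from pi show "x \<in> H ==> \<chi> (x [^] (i::int)) = \<chi> x powi i" .
qed

definition adjoin :: "('g, 'm) monoid_scheme => 'g set => 'g => 'g set" where
  "adjoin G H y = {h \<otimes>\<^bsub>G\<^esub> y [^]\<^bsub>G\<^esub> (i::int) | h i. h \<in> H}"

lemma (in comm_group) adjoin_facts:
  assumes H: "subgroup H G" and y: "y \<in> carrier G"
  shows "subgroup (adjoin G H y) G" "H \<subseteq> adjoin G H y" "y \<in> adjoin G H y"
    "subgroup K G ==> H \<subseteq> K ==> y \<in> K ==> adjoin G H y \<subseteq> K"
proof -
  interpret H: subgroup H G by fact
  have HG: "\<And>h. h \<in> H ==> h \<in> carrier G" using H.subset by blast
  have I: "h \<in> H ==> h \<otimes> y [^] (i::int) \<in> adjoin G H y" for h i by (auto simp: adjoin_def)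
  show "H \<subseteq> adjoin G H y" using I[of _ 0] HG by fastforce
  show "y \<in> adjoin G H y" using I[OF H.one_closed, of 1] y by simp
  show "subgroup (adjoin G H y) G"
  proof (rule subgroupI)
    show "adjoin G H y \<subseteq> carrier G" using HG y by (auto simp: adjoin_def)
    show "adjoin G H y \<noteq> {}" using I[OF H.one_closed] by blast
    fix a assume "a \<in> adjoin G H y"
    then obtain h and i :: int where a: "h \<in> H" "a = h \<otimes> y [^] i" by (auto simp: adjoin_def)
    have "inv a = inv h \<otimes> y [^] (-i)" using a HG y by (simp add: inv_mult int_pow_neg)
    then show "inv a \<in> adjoin G H y" using I[of "inv h" "-i"] a by simp
    fix b assume "b \<in> adjoin G H y"
    then obtain k and j :: int where b: "k \<in> H" "b = k \<otimes> y [^] j" by (auto simp: adjoin_def)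
    have "a \<otimes> b = (h \<otimes> k) \<otimes> y [^] (i + j)" using a b HG y by (simp add: int_pow_mult m_ac)
    then show "a \<otimes> b \<in> adjoin G H y" using I[of "h \<otimes> k" "i + j"] a b by simp
  qed
  show "adjoin G H y \<subseteq> K" if "subgroup K G" "H \<subseteq> K" "y \<in> K"
  proof
    fix a assume "a \<in> adjoin G H y"
    then obtain h and i :: int where "h \<in> H" "a = h \<otimes> y [^] i" by (auto simp: adjoin_def)
    then show "a \<in> K" using that subgroup.m_closed[OF that(1)] subgroup_int_pow_closed[OF that(1,3)] by blast
  qed
qed

text \<open>The assignment \<open>h y\<^sup>i \<mapsto> \<chi> h z\<^sup>i\<close> is well defined precisely because of the compatibility condition.\<close>

lemma (in comm_group) extend_char:
  assumes H: "subgroup H G" and c: "is_char G H \<chi>" and y: "y \<in> carrier G" and z: "z \<noteq> 0"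
    and compat: "\<And>i::int. y [^] i \<in> H ==> \<chi> (y [^] i) = z powi i"
  obtains \<chi>' where "is_char G (adjoin G H y) \<chi>'" "\<And>h (i::int). h \<in> H ==> \<chi>' (h \<otimes> y [^] i) = \<chi> h * z powi i"
    "\<And>h. h \<in> H ==> \<chi>' h = \<chi> h" "\<chi>' y = z"
proof -
  interpret H: subgroup H G by fact
  note C = is_charD[OF H c]
  have HG: "\<And>h. h \<in> H ==> h \<in> carrier G" using H.subset by blast
  have wd: "\<chi> h * z powi i = \<chi> k * z powi j" if h: "h \<in> H" "k \<in> H" "h \<otimes> y [^] i = k \<otimes> y [^] j" for h k and i j :: int
  proof -
    have "y [^] (i - j) = inv h \<otimes> k"
    proof -
      have "y [^] i = inv h \<otimes> (k \<otimes> y [^] j)" using h HG y by (metis int_pow_closed inv_solve_left m_closed)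
      then show ?thesis using h HG y by (simp add: int_pow_diff m_assoc)
    qed
    then have "z powi (i - j) = \<chi> (inv h \<otimes> k)" using compat[of "i - j"] h by simp
    then have "z powi (i - j) = inverse (\<chi> h) * \<chi> k" using h C by simp
    then show ?thesis using z C(1)[OF h(1)] by (simp add: power_int_diff field_simps)
  qed
  define \<chi>' where "\<chi>' = (\<lambda>x. SOME v. \<exists>h\<in>H. \<exists>i::int. x = h \<otimes> y [^] i \<and> v = \<chi> h * z powi i)"
  have eq: "\<chi>' (h \<otimes> y [^] i) = \<chi> h * z powi i" if "h \<in> H" for h and i :: int
    unfolding \<chi>'_def
  proof (rule some_equality)
    show "\<exists>k\<in>H. \<exists>j::int. h \<otimes> y [^] i = k \<otimes> y [^] j \<and> \<chi> h * z powi i = \<chi> k * z powi j" using that by blast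
    show "v = \<chi> h * z powi i" if "\<exists>k\<in>H. \<exists>j::int. h \<otimes> y [^] i = k \<otimes> y [^] j \<and> v = \<chi> k * z powi j" for v
      using that wd \<open>h \<in> H\<close> by metis
  qed
  show thesis
  proof (rule that[of \<chi>'])
    show "\<chi>' (h \<otimes> y [^] i) = \<chi> h * z powi i" if "h \<in> H" for h and i :: int by (rule eq[OF that])
    show "\<chi>' h = \<chi> h" if "h \<in> H" for h using eq[OF that, of 0] HG[OF that] by simp
    show "\<chi>' y = z" using eq[OF H.one_closed, of 1] y C(3) by simp
    show "is_char G (adjoin G H y) \<chi>'"
      unfolding is_char_def
    proof (intro conjI ballI)
      fix a assume "a \<in> adjoin G H y"
      then obtain h and i :: int where a: "h \<in> H" "a = h \<otimes> y [^] i" by (auto simp: adjoin_def)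
      show "\<chi>' a \<noteq> 0" using a eq C(1) z by simp
      fix b assume "b \<in> adjoin G H y"
      then obtain k and j :: int where b: "k \<in> H" "b = k \<otimes> y [^] j" by (auto simp: adjoin_def)
      have "a \<otimes> b = (h \<otimes> k) \<otimes> y [^] (i + j)" using a b HG y by (simp add: int_pow_mult m_ac)
      then show "\<chi>' (a \<otimes> b) = \<chi>' a * \<chi>' b" using a b eq C(2) z by (simp add: power_int_add)
    qed
  qed
qed

lemma (in group) prime_int_pow_in_subgroup:
  assumes H: "subgroup H G" and y: "y \<in> carrier G" "y \<notin> H" "y [^] q \<in> H" and q: "Factorial_Ring.prime (q::nat)"
  shows "y [^] (i::int) \<in> H \<longleftrightarrow> int q dvd i"
proof
  assume i: "y [^] i \<in> H"
  show "int q dvd i"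
  proof (rule ccontr)
    assume "\<not> int q dvd i"
    then have "coprime (int q) i" using q prime_imp_coprime[of "int q" i] by simp
    then obtain u v where uv: "u * int q + v * i = 1" by (metis bezout_int coprime_iff_gcd_eq_1)
    have "y = y [^] (int q * u + i * v)" using y uv by (simp add: mult.commute)
    also have "\<dots> = (y [^] q) [^] u \<otimes> (y [^] i) [^] v"
      using y by (simp add: int_pow_mult int_pow_pow[symmetric] int_pow_int)
    also have "\<dots> \<in> H" using subgroup.m_closed[OF H] subgroup_int_pow_closed[OF H] y(3) i by blast
    finally show False using y by blast
  qed
next
  assume "int q dvd i"
  then obtain j where "i = int q * j" by blast
  then have "y [^] i = (y [^] q) [^] j" using y by (simp add: int_pow_pow[symmetric] int_pow_int)
  then show "y [^] i \<in> H" using subgroup_int_pow_closed[OF H y(3)] by simp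
qed

text \<open>Extensional functions, so that characters of \<open>H\<close> can be counted.\<close>

definition chars :: "('g, 'm) monoid_scheme => 'g set => ('g => complex) set" where
  "chars G H = {\<chi> \<in> extensional H. is_char G H \<chi>}"

lemma (in comm_group) card_chars:
  assumes q: "Factorial_Ring.prime (q::nat)" and H: "subgroup H G" "finite H" "\<And>x. x \<in> H ==> x [^] q = \<one>"
  shows "finite (chars G H) \<and> card (chars G H) = card H"
  using H
proof (induction "card H" arbitrary: H rule: less_induct)
  case less
  interpret H: subgroup H G by (rule less.prems(1))
  have HG: "\<And>h. h \<in> H ==> h \<in> carrier G" using H.subset by blast
  show ?case
  proof (cases "H = {\<one>}")
    case True
    have "chars G H = {\<lambda>x\<in>{\<one>}. 1}"
    proof
      show "chars G H \<subseteq> {\<lambda>x\<in>{\<one>}. 1}"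
      proof
        fix \<chi> assume "\<chi> \<in> chars G H"
        then have "\<chi> \<in> extensional {\<one>}" "\<chi> \<one> = 1" using is_charD(3)[OF less.prems(1)] True by (auto simp: chars_def)
        then have "\<chi> = (\<lambda>x\<in>{\<one>}. 1)" by (intro extensionalityI[of _ "{\<one>}"]) auto
        then show "\<chi> \<in> {\<lambda>x\<in>{\<one>}. 1}" by simp
      qed
      show "{\<lambda>x\<in>{\<one>}. 1} \<subseteq> chars G H" by (auto simp: chars_def is_char_def True)
    qed
    then show ?thesis by (simp add: True)
  next
    case False
    let ?P = "\<lambda>K. subgroup K G \<and> K \<subset> H"
    have P1: "?P {\<one>}" using False H.one_closed triv_subgroup by blast
    obtain K where K: "?P K" and Kmax: "\<And>L. ?P L ==> card L \<le> card K"
    proof -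
      have "\<forall>L. ?P L --> card L < card H" using psubset_card_mono[OF less.prems(2)] by blast
      then show thesis using that ex_has_greatest_nat[of ?P "{\<one>}" card "card H"] P1 by blast
    qed
    have finK: "finite K" using K less.prems(2) finite_subset by blast
    obtain y where y: "y \<in> H" "y \<notin> K" using K by blast
    have yG: "y \<in> carrier G" using y HG by blast
    have sK: "subgroup K G" using K by blast
    interpret K: subgroup K G by (rule sK)
    have KG: "\<And>h. h \<in> K ==> h \<in> carrier G" using K.subset by blast
    note ad = adjoin_facts[OF sK yG]
    have adH: "adjoin G K y = H"
    proof (rule ccontr)
      assume ne: "adjoin G K y \<noteq> H"
      have "adjoin G K y \<subseteq> H" using ad(4)[OF less.prems(1)] K y by blast
      then have "?P (adjoin G K y)" using ad(1) ne by blast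
      then have "card (adjoin G K y) \<le> card K" by (rule Kmax)
      moreover have "K \<subset> adjoin G K y" using ad(2,3) y by blast
      moreover have "finite (adjoin G K y)" using \<open>adjoin G K y \<subseteq> H\<close> less.prems(2) finite_subset by blast
      ultimately show False using psubset_card_mono[of "adjoin G K y" K] by simp
    qed
    have yq: "y [^] q = \<one>" using less.prems(3) y by blast
    have dvd: "y [^] (i::int) \<in> K \<longleftrightarrow> int q dvd i" for i
      by (rule prime_int_pow_in_subgroup[OF sK yG y(2) _ q]) (simp add: yq K.one_closed)
    have q0: "q > 0" using prime_gt_0_nat[OF q] .
    have IH: "finite (chars G K)" "card (chars G K) = card K"
      using less.hyps[OF psubset_card_mono[OF less.prems(2)] sK finK] K less.prems(3) by auto
    have "card H = card K * q"
    proof -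
      have "bij_betw (\<lambda>(h, i). h \<otimes> y [^] i) (K \<times> {..<q}) H"
        unfolding bij_betw_def
      proof
        show "inj_on (\<lambda>(h, i). h \<otimes> y [^] i) (K \<times> {..<q})"
        proof (rule inj_onI)
          fix a b assume ab: "a \<in> K \<times> {..<q}" "b \<in> K \<times> {..<q}"
            "(case a of (h, i) => h \<otimes> y [^] i) = (case b of (h, i) => h \<otimes> y [^] i)"
          obtain h i k j where hk: "a = (h, i)" "b = (k, j)" by (cases a, cases b)
          have h: "h \<in> K" "k \<in> K" "i \<in> {..<q}" "j \<in> {..<q}" "h \<otimes> y [^] (i::nat) = k \<otimes> y [^] (j::nat)"
            using ab by (auto simp: hk)
          have "y [^] i = inv h \<otimes> (k \<otimes> y [^] j)" using h KG yG by (metis inv_solve_left m_closed nat_pow_closed)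
          then have "y [^] (int i - int j) = inv h \<otimes> k"
            using h KG yG by (simp add: int_pow_diff m_assoc int_pow_int)
          then have "y [^] (int i - int j) \<in> K" using h by simp
          then have "int q dvd int i - int j" using dvd by blast
          then have "i = j" using h(3,4) zdvd_not_zless[of "int i - int j" "int q"] zdvd_not_zless[of "int j - int i" "int q"]
            by (cases i j rule: linorder_cases) (auto simp: dvd_diff_commute)
          moreover then have "h = k" using h KG yG by simp
          ultimately show "a = b" by (simp add: hk)
        qed
        show "(\<lambda>(h, i). h \<otimes> y [^] i) ` (K \<times> {..<q}) = H"
        proof
          show "(\<lambda>(h, i). h \<otimes> y [^] i) ` (K \<times> {..<q}) \<subseteq> H"
          proof
            fix x assume "x \<in> (\<lambda>(h, i). h \<otimes> y [^] i) ` (K \<times> {..<q})"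
            then obtain h i where "h \<in> K" "x = h \<otimes> y [^] (i::nat)" by auto
            then have "x = h \<otimes> y [^] int i" by (simp only: int_pow_int)
            with \<open>h \<in> K\<close> have "x \<in> adjoin G K y" by (auto simp only: adjoin_def)
            then show "x \<in> H" by (simp only: adH)
          qed
          show "H \<subseteq> (\<lambda>(h, i). h \<otimes> y [^] i) ` (K \<times> {..<q})"
          proof
            fix x assume "x \<in> H"
            then obtain h and i :: int where h: "h \<in> K" "x = h \<otimes> y [^] i" using adH by (auto simp: adjoin_def)
            define j where "j = nat (i mod int q)"
            have j: "j < q" "int j = i mod int q" using q0 by (auto simp: j_def nat_less_iff)
            have "y [^] i = y [^] (int q * (i div int q) + int j)" by (simp add: j(2))
            also have "\<dots> = (y [^] int q) [^] (i div int q) \<otimes> y [^] int j"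
              using yG by (simp only: int_pow_mult int_pow_pow)
            also have "\<dots> = y [^] j" using yG yq by (simp add: int_pow_int)
            finally show "x \<in> (\<lambda>(h, i). h \<otimes> y [^] i) ` (K \<times> {..<q})" using h j by auto
          qed
        qed
      qed
      from bij_betw_same_card[OF this] show ?thesis by (simp add: card_cartesian_product)
    qed
    moreover have "finite (chars G H) \<and> card (chars G H) = card (chars G K) * q"
    proof -
      let ?\<mu> = "{z::complex. z ^ q = 1}"
      let ?f = "\<lambda>\<chi>. (restrict \<chi> K, \<chi> y)"
      have bij: "bij_betw ?f (chars G H) (chars G K \<times> ?\<mu>)"
        unfolding bij_betw_def
      proof
        show "inj_on ?f (chars G H)"
        proof (rule inj_onI)
          fix \<chi> \<psi> assume c: "\<chi> \<in> chars G H" "\<psi> \<in> chars G H" "?f \<chi> = ?f \<psi>"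
          have c': "is_char G H \<chi>" "is_char G H \<psi>" using c by (auto simp: chars_def)
          show "\<chi> = \<psi>"
          proof (rule extensionalityI[of _ H])
            show "\<chi> \<in> extensional H" "\<psi> \<in> extensional H" using c by (auto simp: chars_def)
            fix x assume "x \<in> H"
            then obtain h and i :: int where h: "h \<in> K" "x = h \<otimes> y [^] i" using adH by (auto simp: adjoin_def)
            have hH: "h \<in> H" "y [^] i \<in> H" using h K y subgroup_int_pow_closed[OF less.prems(1)] by auto
            have "restrict \<chi> K h = restrict \<psi> K h" using c(3) by simp
            then have "\<chi> h = \<psi> h" "\<chi> y = \<psi> y" using c(3) h by simp_all
            then show "\<chi> x = \<psi> x" using h hH y is_charD(2,6)[OF less.prems(1) c'(1)] is_charD(2,6)[OF less.prems(1) c'(2)] by simp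
          qed
        qed
        show "?f ` chars G H = chars G K \<times> ?\<mu>"
        proof
          show "?f ` chars G H \<subseteq> chars G K \<times> ?\<mu>"
          proof clarify
            fix \<chi> assume "\<chi> \<in> chars G H"
            then have c: "is_char G H \<chi>" by (simp add: chars_def)
            have "\<chi> y ^ q = 1" using is_charD(5)[OF less.prems(1) c y(1), of q] is_charD(3)[OF less.prems(1) c] yq by simp
            moreover have "restrict \<chi> K \<in> chars G K"
              using c K by (auto simp: chars_def is_char_def subset_iff psubset_eq)
            ultimately show "restrict \<chi> K \<in> chars G K \<and> \<chi> y \<in> ?\<mu>" by simp
          qed
          show "chars G K \<times> ?\<mu> \<subseteq> ?f ` chars G H"
          proof clarify
            fix \<psi> and z :: complex assume c: "\<psi> \<in> chars G K" and z: "z ^ q = 1"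
            have cK: "is_char G K \<psi>" using c by (simp add: chars_def)
            have z0: "z \<noteq> 0" using z q0 by (auto simp: power_0_left)
            have compat: "\<psi> (y [^] i) = z powi i" if i: "y [^] i \<in> K" for i :: int
            proof -
              obtain j where j: "i = int q * j" using i dvd by blast
              have "y [^] i = (y [^] int q) [^] j" unfolding j using yG by (rule int_pow_pow[symmetric])
              then have "y [^] i = \<one>" using yq by (simp add: int_pow_int)
              moreover have "z powi i = (z powi int q) powi j" unfolding j by (rule power_int_mult)
              ultimately show ?thesis using is_charD(3)[OF sK cK] z by simp
            qed
            obtain \<chi> where x: "is_char G (adjoin G K y) \<chi>" "\<And>h. h \<in> K ==> \<chi> h = \<psi> h" "\<chi> y = z"
              using extend_char[OF sK cK yG z0 compat] by metis
            have "restrict \<chi> H \<in> chars G H" using x(1) adH by (auto simp: chars_def is_char_def)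
            moreover have "?f (restrict \<chi> H) = (\<psi>, z)"
            proof -
              have "restrict (restrict \<chi> H) K = \<psi>"
                by (rule extensionalityI[of _ K]) (use c x K in \<open>auto simp: chars_def\<close>)
              then show ?thesis using x y by simp
            qed
            ultimately show "(\<psi>, z) \<in> ?f ` chars G H" by (metis (no_types, lifting) image_eqI)
          qed
        qed
      qed
      have "finite (chars G K \<times> ?\<mu>)" "card (chars G K \<times> ?\<mu>) = card (chars G K) * q"
        using IH card_roots_unity_eq[of q] finite_roots_unity[of q] q0 by (auto simp: card_cartesian_product)
      then show ?thesis using bij_betw_same_card[OF bij] bij_betw_finite[OF bij] by simp
    qed
    ultimately show ?thesis using IH by simp
  qed
qed

section \<open>Finite semisimple normal subgroups\<close>

text \<open>A finite module for \<open>G\<close> over the field with \<open>q\<close> elements, realised as a normal subgroup. The last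
  assumption says that the minimal submodules generate it, so it is semisimple.\<close>

locale semisimple_section = group G for G :: "('g, 'm) monoid_scheme" (structure) +
  fixes S :: "'g set" and q :: nat
  assumes S_normal: "S \<lhd> G" and S_finite: "finite S" and q: "Factorial_Ring.prime q"
    and S_comm: "\<And>x y. x \<in> S ==> y \<in> S ==> x \<otimes> y = y \<otimes> x"
    and S_exp: "\<And>x. x \<in> S ==> x [^] q = \<one>"
    and S_gen: "\<And>M. M \<lhd> G ==> (\<And>N. minimal_normal N G ==> N \<subseteq> S ==> N \<subseteq> M) ==> S \<subseteq> M"
begin

definition nrm :: "'g set => bool" where "nrm M \<longleftrightarrow> M \<lhd> G \<and> M \<subseteq> S"

abbreviation cj :: "'g => 'g => 'g" where "cj g x \<equiv> g \<otimes> x \<otimes> inv g"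

lemma SG: "x \<in> S ==> x \<in> carrier G"
  using S_normal normal_imp_subgroup subgroup.subset by blast

lemma nrmD:
  assumes "nrm M"
  shows "\<one> \<in> M" "x \<in> M ==> y \<in> M ==> x \<otimes> y \<in> M" "x \<in> M ==> inv x \<in> M"
    "g \<in> carrier G ==> x \<in> M ==> cj g x \<in> M" "x \<in> M ==> x \<in> S" "x \<in> M ==> x \<in> carrier G" "finite M" "subgroup M G"
proof -
  have M: "M \<lhd> G" "M \<subseteq> S" using assms by (auto simp: nrm_def)
  interpret M: normal M G by (rule M(1))
  show "\<one> \<in> M" "x \<in> M ==> y \<in> M ==> x \<otimes> y \<in> M" "x \<in> M ==> inv x \<in> M" by simp_all
  show "g \<in> carrier G ==> x \<in> M ==> cj g x \<in> M" by (rule M.inv_op_closed2)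
  show "x \<in> M ==> x \<in> S" "x \<in> M ==> x \<in> carrier G" using M(2) SG by auto
  show "finite M" using M(2) S_finite finite_subset by blast
  show "subgroup M G" by unfold_locales
qed

lemma nrmI:
  assumes "M \<subseteq> S" "\<one> \<in> M" "\<And>x y. x \<in> M ==> y \<in> M ==> x \<otimes> y \<in> M" "\<And>x. x \<in> M ==> inv x \<in> M"
    "\<And>g x. g \<in> carrier G ==> x \<in> M ==> cj g x \<in> M"
  shows "nrm M"
proof -
  have "subgroup M G" using assms SG by (intro subgroupI) auto
  then show ?thesis using assms by (simp add: nrm_def normal_inv_iff)
qed

lemma nrm_S: "nrm S" using S_normal by (simp add: nrm_def)
lemma nrm_1: "nrm {\<one>}" using nrmD(1)[OF nrm_S] by (intro nrmI) auto
lemma nrm_Int: "nrm M ==> nrm N ==> nrm (M \<inter> N)"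
  by (rule nrmI) (auto simp: nrmD)

lemma cj_mult: "g \<in> carrier G ==> x \<in> carrier G ==> y \<in> carrier G ==> cj g (x \<otimes> y) = cj g x \<otimes> cj g y"
  by (simp add: m_assoc inv_cancel)

lemma cj_inv: "g \<in> carrier G ==> x \<in> carrier G ==> cj g (inv x) = inv (cj g x)"
  by (simp add: inv_mult_group m_assoc)

lemma S_inv_mult: "x \<in> S ==> y \<in> S ==> inv (x \<otimes> y) = inv x \<otimes> inv y"
  using S_comm[of x y] SG nrmD(3)[OF nrm_S] S_comm[of "inv x" "inv y"] by (simp add: inv_mult_group)

lemma S_swap: "a \<in> S ==> b \<in> S ==> c \<in> S ==> d \<in> S ==> (a \<otimes> b) \<otimes> (c \<otimes> d) = (a \<otimes> c) \<otimes> (b \<otimes> d)"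
  using S_comm[of b c] SG by (simp add: m_assoc) (simp add: m_assoc[symmetric])

definition mul :: "'g set => 'g set => 'g set" where "mul M N = {x \<otimes> y | x y. x \<in> M \<and> y \<in> N}"

lemma mulI: "x \<in> M ==> y \<in> N ==> x \<otimes> y \<in> mul M N" by (auto simp: mul_def)

lemma nrm_mul:
  assumes M: "nrm M" and N: "nrm N"
  shows "nrm (mul M N)" "M \<subseteq> mul M N" "N \<subseteq> mul M N"
proof -
  note m = nrmD[OF M] and n = nrmD[OF N] and s = nrmD[OF nrm_S]
  show "nrm (mul M N)"
  proof (rule nrmI)
    show "mul M N \<subseteq> S" using m n s by (auto simp: mul_def)
    show "\<one> \<in> mul M N" using mulI[OF m(1) n(1)] by simp
    fix a assume "a \<in> mul M N"
    then obtain x y where a: "x \<in> M" "y \<in> N" "a = x \<otimes> y" by (auto simp: mul_def)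
    show "inv a \<in> mul M N" using a mulI[OF m(3) n(3), of x y] S_inv_mult[of x y] m(5) n(5) by simp
    show "cj g a \<in> mul M N" if "g \<in> carrier G" for g
      using mulI[OF m(4) n(4), of g x g y] cj_mult[of g x y] that a m(6) n(6) by simp
    fix b assume "b \<in> mul M N"
    then obtain x' y' where b: "x' \<in> M" "y' \<in> N" "b = x' \<otimes> y'" by (auto simp: mul_def)
    have "a \<otimes> b = (x \<otimes> x') \<otimes> (y \<otimes> y')" using S_swap[of x y x' y'] a b m(5) n(5) by simp
    then show "a \<otimes> b \<in> mul M N" using mulI[of "x \<otimes> x'" M "y \<otimes> y'" N] m(2) n(2) a b by simp
  qed
  show "M \<subseteq> mul M N" using mulI[OF _ n(1)] m(6) by force
  show "N \<subseteq> mul M N" using mulI[OF m(1)] n(6) by force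
qed

lemma mul_least: "nrm L ==> M \<subseteq> L ==> N \<subseteq> L ==> mul M N \<subseteq> L"
  by (auto simp: mul_def intro: nrmD(2))

lemma mul_unique:
  assumes M: "nrm M" and N: "nrm N" and d: "M \<inter> N = {\<one>}"
    and h: "x \<in> M" "y \<in> N" "x' \<in> M" "y' \<in> N" "x \<otimes> y = x' \<otimes> y'"
  shows "x = x' \<and> y = y'"
proof -
  note m = nrmD[OF M] and n = nrmD[OF N]
  have car: "x \<in> carrier G" "y \<in> carrier G" "x' \<in> carrier G" "y' \<in> carrier G" using h m n by auto
  have "inv x' \<otimes> x = y' \<otimes> inv y"
  proof -
    have "x = x' \<otimes> y' \<otimes> inv y" using h(5) car by (metis inv_solve_right m_closed)
    then show ?thesis using car by (simp add: m_assoc inv_cancel)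
  qed
  then have "inv x' \<otimes> x \<in> M \<inter> N" using m(2,3) n(2,3) h by (metis IntI)
  then have "inv x' \<otimes> x = \<one>" using d by blast
  then have "x = x'" using car by (metis inv_equality inv_inv inv_closed)
  moreover then have "y = y'" using h(5) car by simp
  ultimately show ?thesis by simp
qed

lemma minimal_in:
  assumes M: "nrm M" "M \<noteq> {\<one>}"
  obtains N where "minimal_normal N G" "N \<subseteq> M" "nrm N"
proof -
  have Mn: "M \<lhd> G" "M \<subseteq> S" using M(1) by (auto simp: nrm_def)
  obtain N where N: "minimal_normal N G" "N \<subseteq> M" by (rule finite_normal_contains_minimal[OF Mn(1) nrmD(7)[OF M(1)] M(2)])
  then have "nrm N" using Mn(2) by (auto simp: nrm_def minimal_normal_def)
  with N that show thesis by blast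
qed

lemma minimal_Int:
  assumes "minimal_normal N G" "nrm N" "nrm M"
  shows "N \<subseteq> M \<or> N \<inter> M = {\<one>}"
proof -
  have "nrm (N \<inter> M)" by (rule nrm_Int[OF assms(2,3)])
  then show ?thesis using assms(1) unfolding minimal_normal_def nrm_def by blast
qed

text \<open>A largest \<open>C\<close> with \<open>C \<inter> M1\<close> trivial satisfies \<open>M1 C = S\<close>, as \<open>M1 C\<close> contains every minimal normal subgroup
  of \<open>S\<close>. So \<open>C\<close> meets \<open>M2\<close> nontrivially.\<close>

lemma weak_complement:
  assumes M: "nrm M1" "nrm M2" "M1 \<subseteq> M2" "M1 \<noteq> M2"
  obtains N where "minimal_normal N G" "nrm N" "N \<subseteq> M2" "N \<inter> M1 = {\<one>}"
proof -
  let ?P = "\<lambda>C. nrm C \<and> C \<inter> M1 = {\<one>}"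
  have P1: "?P {\<one>}" using nrm_1 nrmD(1)[OF M(1)] by auto
  have bd: "\<forall>C. ?P C --> card C < Suc (card S)"
    using card_mono[OF S_finite] by (auto simp: nrm_def less_Suc_eq_le)
  obtain C where C: "?P C" "\<And>D. ?P D ==> card D \<le> card C"
    using ex_has_greatest_nat[of ?P "{\<one>}" card, OF P1 bd] by blast
  have nC: "nrm C" using C by blast
  have sub: "S \<subseteq> mul M1 C"
  proof (rule S_gen)
    show "mul M1 C \<lhd> G" using nrm_mul[OF M(1) nC] by (simp add: nrm_def)
    fix N assume N: "minimal_normal N G" "N \<subseteq> S"
    then have nN: "nrm N" by (simp add: nrm_def minimal_normal_def)
    show "N \<subseteq> mul M1 C"
    proof (rule ccontr)
      assume "\<not> N \<subseteq> mul M1 C"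
      then have d: "N \<inter> mul M1 C = {\<one>}" using minimal_Int[OF N(1) nN nrm_mul(1)[OF M(1) nC]] by blast
      have "mul C N \<inter> M1 = {\<one>}"
      proof -
        have "x = \<one>" if x: "x \<in> mul C N" "x \<in> M1" for x
        proof -
          obtain c n where cn: "c \<in> C" "n \<in> N" "x = c \<otimes> n" using x by (auto simp: mul_def)
          have car: "c \<in> carrier G" "n \<in> carrier G" "x \<in> carrier G" using cn nrmD(6)[OF nC] nrmD(6)[OF nN] by auto
          have "n = inv c \<otimes> x" using cn car by (simp add: inv_cancel)
          also have "\<dots> = x \<otimes> inv c" using S_comm x cn nrmD(3,5)[OF nC] nrmD(5)[OF M(1)] by blast
          finally have "n \<in> mul M1 C" using mulI[OF x(2) nrmD(3)[OF nC cn(1)]] by simp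
          then have "n = \<one>" using d cn by blast
          then have "x \<in> C \<inter> M1" using cn car x by simp
          then show ?thesis using C by blast
        qed
        then show ?thesis using nrmD(1)[OF nrm_mul(1)[OF nC nN]] nrmD(1)[OF M(1)] by blast
      qed
      then have "card (mul C N) \<le> card C" using C(2) nrm_mul(1)[OF nC nN] by blast
      then have "C = mul C N" using card_seteq[OF nrmD(7)[OF nrm_mul(1)[OF nC nN]] nrm_mul(2)[OF nC nN]] by blast
      then have "N \<subseteq> C" using nrm_mul(3)[OF nC nN] by simp
      also have "C \<subseteq> mul M1 C" by (rule nrm_mul(3)[OF M(1) nC])
      finally show False using \<open>\<not> N \<subseteq> mul M1 C\<close> by blast
    qed
  qed
  obtain x where x: "x \<in> M2" "x \<notin> M1" using M by blast
  then have "x \<in> mul M1 C" using sub nrmD(5)[OF M(2)] by blast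
  then obtain m c where mc: "m \<in> M1" "c \<in> C" "x = m \<otimes> c" by (auto simp: mul_def)
  have "c = inv m \<otimes> x" using mc nrmD(6)[OF M(1) mc(1)] nrmD(6)[OF nC mc(2)] by (simp add: inv_cancel)
  moreover have "inv m \<otimes> x \<in> M2" using nrmD(2)[OF M(2) nrmD(3)[OF M(2)] x(1), of m] mc(1) M(3) by blast
  ultimately have "c \<in> M2 \<inter> C" using mc by simp
  moreover have "c \<noteq> \<one>" using x mc nrmD(6)[OF M(1) mc(1)] by auto
  ultimately have "M2 \<inter> C \<noteq> {\<one>}" by blast
  then obtain N where N: "minimal_normal N G" "N \<subseteq> M2 \<inter> C" "nrm N"
    using minimal_in[OF nrm_Int[OF M(2) nC]] by metis
  have "N \<inter> M1 = {\<one>}" using N(2) C(1) nrmD(1)[OF N(3)] nrmD(1)[OF M(1)] by blast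
  with N that show thesis by blast
qed

lemma complement:
  assumes M: "nrm M1" "nrm M2" "M1 \<subseteq> M2"
  obtains C where "nrm C" "C \<subseteq> M2" "M1 \<inter> C = {\<one>}" "mul M1 C = M2"
proof -
  let ?P = "\<lambda>C. nrm C \<and> C \<subseteq> M2 \<and> M1 \<inter> C = {\<one>}"
  have P1: "?P {\<one>}" using nrm_1 nrmD(1)[OF M(1)] nrmD(1)[OF M(2)] by auto
  have bd: "\<forall>C. ?P C --> card C < Suc (card S)"
    using card_mono[OF S_finite] by (auto simp: nrm_def less_Suc_eq_le)
  obtain C where C: "?P C" "\<And>D. ?P D ==> card D \<le> card C"
    using ex_has_greatest_nat[of ?P "{\<one>}" card, OF P1 bd] by blast
  have nC: "nrm C" using C by blast
  have "mul M1 C = M2"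
  proof (rule ccontr)
    assume ne: "mul M1 C \<noteq> M2"
    have sub: "mul M1 C \<subseteq> M2" using mul_least[OF M(2)] M(3) C by blast
    obtain N where N: "minimal_normal N G" "nrm N" "N \<subseteq> M2" "N \<inter> mul M1 C = {\<one>}"
      using weak_complement[OF nrm_mul(1)[OF M(1) nC] M(2) sub ne] by metis
    have "M1 \<inter> mul C N = {\<one>}"
    proof -
      have "x = \<one>" if x: "x \<in> M1" "x \<in> mul C N" for x
      proof -
        obtain c n where cn: "c \<in> C" "n \<in> N" "x = c \<otimes> n" using x by (auto simp: mul_def)
        have car: "c \<in> carrier G" "n \<in> carrier G" using cn nrmD(6)[OF nC] nrmD(6)[OF N(2)] by auto
        have "n = inv c \<otimes> x" using cn car by (simp add: inv_cancel)
        also have "\<dots> = x \<otimes> inv c" using S_comm x cn nrmD(3,5)[OF nC] nrmD(5)[OF M(1)] by blast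
        finally have "n \<in> mul M1 C" using mulI[OF x(1) nrmD(3)[OF nC cn(1)]] by simp
        then have "n = \<one>" using N(4) cn by blast
        then have "x \<in> M1 \<inter> C" using cn car x by simp
        then show ?thesis using C by blast
      qed
      then show ?thesis using nrmD(1)[OF nrm_mul(1)[OF nC N(2)]] nrmD(1)[OF M(1)] by blast
    qed
    moreover have "mul C N \<subseteq> M2" using mul_least[OF M(2)] C(1) N(3) by blast
    ultimately have "card (mul C N) \<le> card C" using C(2) nrm_mul(1)[OF nC N(2)] by blast
    then have "C = mul C N" using card_seteq[OF nrmD(7)[OF nrm_mul(1)[OF nC N(2)]] nrm_mul(2)[OF nC N(2)]] by blast
    then have "N \<subseteq> mul M1 C" using nrm_mul(3)[OF nC N(2)] nrm_mul(3)[OF M(1) nC] by blast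
    then have "N = {\<one>}" using N(4) by blast
    then show False using N(1) by (simp add: minimal_normal_def)
  qed
  with C that show thesis by blast
qed

text \<open>The module homomorphisms; they are extensional in order to be counted.\<close>

definition EH :: "'g set => 'g set => ('g => 'g) set" where
  "EH M N = {f \<in> M \<rightarrow>\<^sub>E N. (\<forall>x\<in>M. \<forall>y\<in>M. f (x \<otimes> y) = f x \<otimes> f y) \<and> (\<forall>g\<in>carrier G. \<forall>x\<in>M. f (cj g x) = cj g (f x))}"

lemma EH_D:
  assumes "f \<in> EH M N"
  shows "x \<in> M ==> f x \<in> N" "x \<in> M ==> y \<in> M ==> f (x \<otimes> y) = f x \<otimes> f y"
    "g \<in> carrier G ==> x \<in> M ==> f (cj g x) = cj g (f x)" "f \<in> extensional M"
  using assms by (auto simp: EH_def PiE_def)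

lemma EH_I:
  assumes "\<And>x. x \<in> M ==> f x \<in> N" "\<And>x y. x \<in> M ==> y \<in> M ==> f (x \<otimes> y) = f x \<otimes> f y"
    "\<And>g x. g \<in> carrier G ==> x \<in> M ==> f (cj g x) = cj g (f x)" "nrm M"
  shows "restrict f M \<in> EH M N"
  using assms nrmD(2,4)[OF assms(4)] by (auto simp: EH_def)

lemma EH_one:
  assumes "f \<in> EH M N" "nrm M" "nrm N"
  shows "f \<one> = \<one>" "x \<in> M ==> f (inv x) = inv (f x)"
proof -
  note m = nrmD[OF assms(2)] and n = nrmD[OF assms(3)] and e = EH_D[OF assms(1)]
  have "f \<one> \<otimes> f \<one> = f \<one>" using e(2)[OF m(1) m(1)] by simp
  then show o: "f \<one> = \<one>" using n(6)[OF e(1)[OF m(1)]] by simp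
  show "f (inv x) = inv (f x)" if x: "x \<in> M"
  proof -
    have "f (inv x) \<otimes> f x = \<one>" using e(2)[OF m(3)[OF x] x] o m(6)[OF x] by simp
    then show ?thesis using n(6)[OF e(1)[OF x]] n(6)[OF e(1)[OF m(3)[OF x]]] by (simp add: inv_equality)
  qed
qed

lemma finite_EH: "nrm M ==> nrm N ==> finite (EH M N)"
  unfolding EH_def by (rule finite_subset[OF _ finite_PiE[of M "\<lambda>_. N"]]) (auto simp: nrmD)

lemma EH_eqI: "f \<in> EH M N ==> g \<in> EH M N' ==> (\<And>x. x \<in> M ==> f x = g x) ==> f = g" for f g
  by (rule extensionalityI[OF EH_D(4) EH_D(4)])

lemma EH_kernel_image:
  assumes f: "f \<in> EH M N" and M: "nrm M" and N: "nrm N"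
  shows "nrm {x \<in> M. f x = \<one>}" "nrm (f ` M)"
proof -
  note m = nrmD[OF M] and n = nrmD[OF N] and e = EH_D[OF f] and o = EH_one[OF f M N]
  show "nrm {x \<in> M. f x = \<one>}"
    by (rule nrmI) (auto simp: m o e)
  show "nrm (f ` M)"
  proof (rule nrmI)
    show "f ` M \<subseteq> S" using e(1) n(5) by blast
    show "\<one> \<in> f ` M" using o(1) m(1) by (metis imageI)
    fix a assume "a \<in> f ` M"
    then obtain x where x: "x \<in> M" "a = f x" by blast
    show "inv a \<in> f ` M" using x o(2) m(3) by (metis imageI)
    show "cj g a \<in> f ` M" if "g \<in> carrier G" for g using x e(3)[OF that x(1)] m(4)[OF that x(1)] by (metis imageI)
    fix b assume "b \<in> f ` M"
    then obtain y where y: "y \<in> M" "b = f y" by blast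
    have "a \<otimes> b = f (x \<otimes> y)" using x y e(2) by simp
    then show "a \<otimes> b \<in> f ` M" using m(2)[OF x(1) y(1)] by blast
  qed
qed

lemma EH_mult:
  assumes f: "f \<in> EH M N" and g: "g \<in> EH M N" and M: "nrm M" and N: "nrm N"
  shows "(\<lambda>x\<in>M. f x \<otimes> g x) \<in> EH M N"
proof (rule EH_I[OF _ _ _ M])
  note n = nrmD[OF N] and e = EH_D[OF f] and e' = EH_D[OF g]
  show "f x \<otimes> g x \<in> N" if "x \<in> M" for x using that e e' n by simp
  show "f (x \<otimes> y) \<otimes> g (x \<otimes> y) = f x \<otimes> g x \<otimes> (f y \<otimes> g y)" if "x \<in> M" "y \<in> M" for x y
    using that e e' n(5) S_swap by simp
  show "f (cj h x) \<otimes> g (cj h x) = cj h (f x \<otimes> g x)" if "h \<in> carrier G" "x \<in> M" for h x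
    using that e(1,3) e'(1,3) n(6) cj_mult by simp
qed

lemma EH_inv:
  assumes f: "f \<in> EH M N" and M: "nrm M" and N: "nrm N"
  shows "(\<lambda>x\<in>M. inv (f x)) \<in> EH M N"
proof (rule EH_I[OF _ _ _ M])
  note n = nrmD[OF N] and e = EH_D[OF f]
  show "inv (f x) \<in> N" if "x \<in> M" for x using that e n by simp
  show "inv (f (x \<otimes> y)) = inv (f x) \<otimes> inv (f y)" if "x \<in> M" "y \<in> M" for x y
    using that e n(5) S_inv_mult by simp
  show "inv (f (cj h x)) = cj h (inv (f x))" if "h \<in> carrier G" "x \<in> M" for h x
    using that e(1,3) n(6) cj_inv by simp
qed

lemma EH_comp:
  assumes f: "f \<in> EH L M" and g: "g \<in> EH M N" and L: "nrm L"
  shows "(\<lambda>x\<in>L. g (f x)) \<in> EH L N"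
  by (rule EH_I[OF _ _ _ L]) (use EH_D[OF f] EH_D[OF g] in auto)

lemma EH_restrict: "f \<in> EH M N ==> L \<subseteq> M ==> nrm L ==> restrict f L \<in> EH L N"
  using EH_D[of f M N] by (intro EH_I) (auto simp: subset_iff)

lemma EH_mono: "f \<in> EH M N ==> N \<subseteq> N' ==> f \<in> EH M N'"
  by (auto simp: EH_def PiE_def Pi_def)

lemma EH_id: "nrm M ==> M \<subseteq> N ==> (\<lambda>x\<in>M. x) \<in> EH M N" by (rule EH_I) auto

lemma EH_triv: "nrm M ==> nrm N ==> (\<lambda>x\<in>M. \<one>) \<in> EH M N" by (rule EH_I) (auto simp: nrmD)

lemma projections:
  assumes M: "nrm M" and N: "nrm N" and d: "M \<inter> N = {\<one>}"
  obtains p r where "p \<in> EH (mul M N) M" "r \<in> EH (mul M N) N"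
    "\<And>x y. x \<in> M ==> y \<in> N ==> p (x \<otimes> y) = x \<and> r (x \<otimes> y) = y"
    "\<And>x. x \<in> M ==> p x = x \<and> r x = \<one>" "\<And>y. y \<in> N ==> p y = \<one> \<and> r y = y"
    "\<And>z. z \<in> mul M N ==> z = p z \<otimes> r z"
proof -
  note m = nrmD[OF M] and n = nrmD[OF N]
  note MN = nrm_mul[OF M N]
  have "\<exists>x y. x \<in> M \<and> y \<in> N \<and> z = x \<otimes> y" if "z \<in> mul M N" for z using that by (auto simp: mul_def)
  then obtain p0 r0 where pr0: "\<And>z. z \<in> mul M N ==> p0 z \<in> M \<and> r0 z \<in> N \<and> z = p0 z \<otimes> r0 z" by metis
  have u: "p0 (x \<otimes> y) = x \<and> r0 (x \<otimes> y) = y" if "x \<in> M" "y \<in> N" for x y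
    using mul_unique[OF M N d, of "p0 (x \<otimes> y)" "r0 (x \<otimes> y)" x y] pr0[OF mulI[OF that]] that by simp
  have mult: "p0 (a \<otimes> b) = p0 a \<otimes> p0 b \<and> r0 (a \<otimes> b) = r0 a \<otimes> r0 b" if a: "a \<in> mul M N" and b: "b \<in> mul M N" for a b
  proof -
    note A = pr0[OF a] and B = pr0[OF b]
    have "a \<otimes> b = (p0 a \<otimes> r0 a) \<otimes> (p0 b \<otimes> r0 b)" using A B by simp
    also have "\<dots> = (p0 a \<otimes> p0 b) \<otimes> (r0 a \<otimes> r0 b)" by (rule S_swap) (use A B m(5) n(5) in auto)
    finally show ?thesis using u[of "p0 a \<otimes> p0 b" "r0 a \<otimes> r0 b"] A B m(2) n(2) by simp
  qed
  have conj: "p0 (cj g a) = cj g (p0 a) \<and> r0 (cj g a) = cj g (r0 a)" if a: "a \<in> mul M N" and g: "g \<in> carrier G" for a g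
  proof -
    note A = pr0[OF a]
    have "cj g a = cj g (p0 a \<otimes> r0 a)" using A by simp
    also have "\<dots> = cj g (p0 a) \<otimes> cj g (r0 a)" by (rule cj_mult[OF g]) (use A m(6) n(6) in auto)
    finally show ?thesis using u[of "cj g (p0 a)" "cj g (r0 a)"] A m(4)[OF g] n(4)[OF g] by simp
  qed
  show thesis
  proof (rule that[of "restrict p0 (mul M N)" "restrict r0 (mul M N)"])
    show "restrict p0 (mul M N) \<in> EH (mul M N) M" "restrict r0 (mul M N) \<in> EH (mul M N) N"
      by (rule EH_I; use pr0 mult conj MN in blast)+
    show "restrict p0 (mul M N) (x \<otimes> y) = x \<and> restrict r0 (mul M N) (x \<otimes> y) = y" if "x \<in> M" "y \<in> N" for x y
      using u[OF that] mulI[OF that] by simp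
    show "restrict p0 (mul M N) x = x \<and> restrict r0 (mul M N) x = \<one>" if "x \<in> M" for x
      using u[OF that n(1)] m(6)[OF that] MN(2) that by auto
    show "restrict p0 (mul M N) y = \<one> \<and> restrict r0 (mul M N) y = y" if "y \<in> N" for y
      using u[OF m(1) that] n(6)[OF that] MN(3) that by auto
    show "z = restrict p0 (mul M N) z \<otimes> restrict r0 (mul M N) z" if "z \<in> mul M N" for z
      using pr0[OF that] that by simp
  qed
qed

lemma EH_inverse:
  assumes f: "f \<in> EH M N" and M: "nrm M" and N: "nrm N"
    and ker: "\<And>x. x \<in> M ==> f x = \<one> ==> x = \<one>" and img: "f ` M = N"
  obtains h where "h \<in> EH N M" "\<And>x. x \<in> M ==> h (f x) = x" "\<And>y. y \<in> N ==> f (h y) = y"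
proof -
  note m = nrmD[OF M] and n = nrmD[OF N] and e = EH_D[OF f] and o = EH_one[OF f M N]
  have inj: "inj_on f M"
  proof (rule inj_onI)
    fix x y assume xy: "x \<in> M" "y \<in> M" "f x = f y"
    have "f (x \<otimes> inv y) = f x \<otimes> inv (f y)" using e(2)[OF xy(1) m(3)[OF xy(2)]] o(2)[OF xy(2)] by simp
    also have "\<dots> = \<one>" using xy(3) n(6)[OF e(1)[OF xy(2)]] by simp
    finally have "x \<otimes> inv y = \<one>" using ker[OF m(2)[OF xy(1) m(3)[OF xy(2)]]] by simp
    then show "x = y" using m(6) xy by (metis inv_equality inv_inv inv_closed)
  qed
  define h where "h = restrict (inv_into M f) N"
  have hf: "h (f x) = x" if "x \<in> M" for x using that inj e(1) by (simp add: h_def)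
  have fh: "h y \<in> M \<and> f (h y) = y" if "y \<in> N" for y
    using that img by (auto simp: h_def intro: inv_into_into f_inv_into_f)
  have "restrict h N \<in> EH N M"
  proof (rule EH_I[OF _ _ _ N])
    show "h y \<in> M" if "y \<in> N" for y using fh[OF that] by simp
    show "h (y \<otimes> z) = h y \<otimes> h z" if yz: "y \<in> N" "z \<in> N" for y z
    proof -
      have "f (h y \<otimes> h z) = y \<otimes> z" using e(2) fh[OF yz(1)] fh[OF yz(2)] by simp
      then show ?thesis using hf[of "h y \<otimes> h z"] fh[OF yz(1)] fh[OF yz(2)] m(2) by simp
    qed
    show "h (cj g y) = cj g (h y)" if g: "g \<in> carrier G" and y: "y \<in> N" for g y
    proof -
      have "f (cj g (h y)) = cj g y" using e(3)[OF g] fh[OF y] by simp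
      then show ?thesis using hf[of "cj g (h y)"] fh[OF y] m(4)[OF g] by metis
    qed
  qed
  then have "h \<in> EH N M" by (simp add: h_def)
  from this hf show thesis by (rule that) (use fh in blast)+
qed

lemma card_EH_minimal:
  assumes N: "minimal_normal N G" "nrm N" and N': "minimal_normal N' G" "nrm N'"
  shows "card (EH N N') \<le> card (EH N' N)"
proof (cases "\<exists>f\<in>EH N N'. f \<noteq> (\<lambda>x\<in>N. \<one>)")
  case False
  then have "EH N N' \<subseteq> {\<lambda>x\<in>N. \<one>}" by blast
  then have "card (EH N N') \<le> card {\<lambda>x\<in>N. \<one>}" by (intro card_mono) auto
  moreover have "card {\<lambda>x\<in>N'. \<one>} \<le> card (EH N' N)"
    using EH_triv[OF N'(2) N(2)] by (intro card_mono finite_EH N N') auto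
  ultimately show ?thesis by simp
next
  case True
  then obtain f where f: "f \<in> EH N N'" "f \<noteq> (\<lambda>x\<in>N. \<one>)" by blast
  note e = EH_D[OF f(1)]
  obtain x0 where x0: "x0 \<in> N" "f x0 \<noteq> \<one>"
    using f(2) e(4) extensionalityI[of f N "\<lambda>x\<in>N. \<one>"] by auto
  have "{x \<in> N. f x = \<one>} = {\<one>}"
    using EH_kernel_image(1)[OF f(1) N(2) N'(2)] N(1) x0 unfolding minimal_normal_def nrm_def by blast
  then have ker: "x = \<one>" if "x \<in> N" "f x = \<one>" for x using that by blast
  have img: "f ` N = N'"
  proof -
    have "f ` N \<subseteq> N'" using e(1) by blast
    moreover have "f ` N \<noteq> {\<one>}" using x0 by blast
    ultimately show ?thesis
      using EH_kernel_image(2)[OF f(1) N(2) N'(2)] N'(1) unfolding minimal_normal_def nrm_def by blast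
  qed
  obtain h where hEH: "h \<in> EH N' N" and hf: "\<And>x. x \<in> N ==> h (f x) = x" and fh': "\<And>y. y \<in> N' ==> f (h y) = y"
    by (rule EH_inverse[OF f(1) N(2) N'(2) ker img]) (assumption | rule that)+
  have fh: "h y \<in> N \<and> f (h y) = y" if "y \<in> N'" for y using EH_D(1)[OF hEH that] fh'[OF that] by blast
  show ?thesis
  proof (rule card_inj_on_le)
    let ?\<Phi> = "\<lambda>k. \<lambda>y\<in>N'. h (k (h y))"
    show "inj_on ?\<Phi> (EH N N')"
    proof (rule inj_onI)
      fix k l assume kl: "k \<in> EH N N'" "l \<in> EH N N'" "?\<Phi> k = ?\<Phi> l"
      show "k = l"
      proof (rule EH_eqI[OF kl(1,2)])
        fix x assume x: "x \<in> N"
        have "?\<Phi> k (f x) = ?\<Phi> l (f x)" using kl(3) by simp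
        then have "h (k x) = h (l x)" using hf[OF x] e(1)[OF x] by simp
        then show "k x = l x" using fh[OF EH_D(1)[OF kl(1) x]] fh[OF EH_D(1)[OF kl(2) x]] by metis
      qed
    qed
    show "?\<Phi> ` EH N N' \<subseteq> EH N' N"
    proof
      fix m assume "m \<in> ?\<Phi> ` EH N N'"
      then obtain k where k: "k \<in> EH N N'" "m = ?\<Phi> k" by blast
      have "(\<lambda>x\<in>N. h (k x)) \<in> EH N N" by (rule EH_comp[OF k(1) hEH N(2)])
      from EH_comp[OF hEH this N'(2)] have "(\<lambda>y\<in>N'. (\<lambda>x\<in>N. h (k x)) (h y)) \<in> EH N' N" .
      moreover have "(\<lambda>y\<in>N'. (\<lambda>x\<in>N. h (k x)) (h y)) = ?\<Phi> k"
        by (rule restrict_ext) (use fh in auto)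
      ultimately show "m \<in> EH N' N" using k by simp
    qed
    show "finite (EH N' N)" by (rule finite_EH[OF N'(2) N(2)])
  qed
qed

text \<open>By Schur's lemma the equality holds when \<open>M\<close> is minimal, and both sides are multiplicative when a
  minimal summand is split off from \<open>M\<close>.\<close>

lemma card_EH_minimal_sym:
  assumes N: "minimal_normal N G" "nrm N" and M: "nrm M"
  shows "card (EH N M) = card (EH M N)"
  using M
proof (induction "card M" arbitrary: M rule: less_induct)
  case less
  note M = less.prems
  show ?case
  proof (cases "M = {\<one>}")
    case True
    have "EH N M = {\<lambda>x\<in>N. \<one>}"
    proof -
      have "f = (\<lambda>x\<in>N. \<one>)" if "f \<in> EH N M" for f
        by (rule EH_eqI[OF that EH_triv[OF N(2) M]]) (use EH_D(1)[OF that] True in auto)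
      then show ?thesis using EH_triv[OF N(2) M] by blast
    qed
    moreover have "EH M N = {\<lambda>x\<in>M. \<one>}"
    proof -
      have "f = (\<lambda>x\<in>M. \<one>)" if "f \<in> EH M N" for f
        by (rule EH_eqI[OF that EH_triv[OF M N(2)]]) (use EH_one(1)[OF that M N(2)] True in auto)
      then show ?thesis using EH_triv[OF M N(2)] by blast
    qed
    ultimately show ?thesis by simp
  next
    case False
    let ?P = "\<lambda>L. nrm L \<and> L \<subset> M"
    have P1: "?P {\<one>}" using nrm_1 False nrmD(1)[OF M] by blast
    have bd: "\<forall>L. ?P L --> card L < card M" using psubset_card_mono[OF nrmD(7)[OF M]] by blast
    obtain L where L: "?P L" "\<And>L'. ?P L' ==> card L' \<le> card L"
      using ex_has_greatest_nat[of ?P "{\<one>}" card, OF P1 bd] by blast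
    have nL: "nrm L" using L by blast
    obtain N' where N': "minimal_normal N' G" "nrm N'" "N' \<subseteq> M" "N' \<inter> L = {\<one>}"
      using weak_complement[OF nL M] L(1) by (metis psubset_eq)
    have d: "L \<inter> N' = {\<one>}" using N'(4) by blast
    have eq: "mul L N' = M"
    proof (rule ccontr)
      assume "mul L N' \<noteq> M"
      then have "?P (mul L N')" using mul_least[OF M] L(1) N'(3) nrm_mul(1)[OF nL N'(2)] by blast
      then have "card (mul L N') \<le> card L" by (rule L(2))
      then have "L = mul L N'" using card_seteq[OF nrmD(7)[OF nrm_mul(1)[OF nL N'(2)]] nrm_mul(2)[OF nL N'(2)]] by blast
      then have "N' \<subseteq> L" using nrm_mul(3)[OF nL N'(2)] by simp
      then have "N' = {\<one>}" using N'(4) by blast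
      then show False using N'(1) by (simp add: minimal_normal_def)
    qed
    obtain p r where p: "p \<in> EH M L" and r: "r \<in> EH M N'"
      and "\<And>x y. x \<in> L ==> y \<in> N' ==> p (x \<otimes> y) = x \<and> r (x \<otimes> y) = y"
      and pr: "\<And>x. x \<in> L ==> p x = x \<and> r x = \<one>" "\<And>y. y \<in> N' ==> p y = \<one> \<and> r y = y" "\<And>z. z \<in> M ==> z = p z \<otimes> r z"
      by (rule projections[OF nL N'(2) d, unfolded eq]) (rule that)
    have LM: "L \<subseteq> M" using L by blast
    have "card (EH N M) = card (EH N L \<times> EH N N')"
    proof (rule bij_betw_same_card[of "\<lambda>f. (\<lambda>x\<in>N. p (f x), \<lambda>x\<in>N. r (f x))"], rule bij_betw_byWitness[where f' = "\<lambda>(f, g). \<lambda>x\<in>N. f x \<otimes> g x"])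
      show "(\<lambda>f. (\<lambda>x\<in>N. p (f x), \<lambda>x\<in>N. r (f x))) ` EH N M \<subseteq> EH N L \<times> EH N N'"
        using EH_comp[OF _ p N(2)] EH_comp[OF _ r N(2)] by blast
      show "(\<lambda>(f, g). \<lambda>x\<in>N. f x \<otimes> g x) ` (EH N L \<times> EH N N') \<subseteq> EH N M"
      proof clarify
        fix f g assume "f \<in> EH N L" "g \<in> EH N N'"
        then show "(\<lambda>x\<in>N. f x \<otimes> g x) \<in> EH N M"
          using EH_mult[OF EH_mono[OF _ LM] EH_mono[OF _ N'(3)] N(2) M] by simp
      qed
      show "\<forall>f\<in>EH N M. (case (\<lambda>x\<in>N. p (f x), \<lambda>x\<in>N. r (f x)) of (f, g) => \<lambda>x\<in>N. f x \<otimes> g x) = f"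
      proof
        fix f assume f: "f \<in> EH N M"
        have "(\<lambda>x\<in>N. p (f x) \<otimes> r (f x)) = f"
        proof (rule extensionalityI[of _ N])
          show "f \<in> extensional N" by (rule EH_D(4)[OF f])
          fix x assume x: "x \<in> N"
          show "(\<lambda>x\<in>N. p (f x) \<otimes> r (f x)) x = f x" using pr(3)[OF EH_D(1)[OF f x]] x by simp
        qed simp
        moreover have "(\<lambda>x\<in>N. (\<lambda>x\<in>N. p (f x)) x \<otimes> (\<lambda>x\<in>N. r (f x)) x) = (\<lambda>x\<in>N. p (f x) \<otimes> r (f x))"
          by (rule restrict_ext) simp
        ultimately show "(case (\<lambda>x\<in>N. p (f x), \<lambda>x\<in>N. r (f x)) of (f, g) => \<lambda>x\<in>N. f x \<otimes> g x) = f" by simp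
      qed
      show "\<forall>a\<in>EH N L \<times> EH N N'. (\<lambda>x\<in>N. p ((case a of (f, g) => \<lambda>x\<in>N. f x \<otimes> g x) x), \<lambda>x\<in>N. r ((case a of (f, g) => \<lambda>x\<in>N. f x \<otimes> g x) x)) = a"
      proof
        fix a assume "a \<in> EH N L \<times> EH N N'"
        then obtain f g where a: "a = (f, g)" "f \<in> EH N L" "g \<in> EH N N'" by blast
        have fg: "p (f x \<otimes> g x) = f x \<and> r (f x \<otimes> g x) = g x" if x: "x \<in> N" for x
        proof -
          have h: "f x \<in> L" "g x \<in> N'" using EH_D(1)[OF a(2) x] EH_D(1)[OF a(3) x] by auto
          then have h': "f x \<in> M" "g x \<in> M" using LM N'(3) by auto
          show ?thesis using EH_D(2)[OF p h'] EH_D(2)[OF r h'] pr(1)[OF h(1)] pr(2)[OF h(2)] nrmD(6)[OF nL h(1)] nrmD(6)[OF N'(2) h(2)] by simp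
        qed
        have "(\<lambda>x\<in>N. p ((\<lambda>x\<in>N. f x \<otimes> g x) x)) = f" "(\<lambda>x\<in>N. r ((\<lambda>x\<in>N. f x \<otimes> g x) x)) = g"
          by (rule extensionalityI[of _ N]; use EH_D(4)[OF a(2)] EH_D(4)[OF a(3)] fg in simp)+
        then show "(\<lambda>x\<in>N. p ((case a of (f, g) => \<lambda>x\<in>N. f x \<otimes> g x) x), \<lambda>x\<in>N. r ((case a of (f, g) => \<lambda>x\<in>N. f x \<otimes> g x) x)) = a"
          by (simp add: a(1))
      qed
    qed
    moreover have "card (EH M N) = card (EH L N \<times> EH N' N)"
    proof (rule bij_betw_same_card[of "\<lambda>f. (restrict f L, restrict f N')"], rule bij_betw_byWitness[where f' = "\<lambda>(f, g). \<lambda>x\<in>M. f (p x) \<otimes> g (r x)"])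
      have bwd: "(\<lambda>x\<in>M. f (p x) \<otimes> g (r x)) \<in> EH M N" if f: "f \<in> EH L N" and g: "g \<in> EH N' N" for f g
      proof -
        have "(\<lambda>x\<in>M. (\<lambda>x\<in>M. f (p x)) x \<otimes> (\<lambda>x\<in>M. g (r x)) x) \<in> EH M N"
          by (rule EH_mult[OF EH_comp[OF p f M] EH_comp[OF r g M] M N(2)])
        moreover have "(\<lambda>x\<in>M. (\<lambda>x\<in>M. f (p x)) x \<otimes> (\<lambda>x\<in>M. g (r x)) x) = (\<lambda>x\<in>M. f (p x) \<otimes> g (r x))"
          by (rule restrict_ext) simp
        ultimately show ?thesis by simp
      qed
      show "(\<lambda>f. (restrict f L, restrict f N')) ` EH M N \<subseteq> EH L N \<times> EH N' N"
        using EH_restrict[OF _ LM nL] EH_restrict[OF _ N'(3,2)] by blast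
      show "(\<lambda>(f, g). \<lambda>x\<in>M. f (p x) \<otimes> g (r x)) ` (EH L N \<times> EH N' N) \<subseteq> EH M N"
      proof clarify
        fix f g assume "f \<in> EH L N" "g \<in> EH N' N"
        then show "(\<lambda>x\<in>M. f (p x) \<otimes> g (r x)) \<in> EH M N" by (rule bwd)
      qed
      show "\<forall>f\<in>EH M N. (case (restrict f L, restrict f N') of (f, g) => \<lambda>x\<in>M. f (p x) \<otimes> g (r x)) = f"
      proof
        fix f assume f: "f \<in> EH M N"
        have "(\<lambda>x\<in>M. restrict f L (p x) \<otimes> restrict f N' (r x)) = f"
        proof (rule extensionalityI[of _ M])
          show "f \<in> extensional M" by (rule EH_D(4)[OF f])
          fix x assume x: "x \<in> M"
          have h: "p x \<in> L" "r x \<in> N'" using EH_D(1)[OF p x] EH_D(1)[OF r x] by auto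
          then have h': "p x \<in> M" "r x \<in> M" using LM N'(3) by auto
          have "f x = f (p x \<otimes> r x)" using pr(3)[OF x] by simp
          also have "\<dots> = f (p x) \<otimes> f (r x)" by (rule EH_D(2)[OF f h'])
          finally show "(\<lambda>x\<in>M. restrict f L (p x) \<otimes> restrict f N' (r x)) x = f x" using x h by simp
        qed simp
        then show "(case (restrict f L, restrict f N') of (f, g) => \<lambda>x\<in>M. f (p x) \<otimes> g (r x)) = f" by simp
      qed
      show "\<forall>a\<in>EH L N \<times> EH N' N. (restrict (case a of (f, g) => \<lambda>x\<in>M. f (p x) \<otimes> g (r x)) L, restrict (case a of (f, g) => \<lambda>x\<in>M. f (p x) \<otimes> g (r x)) N') = a"
      proof
        fix a assume "a \<in> EH L N \<times> EH N' N"
        then obtain f g where a: "a = (f, g)" "f \<in> EH L N" "g \<in> EH N' N" by blast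
        have "restrict (\<lambda>x\<in>M. f (p x) \<otimes> g (r x)) L = f"
        proof (rule extensionalityI[of _ L])
          fix x assume x: "x \<in> L"
          then show "restrict (\<lambda>x\<in>M. f (p x) \<otimes> g (r x)) L x = f x"
            using LM pr(1)[OF x] EH_one(1)[OF a(3) N'(2) N(2)] nrmD(6)[OF N(2) EH_D(1)[OF a(2) x]] by auto
        qed (use EH_D(4)[OF a(2)] in auto)
        moreover have "restrict (\<lambda>x\<in>M. f (p x) \<otimes> g (r x)) N' = g"
        proof (rule extensionalityI[of _ N'])
          fix x assume x: "x \<in> N'"
          then show "restrict (\<lambda>x\<in>M. f (p x) \<otimes> g (r x)) N' x = g x"
            using N'(3) pr(2)[OF x] EH_one(1)[OF a(2) nL N(2)] nrmD(6)[OF N(2) EH_D(1)[OF a(3) x]] by auto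
        qed (use EH_D(4)[OF a(3)] in auto)
        ultimately show "(restrict (case a of (f, g) => \<lambda>x\<in>M. f (p x) \<otimes> g (r x)) L, restrict (case a of (f, g) => \<lambda>x\<in>M. f (p x) \<otimes> g (r x)) N') = a"
          by (simp add: a(1))
      qed
    qed
    moreover have "card (EH N L) = card (EH L N)"
      using less.hyps[OF _ nL] psubset_card_mono[OF nrmD(7)[OF M]] L(1) by blast
    moreover have "card (EH N N') = card (EH N' N)"
      using card_EH_minimal[OF N N'(1,2)] card_EH_minimal[OF N'(1,2) N] by simp
    ultimately show ?thesis by (simp add: card_cartesian_product)
  qed
qed

end

context semisimple_section begin

definition nc :: "'g => 'g set" where "nc a = normal_closure G {a}"

lemma nc_facts:
  assumes a: "a \<in> S"
  shows "nrm (nc a)" "a \<in> nc a" "nrm M ==> a \<in> M ==> nc a \<subseteq> M"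
proof -
  have "{a} \<subseteq> carrier G" using a SG by blast
  note n = normal_closure_facts[OF this, folded nc_def]
  show "a \<in> nc a" using n(2) by blast
  show "nrm M ==> a \<in> M ==> nc a \<subseteq> M" using n(3)[of M] by (simp add: nrm_def)
  show "nrm (nc a)" using n(1) n(3)[OF S_normal] a by (simp add: nrm_def)
qed

lemma card_chars_nrm:
  assumes M: "nrm M" shows "finite (chars G M)" "card (chars G M) = card M"
proof -
  have sS: "subgroup S G" by (rule nrmD(8)[OF nrm_S])
  interpret C: comm_group "G\<lparr>carrier := S\<rparr>"
    by (rule abelian_subgroup_comm_group[OF sS S_comm])
  have s: "subgroup M (G\<lparr>carrier := S\<rparr>)"
    by (rule subgroup_incl[OF nrmD(8)[OF M] sS]) (use nrmD(5)[OF M] in blast)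
  have e: "x [^]\<^bsub>G\<lparr>carrier := S\<rparr>\<^esub> q = \<one>\<^bsub>G\<lparr>carrier := S\<rparr>\<^esub>" if "x \<in> M" for x
    using S_exp[OF nrmD(5)[OF M that]] by (simp add: nat_pow_def)
  have "chars (G\<lparr>carrier := S\<rparr>) M = chars G M" by (simp add: chars_def is_char_def)
  with C.card_chars[OF q s nrmD(7)[OF M] e] show "finite (chars G M)" "card (chars G M) = card M" by auto
qed

definition core_free :: "'g set => ('g => complex) => bool" where
  "core_free F \<chi> \<longleftrightarrow> is_char G F \<chi> \<and> (\<forall>N. nrm N --> N \<subseteq> F --> (\<forall>x\<in>N. \<chi> x = 1) --> N = {\<one>})"

lemma char_EH:
  assumes f: "f \<in> EH N F" and N: "nrm N" and c: "is_char G F \<chi>"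
  shows "(\<lambda>x\<in>N. \<chi> (f x)) \<in> chars G N"
  using c EH_D(1,2)[OF f] nrmD(2)[OF N] by (auto simp: chars_def is_char_def)

text \<open>Take \<open>x\<close> in \<open>F\<close> with the largest normal closure \<open>L\<close>, and suppose a minimal \<open>N\<close> meets it trivially.
  By maximality the closure of \<open>x y\<close> avoids \<open>N\<close> for each \<open>y\<close> in \<open>N\<close>, so it is the graph of a homomorphism
  \<open>L \<rightarrow> N\<close> with \<open>x \<mapsto> y\<close>. Hence there are at least \<open>|N|\<close> homomorphisms \<open>N \<rightarrow> L\<close>,
  and with the identity of \<open>N\<close> more than there are characters of \<open>N\<close>. Two of them agree after composition with
  \<open>\<chi>\<close>, and the image of their quotient is a nontrivial normal subgroup in the kernel of \<open>\<chi>\<close>.\<close>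

lemma cyclic_if_core_free_char:
  assumes F: "nrm F" and c: "core_free F \<chi>"
  shows "\<exists>a\<in>F. nc a = F"
proof -
  have bd: "\<forall>x. x \<in> F --> card (nc x) < Suc (card F)"
    using card_mono[OF nrmD(7)[OF F] nc_facts(3)[OF nrmD(5)[OF F] F]] by (auto simp: less_Suc_eq_le)
  obtain x where x: "x \<in> F" "\<And>y. y \<in> F ==> card (nc y) \<le> card (nc x)"
    using ex_has_greatest_nat[of "\<lambda>x. x \<in> F" \<one> "\<lambda>x. card (nc x)", OF nrmD(1)[OF F] bd] by blast
  note X = nc_facts[OF nrmD(5)[OF F x(1)]]
  have XF: "nc x \<subseteq> F" by (rule X(3)[OF F x(1)])
  have "nc x = F"
  proof (rule ccontr)
    assume "nc x \<noteq> F"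
    then obtain N where N: "minimal_normal N G" "nrm N" "N \<subseteq> F" "N \<inter> nc x = {\<one>}"
      using weak_complement[OF X(1) F XF] by metis
    have d: "nc x \<inter> N = {\<one>}" using N(4) by blast
    obtain p r where p: "p \<in> EH (mul (nc x) N) (nc x)" and r: "r \<in> EH (mul (nc x) N) N"
      and u: "\<And>x' y. x' \<in> nc x ==> y \<in> N ==> p (x' \<otimes> y) = x' \<and> r (x' \<otimes> y) = y"
      and pr: "\<And>x'. x' \<in> nc x ==> p x' = x' \<and> r x' = \<one>" "\<And>y. y \<in> N ==> p y = \<one> \<and> r y = y"
        "\<And>z. z \<in> mul (nc x) N ==> z = p z \<otimes> r z"
      by (rule projections[OF X(1) N(2) d]) (rule that)
    have "\<exists>f\<in>EH (nc x) N. f x = y" if y: "y \<in> N" for y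
    proof -
      let ?z = "x \<otimes> y"
      have zF: "?z \<in> F" using nrmD(2)[OF F x(1)] y N(3) by blast
      note Z = nc_facts[OF nrmD(5)[OF F zF]]
      have zm: "?z \<in> mul (nc x) N" by (rule mulI[OF X(2) y])
      have Zm: "nc ?z \<subseteq> mul (nc x) N" by (rule Z(3)[OF nrm_mul(1)[OF X(1) N(2)] zm])
      have dz: "N \<inter> nc ?z = {\<one>}"
      proof (rule ccontr)
        assume "N \<inter> nc ?z \<noteq> {\<one>}"
        then have NZ: "N \<subseteq> nc ?z" using minimal_Int[OF N(1,2) Z(1)] by blast
        have "?z \<otimes> inv y \<in> nc ?z" using nrmD(2)[OF Z(1) Z(2) nrmD(3)[OF Z(1)]] NZ y by blast
        moreover have "?z \<otimes> inv y = x" using nrmD(6)[OF F x(1)] nrmD(6)[OF N(2) y] by (simp add: m_assoc)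
        ultimately have XZ: "nc x \<subseteq> nc ?z" using X(3)[OF Z(1)] by simp
        have "nc x = nc ?z" using card_seteq[OF nrmD(7)[OF Z(1)] XZ x(2)[OF zF]] .
        then have "N \<subseteq> nc x" using NZ by simp
        then have "N = {\<one>}" using N(4) by blast
        then show False using N(1) by (simp add: minimal_normal_def)
      qed
      have pZ: "restrict p (nc ?z) \<in> EH (nc ?z) (nc x)" by (rule EH_restrict[OF p Zm Z(1)])
      have ker: "w = \<one>" if w: "w \<in> nc ?z" "restrict p (nc ?z) w = \<one>" for w
      proof -
        have "w = p w \<otimes> r w" by (rule pr(3)) (use Zm w in blast)
        moreover have "r w \<in> N" by (rule EH_D(1)[OF r]) (use Zm w in blast)
        ultimately have "w \<in> N" using w nrmD(6)[OF N(2), of "r w"] by simp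
        then show ?thesis using dz w by blast
      qed
      have img: "restrict p (nc ?z) ` nc ?z = nc x"
      proof
        show "restrict p (nc ?z) ` nc ?z \<subseteq> nc x" using EH_D(1)[OF pZ] by blast
        have "restrict p (nc ?z) ?z = x" using u[OF X(2) y] Z(2) by simp
        then have "x \<in> restrict p (nc ?z) ` nc ?z" using Z(2) by (metis image_eqI)
        then show "nc x \<subseteq> restrict p (nc ?z) ` nc ?z" by (rule X(3)[OF EH_kernel_image(2)[OF pZ Z(1) X(1)]])
      qed
      obtain h where h: "h \<in> EH (nc x) (nc ?z)" "\<And>w. w \<in> nc ?z ==> h (restrict p (nc ?z) w) = w"
        using EH_inverse[OF pZ Z(1) X(1) ker img] by metis
      have "h x = ?z" using h(2)[OF Z(2)] u[OF X(2) y] Z(2) by simp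
      then have "(\<lambda>w\<in>nc x. r (h w)) x = y" using u[OF X(2) y] X(2) by simp
      moreover have "(\<lambda>w\<in>nc x. r (h w)) \<in> EH (nc x) N" by (rule EH_comp[OF EH_mono[OF h(1) Zm] r X(1)])
      ultimately show ?thesis by blast
    qed
    then obtain ff where ff: "\<And>y. y \<in> N ==> ff y \<in> EH (nc x) N \<and> ff y x = y" by metis
    have "card N \<le> card (EH (nc x) N)"
    proof (rule card_inj_on_le[of ff])
      show "inj_on ff N" using ff by (metis inj_onI)
      show "ff ` N \<subseteq> EH (nc x) N" using ff by blast
      show "finite (EH (nc x) N)" by (rule finite_EH[OF X(1) N(2)])
    qed
    also have "\<dots> = card (EH N (nc x))" by (rule card_EH_minimal_sym[OF N(1,2) X(1), symmetric])
    finally have le: "card N \<le> card (EH N (nc x))" .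
    let ?i = "\<lambda>x\<in>N. x"
    let ?E = "insert ?i (EH N (nc x))"
    have "?i \<notin> EH N (nc x)"
    proof
      assume "?i \<in> EH N (nc x)"
      then have "\<And>y. y \<in> N ==> y \<in> nc x" using EH_D(1)[of ?i N "nc x"] by simp
      then have "N = {\<one>}" using N(4) by blast
      then show False using N(1) by (simp add: minimal_normal_def)
    qed
    then have cE: "card ?E > card (chars G N)"
      using le finite_EH[OF N(2) X(1)] card_chars_nrm[OF N(2)] by simp
    have EF: "?E \<subseteq> EH N F" using EH_mono[OF _ XF] EH_id[OF N(2,3)] by blast
    have chi: "is_char G F \<chi>" using c by (simp add: core_free_def)
    have "(\<lambda>f. \<lambda>x\<in>N. \<chi> (f x)) ` ?E \<subseteq> chars G N" using char_EH[OF _ N(2) chi] EF by blast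
    then have "\<not> inj_on (\<lambda>f. \<lambda>x\<in>N. \<chi> (f x)) ?E"
      using cE card_inj_on_le[OF _ _ card_chars_nrm(1)[OF N(2)]] by (metis not_le)
    then obtain f g where fg: "f \<in> ?E" "g \<in> ?E" "f \<noteq> g" "(\<lambda>x\<in>N. \<chi> (f x)) = (\<lambda>x\<in>N. \<chi> (g x))"
      unfolding inj_on_def by blast
    have f: "f \<in> EH N F" and g: "g \<in> EH N F" using fg EF by auto
    let ?h = "\<lambda>x\<in>N. f x \<otimes> (\<lambda>x\<in>N. inv (g x)) x"
    have h: "?h \<in> EH N F" by (rule EH_mult[OF f EH_inv[OF g N(2) F] N(2) F])
    have one: "\<chi> (?h y) = 1" if y: "y \<in> N" for y
    proof -
      have m: "f y \<in> F" "g y \<in> F" using EH_D(1)[OF f y] EH_D(1)[OF g y] by auto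
      have "\<chi> (f y) = \<chi> (g y)" using fun_cong[OF fg(4), of y] y by simp
      then show ?thesis
        using y is_charD(2)[OF nrmD(8)[OF F] chi m(1) nrmD(3)[OF F m(2)]] is_charD(1,4)[OF nrmD(8)[OF F] chi m(2)] by simp
    qed
    have "?h ` N = {\<one>}"
      using c EH_kernel_image(2)[OF h N(2) F] EH_D(1)[OF h] one unfolding core_free_def
      by (metis (no_types, lifting) image_iff image_subsetI)
    then have h1: "?h y = \<one>" if "y \<in> N" for y using that by blast
    have "f = g"
    proof (rule EH_eqI[OF f g])
      fix y assume y: "y \<in> N"
      have "f y \<otimes> inv (g y) = \<one>" using h1[OF y] y by simp
      then show "f y = g y" using nrmD(6)[OF F EH_D(1)[OF f y]] nrmD(6)[OF F EH_D(1)[OF g y]]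
        by (metis inv_equality inv_inv inv_closed)
    qed
    then show False using fg(3) by blast
  qed
  then show ?thesis using x(1) by blast
qed

text \<open>Dually, take \<open>M\<close> largest with a core-free character \<open>\<chi>\<close>, and a minimal \<open>N\<close> meeting it trivially.
  For every character \<open>\<psi>\<close> of \<open>N\<close> the character \<open>\<chi>\<psi>\<close> of \<open>MN\<close> is trivial on a normal subgroup, which is
  the graph of a homomorphism \<open>N \<rightarrow> M\<close> that determines \<open>\<psi>\<close>. So there are at least \<open>|N|\<close> homomorphisms
  \<open>M \<rightarrow> N\<close>, and one more, the projection, from \<open>MN\<close> to \<open>N\<close>. But \<open>MN\<close>, a quotient of the
  cyclic module, is cyclic, and a homomorphism is determined by the image of a generator.\<close>

lemma core_free_char_if_cyclic:
  assumes a: "a \<in> S"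
  shows "\<exists>\<chi>. core_free (nc a) \<chi>"
proof -
  define F where "F = nc a"
  have F: "nrm F" and aF: "a \<in> F" and least: "\<And>M. nrm M ==> a \<in> M ==> F \<subseteq> M"
    using nc_facts[OF a] by (auto simp: F_def)
  let ?P = "\<lambda>M. nrm M \<and> M \<subseteq> F \<and> (\<exists>\<chi>. core_free M \<chi>)"
  have "core_free {\<one>} (\<lambda>_. 1)" by (auto simp: core_free_def is_char_def dest: nrmD(1))
  then have P1: "?P {\<one>}" using nrm_1 nrmD(1)[OF F] by blast
  have bd: "\<forall>M. ?P M --> card M < Suc (card F)"
    using card_mono[OF nrmD(7)[OF F]] by (auto simp: less_Suc_eq_le)
  obtain M where PM: "?P M" and max: "\<And>L. ?P L ==> card L \<le> card M"
    using ex_has_greatest_nat[of ?P "{\<one>}" card, OF P1 bd] by blast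
  then obtain \<chi> where M: "nrm M" "M \<subseteq> F" and c: "core_free M \<chi>" by blast
  have "M = F"
  proof (rule ccontr)
    assume "M \<noteq> F"
    then obtain N where N: "minimal_normal N G" "nrm N" "N \<subseteq> F" "N \<inter> M = {\<one>}"
      using weak_complement[OF M(1) F M(2)] by metis
    have N1: "N \<noteq> {\<one>}" using N(1) by (simp add: minimal_normal_def)
    have d: "M \<inter> N = {\<one>}" using N(4) by blast
    define Q where "Q = mul M N"
    have Q: "nrm Q" "M \<subseteq> Q" "N \<subseteq> Q" using nrm_mul[OF M(1) N(2)] by (auto simp: Q_def)
    have QF: "Q \<subseteq> F" unfolding Q_def by (rule mul_least[OF F M(2) N(3)])
    obtain p r where p: "p \<in> EH Q M" and r: "r \<in> EH Q N"
      and u: "\<And>x y. x \<in> M ==> y \<in> N ==> p (x \<otimes> y) = x \<and> r (x \<otimes> y) = y"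
      and pr: "\<And>x. x \<in> M ==> p x = x \<and> r x = \<one>" "\<And>y. y \<in> N ==> p y = \<one> \<and> r y = y"
        "\<And>z. z \<in> Q ==> z = p z \<otimes> r z"
      by (rule projections[OF M(1) N(2) d, folded Q_def]) (rule that)
    have chi: "is_char G M \<chi>" using c by (simp add: core_free_def)
    have "\<exists>\<phi>\<in>EH N M. \<forall>n\<in>N. \<chi> (\<phi> n) * \<psi> n = 1" if psi: "\<psi> \<in> chars G N" for \<psi>
    proof -
      have psi': "is_char G N \<psi>" using psi by (simp add: chars_def)
      let ?\<theta> = "\<lambda>z. \<chi> (p z) * \<psi> (r z)"
      have th: "is_char G Q ?\<theta>"
        using chi psi' EH_D(1,2)[OF p] EH_D(1,2)[OF r] by (auto simp: is_char_def)
      have "\<not> core_free Q ?\<theta>"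
      proof
        assume "core_free Q ?\<theta>"
        then have "card Q \<le> card M" using max Q(1) QF by blast
        then have "M = Q" by (rule card_seteq[OF nrmD(7)[OF Q(1)] Q(2)])
        then have "N = {\<one>}" using Q(3) N(4) by blast
        then show False using N1 by blast
      qed
      then obtain L where L: "nrm L" "L \<subseteq> Q" "\<And>z. z \<in> L ==> ?\<theta> z = 1" "L \<noteq> {\<one>}"
        using th by (auto simp: core_free_def)
      have "\<forall>x\<in>L \<inter> M. \<chi> x = 1"
      proof
        fix x assume x: "x \<in> L \<inter> M"
        then have "?\<theta> x = \<chi> x" using pr(1)[of x] is_charD(3)[OF nrmD(8)[OF N(2)] psi'] by simp
        then show "\<chi> x = 1" using L(3)[of x] x by simp
      qed
      then have LM: "L \<inter> M = {\<one>}" using c nrm_Int[OF L(1) M(1)] unfolding core_free_def by blast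
      have rL: "restrict r L \<in> EH L N" by (rule EH_restrict[OF r L(2,1)])
      have ker: "w = \<one>" if w: "w \<in> L" "restrict r L w = \<one>" for w
      proof -
        have wQ: "w \<in> Q" using w L by blast
        have "w = p w \<otimes> r w" by (rule pr(3)[OF wQ])
        then have "w = p w" using w nrmD(6)[OF M(1) EH_D(1)[OF p wQ]] by simp
        then have "w \<in> L \<inter> M" using w(1) EH_D(1)[OF p wQ] by simp
        then show ?thesis using LM by blast
      qed
      have img: "restrict r L ` L = N"
      proof -
        have 1: "nrm (restrict r L ` L)" by (rule EH_kernel_image(2)[OF rL L(1) N(2)])
        have 2: "restrict r L ` L \<subseteq> N" using EH_D(1)[OF rL] by blast
        have "restrict r L ` L \<noteq> {\<one>}"
        proof
          assume "restrict r L ` L = {\<one>}"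
          then have "w = \<one>" if "w \<in> L" for w using ker[OF that] that by blast
          then show False using L(4) nrmD(1)[OF L(1)] by blast
        qed
        then show ?thesis using N(1) 1 2 unfolding minimal_normal_def nrm_def by blast
      qed
      obtain h where h: "h \<in> EH N L" "\<And>y. y \<in> N ==> restrict r L (h y) = y"
        using EH_inverse[OF rL L(1) N(2) ker img] by metis
      have "(\<lambda>n\<in>N. p (h n)) \<in> EH N M" by (rule EH_comp[OF EH_mono[OF h(1) L(2)] p N(2)])
      moreover have "\<forall>n\<in>N. \<chi> ((\<lambda>n\<in>N. p (h n)) n) * \<psi> n = 1"
      proof
        fix n assume n: "n \<in> N"
        have hL: "h n \<in> L" by (rule EH_D(1)[OF h(1) n])
        have "r (h n) = n" using h(2)[OF n] hL by simp
        then show "\<chi> ((\<lambda>n\<in>N. p (h n)) n) * \<psi> n = 1" using L(3)[OF hL] n by simp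
      qed
      ultimately show ?thesis by blast
    qed
    then obtain \<phi> where \<phi>: "\<And>\<psi>. \<psi> \<in> chars G N ==> \<phi> \<psi> \<in> EH N M \<and> (\<forall>n\<in>N. \<chi> (\<phi> \<psi> n) * \<psi> n = 1)" by metis
    have "card (chars G N) \<le> card (EH N M)"
    proof (rule card_inj_on_le[of \<phi>])
      show "inj_on \<phi> (chars G N)"
      proof (rule inj_onI)
        fix \<psi> \<psi>' assume h: "\<psi> \<in> chars G N" "\<psi>' \<in> chars G N" "\<phi> \<psi> = \<phi> \<psi>'"
        show "\<psi> = \<psi>'"
        proof (rule extensionalityI[of _ N])
          fix n assume n: "n \<in> N"
          have "\<chi> (\<phi> \<psi> n) * \<psi> n = 1" "\<chi> (\<phi> \<psi> n) * \<psi>' n = 1" using \<phi>[OF h(1)] \<phi>[OF h(2)] h(3) n by auto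
          then show "\<psi> n = \<psi>' n" by (metis mult_cancel_left mult_zero_left zero_neq_one)
        qed (use h in \<open>auto simp: chars_def\<close>)
      qed
      show "\<phi> ` chars G N \<subseteq> EH N M" using \<phi> by blast
      show "finite (EH N M)" by (rule finite_EH[OF N(2) M(1)])
    qed
    then have le: "card N \<le> card (EH M N)"
      using card_chars_nrm(2)[OF N(2)] card_EH_minimal_sym[OF N(1,2) M(1)] by simp
    obtain C where C: "nrm C" "C \<subseteq> F" "Q \<inter> C = {\<one>}" "mul Q C = F" by (rule complement[OF Q(1) F QF]) (rule that)
    obtain p2 r2 where p2: "p2 \<in> EH F Q" "r2 \<in> EH F C" and "\<And>x y. x \<in> Q ==> y \<in> C ==> p2 (x \<otimes> y) = x \<and> r2 (x \<otimes> y) = y"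
      and p2Q: "\<And>x. x \<in> Q ==> p2 x = x \<and> r2 x = \<one>"
      and "\<And>y. y \<in> C ==> p2 y = \<one> \<and> r2 y = y" "\<And>z. z \<in> F ==> z = p2 z \<otimes> r2 z"
      by (rule projections[OF Q(1) C(1,3), unfolded C(4)]) (rule that)
    have "card (EH Q N) \<le> card N"
    proof (rule card_inj_on_le[of "\<lambda>f. f (p2 a)"])
      show "(\<lambda>f. f (p2 a)) ` EH Q N \<subseteq> N" using EH_D(1) EH_D(1)[OF p2(1) aF] by blast
      show "finite N" by (rule nrmD(7)[OF N(2)])
      show "inj_on (\<lambda>f. f (p2 a)) (EH Q N)"
      proof (rule inj_onI)
        fix f g assume f: "f \<in> EH Q N" and g: "g \<in> EH Q N" and e: "f (p2 a) = g (p2 a)"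
        let ?E = "{x \<in> F. f (p2 x) = g (p2 x)}"
        note D = EH_D(1-3)[OF p2(1)] nrmD[OF F] EH_D(1-3)[OF f] EH_D(1-3)[OF g]
        have "nrm ?E"
        proof (rule nrmI)
          show "?E \<subseteq> S" using nrmD(5)[OF F] by blast
          show "\<one> \<in> ?E" using EH_one(1)[OF p2(1) F Q(1)] EH_one(1)[OF f Q(1) N(2)] EH_one(1)[OF g Q(1) N(2)] nrmD(1)[OF F] by simp
          fix x assume x: "x \<in> ?E"
          then show "inv x \<in> ?E"
            using EH_one(2)[OF p2(1) F Q(1), of x] EH_one(2)[OF f Q(1) N(2), of "p2 x"] EH_one(2)[OF g Q(1) N(2), of "p2 x"]
              nrmD(3)[OF F, of x] D(1)[of x] by simp
          show "cj b x \<in> ?E" if b: "b \<in> carrier G" for b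
            using x D(1)[of x] D(3)[OF b, of x] EH_D(3)[OF f b, of "p2 x"] EH_D(3)[OF g b, of "p2 x"] nrmD(4)[OF F b, of x] by simp
          fix y assume y: "y \<in> ?E"
          show "x \<otimes> y \<in> ?E"
            using x y D(1)[of x] D(1)[of y] D(2)[of x y] EH_D(2)[OF f, of "p2 x" "p2 y"] EH_D(2)[OF g, of "p2 x" "p2 y"] nrmD(2)[OF F, of x y] by simp
        qed
        then have "F \<subseteq> ?E" using least[of ?E] aF e by simp
        then have "f x = g x" if "x \<in> Q" for x using that QF p2Q[OF that] by force
        then show "f = g" by (rule EH_eqI[OF f g])
      qed
    qed
    moreover have "card (insert r ((\<lambda>f. \<lambda>x\<in>Q. f (p x)) ` EH M N)) \<le> card (EH Q N)"
      by (rule card_mono[OF finite_EH[OF Q(1) N(2)]]) (use r EH_comp[OF p _ Q(1)] in blast)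
    moreover have "r \<notin> (\<lambda>f. \<lambda>x\<in>Q. f (p x)) ` EH M N"
    proof
      assume "r \<in> (\<lambda>f. \<lambda>x\<in>Q. f (p x)) ` EH M N"
      then obtain f where f: "f \<in> EH M N" "r = (\<lambda>x\<in>Q. f (p x))" by blast
      have "y = \<one>" if y: "y \<in> N" for y
      proof -
        have "r y = f (p y)" using f(2) Q(3) y by auto
        then show ?thesis using pr(2)[OF y] EH_one(1)[OF f(1) M(1) N(2)] by simp
      qed
      then show False using N1 nrmD(1)[OF N(2)] by blast
    qed
    moreover have "inj_on (\<lambda>f. \<lambda>x\<in>Q. f (p x)) (EH M N)"
    proof (rule inj_onI)
      fix f g assume fg: "f \<in> EH M N" "g \<in> EH M N" "(\<lambda>x\<in>Q. f (p x)) = (\<lambda>x\<in>Q. g (p x))"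
      show "f = g"
      proof (rule EH_eqI[OF fg(1,2)])
        fix x assume x: "x \<in> M"
        show "f x = g x" using fun_cong[OF fg(3), of x] Q(2) x pr(1)[OF x] by auto
      qed
    qed
    ultimately show False
      using le finite_EH[OF M(1) N(2)] by (simp add: card_image)
  qed
  then show ?thesis using c F_def by blast
qed

end

section \<open>Representations induced from an abelian subgroup\<close>

text \<open>Sums over an initial segment whose recursion equations, unlike those of \<open>finsum\<close>, hold without
  closure conditions.\<close>

primrec rsum :: "('a, 'm) ring_scheme => (nat => 'a) => nat => 'a" where
  "rsum R f 0 = \<zero>\<^bsub>R\<^esub>"
| "rsum R f (Suc n) = rsum R f n \<oplus>\<^bsub>R\<^esub> f n"

lemma (in abelian_monoid) rsum_closed: "(\<And>i. i < n ==> f i \<in> carrier G) ==> rsum G f n \<in> carrier G"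
  by (induction n) auto

lemma rsum_cong: "(\<And>i. i < n ==> f i = g i) ==> rsum R f n = rsum R g n"
  by (induction n) auto

lemma (in abelian_group) rsum_telescope:
  assumes "\<And>i. f i \<in> carrier G"
  shows "rsum G (\<lambda>i. f i \<ominus> f (Suc i)) n = f 0 \<ominus> f n"
  by (induction n) (use assms in \<open>auto simp: a_minus_def a_assoc r_neg r_neg1 l_neg\<close>)

lemma (in linear_rep) rho_closed: "g \<in> carrier G ==> v \<in> carrier V ==> \<rho> g v \<in> carrier V"
  using act.element_image by blast

lemma (in linear_rep) rho_mult:
  "g \<in> carrier G ==> h \<in> carrier G ==> v \<in> carrier V ==> \<rho> (g \<otimes>\<^bsub>G\<^esub> h) v = \<rho> g (\<rho> h v)"
  using act.composition_rule by blast

lemma (in linear_rep) rho_one: "v \<in> carrier V ==> \<rho> \<one>\<^bsub>G\<^esub> v = v"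
  using act.id_eq_one by (metis restrict_apply')

lemma (in linear_rep) rho_zero: "g \<in> carrier G ==> \<rho> g \<zero>\<^bsub>V\<^esub> = \<zero>\<^bsub>V\<^esub>"
  using rep_smult[of g "\<zero>\<^bsub>k\<^esub>" "\<zero>\<^bsub>V\<^esub>"] rho_closed[of g "\<zero>\<^bsub>V\<^esub>"] by simp

lemma linear_repI:
  fixes V :: "('k, 'v) module"
  assumes "field k" "group G" "module k V"
    and cl: "\<And>g v. g \<in> carrier G ==> v \<in> carrier V ==> \<rho> g v \<in> carrier V"
    and mu: "\<And>g h v. g \<in> carrier G ==> h \<in> carrier G ==> v \<in> carrier V ==> \<rho> (g \<otimes>\<^bsub>G\<^esub> h) v = \<rho> g (\<rho> h v)"
    and on: "\<And>v. v \<in> carrier V ==> \<rho> \<one>\<^bsub>G\<^esub> v = v"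
    and ad: "\<And>g v w. g \<in> carrier G ==> v \<in> carrier V ==> w \<in> carrier V ==> \<rho> g (v \<oplus>\<^bsub>V\<^esub> w) = \<rho> g v \<oplus>\<^bsub>V\<^esub> \<rho> g w"
    and sm: "\<And>g a v. g \<in> carrier G ==> a \<in> carrier k ==> v \<in> carrier V ==> \<rho> g (a \<odot>\<^bsub>V\<^esub> v) = a \<odot>\<^bsub>V\<^esub> \<rho> g v"
  shows "linear_rep k G V (\<lambda>g. restrict (\<rho> g) (carrier V))"
proof -
  interpret G: group G by fact
  interpret V: module k V by fact
  have bij: "restrict (\<rho> g) (carrier V) \<in> Bij (carrier V)" if g: "g \<in> carrier G" for g
  proof -
    have "bij_betw (restrict (\<rho> g) (carrier V)) (carrier V) (carrier V)"
      by (rule bij_betw_byWitness[where f' = "\<rho> (inv\<^bsub>G\<^esub> g)"])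
        (use g cl in \<open>auto simp: mu[symmetric] on\<close>)
    then show ?thesis by (simp add: Bij_def)
  qed
  have "group_action G (carrier V) (\<lambda>g. restrict (\<rho> g) (carrier V))"
    unfolding group_action_def group_hom_def group_hom_axioms_def
  proof (intro conjI homI G.is_group group_BijGroup)
    show "restrict (\<rho> g) (carrier V) \<in> carrier (BijGroup (carrier V))" if "g \<in> carrier G" for g
      using bij[OF that] by (simp add: BijGroup_def)
    show "restrict (\<rho> (g \<otimes>\<^bsub>G\<^esub> h)) (carrier V) =
        restrict (\<rho> g) (carrier V) \<otimes>\<^bsub>BijGroup (carrier V)\<^esub> restrict (\<rho> h) (carrier V)"
      if g: "g \<in> carrier G" and h: "h \<in> carrier G" for g h
    proof -
      have "restrict (\<rho> (g \<otimes>\<^bsub>G\<^esub> h)) (carrier V) = compose (carrier V) (restrict (\<rho> g) (carrier V)) (restrict (\<rho> h) (carrier V))"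
        using g h cl by (auto simp: compose_def mu fun_eq_iff)
      then show ?thesis using bij[OF g] bij[OF h] by (simp add: BijGroup_def)
    qed
  qed
  then show ?thesis
    by (intro linear_rep.intro linear_rep_axioms.intro assms(1,3)) (auto simp: ad sm cl)
qed

text \<open>A submodule maximal subject to not containing \<open>w\<close> is a maximal submodule, since \<open>w\<close> generates \<open>V\<close>.\<close>

lemma exists_irreducible_quotient:
  fixes V :: "('k, 'v) module"
  assumes "linear_rep k G V \<rho>" and w: "w \<in> carrier V" "w \<noteq> \<zero>\<^bsub>V\<^esub>"
    and gen: "\<And>S. submodule S k V ==> \<forall>g\<in>carrier G. \<forall>s\<in>S. \<rho> g s \<in> S ==> w \<in> S ==> S = carrier V"
  shows "\<exists>(V' :: ('k, 'v set) module) \<rho>' \<pi>. irreducible_rep k G V' \<rho>' \<and> \<pi> \<in> carrier V \<rightarrow> carrier V' \<and>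
    (\<forall>x\<in>carrier V. \<forall>y\<in>carrier V. \<pi> (x \<oplus>\<^bsub>V\<^esub> y) = \<pi> x \<oplus>\<^bsub>V'\<^esub> \<pi> y) \<and> \<pi> \<zero>\<^bsub>V\<^esub> = \<zero>\<^bsub>V'\<^esub> \<and>
    (\<forall>g\<in>carrier G. \<forall>x\<in>carrier V. \<pi> (\<rho> g x) = \<rho>' g (\<pi> x)) \<and> \<pi> w \<noteq> \<zero>\<^bsub>V'\<^esub>"
proof -
  interpret L: linear_rep k G V \<rho> by fact
  interpret GH: group_hom G "BijGroup (carrier V)" \<rho> by (rule L.act.group_hom)
  note GH.hom_mult [simp del] GH.hom_inv [simp del] GH.hom_one [simp del]
  have min0: "x \<ominus>\<^bsub>V\<^esub> \<zero>\<^bsub>V\<^esub> = x" if "x \<in> carrier V" for x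
    using that L.V.minus_equality[of "\<zero>\<^bsub>V\<^esub>" "\<zero>\<^bsub>V\<^esub>"] by (simp add: a_minus_def)
  define sub where "sub = (\<lambda>S. submodule S k V \<and> (\<forall>g\<in>carrier G. \<forall>s\<in>S. \<rho> g s \<in> S))"
  have subI: "sub S" if S: "S \<subseteq> carrier V" "\<zero>\<^bsub>V\<^esub> \<in> S" "\<And>x y. x \<in> S ==> y \<in> S ==> x \<oplus>\<^bsub>V\<^esub> y \<in> S"
    "\<And>a x. a \<in> carrier k ==> x \<in> S ==> a \<odot>\<^bsub>V\<^esub> x \<in> S" "\<And>g x. g \<in> carrier G ==> x \<in> S ==> \<rho> g x \<in> S" for S
  proof -
    have "\<ominus>\<^bsub>V\<^esub> x \<in> S" if x: "x \<in> S" for x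
    proof -
      have "\<ominus>\<^bsub>V\<^esub> x = (\<ominus>\<^bsub>k\<^esub> \<one>\<^bsub>k\<^esub>) \<odot>\<^bsub>V\<^esub> x" using x S(1) L.V.smult_l_minus[of "\<one>\<^bsub>k\<^esub>" x] by auto
      then show ?thesis using S(4)[of "\<ominus>\<^bsub>k\<^esub> \<one>\<^bsub>k\<^esub>" x] x by simp
    qed
    then show ?thesis unfolding sub_def using S by (auto intro!: L.V.submoduleI)
  qed
  have subD: "S \<subseteq> carrier V" "\<zero>\<^bsub>V\<^esub> \<in> S" "x \<in> S ==> y \<in> S ==> x \<oplus>\<^bsub>V\<^esub> y \<in> S"
    "a \<in> carrier k ==> x \<in> S ==> a \<odot>\<^bsub>V\<^esub> x \<in> S" "g \<in> carrier G ==> x \<in> S ==> \<rho> g x \<in> S"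
    "x \<in> S ==> \<ominus>\<^bsub>V\<^esub> x \<in> S" "x \<in> S ==> y \<in> S ==> x \<ominus>\<^bsub>V\<^esub> y \<in> S" if S: "sub S" for S x y a g
  proof -
    have "submodule S k V" using S by (simp add: sub_def)
    note E = L.V.submoduleE[OF this]
    show 1: "S \<subseteq> carrier V" using E by blast
    show 2: "a \<in> carrier k ==> x \<in> S ==> a \<odot>\<^bsub>V\<^esub> x \<in> S" using E by blast
    obtain s where s: "s \<in> S" using E by blast
    then have "\<zero>\<^bsub>k\<^esub> \<odot>\<^bsub>V\<^esub> s \<in> S" using E(4)[of "\<zero>\<^bsub>k\<^esub>" s] by simp
    then show "\<zero>\<^bsub>V\<^esub> \<in> S" using s 1 by auto
    show 3: "x \<in> S ==> y \<in> S ==> x \<oplus>\<^bsub>V\<^esub> y \<in> S" for x y using E by blast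
    show "g \<in> carrier G ==> x \<in> S ==> \<rho> g x \<in> S" using S by (simp add: sub_def)
    show 4: "x \<in> S ==> \<ominus>\<^bsub>V\<^esub> x \<in> S" for x using E by blast
    show "x \<in> S ==> y \<in> S ==> x \<ominus>\<^bsub>V\<^esub> y \<in> S" using 3 4 by (simp add: a_minus_def)
  qed
  let ?A = "{S. sub S \<and> w \<notin> S}"
  have "\<exists>M\<in>?A. \<forall>T\<in>?A. M \<subseteq> T --> T = M"
  proof (rule subset_Zorn_nonempty)
    have "sub {\<zero>\<^bsub>V\<^esub>}" by (rule subI) (auto simp: L.rho_zero)
    then show "?A \<noteq> {}" using w by blast
    fix C assume C: "C \<noteq> {}" "subset.chain ?A C"
    then have Cs: "\<And>S. S \<in> C ==> sub S \<and> w \<notin> S" and lin: "\<And>S T. S \<in> C ==> T \<in> C ==> S \<subseteq> T \<or> T \<subseteq> S"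
      by (auto simp: subset.chain_def)
    have "sub (\<Union>C)"
    proof (rule subI)
      show "\<Union>C \<subseteq> carrier V" using Cs subD(1) by blast
      show "\<zero>\<^bsub>V\<^esub> \<in> \<Union>C" using C(1) Cs subD(2) by blast
      fix x assume x: "x \<in> \<Union>C"
      show "a \<odot>\<^bsub>V\<^esub> x \<in> \<Union>C" if "a \<in> carrier k" for a using x that Cs subD(4) by blast
      show "\<rho> g x \<in> \<Union>C" if "g \<in> carrier G" for g using x that Cs subD(5) by blast
      fix y assume "y \<in> \<Union>C"
      then obtain S where "S \<in> C" "x \<in> S" "y \<in> S" using x lin by blast
      then show "x \<oplus>\<^bsub>V\<^esub> y \<in> \<Union>C" using Cs subD(3) by blast
    qed
    then show "\<Union>C \<in> ?A" using Cs by blast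
  qed
  then obtain J where J: "sub J" "w \<notin> J" and Jmax: "\<And>T. sub T ==> w \<notin> T ==> J \<subseteq> T ==> T = J" by blast
  note JD = subD[OF J(1)]
  define e where "e = (\<lambda>x. {y \<in> carrier V. y \<ominus>\<^bsub>V\<^esub> x \<in> J})"
  have e_eq: "e x = e y \<longleftrightarrow> x \<ominus>\<^bsub>V\<^esub> y \<in> J" if x: "x \<in> carrier V" and y: "y \<in> carrier V" for x y
  proof
    assume "e x = e y"
    moreover have "x \<in> e x" using x JD(2) by (simp add: e_def a_minus_def L.V.r_neg)
    ultimately show "x \<ominus>\<^bsub>V\<^esub> y \<in> J" by (simp add: e_def)
  next
    assume xy: "x \<ominus>\<^bsub>V\<^esub> y \<in> J"
    have "z \<ominus>\<^bsub>V\<^esub> x \<in> J \<longleftrightarrow> z \<ominus>\<^bsub>V\<^esub> y \<in> J" if z: "z \<in> carrier V" for z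
    proof
      assume "z \<ominus>\<^bsub>V\<^esub> x \<in> J"
      then have "(z \<ominus>\<^bsub>V\<^esub> x) \<oplus>\<^bsub>V\<^esub> (x \<ominus>\<^bsub>V\<^esub> y) \<in> J" using xy JD(3) by blast
      then show "z \<ominus>\<^bsub>V\<^esub> y \<in> J" using x y z by (simp add: a_minus_def L.V.a_assoc L.V.r_neg1)
    next
      assume "z \<ominus>\<^bsub>V\<^esub> y \<in> J"
      moreover have "y \<ominus>\<^bsub>V\<^esub> x \<in> J"
      proof -
        have "y \<ominus>\<^bsub>V\<^esub> x = \<ominus>\<^bsub>V\<^esub> (x \<ominus>\<^bsub>V\<^esub> y)"
          using x y by (simp add: a_minus_def L.V.minus_add L.V.a_comm)
        then show ?thesis using JD(6)[OF xy] by simp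
      qed
      ultimately have "(z \<ominus>\<^bsub>V\<^esub> y) \<oplus>\<^bsub>V\<^esub> (y \<ominus>\<^bsub>V\<^esub> x) \<in> J" by (rule JD(3))
      then show "z \<ominus>\<^bsub>V\<^esub> x \<in> J" using x y z by (simp add: a_minus_def L.V.a_assoc L.V.r_neg1)
    qed
    then show "e x = e y" by (auto simp: e_def)
  qed
  define d where "d = inv_into (carrier V) e"
  have d: "d (e x) \<in> carrier V" "e (d (e x)) = e x" if "x \<in> carrier V" for x
    using that by (simp_all add: d_def inv_into_into f_inv_into_f)
  define V' :: "('k, 'v set) module" where
    "V' = \<lparr>carrier = e ` carrier V, monoid.mult = (\<lambda>x y. x), one = e \<zero>\<^bsub>V\<^esub>, ring.zero = e \<zero>\<^bsub>V\<^esub>,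
           ring.add = (\<lambda>x y. e (d x \<oplus>\<^bsub>V\<^esub> d y)), module.smult = (\<lambda>a x. e (a \<odot>\<^bsub>V\<^esub> d x))\<rparr>"
  define \<sigma> where "\<sigma> = (\<lambda>g y. e (\<rho> g (d y)))"
  have car: "carrier V' = e ` carrier V" "\<zero>\<^bsub>V'\<^esub> = e \<zero>\<^bsub>V\<^esub>" by (simp_all add: V'_def)
  have eadd: "e x \<oplus>\<^bsub>V'\<^esub> e y = e (x \<oplus>\<^bsub>V\<^esub> y)" if x: "x \<in> carrier V" and y: "y \<in> carrier V" for x y
  proof -
    have "d (e x) \<ominus>\<^bsub>V\<^esub> x \<in> J" "d (e y) \<ominus>\<^bsub>V\<^esub> y \<in> J" using e_eq d x y by auto
    then have "(d (e x) \<ominus>\<^bsub>V\<^esub> x) \<oplus>\<^bsub>V\<^esub> (d (e y) \<ominus>\<^bsub>V\<^esub> y) \<in> J" by (rule JD(3))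
    moreover have "(d (e x) \<ominus>\<^bsub>V\<^esub> x) \<oplus>\<^bsub>V\<^esub> (d (e y) \<ominus>\<^bsub>V\<^esub> y) = (d (e x) \<oplus>\<^bsub>V\<^esub> d (e y)) \<ominus>\<^bsub>V\<^esub> (x \<oplus>\<^bsub>V\<^esub> y)"
      using x y d by (simp add: a_minus_def L.V.minus_add L.V.a_ac)
    ultimately have "e (d (e x) \<oplus>\<^bsub>V\<^esub> d (e y)) = e (x \<oplus>\<^bsub>V\<^esub> y)" using e_eq d x y by simp
    then show ?thesis by (simp add: V'_def)
  qed
  have esm: "a \<odot>\<^bsub>V'\<^esub> e x = e (a \<odot>\<^bsub>V\<^esub> x)" if a: "a \<in> carrier k" and x: "x \<in> carrier V" for a x
  proof -
    have "d (e x) \<ominus>\<^bsub>V\<^esub> x \<in> J" using e_eq d x by auto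
    then have "a \<odot>\<^bsub>V\<^esub> (d (e x) \<ominus>\<^bsub>V\<^esub> x) \<in> J" using JD(4) a by blast
    then have "(a \<odot>\<^bsub>V\<^esub> d (e x)) \<ominus>\<^bsub>V\<^esub> (a \<odot>\<^bsub>V\<^esub> x) \<in> J"
      using x d a by (simp add: a_minus_def L.V.smult_r_distr L.V.smult_r_minus)
    then have "e (a \<odot>\<^bsub>V\<^esub> d (e x)) = e (a \<odot>\<^bsub>V\<^esub> x)" using e_eq d x a by simp
    then show ?thesis by (simp add: V'_def)
  qed
  have erho: "\<sigma> g (e x) = e (\<rho> g x)" if g: "g \<in> carrier G" and x: "x \<in> carrier V" for g x
  proof -
    have "d (e x) \<ominus>\<^bsub>V\<^esub> x \<in> J" using e_eq d x by auto
    then have "\<rho> g (d (e x) \<ominus>\<^bsub>V\<^esub> x) \<in> J" using JD(5) g by blast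
    moreover have "\<rho> g (d (e x) \<ominus>\<^bsub>V\<^esub> x) = \<rho> g (d (e x)) \<ominus>\<^bsub>V\<^esub> \<rho> g x"
    proof -
      have neg: "\<ominus>\<^bsub>V\<^esub> y = (\<ominus>\<^bsub>k\<^esub> \<one>\<^bsub>k\<^esub>) \<odot>\<^bsub>V\<^esub> y" if "y \<in> carrier V" for y
        using that L.V.smult_l_minus[of "\<one>\<^bsub>k\<^esub>" y] by simp
      show ?thesis using x d g L.rho_closed by (simp add: a_minus_def L.rep_add neg L.rep_smult)
    qed
    ultimately show ?thesis using e_eq d x g L.rho_closed by (simp add: \<sigma>_def)
  qed
  have ab: "abelian_group V'"
  proof (rule abelian_groupI)
    fix x assume "x \<in> carrier V'"
    then obtain u where "u \<in> carrier V" "x = e u" by (auto simp: car)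
    then show "\<exists>y\<in>carrier V'. y \<oplus>\<^bsub>V'\<^esub> x = \<zero>\<^bsub>V'\<^esub>"
      by (intro bexI[of _ "e (\<ominus>\<^bsub>V\<^esub> u)"]) (auto simp: L.V.l_neg car eadd)
  qed (auto simp: L.V.a_ac car eadd)
  have mod: "module k V'"
    by (rule moduleI)
      (auto simp: ab car eadd esm L.V.smult_l_distr L.V.smult_r_distr L.V.smult_assoc1 L.K.is_cring)
  let ?\<rho>' = "\<lambda>g. restrict (\<sigma> g) (carrier V')"
  have lin: "linear_rep k G V' ?\<rho>'"
    by (rule linear_repI[OF L.K.field_axioms GH.G.is_group mod])
      (auto simp: car eadd esm erho L.rho_closed L.rho_mult L.rho_one L.rep_add L.rep_smult)
  have ew: "e w \<noteq> \<zero>\<^bsub>V'\<^esub>" using e_eq[of w "\<zero>\<^bsub>V\<^esub>"] w J by (simp add: car min0)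
  have "irreducible_rep k G V' ?\<rho>'"
    unfolding irreducible_rep_def
  proof (intro conjI allI impI lin)
    show "carrier V' \<noteq> {\<zero>\<^bsub>V'\<^esub>}" using ew w by (auto simp: car)
    fix U assume U: "submodule U k V' \<and> (\<forall>g\<in>carrier G. \<forall>u\<in>U. ?\<rho>' g u \<in> U)"
    interpret M': module k V' by (rule mod)
    note E = M'.submoduleE[OF conjunct1[OF U]]
    define T where "T = {x \<in> carrier V. e x \<in> U}"
    have UT: "U = e ` T" using E(1) by (auto simp: T_def car)
    have zU: "\<zero>\<^bsub>V'\<^esub> \<in> U"
    proof -
      obtain u where u: "u \<in> U" using E(2) by blast
      then have "\<zero>\<^bsub>k\<^esub> \<odot>\<^bsub>V'\<^esub> u \<in> U" using E(4) by simp
      then show ?thesis using u E(1) by auto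
    qed
    have subT: "sub T"
    proof (rule subI)
      show "T \<subseteq> carrier V" by (auto simp: T_def)
      show "\<zero>\<^bsub>V\<^esub> \<in> T" using zU by (simp add: T_def car)
      show "x \<oplus>\<^bsub>V\<^esub> y \<in> T" if "x \<in> T" "y \<in> T" for x y
        using E(5)[of "e x" "e y"] that by (auto simp: T_def eadd)
      show "a \<odot>\<^bsub>V\<^esub> x \<in> T" if "a \<in> carrier k" "x \<in> T" for a x
        using E(4)[of a "e x"] that by (auto simp: T_def esm)
      show "\<rho> g x \<in> T" if "g \<in> carrier G" "x \<in> T" for g x
      proof -
        have "?\<rho>' g (e x) \<in> U" using U that by (auto simp: T_def)
        then show ?thesis using that by (simp add: T_def erho car L.rho_closed)
      qed
    qed
    show "U = {\<zero>\<^bsub>V'\<^esub>} \<or> U = carrier V'"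
    proof (cases "w \<in> T")
      case True
      then have "T = carrier V" using gen subT by (auto simp: sub_def)
      then show ?thesis by (simp add: UT car)
    next
      case False
      have "e x = \<zero>\<^bsub>V'\<^esub>" if x: "x \<in> J" for x
      proof -
        have "x \<in> carrier V" using x JD(1) by blast
        then show ?thesis using e_eq[of x "\<zero>\<^bsub>V\<^esub>"] x by (simp add: car min0)
      qed
      then have "J \<subseteq> T" using zU JD(1) by (auto simp: T_def)
      then have "T = J" using Jmax subT False by blast
      then show ?thesis using UT \<open>\<And>x. x \<in> J ==> e x = \<zero>\<^bsub>V'\<^esub>\<close> zU by blast
    qed
  qed
  then show ?thesis using ew
    by (intro exI[of _ V'] exI[of _ ?\<rho>'] exI[of _ e]) (auto simp: car eadd erho)
qed

text \<open>Call \<open>QQ\<close> the set of prime orders in \<open>A / K\<close>, and let \<open>c q\<close> have order \<open>q\<close> there. There is a function \<open>w\<close> on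
  \<open>G\<close>, supported on \<open>A\<close> and invariant under \<open>K\<close>, with \<open>w 1 = 1\<close> whose sum over the powers of each \<open>c q\<close>
  vanishes. Take an irreducible quotient, in which \<open>w\<close> survives, of the module generated by \<open>w\<close>. If
  its kernel \<open>N\<close> were nontrivial, \<open>N \<inter> A\<close> would contain some \<open>b\<close> of prime order \<open>q\<close> modulo
  \<open>K\<close>; then \<open>c q\<close>, being a power of \<open>b\<close> modulo \<open>K\<close>, fixes the image of \<open>w\<close>, and the vanishing sum is \<open>q w\<close>.\<close>

theorem faithful_irreducible_from_subgroup:
  fixes G :: "('g, 'm) monoid_scheme" (structure) and k :: "('k, 'n) ring_scheme"
  assumes "group G" and "field k" and A: "subgroup A G"
    and comm: "\<And>x y. x \<in> A ==> y \<in> A ==> x \<otimes> y = y \<otimes> x"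
    and K: "subgroup K G" "K \<subseteq> A"
    and tors: "\<And>a. a \<in> A ==> \<exists>n::nat. n > 0 \<and> a [^] n \<in> K"
    and cyc: "\<And>(q::nat) a b. Factorial_Ring.prime q ==> a \<in> A ==> b \<in> A ==> a [^] q \<in> K ==> b [^] q \<in> K ==> a \<notin> K ==>
      \<exists>(j::nat) x. x \<in> K \<and> b = a [^] j \<otimes> x"
    and char: "\<And>(q::nat) a. Factorial_Ring.prime q ==> a \<in> A ==> a [^] q \<in> K ==> a \<notin> K ==> rsum k (\<lambda>_. \<one>\<^bsub>k\<^esub>) q \<noteq> \<zero>\<^bsub>k\<^esub>"
    and core: "\<And>N. N \<lhd> G ==> N \<noteq> {\<one>} ==> \<not> N \<inter> A \<subseteq> K"
  shows "has_faithful_irreducible_rep k G"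
proof -
  interpret G: group G by fact
  interpret k: field k by fact
  interpret A: subgroup A G by fact
  interpret K: subgroup K G by fact
  have AG: "\<And>x. x \<in> A ==> x \<in> carrier G" using A.subset by blast
  have KA: "\<And>x. x \<in> K ==> x \<in> A" using K by blast
  have Apow: "x [^] (n::nat) \<in> A" if "x \<in> A" for x n
    by (induction n) (use that A.one_closed in auto)
  have Kpow: "x [^] (n::nat) \<in> K" if "x \<in> K" for x n
    by (induction n) (use that K.one_closed in auto)
  have dist: "(x \<otimes> y) [^] (n::nat) = x [^] n \<otimes> y [^] n" if "x \<in> A" "y \<in> A" for x y n
    by (rule G.pow_mult_distrib) (use that comm AG in auto)
  have Kcancel: "y \<in> K" if "x \<in> K" "x \<otimes> y \<in> K" "y \<in> A" for x y
  proof -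
    have "inv x \<otimes> (x \<otimes> y) \<in> K" using that by blast
    then show ?thesis using that AG KA by (simp add: G.m_assoc[symmetric])
  qed
  define QQ where "QQ = {q::nat. Factorial_Ring.prime q \<and> (\<exists>a\<in>A. a [^] q \<in> K \<and> a \<notin> K)}"
  have "\<exists>a. a \<in> A \<and> a [^] q \<in> K \<and> a \<notin> K" if "q \<in> QQ" for q using that unfolding QQ_def by blast
  then obtain c where c: "\<And>q. q \<in> QQ ==> c q \<in> A \<and> c q [^] q \<in> K \<and> c q \<notin> K"
    by metis
  have mz: "\<zero>\<^bsub>k\<^esub> \<ominus>\<^bsub>k\<^esub> \<zero>\<^bsub>k\<^esub> = \<zero>\<^bsub>k\<^esub>" "x \<ominus>\<^bsub>k\<^esub> \<zero>\<^bsub>k\<^esub> = x" if "x \<in> carrier k" for x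
    using that k.minus_equality[of "\<zero>\<^bsub>k\<^esub>" "\<zero>\<^bsub>k\<^esub>"] by (simp_all add: a_minus_def)
  have coprime_K: "a \<in> K" if h: "a \<in> A" "a [^] (m::nat) \<in> K" "a [^] (n::nat) \<in> K" "coprime m n" for a m n
  proof -
    obtain u v where "u * int m + v * int n = 1"
      using h(4) by (metis bezout_int coprime_iff_gcd_eq_1 coprime_int_iff)
    then have "a = a [^] (int m * u + int n * v)" using AG[OF h(1)] by (simp add: mult.commute)
    also have "\<dots> = (a [^] m) [^] u \<otimes> (a [^] n) [^] v"
      using AG[OF h(1)] by (simp add: G.int_pow_mult G.int_pow_pow[symmetric] int_pow_int)
    also have "\<dots> \<in> K" using h G.subgroup_int_pow_closed[OF K.subgroup_axioms] by blast
    finally show ?thesis .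
  qed
  define prd where "prd = (\<lambda>n::nat. \<Prod>q\<in>{q \<in> QQ. q < n}. q)"
  have prd_Suc: "prd (Suc n) = (if n \<in> QQ then n * prd n else prd n)" for n
  proof -
    have "{q \<in> QQ. q < Suc n} = (if n \<in> QQ then insert n {q \<in> QQ. q < n} else {q \<in> QQ. q < n})"
      by (auto simp: less_Suc_eq)
    then show ?thesis by (simp add: prd_def)
  qed
  have prd_coprime: "coprime (prd n) q" if "q \<in> QQ" "n \<le> q" for n q
    unfolding prd_def
  proof (rule prod_coprime_left)
    fix p assume "p \<in> {q \<in> QQ. q < n}"
    then show "coprime p q" using that by (auto simp: QQ_def primes_coprime)
  qed
  \<comment> \<open>Subtracting the translate by \<open>c n\<close> makes the sum over its powers telescope; at each point only finitely many steps change the value.\<close>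
  define wn where "wn = rec_nat (\<lambda>g. if g \<in> K then \<one>\<^bsub>k\<^esub> else \<zero>\<^bsub>k\<^esub>)
    (\<lambda>n f g. if n \<in> QQ \<and> g \<in> A then f g \<ominus>\<^bsub>k\<^esub> f (g \<otimes> c n) else f g)"
  have wn_0: "wn 0 g = (if g \<in> K then \<one>\<^bsub>k\<^esub> else \<zero>\<^bsub>k\<^esub>)" for g by (simp add: wn_def)
  have wn_Suc: "wn (Suc n) g = (if n \<in> QQ \<and> g \<in> A then wn n g \<ominus>\<^bsub>k\<^esub> wn n (g \<otimes> c n) else wn n g)" for n g
    by (simp add: wn_def)
  have wn_k: "wn n g \<in> carrier k" for n g by (induction n arbitrary: g) (auto simp: wn_0 wn_Suc)
  have wn_A: "wn n g = \<zero>\<^bsub>k\<^esub>" if "g \<notin> A" for n g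
    using that KA by (induction n) (auto simp: wn_0 wn_Suc)
  have wn_K: "wn n (g \<otimes> x) = wn n g" if "g \<in> A" "x \<in> K" for n g x
    using that(1)
  proof (induction n arbitrary: g)
    case 0
    have xA: "x \<in> A" using \<open>x \<in> K\<close> KA by blast
    have "g \<in> K" if "g \<otimes> x \<in> K"
      using Kcancel[OF \<open>x \<in> K\<close> _ 0] that unfolding comm[OF 0 xA] .
    then have "g \<otimes> x \<in> K \<longleftrightarrow> g \<in> K" using K.m_closed[OF _ \<open>x \<in> K\<close>] by blast
    then show ?case by (simp add: wn_0)
  next
    case (Suc n)
    have "g \<otimes> x \<otimes> c n = (g \<otimes> c n) \<otimes> x" if "n \<in> QQ"
      using Suc.prems \<open>x \<in> K\<close> c[OF that] AG KA comm[of x "c n"] by (simp add: G.m_assoc)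
    moreover have "wn n (g \<otimes> c n \<otimes> x) = wn n (g \<otimes> c n)" if "n \<in> QQ"
      by (rule Suc.IH[OF A.m_closed[OF Suc.prems]]) (use c[OF that] in blast)
    moreover have "g \<otimes> x \<in> A" using A.m_closed[OF Suc.prems KA[OF \<open>x \<in> K\<close>]] .
    ultimately show ?case using Suc.IH[OF Suc.prems] Suc.prems by (simp add: wn_Suc)
  qed
  have wn_supp: "g [^] prd n \<in> K" if "wn n g \<noteq> \<zero>\<^bsub>k\<^esub>" for n g
    using that
  proof (induction n arbitrary: g)
    case 0
    then show ?case by (auto simp: wn_0 prd_def split: if_splits)
  next
    case (Suc n)
    have gA: "g \<in> A" using wn_A Suc.prems by blast
    show ?case
    proof (cases "n \<in> QQ \<and> wn n g = \<zero>\<^bsub>k\<^esub>")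
      case True
      then have "wn n (g \<otimes> c n) \<noteq> \<zero>\<^bsub>k\<^esub>" using Suc.prems gA mz(1)[OF k.zero_closed] by (auto simp: wn_Suc)
      then have "(g \<otimes> c n) [^] prd n \<in> K" by (rule Suc.IH)
      then have "((g \<otimes> c n) [^] prd n) [^] n \<in> K" by (rule Kpow)
      moreover have "((g \<otimes> c n) [^] prd n) [^] n = (c n [^] n) [^] prd n \<otimes> g [^] (n * prd n)"
        using gA c True AG dist comm Apow by (simp add: G.nat_pow_pow mult.commute)
      moreover have "(c n [^] n) [^] prd n \<in> K" using c True Kpow by blast
      ultimately have "g [^] (n * prd n) \<in> K" using Kcancel[OF _ _ Apow[OF gA]] by metis
      then show ?thesis using True by (simp only: prd_Suc if_True)
    next
      case False
      then have "wn n g \<noteq> \<zero>\<^bsub>k\<^esub>" using Suc.prems by (auto simp: wn_Suc)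
      then have "g [^] prd n \<in> K" by (rule Suc.IH)
      then have "(g [^] prd n) [^] n \<in> K" by (rule Kpow)
      then show ?thesis using \<open>g [^] prd n \<in> K\<close> AG[OF gA] by (simp add: prd_Suc G.nat_pow_pow mult.commute)
    qed
  qed
  have wn_one: "wn n \<one> = \<one>\<^bsub>k\<^esub>" for n
  proof (induction n)
    case (Suc n)
    have "wn n (c n) = \<zero>\<^bsub>k\<^esub>" if n: "n \<in> QQ"
    proof (rule ccontr)
      assume "wn n (c n) \<noteq> \<zero>\<^bsub>k\<^esub>"
      then have "c n [^] prd n \<in> K" by (rule wn_supp)
      then have "c n \<in> K" using coprime_K[of "c n" "prd n" n] c[OF n] prd_coprime[OF n] by blast
      then show False using c[OF n] by blast
    qed
    then show ?case using Suc c AG mz(2)[OF k.one_closed] by (auto simp: wn_Suc A.one_closed)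
  qed (simp add: wn_0 K.one_closed)
  have wn_sum: "rsum k (\<lambda>i. wn n (g \<otimes> c q [^] i)) q = \<zero>\<^bsub>k\<^esub>" if "g \<in> A" "q \<in> QQ" "q < n" for n g q
    using that
  proof (induction n arbitrary: g)
    case (Suc n)
    have cq: "c q \<in> A" using c Suc by blast
    have assoc: "g \<otimes> c q [^] i \<otimes> y = (g \<otimes> y) \<otimes> c q [^] i" if "y \<in> A" for y and i :: nat
      using Suc.prems(1) that AG Apow[OF cq, of i] comm[of "c q [^] i" y] by (simp add: G.m_assoc)
    show ?case
    proof (cases "q = n")
      case True
      let ?f = "\<lambda>i::nat. wn n (g \<otimes> c q [^] i)"
      have "rsum k (\<lambda>i. wn (Suc n) (g \<otimes> c q [^] i)) q = rsum k (\<lambda>i. ?f i \<ominus>\<^bsub>k\<^esub> ?f (Suc i)) q"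
        by (rule rsum_cong) (use Suc.prems True cq Apow AG in \<open>auto simp: wn_Suc G.m_assoc\<close>)
      also have "\<dots> = ?f 0 \<ominus>\<^bsub>k\<^esub> ?f q" by (rule k.rsum_telescope[of ?f q, OF wn_k])
      also have "?f q = ?f 0" using wn_K[OF Suc.prems(1), of "c q [^] q" n] c[OF Suc.prems(2)] Suc.prems(1) AG by simp
      finally show ?thesis using wn_k by (simp add: a_minus_def k.r_neg)
    next
      case False
      then have IH: "rsum k (\<lambda>i. wn n (h \<otimes> c q [^] i)) q = \<zero>\<^bsub>k\<^esub>" if "h \<in> A" for h
        using Suc that by simp
      show ?thesis
      proof (cases "n \<in> QQ")
        case True
        have cn: "c n \<in> A" using c True by blast
        have split: "rsum k (\<lambda>i. a i \<ominus>\<^bsub>k\<^esub> b i) m = rsum k a m \<ominus>\<^bsub>k\<^esub> rsum k b m"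
          if "\<And>i. a i \<in> carrier k" "\<And>i. b i \<in> carrier k" for a b :: "nat => 'k" and m
          using that by (induction m) (auto simp: a_minus_def k.minus_add k.rsum_closed k.a_ac)
        have "rsum k (\<lambda>i. wn (Suc n) (g \<otimes> c q [^] i)) q
            = rsum k (\<lambda>i. wn n (g \<otimes> c q [^] i) \<ominus>\<^bsub>k\<^esub> wn n ((g \<otimes> c n) \<otimes> c q [^] i)) q"
          by (rule rsum_cong) (use Suc.prems True cq Apow assoc[OF cn] in \<open>auto simp: wn_Suc\<close>)
        also have "\<dots> = \<zero>\<^bsub>k\<^esub>"
          using IH[OF Suc.prems(1)] IH[of "g \<otimes> c n"] Suc.prems(1) cn wn_k by (simp add: split mz(1)[OF k.zero_closed])
        finally show ?thesis .
      next
        case False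
        then show ?thesis using IH[OF Suc.prems(1)] by (simp add: wn_Suc)
      qed
    qed
  qed simp
  have wn_stable: "wn n g = wn m g" if g: "g \<in> A" "g [^] l \<in> K" "l > 0" and nm: "l < m" "m \<le> n" for g l m n
    using nm(2)
  proof (induction n rule: dec_induct)
    case (step n)
    have "wn n (g \<otimes> c n) = \<zero>\<^bsub>k\<^esub>" if n: "n \<in> QQ"
    proof (rule ccontr)
      note cn = c[OF n]
      assume "wn n (g \<otimes> c n) \<noteq> \<zero>\<^bsub>k\<^esub>"
      then have "(g \<otimes> c n) [^] prd n \<in> K" by (rule wn_supp)
      then have "((g \<otimes> c n) [^] prd n) [^] l \<in> K" by (rule Kpow)
      moreover have "((g \<otimes> c n) [^] prd n) [^] l = (g [^] l) [^] prd n \<otimes> c n [^] (prd n * l)"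
        using g cn AG dist Apow by (simp add: G.nat_pow_pow mult.commute)
      moreover have "(g [^] l) [^] prd n \<in> K" using g Kpow by blast
      ultimately have "c n [^] (prd n * l) \<in> K" using Kcancel Apow cn by metis
      moreover have "coprime (prd n * l) n"
      proof -
        have "\<not> n dvd l" using g(3) nm step by (auto dest: dvd_imp_le)
        then have "coprime l n" using n prime_imp_coprime[of n l] by (auto simp: QQ_def coprime_commute)
        then show ?thesis using prd_coprime[OF n, of n] by simp
      qed
      ultimately have "c n \<in> K" using coprime_K[of "c n" "prd n * l" n] cn by blast
      then show False using cn by blast
    qed
    then show ?case using step mz(2)[OF wn_k] by (auto simp: wn_Suc)
  qed simp
  have "\<exists>m. \<forall>n\<ge>m. wn n g = wn m g" for g
  proof (cases "g \<in> A")
    case True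
    then obtain l :: nat where "l > 0" "g [^] l \<in> K" using tors by blast
    then show ?thesis using wn_stable[OF True, of l "Suc l"] by blast
  qed (simp add: wn_A)
  then obtain m where m: "\<And>g n. n \<ge> m g ==> wn n g = wn (m g) g" by metis
  define w where "w = (\<lambda>g. wn (m g) g)"
  have w_eq: "w g = wn n g" if "n \<ge> m g" for g n unfolding w_def using m[OF that] by (rule sym)
  have w_k: "w g \<in> carrier k" for g unfolding w_def by (rule wn_k)
  have w_A: "w g = \<zero>\<^bsub>k\<^esub>" if "g \<notin> A" for g unfolding w_def using that by (rule wn_A)
  have w_K: "w (g \<otimes> x) = w g" if "g \<in> A" "x \<in> K" for g x
    using w_eq[of g "max (m g) (m (g \<otimes> x))"] w_eq[of "g \<otimes> x" "max (m g) (m (g \<otimes> x))"] wn_K[OF that] by simp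
  have w_one: "w \<one> = \<one>\<^bsub>k\<^esub>" unfolding w_def by (rule wn_one)
  have w_sum: "rsum k (\<lambda>i. w (g \<otimes> c q [^] i)) q = \<zero>\<^bsub>k\<^esub>" if g: "g \<in> A" and q: "q \<in> QQ" for g q
  proof -
    define n where "n = Max (insert (Suc q) ((\<lambda>i. m (g \<otimes> c q [^] i)) ` {..<q}))"
    have "n \<ge> Suc q" "\<And>i. i < q ==> n \<ge> m (g \<otimes> c q [^] i)" by (auto simp: n_def intro!: Max_ge)
    then have "rsum k (\<lambda>i. w (g \<otimes> c q [^] i)) q = rsum k (\<lambda>i. wn n (g \<otimes> c q [^] i)) q"
      by (intro rsum_cong w_eq)
    then show ?thesis using wn_sum[OF g q, of n] \<open>n \<ge> Suc q\<close> by simp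
  qed
  define sh where "sh = (\<lambda>a (f :: 'g => 'k) g. if g \<in> carrier G then f (g \<otimes> a) else \<zero>\<^bsub>k\<^esub>)"
  define Fun where "Fun = {f :: 'g => 'k. (\<forall>g. f g \<in> carrier k) \<and> (\<forall>g. g \<notin> carrier G --> f g = \<zero>\<^bsub>k\<^esub>)}"
  define closed where "closed = (\<lambda>S. S \<subseteq> Fun \<and> (\<lambda>_. \<zero>\<^bsub>k\<^esub>) \<in> S \<and> (\<forall>f\<in>S. \<forall>h\<in>S. (\<lambda>g. f g \<oplus>\<^bsub>k\<^esub> h g) \<in> S) \<and>
    (\<forall>a\<in>carrier k. \<forall>f\<in>S. (\<lambda>g. a \<otimes>\<^bsub>k\<^esub> f g) \<in> S) \<and> (\<forall>a\<in>carrier G. \<forall>f\<in>S. sh a f \<in> S))"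
  define M where "M = \<Inter>{S. closed S \<and> w \<in> S}"
  have wFun: "w \<in> Fun" unfolding Fun_def using w_k w_A AG by blast
  have "closed Fun" by (auto simp: closed_def Fun_def sh_def)
  then have MF: "M \<subseteq> Fun" using wFun unfolding M_def by (intro Inter_lower) simp
  have clM: "closed M" unfolding closed_def
  proof (intro conjI ballI MF)
    show "(\<lambda>_. \<zero>\<^bsub>k\<^esub>) \<in> M" by (simp add: M_def closed_def)
    fix f assume f: "f \<in> M"
    show "(\<lambda>g. f g \<oplus>\<^bsub>k\<^esub> h g) \<in> M" if "h \<in> M" for h using f that by (simp add: M_def closed_def)
    show "(\<lambda>g. a \<otimes>\<^bsub>k\<^esub> f g) \<in> M" if "a \<in> carrier k" for a using f that by (simp add: M_def closed_def)
    show "sh a f \<in> M" if "a \<in> carrier G" for a using f that by (simp add: M_def closed_def)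
  qed
  have wM: "w \<in> M" by (simp add: M_def)
  have M_least: "M \<subseteq> S" if "closed S" "w \<in> S" for S using that unfolding M_def by blast
  have Mk: "f g \<in> carrier k" "g \<notin> carrier G ==> f g = \<zero>\<^bsub>k\<^esub>" if "f \<in> M" for f g
    using clM that by (auto simp: closed_def Fun_def)
  define V :: "('k, 'g => 'k) module" where
    "V = \<lparr>carrier = M, monoid.mult = (\<lambda>x y. x), one = (\<lambda>_. \<zero>\<^bsub>k\<^esub>), ring.zero = (\<lambda>_. \<zero>\<^bsub>k\<^esub>),
       ring.add = (\<lambda>f h g. f g \<oplus>\<^bsub>k\<^esub> h g), module.smult = (\<lambda>a f g. a \<otimes>\<^bsub>k\<^esub> f g)\<rparr>"
  have sel: "carrier V = M" "\<zero>\<^bsub>V\<^esub> = (\<lambda>_. \<zero>\<^bsub>k\<^esub>)" "f \<oplus>\<^bsub>V\<^esub> h = (\<lambda>g. f g \<oplus>\<^bsub>k\<^esub> h g)" "a \<odot>\<^bsub>V\<^esub> f = (\<lambda>g. a \<otimes>\<^bsub>k\<^esub> f g)" for f h a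
    by (simp_all add: V_def)
  have Mcl: "(\<lambda>_. \<zero>\<^bsub>k\<^esub>) \<in> M" "f \<in> M ==> h \<in> M ==> (\<lambda>g. f g \<oplus>\<^bsub>k\<^esub> h g) \<in> M"
    "a \<in> carrier k ==> f \<in> M ==> (\<lambda>g. a \<otimes>\<^bsub>k\<^esub> f g) \<in> M" "x \<in> carrier G ==> f \<in> M ==> sh x f \<in> M" for f h a x
    using clM by (simp_all add: closed_def)
  have abV: "abelian_group V"
  proof (rule abelian_groupI)
    fix f assume "f \<in> carrier V"
    then have f: "f \<in> M" by (simp add: sel)
    show "\<exists>h\<in>carrier V. h \<oplus>\<^bsub>V\<^esub> f = \<zero>\<^bsub>V\<^esub>"
    proof (rule bexI)
      show "(\<lambda>g. (\<ominus>\<^bsub>k\<^esub> \<one>\<^bsub>k\<^esub>) \<otimes>\<^bsub>k\<^esub> f g) \<in> carrier V" using Mcl(3) f by (simp add: sel)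
      show "(\<lambda>g. (\<ominus>\<^bsub>k\<^esub> \<one>\<^bsub>k\<^esub>) \<otimes>\<^bsub>k\<^esub> f g) \<oplus>\<^bsub>V\<^esub> f = \<zero>\<^bsub>V\<^esub>" using Mk(1)[OF f] by (simp add: sel k.l_minus k.l_neg)
    qed
  qed (auto simp: sel Mcl Mk k.a_ac)
  have modV: "module k V"
    by (rule moduleI) (auto simp: abV sel Mcl Mk k.l_distr k.r_distr k.m_assoc k.is_cring fun_eq_iff)
  let ?\<rho> = "\<lambda>g. restrict (sh g) (carrier V)"
  have lin: "linear_rep k G V ?\<rho>"
  proof (rule linear_repI[OF k.field_axioms G.is_group modV])
    fix g v assume g: "g \<in> carrier G" and v: "v \<in> carrier V"
    show "sh g v \<in> carrier V" using Mcl g v by (simp add: sel)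
    show "sh (g \<otimes> h) v = sh g (sh h v)" if "h \<in> carrier G" for h
      using g that by (auto simp: sh_def fun_eq_iff G.m_assoc)
  next
    fix v assume v: "v \<in> carrier V"
    show "sh \<one> v = v" using v Mk(2)[of v] by (auto simp: sh_def fun_eq_iff sel)
  qed (auto simp: sh_def sel fun_eq_iff)
  have wV: "w \<in> carrier V" "w \<noteq> \<zero>\<^bsub>V\<^esub>" using wM w_one by (auto simp: sel fun_eq_iff intro!: exI[of _ "\<one>"])
  have "\<exists>(V' :: ('k, ('g => 'k) set) module) \<rho>' \<pi>. irreducible_rep k G V' \<rho>' \<and> \<pi> \<in> carrier V \<rightarrow> carrier V' \<and>
    (\<forall>x\<in>carrier V. \<forall>y\<in>carrier V. \<pi> (x \<oplus>\<^bsub>V\<^esub> y) = \<pi> x \<oplus>\<^bsub>V'\<^esub> \<pi> y) \<and> \<pi> \<zero>\<^bsub>V\<^esub> = \<zero>\<^bsub>V'\<^esub> \<and>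
    (\<forall>g\<in>carrier G. \<forall>x\<in>carrier V. \<pi> (?\<rho> g x) = \<rho>' g (\<pi> x)) \<and> \<pi> w \<noteq> \<zero>\<^bsub>V'\<^esub>"
  proof (rule exists_irreducible_quotient[OF lin wV])
    fix S assume S: "submodule S k V" "\<forall>g\<in>carrier G. \<forall>s\<in>S. ?\<rho> g s \<in> S" "w \<in> S"
    interpret V: module k V by (rule modV)
    note E = V.submoduleE[OF S(1)]
    have SM: "S \<subseteq> M" using E(1) by (simp add: sel)
    have "closed S" unfolding closed_def
    proof (intro conjI ballI)
      show "S \<subseteq> Fun" using SM clM by (auto simp: closed_def)
      have "\<zero>\<^bsub>k\<^esub> \<odot>\<^bsub>V\<^esub> w \<in> S" using E(4)[of "\<zero>\<^bsub>k\<^esub>" w] S(3) by simp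
      then show "(\<lambda>_. \<zero>\<^bsub>k\<^esub>) \<in> S" using w_k by (simp add: sel)
      fix f assume f: "f \<in> S"
      show "(\<lambda>g. f g \<oplus>\<^bsub>k\<^esub> h g) \<in> S" if "h \<in> S" for h using E(5)[OF f that] by (simp add: sel)
      show "(\<lambda>g. a \<otimes>\<^bsub>k\<^esub> f g) \<in> S" if "a \<in> carrier k" for a using E(4)[OF that f] by (simp add: sel)
      show "sh a f \<in> S" if "a \<in> carrier G" for a
      proof -
        have "?\<rho> a f \<in> S" using S(2) that f by blast
        moreover have "f \<in> carrier V" using f SM by (auto simp: sel)
        ultimately show ?thesis by simp
      qed
    qed
    then show "S = carrier V" using M_least[OF _ S(3)] SM by (auto simp: sel)
  qed
  then obtain V' :: "('k, ('g => 'k) set) module" and \<rho>' \<pi> where irr: "irreducible_rep k G V' \<rho>'"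
    and \<pi>0: "\<pi> \<in> carrier V \<rightarrow> carrier V'"
    and \<pi>add: "\<forall>x\<in>carrier V. \<forall>y\<in>carrier V. \<pi> (x \<oplus>\<^bsub>V\<^esub> y) = \<pi> x \<oplus>\<^bsub>V'\<^esub> \<pi> y" and \<pi>z: "\<pi> \<zero>\<^bsub>V\<^esub> = \<zero>\<^bsub>V'\<^esub>"
    and \<pi>\<rho>: "\<forall>g\<in>carrier G. \<forall>x\<in>carrier V. \<pi> (?\<rho> g x) = \<rho>' g (\<pi> x)" and \<pi>nz: "\<pi> w \<noteq> \<zero>\<^bsub>V'\<^esub>"
    by (elim exE conjE) (rule that)
  have \<pi>: "\<And>x. x \<in> M ==> \<pi> x \<in> carrier V'" "\<And>x y. x \<in> M ==> y \<in> M ==> \<pi> (x \<oplus>\<^bsub>V\<^esub> y) = \<pi> x \<oplus>\<^bsub>V'\<^esub> \<pi> y"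
      "\<pi> \<zero>\<^bsub>V\<^esub> = \<zero>\<^bsub>V'\<^esub>" "\<And>g x. g \<in> carrier G ==> x \<in> M ==> \<pi> (sh g x) = \<rho>' g (\<pi> x)" "\<pi> w \<noteq> \<zero>\<^bsub>V'\<^esub>"
  proof -
    show "\<pi> x \<in> carrier V'" if "x \<in> M" for x using \<pi>0 that by (auto simp: sel)
    show "\<pi> (x \<oplus>\<^bsub>V\<^esub> y) = \<pi> x \<oplus>\<^bsub>V'\<^esub> \<pi> y" if "x \<in> M" "y \<in> M" for x y
      using \<pi>add that unfolding sel(1) by blast
    show "\<pi> (sh g x) = \<rho>' g (\<pi> x)" if "g \<in> carrier G" "x \<in> M" for g x
      using bspec[OF bspec[OF \<pi>\<rho> that(1)], of x] that(2) by (simp add: sel(1))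
  qed (rule \<pi>z, rule \<pi>nz)
  interpret L: linear_rep k G V' \<rho>' using irr by (simp add: irreducible_rep_def)
  interpret GH: group_hom G "BijGroup (carrier V')" \<rho>' by (rule L.act.group_hom)
  note GH.hom_mult [simp del] GH.hom_inv [simp del] GH.hom_one [simp del]
  define N where "N = kernel G (BijGroup (carrier V')) \<rho>'"
  have N: "N \<lhd> G" unfolding N_def by (rule GH.normal_kernel)
  then interpret N: normal N G .
  have Npow: "x [^] (n::nat) \<in> N" if "x \<in> N" for x n
    by (induction n) (use that N.one_closed in auto)
  have triv: "\<rho>' x v = v" if "x \<in> N" "v \<in> carrier V'" for x v
  proof -
    have "\<rho>' x = \<one>\<^bsub>BijGroup (carrier V')\<^esub>" using that(1) unfolding N_def kernel_def by blast
    then have "\<rho>' x v = (\<lambda>y\<in>carrier V'. y) v" by (simp only: BijGroup_def monoid.simps)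
    then show ?thesis using that(2) by simp
  qed
  have "N = {\<one>}"
  proof (rule ccontr)
    assume "N \<noteq> {\<one>}"
    then obtain a where a: "a \<in> N" "a \<in> A" "a \<notin> K" using core[OF N] by blast
    obtain n0 :: nat where n0: "n0 > 0 \<and> a [^] n0 \<in> K" using tors[OF a(2)] by blast
    define n where "n = (LEAST n::nat. n > 0 \<and> a [^] n \<in> K)"
    have n: "n > 0" "a [^] n \<in> K" using LeastI[of "\<lambda>n::nat. n > 0 \<and> a [^] n \<in> K", OF n0] by (auto simp: n_def)
    have "n \<noteq> 1" using n a AG by auto
    then obtain q where q: "Factorial_Ring.prime q" "q dvd n" using prime_factor_nat by blast
    then obtain l where l: "n = l * q" by (metis dvd_def mult.commute)
    have "l < n" "l > 0" using l n prime_gt_1_nat[OF q(1)] by auto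
    then have "a [^] l \<notin> K" using not_less_Least[of l "\<lambda>n::nat. n > 0 \<and> a [^] n \<in> K"] by (auto simp: n_def)
    define b where "b = a [^] l"
    have b: "b \<in> N" "b \<in> A" "b \<notin> K" "b [^] q \<in> K"
      using Npow a Apow \<open>a [^] l \<notin> K\<close> n l AG by (auto simp: b_def G.nat_pow_pow)
    then have qQ: "q \<in> QQ" using q by (auto simp: QQ_def)
    note cq = c[OF qQ]
    have cqG: "c q \<in> carrier G" using cq AG by blast
    obtain j :: nat and x where x: "x \<in> K" "c q = b [^] j \<otimes> x"
      using cyc[OF q(1), of b "c q"] b cq by blast
    have xG: "x \<in> carrier G" using x KA AG by blast
    have shw: "sh x w = w"
    proof
      fix g
      show "sh x w g = w g"
      proof (cases "g \<in> A")
        case True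
        then show ?thesis using w_K x AG by (simp add: sh_def)
      next
        case False
        have "g \<otimes> x \<notin> A" if "g \<in> carrier G"
        proof
          assume "g \<otimes> x \<in> A"
          then have "g \<otimes> x \<otimes> inv x \<in> A" using x KA by blast
          then show False using False that xG by (simp add: G.m_assoc)
        qed
        then show ?thesis using False w_A by (simp add: sh_def)
      qed
    qed
    have \<pi>w: "\<pi> w \<in> carrier V'" using \<pi>(1) wM by blast
    have bj: "b [^] j \<in> N" "b [^] j \<in> carrier G" using Npow b AG Apow by blast+
    have c_fix: "\<rho>' (c q) (\<pi> w) = \<pi> w"
    proof -
      have "\<rho>' (c q) (\<pi> w) = \<rho>' (b [^] j) (\<rho>' x (\<pi> w))" unfolding x(2) by (rule L.rho_mult[OF bj(2) xG \<pi>w])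
      also have "\<rho>' x (\<pi> w) = \<pi> w" using \<pi>(4)[OF xG wM] shw by simp
      finally show ?thesis using triv bj \<pi>w by simp
    qed
    have ci_fix: "\<rho>' (c q [^] i) (\<pi> w) = \<pi> w" for i :: nat
      by (induction i) (auto simp: L.rho_one L.rho_mult \<pi>w cqG c_fix)
    have sumM: "rsum V (\<lambda>i. sh (c q [^] i) w) n \<in> M" for n
      by (induction n) (auto simp: sel Mcl wM cqG)
    have "\<pi> (rsum V (\<lambda>i. sh (c q [^] i) w) n) = rsum k (\<lambda>_. \<one>\<^bsub>k\<^esub>) n \<odot>\<^bsub>V'\<^esub> \<pi> w" for n
    proof (induction n)
      case (Suc n)
      have "\<pi> (sh (c q [^] n) w) = \<pi> w" using \<pi>(4)[of "c q [^] n" w] cqG wM ci_fix by simp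
      then show ?case using Suc \<pi>(2)[OF sumM, of "sh (c q [^] n) w" n] Mcl(4)[of "c q [^] n" w] wM cqG \<pi>w
        by (simp add: L.V.smult_l_distr k.rsum_closed)
    qed (simp add: \<pi>(3) \<pi>w)
    moreover have "rsum V (\<lambda>i. sh (c q [^] i) w) q = \<zero>\<^bsub>V\<^esub>"
    proof
      fix g
      have app: "rsum V (\<lambda>i. sh (c q [^] i) w) n g = rsum k (\<lambda>i. sh (c q [^] i) w g) n" for n
        by (induction n) (auto simp: sel)
      have "rsum k (\<lambda>i. sh (c q [^] i) w g) q = \<zero>\<^bsub>k\<^esub>"
      proof (cases "g \<in> A")
        case True
        then have "rsum k (\<lambda>i. sh (c q [^] i) w g) q = rsum k (\<lambda>i. w (g \<otimes> c q [^] i)) q"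
          using AG by (intro rsum_cong) (simp add: sh_def)
        then show ?thesis using w_sum[OF True qQ] by simp
      next
        case False
        have "sh (c q [^] i) w g = \<zero>\<^bsub>k\<^esub>" for i :: nat
        proof -
          have ci: "c q [^] i \<in> A" using Apow cq by blast
          have "g \<otimes> c q [^] i \<notin> A" if "g \<in> carrier G"
          proof
            assume "g \<otimes> c q [^] i \<in> A"
            then have "g \<otimes> c q [^] i \<otimes> inv (c q [^] i) \<in> A" using ci by blast
            then show False using False that AG[OF ci] by (simp add: G.m_assoc)
          qed
          then show ?thesis using w_A by (simp add: sh_def)
        qed
        moreover have "rsum k (\<lambda>_. \<zero>\<^bsub>k\<^esub>) n = \<zero>\<^bsub>k\<^esub>" for n by (induction n) auto
        ultimately show ?thesis by simp
      qed
      then show "rsum V (\<lambda>i. sh (c q [^] i) w) q g = \<zero>\<^bsub>V\<^esub> g" by (simp add: app sel)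
    qed
    ultimately have e0: "rsum k (\<lambda>_. \<one>\<^bsub>k\<^esub>) q \<odot>\<^bsub>V'\<^esub> \<pi> w = \<zero>\<^bsub>V'\<^esub>" using \<pi>(3) by metis
    let ?s = "rsum k (\<lambda>_. \<one>\<^bsub>k\<^esub>) q"
    have s: "?s \<in> carrier k" "?s \<noteq> \<zero>\<^bsub>k\<^esub>" using char[OF q(1), of b] b by (auto intro: k.rsum_closed)
    then have "inv\<^bsub>k\<^esub> ?s \<in> carrier k" "inv\<^bsub>k\<^esub> ?s \<otimes>\<^bsub>k\<^esub> ?s = \<one>\<^bsub>k\<^esub>" using k.field_Units by auto
    then have "\<pi> w = inv\<^bsub>k\<^esub> ?s \<odot>\<^bsub>V'\<^esub> (?s \<odot>\<^bsub>V'\<^esub> \<pi> w)" using s \<pi>w by (simp add: L.V.smult_assoc1[symmetric])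
    then have "\<pi> w = \<zero>\<^bsub>V'\<^esub>" using e0 \<open>inv\<^bsub>k\<^esub> ?s \<in> carrier k\<close> by simp
    then show False using \<pi>(5) by blast
  qed
  then show ?thesis
    using has_faithful_irreducible_repI[OF irr] by (simp add: faithful_rep_def N_def)
qed

section \<open>Elementary abelian subgroups in a faithful irreducible representation\<close>

lemma (in abelian_monoid) rsum_add:
  assumes "\<And>i. f i \<in> carrier G" "\<And>i. g i \<in> carrier G"
  shows "rsum G (\<lambda>i. f i \<oplus> g i) n = rsum G f n \<oplus> rsum G g n"
  by (induction n) (use assms in \<open>auto simp: rsum_closed a_ac\<close>)

lemma (in abelian_monoid) rsum_zero: "(\<And>i. i < n ==> f i = \<zero>) ==> rsum G f n = \<zero>"
  by (induction n) auto

lemma (in abelian_monoid) rsum_swap: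
  assumes "\<And>i j. f i j \<in> carrier G"
  shows "rsum G (\<lambda>i. rsum G (\<lambda>j. f i j) n) m = rsum G (\<lambda>j. rsum G (\<lambda>i. f i j) m) n"
proof (induction m)
  case 0
  show ?case by (simp add: rsum_zero)
next
  case (Suc m)
  then show ?case using assms by (simp add: rsum_add rsum_closed)
qed

lemma (in abelian_monoid) rsum_first:
  assumes "\<And>i. f i \<in> carrier G"
  shows "rsum G f (Suc n) = f 0 \<oplus> rsum G (\<lambda>i. f (Suc i)) n"
  by (induction n) (use assms in \<open>auto simp: rsum_closed a_assoc\<close>)

context linear_rep
begin

interpretation GH: group_hom G "BijGroup (carrier V)" \<rho> by (rule act.group_hom)

lemmas [simp del] = GH.hom_mult GH.hom_inv GH.hom_one

definition nsm :: "nat => 'v => 'v" where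
  "nsm n v = rsum k (\<lambda>_. \<one>\<^bsub>k\<^esub>) n \<odot>\<^bsub>V\<^esub> v"

lemma ones_closed: "rsum k (\<lambda>_. \<one>\<^bsub>k\<^esub>) n \<in> carrier k"
  by (rule K.rsum_closed) simp

lemma nsm_closed: "v \<in> carrier V ==> nsm n v \<in> carrier V"
  by (simp add: nsm_def ones_closed)

lemma nsm_eq_rsum: "v \<in> carrier V ==> rsum V (\<lambda>_. v) n = nsm n v"
  by (induction n) (auto simp: nsm_def V.smult_l_distr ones_closed)

lemma nsm_0: "v \<in> carrier V ==> nsm 0 v = \<zero>\<^bsub>V\<^esub>" and nsm_1: "v \<in> carrier V ==> nsm 1 v = v"
  by (simp_all add: nsm_def)

lemma ones_add: "rsum k (\<lambda>_. \<one>\<^bsub>k\<^esub>) (m + n) = rsum k (\<lambda>_. \<one>\<^bsub>k\<^esub>) m \<oplus>\<^bsub>k\<^esub> rsum k (\<lambda>_. \<one>\<^bsub>k\<^esub>) n"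
  by (induction n) (auto simp: ones_closed K.a_assoc)

lemma nsm_add: "v \<in> carrier V ==> nsm (m + n) v = nsm m v \<oplus>\<^bsub>V\<^esub> nsm n v"
  by (simp add: nsm_def ones_add V.smult_l_distr ones_closed)

lemma nsm_mult_eq_0:
  assumes "rsum k (\<lambda>_. \<one>\<^bsub>k\<^esub>) p = \<zero>\<^bsub>k\<^esub>" "v \<in> carrier V"
  shows "nsm (m * p) v = \<zero>\<^bsub>V\<^esub>"
proof (induction m)
  case (Suc m)
  then show ?case using assms by (simp add: nsm_add nsm_def[of p])
qed (use assms nsm_0 in simp)

lemma nsm_eq_0D:
  assumes "rsum k (\<lambda>_. \<one>\<^bsub>k\<^esub>) q \<noteq> \<zero>\<^bsub>k\<^esub>" "v \<in> carrier V" "nsm q v = \<zero>\<^bsub>V\<^esub>"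
  shows "v = \<zero>\<^bsub>V\<^esub>"
proof -
  let ?s = "rsum k (\<lambda>_. \<one>\<^bsub>k\<^esub>) q"
  have s: "inv\<^bsub>k\<^esub> ?s \<in> carrier k" "inv\<^bsub>k\<^esub> ?s \<otimes>\<^bsub>k\<^esub> ?s = \<one>\<^bsub>k\<^esub>"
    using K.field_Units assms(1) ones_closed by auto
  then have "v = inv\<^bsub>k\<^esub> ?s \<odot>\<^bsub>V\<^esub> (?s \<odot>\<^bsub>V\<^esub> v)" using assms(2) ones_closed by (simp add: V.smult_assoc1[symmetric])
  then show ?thesis using assms(3) s by (simp add: nsm_def)
qed

lemma rho_rsum:
  assumes "g \<in> carrier G" "\<And>i. f i \<in> carrier V"
  shows "\<rho> g (rsum V f n) = rsum V (\<lambda>i. \<rho> g (f i)) n"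
  by (induction n) (use assms in \<open>auto simp: rho_zero rep_add V.rsum_closed\<close>)

lemma rho_neg: "g \<in> carrier G ==> v \<in> carrier V ==> \<rho> g (\<ominus>\<^bsub>V\<^esub> v) = \<ominus>\<^bsub>V\<^esub> \<rho> g v"
proof -
  assume gv: "g \<in> carrier G" "v \<in> carrier V"
  have "\<ominus>\<^bsub>V\<^esub> y = (\<ominus>\<^bsub>k\<^esub> \<one>\<^bsub>k\<^esub>) \<odot>\<^bsub>V\<^esub> y" if "y \<in> carrier V" for y
    using that V.smult_l_minus[of "\<one>\<^bsub>k\<^esub>" y] by simp
  then show ?thesis using gv rho_closed by (simp add: rep_smult)
qed

lemma rho_smult_nsm: "g \<in> carrier G ==> v \<in> carrier V ==> \<rho> g (nsm n v) = nsm n (\<rho> g v)"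
  by (simp add: nsm_def rep_smult ones_closed)

lemma no_fixed_vectors:
  assumes irr: "irreducible_rep k G V \<rho>" and faith: "faithful_rep G V \<rho>"
    and N: "N \<lhd> G" "N \<noteq> {\<one>\<^bsub>G\<^esub>}" and v: "v \<in> carrier V" "\<And>x. x \<in> N ==> \<rho> x v = v"
  shows "v = \<zero>\<^bsub>V\<^esub>"
proof (rule ccontr)
  assume v0: "v \<noteq> \<zero>\<^bsub>V\<^esub>"
  interpret N: normal N G by fact
  have NG: "\<And>x. x \<in> N ==> x \<in> carrier G" using N.subset by blast
  let ?W = "{v \<in> carrier V. \<forall>x\<in>N. \<rho> x v = v}"
  have "submodule ?W k V"
    by (rule V.submoduleI) (auto simp: NG rho_zero rho_neg rep_add rep_smult)
  moreover have "\<rho> g w \<in> ?W" if g: "g \<in> carrier G" and w: "w \<in> ?W" for g w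
  proof -
    have "\<rho> x (\<rho> g w) = \<rho> g w" if x: "x \<in> N" for x
    proof -
      have n: "inv\<^bsub>G\<^esub> g \<otimes>\<^bsub>G\<^esub> x \<otimes>\<^bsub>G\<^esub> g \<in> N" using N.inv_op_closed1[OF g x] .
      have "x \<otimes>\<^bsub>G\<^esub> g = g \<otimes>\<^bsub>G\<^esub> (inv\<^bsub>G\<^esub> g \<otimes>\<^bsub>G\<^esub> x \<otimes>\<^bsub>G\<^esub> g)" using g NG[OF x] by (simp add: GH.G.m_assoc[symmetric])
      then have "\<rho> x (\<rho> g w) = \<rho> g (\<rho> (inv\<^bsub>G\<^esub> g \<otimes>\<^bsub>G\<^esub> x \<otimes>\<^bsub>G\<^esub> g) w)"
        using g NG[OF x] NG[OF n] w by (simp add: rho_mult[symmetric])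
      then show ?thesis using n w by simp
    qed
    then show ?thesis using rho_closed g w by simp
  qed
  ultimately have "?W = {\<zero>\<^bsub>V\<^esub>} \<or> ?W = carrier V" using irr unfolding irreducible_rep_def by blast
  moreover have "v \<in> ?W" using v by blast
  ultimately have W: "?W = carrier V" using v0 by blast
  have "x = \<one>\<^bsub>G\<^esub>" if x: "x \<in> N" for x
  proof -
    have "\<rho> x y = y" if "y \<in> carrier V" for y using W that x by blast
    moreover have "\<rho> x \<in> extensional (carrier V)"
      using act.bij_prop0[OF NG[OF x]] by (simp add: Bij_def)
    ultimately have "\<rho> x = (\<lambda>y\<in>carrier V. y)"
      by (intro extensionalityI[of _ "carrier V"]) auto
    then have "x \<in> kernel G (BijGroup (carrier V)) \<rho>"
      using NG[OF x] by (simp add: kernel_def BijGroup_def)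
    then show ?thesis using faith by (simp add: faithful_rep_def)
  qed
  then show False using N(2) N.one_closed by blast
qed

text \<open>Take a nonzero vector whose stabiliser in \<open>F\<close> is as large as possible.\<close>

lemma maximal_stabilizer:
  assumes V0: "carrier V \<noteq> {\<zero>\<^bsub>V\<^esub>}" and F: "subgroup F G" "finite F"
  obtains K v where "subgroup K G" "K \<subseteq> F" "v \<in> carrier V" "v \<noteq> \<zero>\<^bsub>V\<^esub>" "\<And>x. x \<in> K ==> \<rho> x v = v"
    "\<And>c u. c \<in> F ==> c \<notin> K ==> u \<in> carrier V ==> (\<And>x. x \<in> K ==> \<rho> x u = u) ==> \<rho> c u = u ==> u = \<zero>\<^bsub>V\<^esub>"
proof -
  interpret F: subgroup F G by fact
  define S where "S = (\<lambda>v. {x \<in> F. \<rho> x v = v})"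
  have FG: "\<And>x. x \<in> F ==> x \<in> carrier G" using F.subset by blast
  obtain v0 where v0: "v0 \<in> carrier V" "v0 \<noteq> \<zero>\<^bsub>V\<^esub>" using V0 V.zero_closed by blast
  have fS: "finite (S v)" for v using F by (simp add: S_def)
  have bdd: "card (S v) \<le> card F" for v using F by (auto simp: S_def intro: card_mono)
  let ?P = "\<lambda>v. v \<in> carrier V \<and> v \<noteq> \<zero>\<^bsub>V\<^esub>"
  obtain v where v: "?P v" and vmax: "\<And>u. ?P u ==> card (S u) \<le> card (S v)"
    using ex_has_greatest_nat[of ?P v0 "\<lambda>v. card (S v)" "Suc (card F)"] v0 bdd by (auto simp: less_Suc_eq_le)
  have "subgroup (S v) G"
  proof (rule GH.G.subgroupI)
    show "S v \<subseteq> carrier G" using FG by (auto simp: S_def)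
    show "S v \<noteq> {}" using F.one_closed rho_one v by (auto simp: S_def intro!: exI[of _ "\<one>\<^bsub>G\<^esub>"])
    fix x assume x: "x \<in> S v"
    have xG: "x \<in> carrier G" using x FG by (simp add: S_def)
    have "\<rho> (inv\<^bsub>G\<^esub> x) v = \<rho> (inv\<^bsub>G\<^esub> x) (\<rho> x v)" using x by (simp add: S_def)
    also have "\<dots> = v" using xG v by (simp add: rho_mult[symmetric] rho_one)
    finally show "inv\<^bsub>G\<^esub> x \<in> S v" using x by (simp add: S_def)
    fix y assume y: "y \<in> S v"
    then show "x \<otimes>\<^bsub>G\<^esub> y \<in> S v" using x v FG by (simp add: S_def rho_mult)
  qed
  moreover have "u = \<zero>\<^bsub>V\<^esub>" if u: "c \<in> F" "c \<notin> S v" "u \<in> carrier V" "\<And>x. x \<in> S v ==> \<rho> x u = u" "\<rho> c u = u" for c u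
  proof (rule ccontr)
    assume "u \<noteq> \<zero>\<^bsub>V\<^esub>"
    have "S v \<subset> S u" using u by (auto simp: S_def)
    then have "card (S v) < card (S u)" by (rule psubset_card_mono[OF fS])
    then show False using vmax[of u] u \<open>u \<noteq> \<zero>\<^bsub>V\<^esub>\<close> by simp
  qed
  ultimately show thesis using v by (intro that[of "S v" v]) (auto simp: S_def)
qed

text \<open>Let \<open>K\<close> be a maximal stabiliser and \<open>c\<close> in \<open>F\<close> outside it. The map \<open>D = c - 1\<close> is injective on the vectors fixed
  by \<open>K\<close>, yet \<open>1 = c\<^sup>p = (1 + D)\<^sup>p = 1 + D\<^sup>p\<close> in characteristic \<open>p\<close>.\<close>

lemma no_char_torsion_in_abelian_normal:
  assumes irr: "irreducible_rep k G V \<rho>" and faith: "faithful_rep G V \<rho>"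
    and F: "F \<lhd> G" "finite F" and comm: "\<And>x y. x \<in> F ==> y \<in> F ==> x \<otimes>\<^bsub>G\<^esub> y = y \<otimes>\<^bsub>G\<^esub> x"
    and p: "Factorial_Ring.prime (p::nat)" "\<And>x. x \<in> F ==> x [^]\<^bsub>G\<^esub> p = \<one>\<^bsub>G\<^esub>"
    and char: "rsum k (\<lambda>_. \<one>\<^bsub>k\<^esub>) p = \<zero>\<^bsub>k\<^esub>"
  shows "F = {\<one>\<^bsub>G\<^esub>}"
proof (rule ccontr)
  assume F1: "F \<noteq> {\<one>\<^bsub>G\<^esub>}"
  interpret F: normal F G by fact
  have FG: "\<And>x. x \<in> F ==> x \<in> carrier G" using F.subset by blast
  have V0: "carrier V \<noteq> {\<zero>\<^bsub>V\<^esub>}" using irr by (simp add: irreducible_rep_def)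
  obtain K v where K: "subgroup K G" "K \<subseteq> F" and v: "v \<in> carrier V" "v \<noteq> \<zero>\<^bsub>V\<^esub>" "\<And>x. x \<in> K ==> \<rho> x v = v"
    and max: "\<And>c u. c \<in> F ==> c \<notin> K ==> u \<in> carrier V ==> (\<And>x. x \<in> K ==> \<rho> x u = u) ==> \<rho> c u = u ==> u = \<zero>\<^bsub>V\<^esub>"
    using maximal_stabilizer[OF V0 F.subgroup_axioms F(2)] by metis
  have "K \<noteq> F"
    using no_fixed_vectors[OF irr faith F(1) F1 v(1)] v by blast
  then obtain c where c: "c \<in> F" "c \<notin> K" using K by blast
  have cG: "c \<in> carrier G" using c FG by blast
  define U where "U = {u \<in> carrier V. \<forall>x\<in>K. \<rho> x u = u}"
  define D where "D = (\<lambda>u. \<rho> c u \<ominus>\<^bsub>V\<^esub> u)"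
  have KG: "\<And>x. x \<in> K ==> x \<in> carrier G" using K FG by blast
  have DU: "D u \<in> U" if u: "u \<in> U" for u
  proof -
    have uV: "u \<in> carrier V" using u by (simp add: U_def)
    have "\<rho> x (\<rho> c u) = \<rho> c u" if x: "x \<in> K" for x
    proof -
      have "\<rho> x (\<rho> c u) = \<rho> (c \<otimes>\<^bsub>G\<^esub> x) u" using comm[of x c] x K c cG KG uV by (simp add: rho_mult[symmetric] subset_iff)
      also have "\<dots> = \<rho> c u" using x u cG KG uV by (simp add: rho_mult U_def)
      finally show ?thesis .
    qed
    then show ?thesis using u uV cG KG rho_closed by (simp add: U_def D_def a_minus_def rep_add rho_neg)
  qed
  have Dnz: "D u \<noteq> \<zero>\<^bsub>V\<^esub>" if u: "u \<in> U" "u \<noteq> \<zero>\<^bsub>V\<^esub>" for u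
  proof
    assume "D u = \<zero>\<^bsub>V\<^esub>"
    moreover have uV: "u \<in> carrier V" using u by (simp add: U_def)
    moreover have "\<rho> c u = (\<rho> c u \<ominus>\<^bsub>V\<^esub> u) \<oplus>\<^bsub>V\<^esub> u"
      using rho_closed[OF cG] u by (simp add: U_def a_minus_def V.a_assoc V.l_neg)
    ultimately have "\<rho> c u = u" by (simp add: D_def)
    then show False using max[OF c uV] u by (auto simp: U_def)
  qed
  define a where "a = (\<lambda>j. (D ^^ j) v)"
  have aU: "a j \<in> U \<and> a j \<noteq> \<zero>\<^bsub>V\<^esub>" for j
    by (induction j) (use v DU Dnz in \<open>auto simp: a_def U_def\<close>)
  have aV: "a j \<in> carrier V" for j using aU by (simp add: U_def)
  have step: "\<rho> c (a j) = a j \<oplus>\<^bsub>V\<^esub> a (Suc j)" for j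
  proof -
    have "a (Suc j) = \<rho> c (a j) \<ominus>\<^bsub>V\<^esub> a j" by (simp add: a_def D_def)
    then show ?thesis
      using aV[of j] rho_closed[OF cG aV[of j]] V.a_lcomm[of "a j" "\<rho> c (a j)" "\<ominus>\<^bsub>V\<^esub> a j"]
      by (simp add: a_minus_def V.r_neg)
  qed
  define S where "S = (\<lambda>n. rsum V (\<lambda>j. nsm (n choose j) (a j)))"
  have pascal: "rsum V (\<lambda>j. nsm (Suc n choose j) (a j)) (Suc N) =
      rsum V (\<lambda>j. nsm (n choose j) (a j)) (Suc N) \<oplus>\<^bsub>V\<^esub> rsum V (\<lambda>j. nsm (n choose j) (a (Suc j))) N" for n N
  proof (induction N)
    case (Suc N)
    have "nsm (Suc n choose Suc N) (a (Suc N)) = nsm (n choose N) (a (Suc N)) \<oplus>\<^bsub>V\<^esub> nsm (n choose Suc N) (a (Suc N))"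
      using aV by (simp add: nsm_add)
    then show ?case
      using Suc by (simp add: V.a_ac nsm_closed aV V.rsum_closed del: binomial_Suc_Suc)
  qed (simp add: nsm_closed aV)
  have "\<rho> (c [^]\<^bsub>G\<^esub> n) v = S n (Suc N)" if "n \<le> N" for n N
    using that
  proof (induction n)
    case 0
    have "rsum V (\<lambda>j. nsm (0 choose j) (a j)) (Suc N) = a 0 \<oplus>\<^bsub>V\<^esub> rsum V (\<lambda>i. nsm (0 choose Suc i) (a (Suc i))) N"
      using V.rsum_first[of "\<lambda>j. nsm (0 choose j) (a j)" N] nsm_closed[OF aV] nsm_1[OF aV] by simp
    also have "rsum V (\<lambda>i. nsm (0 choose Suc i) (a (Suc i))) N = \<zero>\<^bsub>V\<^esub>"
      by (rule V.rsum_zero) (simp add: nsm_0 aV)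
    finally show ?case using v aV[of 0] by (simp add: S_def rho_one a_def)
  next
    case (Suc n)
    have "\<rho> (c [^]\<^bsub>G\<^esub> Suc n) v = \<rho> c (\<rho> (c [^]\<^bsub>G\<^esub> n) v)"
      using cG v by (simp only: GH.G.nat_pow_Suc2) (simp add: rho_mult)
    also have "\<dots> = \<rho> c (S n N)"
      using Suc nsm_0[OF aV] nsm_closed[OF aV] by (simp add: S_def V.rsum_closed binomial_eq_0)
    also have "\<dots> = rsum V (\<lambda>j. nsm (n choose j) (\<rho> c (a j))) N"
      unfolding S_def using cG aV by (subst rho_rsum) (auto simp: nsm_closed rho_smult_nsm)
    also have "\<dots> = rsum V (\<lambda>j. nsm (n choose j) (a j) \<oplus>\<^bsub>V\<^esub> nsm (n choose j) (a (Suc j))) N"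
      using aV by (simp add: step nsm_def V.smult_r_distr ones_closed)
    also have "\<dots> = rsum V (\<lambda>j. nsm (n choose j) (a j)) N \<oplus>\<^bsub>V\<^esub> rsum V (\<lambda>j. nsm (n choose j) (a (Suc j))) N"
      by (rule V.rsum_add) (auto simp: nsm_closed aV)
    also have "rsum V (\<lambda>j. nsm (n choose j) (a j)) N = rsum V (\<lambda>j. nsm (n choose j) (a j)) (Suc N)"
      using Suc.prems nsm_0[OF aV] nsm_closed[OF aV] by (simp add: V.rsum_closed binomial_eq_0)
    finally show ?case by (simp only: S_def pascal)
  qed
  from this[of p p] have e: "v = S p (Suc p)" using p(2)[OF c(1)] v by (simp add: rho_one)
  have "nsm (p choose j) (a j) = \<zero>\<^bsub>V\<^esub>" if j: "0 < j" "j < p" for j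
  proof -
    have "p dvd (p choose j)" by (rule dvd_choose_prime) (use j p(1) in auto)
    then obtain m where "p choose j = m * p" by (metis dvd_def mult.commute)
    then show ?thesis using nsm_mult_eq_0[OF char aV] by simp
  qed
  then have mid: "rsum V (\<lambda>i. nsm (p choose Suc i) (a (Suc i))) (p - 1) = \<zero>\<^bsub>V\<^esub>" by (intro V.rsum_zero) auto
  have p1: "Suc (p - 1) = p" using prime_gt_0_nat[OF p(1)] by simp
  have "S p (Suc p) = S p (Suc (p - 1)) \<oplus>\<^bsub>V\<^esub> a p"
    unfolding p1 using nsm_1[OF aV, of p] by (simp add: S_def)
  also have "S p (Suc (p - 1)) = a 0"
    using V.rsum_first[of "\<lambda>j. nsm (p choose j) (a j)" "p - 1"] nsm_closed[OF aV] nsm_1[OF aV, of 0] mid aV[of 0]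
    by (simp add: S_def del: rsum.simps)
  finally have "v = v \<oplus>\<^bsub>V\<^esub> a p" using e by (simp add: a_def)
  then have "a p = \<zero>\<^bsub>V\<^esub>" using v(1) aV[of p] by simp
  then show False using aU by blast
qed

text \<open>For \<open>x\<close> outside a maximal stabiliser \<open>K\<close> of a vector \<open>v\<close>, the sum of the \<open>x\<^sup>i v\<close> is fixed by \<open>x\<close> and
  \<open>K\<close>, so it is zero. If \<open>c\<close> and \<open>d\<close> were independent modulo \<open>K\<close>, adding up these relations for
  suitable products of \<open>c\<close> and \<open>d\<close> would leave \<open>q v = 0\<close>.\<close>

lemma cyclic_core_free_quotient:
  assumes irr: "irreducible_rep k G V \<rho>" and faith: "faithful_rep G V \<rho>"
    and F: "subgroup F G" "finite F" and comm: "\<And>x y. x \<in> F ==> y \<in> F ==> x \<otimes>\<^bsub>G\<^esub> y = y \<otimes>\<^bsub>G\<^esub> x"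
    and q: "Factorial_Ring.prime (q::nat)" "\<And>x. x \<in> F ==> x [^]\<^bsub>G\<^esub> q = \<one>\<^bsub>G\<^esub>"
    and char: "rsum k (\<lambda>_. \<one>\<^bsub>k\<^esub>) q \<noteq> \<zero>\<^bsub>k\<^esub>"
  obtains K where "subgroup K G" "K \<subseteq> F" "\<And>N. N \<lhd> G ==> N \<subseteq> K ==> N = {\<one>\<^bsub>G\<^esub>}"
    "\<And>c d. c \<in> F ==> d \<in> F ==> c \<notin> K ==> \<exists>i::nat. d \<otimes>\<^bsub>G\<^esub> c [^]\<^bsub>G\<^esub> i \<in> K"
proof -
  interpret F: subgroup F G by fact
  have FG: "\<And>x. x \<in> F ==> x \<in> carrier G" using F.subset by blast
  have Fpow: "x [^]\<^bsub>G\<^esub> (n::nat) \<in> F" if "x \<in> F" for x n by (induction n) (use that F.one_closed in auto)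
  have V0: "carrier V \<noteq> {\<zero>\<^bsub>V\<^esub>}" using irr by (simp add: irreducible_rep_def)
  obtain K v where K: "subgroup K G" "K \<subseteq> F" and v: "v \<in> carrier V" "v \<noteq> \<zero>\<^bsub>V\<^esub>" "\<And>x. x \<in> K ==> \<rho> x v = v"
    and max: "\<And>c u. c \<in> F ==> c \<notin> K ==> u \<in> carrier V ==> (\<And>x. x \<in> K ==> \<rho> x u = u) ==> \<rho> c u = u ==> u = \<zero>\<^bsub>V\<^esub>"
    using maximal_stabilizer[OF V0 F] by metis
  interpret K: subgroup K G by (rule K)
  have KG: "\<And>x. x \<in> K ==> x \<in> carrier G" using K FG by blast
  have norm0: "rsum V (\<lambda>i. \<rho> (x [^]\<^bsub>G\<^esub> i) v) q = \<zero>\<^bsub>V\<^esub>" if x: "x \<in> F" "x \<notin> K" for x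
  proof (rule max[OF x])
    have xG: "x \<in> carrier G" using x FG by blast
    let ?f = "\<lambda>i::nat. \<rho> (x [^]\<^bsub>G\<^esub> i) v"
    have fV: "?f i \<in> carrier V" for i using rho_closed xG v by simp
    show "rsum V ?f q \<in> carrier V" by (rule V.rsum_closed) (rule fV)
    show "\<rho> y (rsum V ?f q) = rsum V ?f q" if y: "y \<in> K" for y
    proof -
      have "\<rho> y (?f i) = ?f i" for i
      proof -
        have "y \<otimes>\<^bsub>G\<^esub> x [^]\<^bsub>G\<^esub> i = x [^]\<^bsub>G\<^esub> i \<otimes>\<^bsub>G\<^esub> y" using comm y K Fpow[OF x(1)] by blast
        then have "\<rho> y (?f i) = \<rho> (x [^]\<^bsub>G\<^esub> i) (\<rho> y v)" using xG KG[OF y] v by (simp add: rho_mult[symmetric])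
        then show ?thesis using v y by simp
      qed
      then show ?thesis using rho_rsum[OF KG[OF y], of ?f q] fV by simp
    qed
    have "\<rho> x (rsum V ?f q) = rsum V (\<lambda>i. ?f (Suc i)) q"
    proof -
      have "\<rho> x (?f i) = ?f (Suc i)" for i
        using xG v by (simp only: GH.G.nat_pow_Suc2) (simp add: rho_mult)
      then show ?thesis using rho_rsum[OF xG, of ?f q] fV by simp
    qed
    also have "\<dots> = rsum V ?f q"
    proof -
      have "?f 0 \<oplus>\<^bsub>V\<^esub> rsum V (\<lambda>i. ?f (Suc i)) q = rsum V ?f q \<oplus>\<^bsub>V\<^esub> ?f q"
        using V.rsum_first[of ?f q] fV by simp
      moreover have "?f q = ?f 0" using q(2)[OF x(1)] by simp
      ultimately have "?f 0 \<oplus>\<^bsub>V\<^esub> rsum V (\<lambda>i. ?f (Suc i)) q = ?f 0 \<oplus>\<^bsub>V\<^esub> rsum V ?f q"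
        using V.a_comm[of "rsum V ?f q" "?f 0"] V.rsum_closed[of q ?f] fV[of 0] fV by simp
      then show ?thesis using V.rsum_closed[of q ?f] V.rsum_closed[of q "\<lambda>i. ?f (Suc i)"] fV[of 0] fV by (simp only: V.add.l_cancel)
    qed
    finally show "\<rho> x (rsum V ?f q) = rsum V ?f q" .
  qed
  have cyc: "\<exists>i::nat. d \<otimes>\<^bsub>G\<^esub> c [^]\<^bsub>G\<^esub> i \<in> K" if c: "c \<in> F" "c \<notin> K" and d: "d \<in> F" for c d
  proof (rule ccontr)
    assume neg: "\<nexists>i::nat. d \<otimes>\<^bsub>G\<^esub> c [^]\<^bsub>G\<^esub> i \<in> K"
    have cG: "c \<in> carrier G" "d \<in> carrier G" using c d FG by auto
    have cj: "c [^]\<^bsub>G\<^esub> j \<notin> K" if j: "0 < j" "j < q" for j :: nat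
    proof
      assume cK: "c [^]\<^bsub>G\<^esub> j \<in> K"
      have "\<not> q dvd j" using j by (auto dest: dvd_imp_le)
      then have "coprime j q" using prime_imp_coprime[of q j] q(1) by (simp add: coprime_commute)
      moreover have "c [^]\<^bsub>G\<^esub> q \<in> K" using q(2)[OF c(1)] by simp
      ultimately have "c \<in> K" using GH.G.coprime_pow_mem[OF K(1) cG(1) cK] j(1) by blast
      then show False using c by blast
    qed
    let ?h = "\<lambda>i j. \<rho> ((d \<otimes>\<^bsub>G\<^esub> c [^]\<^bsub>G\<^esub> (i::nat)) [^]\<^bsub>G\<^esub> (j::nat)) v"
    have hV: "?h i j \<in> carrier V" for i j using rho_closed cG v by simp
    have "\<zero>\<^bsub>V\<^esub> = rsum V (\<lambda>i. rsum V (\<lambda>j. ?h i j) q) q"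
    proof -
      have "rsum V (\<lambda>j. ?h i j) q = \<zero>\<^bsub>V\<^esub>" for i
        by (rule norm0) (use neg c d Fpow in auto)
      then show ?thesis by (simp add: V.rsum_zero)
    qed
    also have "\<dots> = rsum V (\<lambda>j. rsum V (\<lambda>i. ?h i j) q) q" by (rule V.rsum_swap[OF hV])
    also have "\<dots> = rsum V (\<lambda>j. if j = 0 then nsm q v else \<zero>\<^bsub>V\<^esub>) q"
    proof (rule rsum_cong)
      fix j assume jq: "j < q"
      have hij: "?h i j = \<rho> (d [^]\<^bsub>G\<^esub> j) (\<rho> ((c [^]\<^bsub>G\<^esub> j) [^]\<^bsub>G\<^esub> i) v)" for i
      proof -
        have "(d \<otimes>\<^bsub>G\<^esub> c [^]\<^bsub>G\<^esub> i) [^]\<^bsub>G\<^esub> j = d [^]\<^bsub>G\<^esub> j \<otimes>\<^bsub>G\<^esub> (c [^]\<^bsub>G\<^esub> i) [^]\<^bsub>G\<^esub> j"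
          by (rule GH.G.pow_mult_distrib) (use comm d Fpow c cG in auto)
        then show ?thesis using cG v by (simp add: rho_mult GH.G.nat_pow_pow mult.commute)
      qed
      show "rsum V (\<lambda>i. ?h i j) q = (if j = 0 then nsm q v else \<zero>\<^bsub>V\<^esub>)"
      proof (cases "j = 0")
        case True
        then show ?thesis using v nsm_eq_rsum[OF v(1)] by (simp add: rho_one)
      next
        case False
        have "rsum V (\<lambda>i. ?h i j) q = \<rho> (d [^]\<^bsub>G\<^esub> j) (rsum V (\<lambda>i. \<rho> ((c [^]\<^bsub>G\<^esub> j) [^]\<^bsub>G\<^esub> i) v) q)"
          unfolding hij using cG v rho_closed by (subst rho_rsum) auto
        also have "rsum V (\<lambda>i. \<rho> ((c [^]\<^bsub>G\<^esub> j) [^]\<^bsub>G\<^esub> i) v) q = \<zero>\<^bsub>V\<^esub>"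
          by (rule norm0) (use Fpow c cj False jq in auto)
        finally show ?thesis using False cG by (simp add: rho_zero)
      qed
    qed
    also have "\<dots> = nsm q v"
    proof -
      have "Suc (q - 1) = q" using prime_gt_0_nat[OF q(1)] by simp
      then show ?thesis
        using V.rsum_first[of "\<lambda>j. if j = 0 then nsm q v else \<zero>\<^bsub>V\<^esub>" "q - 1"] nsm_closed[OF v(1)]
        by (simp add: V.rsum_zero del: rsum.simps)
    qed
    finally show False using nsm_eq_0D[OF char v(1)] v(2) by simp
  qed
  have "N = {\<one>\<^bsub>G\<^esub>}" if "N \<lhd> G" "N \<subseteq> K" for N
    using no_fixed_vectors[OF irr faith that(1) _ v(1)] v that(2) by blast
  with that K cyc show thesis by blast
qed

end

section \<open>Extending characters beyond the torsion subgroup\<close>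

definition root_of_unity_avoiding :: "nat => complex => bool" where
  "root_of_unity_avoiding p z \<longleftrightarrow> (\<exists>n>0. p \<notin> prime_factors n \<and> z ^ n = 1)"

lemma root_of_unity_avoiding_mult:
  assumes "root_of_unity_avoiding p z" "root_of_unity_avoiding p w"
  shows "root_of_unity_avoiding p (z * w)"
proof -
  obtain n m where n: "n > 0" "p \<notin> prime_factors n" "z ^ n = 1" and m: "m > 0" "p \<notin> prime_factors m" "w ^ m = 1"
    using assms by (auto simp: root_of_unity_avoiding_def)
  have "(z * w) ^ (n * m) = (z ^ n) ^ m * (w ^ m) ^ n" by (simp add: power_mult_distrib power_mult[symmetric] mult.commute)
  then have "(z * w) ^ (n * m) = 1" using n m by simp
  moreover have "p \<notin> prime_factors (n * m)" using n m by (simp add: prime_factors_product)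
  ultimately show ?thesis using n(1) m(1) unfolding root_of_unity_avoiding_def by (intro exI[of _ "n * m"]) simp
qed

lemma root_of_unity_avoiding_powi:
  assumes "root_of_unity_avoiding p z"
  shows "root_of_unity_avoiding p (z powi i)"
proof -
  obtain n where n: "n > 0" "p \<notin> prime_factors n" "z ^ n = 1" using assms by (auto simp: root_of_unity_avoiding_def)
  have "(z powi i) ^ n = (z ^ n) powi i" by (metis power_int_mult power_int_of_nat mult.commute)
  then show ?thesis using n unfolding root_of_unity_avoiding_def by (intro exI[of _ n]) simp
qed

lemma coprime_root_eq_one:
  fixes z :: complex
  assumes "z ^ n = 1" "z ^ m = 1" "coprime n m" "n > 0"
  shows "z = 1"
proof -
  obtain x y where "n * x = m * y + gcd n m" using bezout_nat[of n m] assms(4) by auto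
  then have e: "n * x = m * y + 1" using assms(3) by simp
  have "z ^ (n * x) = z ^ (m * y) * z" unfolding e by simp
  then show ?thesis using assms(1,2) by (simp add: power_mult)
qed

lemma prime_roots_are_powers:
  fixes z w :: complex
  assumes q: "Factorial_Ring.prime (q::nat)" and z: "z ^ q = 1" "z \<noteq> 1" and w: "w ^ q = 1"
  shows "\<exists>s::nat. w = z ^ s"
proof -
  have q0: "q > 0" using q prime_gt_0_nat by blast
  have z0: "z \<noteq> 0" using z(1) q0 by (auto simp: zero_power)
  have inj: "inj_on (\<lambda>s. z ^ s) {..<q}"
  proof (rule linorder_inj_onI)
    fix i j assume ij: "i < j" "i \<in> {..<q}" "j \<in> {..<q}"
    show "z ^ i \<noteq> z ^ j"
    proof
      assume "z ^ i = z ^ j"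
      moreover have "z ^ j = z ^ i * z ^ (j - i)" using ij by (simp add: power_add[symmetric])
      ultimately have 1: "z ^ (j - i) = 1" using z0 by simp
      have "\<not> q dvd (j - i)" using ij by (auto dest: dvd_imp_le)
      then have "coprime q (j - i)" using prime_imp_coprime[OF q] by blast
      then have "z = 1" using coprime_root_eq_one[OF z(1) 1] q0 by blast
      then show False using z(2) by simp
    qed
  qed auto
  have sub: "(\<lambda>s. z ^ s) ` {..<q} \<subseteq> {x. x ^ q = 1}"
    using z(1) by (auto simp: power_mult[symmetric] mult.commute[of _ q]) (simp add: power_mult)
  have "(\<lambda>s. z ^ s) ` {..<q} = {x. x ^ q = 1}"
    by (rule card_seteq[OF finite_roots_unity sub]) (use q0 inj in \<open>auto simp: card_roots_unity_eq card_image\<close>)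
  then show ?thesis using w by blast
qed

lemma nontrivial_prime_root:
  assumes "Factorial_Ring.prime (q::nat)"
  obtains z :: complex where "z ^ q = 1" "z \<noteq> 1"
proof -
  have q: "q > 1" using assms prime_gt_1_nat by blast
  have "\<not> {z::complex. z ^ q = 1} \<subseteq> {1}"
  proof
    assume "{z::complex. z ^ q = 1} \<subseteq> {1}"
    then have "card {z::complex. z ^ q = 1} \<le> card {1::complex}" by (rule card_mono[rotated]) simp
    then show False using q by (simp add: card_roots_unity_eq)
  qed
  then show thesis using that by blast
qed

lemma (in group) union_char:
  assumes H: "\<And>n::nat. subgroup (H n) G" and c: "\<And>n. is_char G (H n) (\<chi> n)"
    and inc: "\<And>n. H n \<subseteq> H (Suc n)" and ext: "\<And>n x. x \<in> H n ==> \<chi> (Suc n) x = \<chi> n x"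
  obtains \<chi>' where "subgroup (\<Union>n. H n) G" "is_char G (\<Union>n. H n) \<chi>'" "\<And>n x. x \<in> H n ==> \<chi>' x = \<chi> n x"
proof -
  have mono: "H n \<subseteq> H m" if "n \<le> m" for n m using lift_Suc_mono_le[of H, OF inc that] .
  have ext': "\<chi> m x = \<chi> n x" if "n \<le> m" "x \<in> H n" for n m x
    using that(1)
  proof (induction rule: dec_induct)
    case (step k)
    then show ?case using ext[of x k] mono[OF step(1)] that(2) by auto
  qed simp
  have two: "\<exists>n. x \<in> H n \<and> y \<in> H n" if xy: "x \<in> (\<Union>n. H n)" "y \<in> (\<Union>n. H n)" for x y
  proof -
    obtain i j where "x \<in> H i" "y \<in> H j" using xy by blast
    then have "x \<in> H (max i j)" "y \<in> H (max i j)" using mono[of i "max i j"] mono[of j "max i j"] by auto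
    then show ?thesis by blast
  qed
  define \<chi>' where "\<chi>' x = \<chi> (LEAST n. x \<in> H n) x" for x
  have val: "\<chi>' x = \<chi> n x" if "x \<in> H n" for n x
    unfolding \<chi>'_def by (rule ext'[OF Least_le[of "\<lambda>n. x \<in> H n", OF that] LeastI[of "\<lambda>n. x \<in> H n", OF that], symmetric])
  have "subgroup (\<Union>n. H n) G"
  proof (rule subgroupI)
    show "(\<Union>n. H n) \<subseteq> carrier G" using subgroup.subset[OF H] by blast
    show "(\<Union>n. H n) \<noteq> {}" using subgroup.one_closed[OF H] by blast
    show "inv a \<in> (\<Union>n. H n)" if "a \<in> (\<Union>n. H n)" for a using that subgroup.m_inv_closed[OF H] by blast
    show "a \<otimes> b \<in> (\<Union>n. H n)" if "a \<in> (\<Union>n. H n)" "b \<in> (\<Union>n. H n)" for a b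
      using two[OF that] subgroup.m_closed[OF H] by blast
  qed
  moreover have "is_char G (\<Union>n. H n) \<chi>'"
    unfolding is_char_def
  proof (intro conjI ballI)
    show "\<chi>' x \<noteq> 0" if "x \<in> (\<Union>n. H n)" for x using that is_charD(1)[OF H c] val by fastforce
    fix x y assume "x \<in> (\<Union>n. H n)" "y \<in> (\<Union>n. H n)"
    then obtain n where n: "x \<in> H n" "y \<in> H n" using two by blast
    show "\<chi>' (x \<otimes> y) = \<chi>' x * \<chi>' y"
      using val[OF n(1)] val[OF n(2)] val[OF subgroup.m_closed[OF H n]] is_charD(2)[OF H c n] by simp
  qed
  ultimately show thesis using that val by blast
qed

lemma (in comm_group) product_char:
  assumes H: "subgroup H G" "is_char G H \<chi>" and K: "subgroup K G" "is_char G K \<psi>" and d: "H \<inter> K = {\<one>}"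
  obtains \<theta> where "subgroup (H <#> K) G" "is_char G (H <#> K) \<theta>"
    "\<And>h k. h \<in> H ==> k \<in> K ==> h \<otimes> k \<in> H <#> K \<and> \<theta> (h \<otimes> k) = \<chi> h * \<psi> k"
proof -
  interpret H: subgroup H G by (rule H(1))
  interpret K: subgroup K G by (rule K(1))
  have s: "subgroup (H <#> K) G" using mult_subgroups[OF H(1) K(1)] .
  have HK: "z \<in> H <#> K \<longleftrightarrow> (\<exists>h\<in>H. \<exists>k\<in>K. z = h \<otimes> k)" for z by (auto simp: set_mult_def)
  have u: "h = h' \<and> k = k'" if h: "h \<in> H" "h' \<in> H" "k \<in> K" "k' \<in> K" "h \<otimes> k = h' \<otimes> k'" for h h' k k'
  proof -
    have car: "h \<in> carrier G" "h' \<in> carrier G" "k \<in> carrier G" "k' \<in> carrier G" using h by auto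
    have "h = h' \<otimes> k' \<otimes> inv k" using h(5) car by (metis inv_solve_right m_closed)
    then have "inv h' \<otimes> h = k' \<otimes> inv k" using car by (simp add: m_assoc inv_cancel)
    moreover have "inv h' \<otimes> h \<in> H" "k' \<otimes> inv k \<in> K" using h by auto
    ultimately have "inv h' \<otimes> h = \<one>" using d by (metis IntI singletonD)
    then have "h = h'" using car by (metis inv_equality inv_inv inv_closed)
    then show ?thesis using h(5) car by simp
  qed
  define dec where "dec z = (SOME hk. fst hk \<in> H \<and> snd hk \<in> K \<and> z = fst hk \<otimes> snd hk)" for z
  have dec: "dec (h \<otimes> k) = (h, k)" if hk: "h \<in> H" "k \<in> K" for h k
  proof -
    have "fst (dec (h \<otimes> k)) \<in> H \<and> snd (dec (h \<otimes> k)) \<in> K \<and> h \<otimes> k = fst (dec (h \<otimes> k)) \<otimes> snd (dec (h \<otimes> k))"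
      unfolding dec_def by (rule someI[of _ "(h, k)"]) (use hk in simp)
    then show ?thesis using u[of h "fst (dec (h \<otimes> k))" k "snd (dec (h \<otimes> k))"] hk by (simp add: prod_eq_iff)
  qed
  define \<theta> where "\<theta> z = \<chi> (fst (dec z)) * \<psi> (snd (dec z))" for z
  have val: "\<theta> (h \<otimes> k) = \<chi> h * \<psi> k" if "h \<in> H" "k \<in> K" for h k using dec[OF that] by (simp add: \<theta>_def)
  have "is_char G (H <#> K) \<theta>"
    unfolding is_char_def
  proof (intro conjI ballI)
    fix x assume "x \<in> H <#> K"
    then obtain h k where x: "h \<in> H" "k \<in> K" "x = h \<otimes> k" using HK by blast
    show "\<theta> x \<noteq> 0" using x val is_charD(1)[OF H x(1)] is_charD(1)[OF K x(2)] by simp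
    fix y assume "y \<in> H <#> K"
    then obtain h' k' where y: "h' \<in> H" "k' \<in> K" "y = h' \<otimes> k'" using HK by blast
    have "x \<otimes> y = (h \<otimes> h') \<otimes> (k \<otimes> k')" using x y by (simp add: m_ac)
    then show "\<theta> (x \<otimes> y) = \<theta> x * \<theta> y"
      using x y val is_charD(2)[OF H x(1) y(1)] is_charD(2)[OF K x(2) y(2)] by simp
  qed
  with s show thesis by (rule that) (use val HK in blast)
qed

text \<open>The primes are treated in increasing order. Elements obtained before step \<open>n\<close> have orders
  dividing a product of primes below \<open>n\<close>, so they meet \<open>P n\<close> trivially.\<close>

lemma (in comm_group) glue_prime_characters:
  assumes P: "\<And>q. q \<in> Q ==> Factorial_Ring.prime (q::nat) \<and> subgroup (P q) G \<and> is_char G (P q) (\<chi> q)"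
    and e: "\<And>q x. q \<in> Q ==> x \<in> P q ==> x [^] q = \<one>"
  obtains S \<theta> where "subgroup S G" "is_char G S \<theta>" "\<And>q. q \<in> Q ==> P q \<subseteq> S" "\<And>q x. q \<in> Q ==> x \<in> P q ==> \<theta> x = \<chi> q x"
    "\<And>x. x \<in> S ==> \<exists>n::nat>0. prime_factors n \<subseteq> Q \<and> x [^] n = \<one>"
proof -
  define m where "m n = (\<Prod>q\<in>{q \<in> Q. q < n}. q)" for n :: nat
  have fin: "finite {q \<in> Q. q < n}" for n by (rule finite_subset[of _ "{..<n}"]) auto
  have m0: "m n > 0" for n unfolding m_def by (rule prod_pos) (use P prime_gt_0_nat in blast)
  have mS: "m (Suc n) = (if n \<in> Q then n * m n else m n)" for n
  proof -
    have "{q \<in> Q. q < Suc n} = (if n \<in> Q then insert n {q \<in> Q. q < n} else {q \<in> Q. q < n})" by (auto simp: less_Suc_eq)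
    then show ?thesis using fin by (simp add: m_def)
  qed
  have mP: "prime_factors (m n) \<subseteq> {q \<in> Q. q < n}" for n
  proof (induction n)
    case (Suc n)
    show ?case
    proof (cases "n \<in> Q")
      case True
      then have "prime_factors (m (Suc n)) = prime_factors n \<union> prime_factors (m n)"
        using m0[of n] prime_gt_0_nat[of n] P[OF True] by (simp add: mS prime_factors_product)
      moreover have "prime_factors n = {n}" using P[OF True] by (simp add: prime_prime_factors)
      ultimately show ?thesis using Suc True by auto
    qed (use Suc mS in auto)
  qed (simp add: m_def)
  define I where "I n s \<longleftrightarrow> subgroup (fst s) G \<and> is_char G (fst s) (snd s) \<and> (\<forall>x\<in>fst s. x [^] m n = \<one>)" for n and s :: "'a set \<times> ('a => complex)"
  define R where "R n s t \<longleftrightarrow> fst s \<subseteq> fst t \<and> (\<forall>x\<in>fst s. snd t x = snd s x) \<and>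
    (n \<in> Q --> P n \<subseteq> fst t \<and> (\<forall>x\<in>P n. snd t x = \<chi> n x))" for n and s t :: "'a set \<times> ('a => complex)"
  have "\<exists>f. \<forall>n. I n (f n) \<and> R n (f n) (f (Suc n))"
  proof (rule dependent_nat_choice)
    have "I 0 ({\<one>}, \<lambda>_. 1)" by (simp add: I_def is_char_def triv_subgroup)
    then show "\<exists>s. I 0 s" by blast
    fix s n assume s: "I n s"
    show "\<exists>t. I (Suc n) t \<and> R n s t"
    proof (cases "n \<in> Q")
      case False
      then have "I (Suc n) s \<and> R n s s" using s mS[of n] by (simp add: I_def R_def)
      then show ?thesis by blast
    next
      case True
      note Pn = P[OF True]
      have s': "subgroup (fst s) G" "is_char G (fst s) (snd s)" "\<And>x. x \<in> fst s ==> x [^] m n = \<one>" using s by (auto simp: I_def)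
      have cop: "coprime n (m n)"
      proof -
        have "n \<notin> prime_factors (m n)" using mP[of n] by auto
        then have "\<not> n dvd m n" using Pn m0[of n] by (auto simp: prime_factors_dvd)
        then show ?thesis using prime_imp_coprime Pn by blast
      qed
      have "x = \<one>" if x: "x \<in> fst s" "x \<in> P n" for x
      proof -
        have xc: "x \<in> carrier G" using subgroup.mem_carrier[OF s'(1) x(1)] .
        have "ord x dvd m n" "ord x dvd n" using s'(3)[OF x(1)] e[OF True x(2)] pow_eq_id[OF xc] by auto
        then have "ord x = 1" using cop by (metis coprime_common_divisor_nat coprime_commute)
        then show ?thesis using ord_eq_1[OF xc] by simp
      qed
      then have d: "fst s \<inter> P n = {\<one>}" using subgroup.one_closed[OF s'(1)] subgroup.one_closed[of "P n" G] Pn by blast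
      obtain \<theta> where \<theta>: "subgroup (fst s <#> P n) G" "is_char G (fst s <#> P n) \<theta>"
        "\<And>h k. h \<in> fst s ==> k \<in> P n ==> h \<otimes> k \<in> fst s <#> P n \<and> \<theta> (h \<otimes> k) = snd s h * \<chi> n k"
        using product_char[OF s'(1,2) _ _ d] Pn by metis
      have o: "\<one> \<in> P n" "\<one> \<in> fst s" "\<chi> n \<one> = 1" "snd s \<one> = 1"
        using Pn subgroup.one_closed s'(1) is_charD(3)[OF s'(1,2)] is_charD(3)[of "P n" "\<chi> n"] by auto
      have 1: "x \<in> fst s <#> P n \<and> \<theta> x = snd s x" if "x \<in> fst s" for x
        using \<theta>(3)[OF that o(1)] o(3) subgroup.mem_carrier[OF s'(1) that] by simp
      have 2: "x \<in> fst s <#> P n \<and> \<theta> x = \<chi> n x" if "x \<in> P n" for x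
        using \<theta>(3)[OF o(2) that] o(4) subgroup.mem_carrier[of "P n" G x] Pn that by simp
      have 3: "x [^] m (Suc n) = \<one>" if xs: "x \<in> fst s <#> P n" for x
      proof -
        obtain h k where hk: "h \<in> fst s" "k \<in> P n" "x = h \<otimes> k" using xs unfolding set_mult_def by blast
        have hc: "h \<in> carrier G" "k \<in> carrier G" using subgroup.mem_carrier[OF s'(1) hk(1)] subgroup.mem_carrier[of "P n" G k] Pn hk by auto
        have "x [^] m (Suc n) = h [^] (m n * n) \<otimes> k [^] (n * m n)" using hk hc True by (simp add: mS nat_pow_distrib mult.commute)
        also have "\<dots> = \<one>" using s'(3)[OF hk(1)] e[OF True hk(2)] hc by (simp add: nat_pow_pow[symmetric])
        finally show ?thesis .
      qed
      have "I (Suc n) (fst s <#> P n, \<theta>) \<and> R n s (fst s <#> P n, \<theta>)"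
        using \<theta>(1,2) 1 2 3 by (auto simp: I_def R_def)
      then show ?thesis by blast
    qed
  qed
  then obtain f where f: "\<And>n. I n (f n)" "\<And>n. R n (f n) (f (Suc n))" by blast
  obtain \<theta> where \<theta>: "subgroup (\<Union>n. fst (f n)) G" "is_char G (\<Union>n. fst (f n)) \<theta>" "\<And>n x. x \<in> fst (f n) ==> \<theta> x = snd (f n) x"
    by (rule union_char[of "\<lambda>n. fst (f n)" "\<lambda>n. snd (f n)"]) (use f in \<open>auto simp: I_def R_def\<close>)
  show thesis
  proof (rule that[OF \<theta>(1,2)])
    show "P q \<subseteq> (\<Union>n. fst (f n))" if "q \<in> Q" for q using f(2)[of q] that unfolding R_def by blast
    show "\<theta> x = \<chi> q x" if "q \<in> Q" "x \<in> P q" for q x using f(2)[of q] that \<theta>(3)[of x "Suc q"] unfolding R_def by auto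
    fix x assume "x \<in> (\<Union>n. fst (f n))"
    then obtain n where "x \<in> fst (f n)" by blast
    then have "x [^] m n = \<one>" using f(1)[of n] by (simp add: I_def)
    then show "\<exists>n::nat>0. prime_factors n \<subseteq> Q \<and> x [^] n = \<one>" using m0[of n] mP[of n] by blast
  qed
qed

lemma (in comm_group) finite_bounded_quotient:
  assumes fr: "finite_rank G" and W: "W \<lhd> G" and m: "(m::nat) > 0" "\<And>u. u \<in> carrier G ==> u [^] m \<in> W"
  shows "finite (carrier (G Mod W))"
proof -
  interpret W: normal W G by (rule W)
  let ?h = "\<lambda>a. W #> a"
  have hom: "?h \<in> hom G (G Mod W)" by (rule W.r_coset_hom_Mod)
  interpret Q: group "G Mod W" by (rule W.factorgroup_is_group)
  interpret gh: group_hom G "G Mod W" ?h by unfold_locales (rule hom)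
  have surj: "carrier (G Mod W) = ?h ` carrier G" by (auto simp: FactGroup_def RCOSETS_def)
  interpret Q: comm_group "G Mod W"
  proof (rule Q.group_comm_groupI)
    fix x y assume "x \<in> carrier (G Mod W)" "y \<in> carrier (G Mod W)"
    then have "x \<in> ?h ` carrier G" "y \<in> ?h ` carrier G" by (simp_all only: surj)
    then obtain a b where a: "a \<in> carrier G" "x = ?h a" and b: "b \<in> carrier G" "y = ?h b" by (elim imageE) (rule that)
    show "x \<otimes>\<^bsub>G Mod W\<^esub> y = y \<otimes>\<^bsub>G Mod W\<^esub> x"
      unfolding a(2) b(2) gh.hom_mult[OF a(1) b(1), symmetric] gh.hom_mult[OF b(1) a(1), symmetric] m_comm[OF a(1) b(1)] by (rule refl)
  qed
  have fq: "finite_rank (G Mod W)" by (rule gh.finite_rank_image[OF fr surj])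
  have "x [^]\<^bsub>G Mod W\<^esub> m = \<one>\<^bsub>G Mod W\<^esub>" if x: "x \<in> carrier (G Mod W)" for x
  proof -
    obtain a where a: "a \<in> carrier G" "x = ?h a" using x[unfolded surj] by (elim imageE) (rule that)
    have "x [^]\<^bsub>G Mod W\<^esub> m = ?h (a [^] m)" using gh.hom_nat_pow[OF a(1), of m] a(2) by simp
    also have "\<dots> = W" by (rule W.rcos_const[OF is_group m(2)[OF a(1)]])
    finally show ?thesis by (simp add: FactGroup_def)
  qed
  then have "{x \<in> carrier (G Mod W). x [^]\<^bsub>G Mod W\<^esub> m = \<one>\<^bsub>G Mod W\<^esub>} = carrier (G Mod W)" by blast
  then show ?thesis using Q.finite_exponent_if_finite_rank[OF fq m(1)] by simp
qed

text \<open>A property of torsion groups that, unlike being torsion, survives the adjunction of elements.\<close>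

definition tf_fg :: "('g, 'm) monoid_scheme => 'g set => bool" where
  "tf_fg G H \<longleftrightarrow> (\<forall>M. subgroup M G --> M \<subseteq> H --> (\<forall>x\<in>M. \<forall>n::nat>0. x [^]\<^bsub>G\<^esub> n = \<one>\<^bsub>G\<^esub> --> x = \<one>\<^bsub>G\<^esub>) -->
     (\<exists>Y. finite Y \<and> Y \<subseteq> carrier G \<and> M = generate G Y))"

lemma (in comm_group) tf_fg_adjoin:
  assumes H: "subgroup H G" and f: "tf_fg G H" and y: "y \<in> carrier G"
  shows "tf_fg G (adjoin G H y)"
  unfolding tf_fg_def
proof (intro allI impI)
  fix M assume M: "subgroup M G" "M \<subseteq> adjoin G H y" "\<forall>x\<in>M. \<forall>n::nat>0. x [^] n = \<one> --> x = \<one>"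
  interpret H: subgroup H G by (rule H)
  interpret M: subgroup M G by (rule M(1))
  obtain Y where Y: "finite Y" "Y \<subseteq> carrier G" "M \<inter> H = generate G Y"
    using f subgroups_Inter_pair[OF M(1) H] M(3) unfolding tf_fg_def by (metis Int_iff Int_lower2)
  have YM: "Y \<subseteq> M" using Y(3) generate.incl by (metis Int_iff subsetI)
  let ?D = "\<lambda>d::nat. d > 0 \<and> (\<exists>h\<in>H. h \<otimes> y [^] int d \<in> M)"
  have rep: "\<exists>h\<in>H. \<exists>i::int. x = h \<otimes> y [^] i" if "x \<in> M" for x using M(2) that by (auto simp: adjoin_def)
  show "\<exists>Y. finite Y \<and> Y \<subseteq> carrier G \<and> M = generate G Y"
  proof (cases "\<exists>d. ?D d")
    case False
    have "x \<in> H" if x: "x \<in> M" for x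
    proof -
      obtain h i where hi: "h \<in> H" "x = h \<otimes> y [^] (i::int)" using rep[OF x] by blast
      have inv: "inv x = inv h \<otimes> y [^] (- i)" using hi y by (simp add: inv_mult int_pow_neg)
      have "i = 0"
      proof (rule ccontr)
        assume "i \<noteq> 0"
        then consider "i > 0" | "- i > 0" by linarith
        then show False
        proof cases
          case 1
          then have "?D (nat i)" using hi x by auto
          then show False using False by blast
        next
          case 2
          then have "?D (nat (- i))" using hi(1) inv M.m_inv_closed[OF x] by (auto intro!: bexI[of _ "inv h"])
          then show False using False by blast
        qed
      qed
      then show ?thesis using hi by simp
    qed
    then have "M \<inter> H = M" by blast
    then show ?thesis using Y by metis
  next
    case True
    define d where "d = (LEAST d. ?D d)"
    have D: "?D d" unfolding d_def by (rule LeastI_ex[OF True])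
    then obtain h0 where h0: "h0 \<in> H" "h0 \<otimes> y [^] int d \<in> M" by blast
    define x0 where "x0 = h0 \<otimes> y [^] int d"
    have x0: "x0 \<in> M" "x0 \<in> carrier G" using h0 M.mem_carrier by (auto simp: x0_def)
    have G: "subgroup (generate G (insert x0 Y)) G" by (rule generate_is_subgroup) (use x0 Y in auto)
    have "x \<in> generate G (insert x0 Y)" if x: "x \<in> M" for x
    proof -
      obtain h i where hi: "h \<in> H" "x = h \<otimes> y [^] (i::int)" using rep[OF x] by blast
      let ?w = "x \<otimes> x0 [^] (- (i div int d))"
      have w: "?w \<in> M" using M.m_closed[OF x subgroup_int_pow_closed[OF M(1) x0(1)]] by blast
      have "?w = (h \<otimes> h0 [^] (- (i div int d))) \<otimes> (y [^] i \<otimes> y [^] (int d * - (i div int d)))"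
        using hi h0 y by (simp add: x0_def int_pow_distrib int_pow_pow m_ac)
      also have "y [^] i \<otimes> y [^] (int d * - (i div int d)) = y [^] (i mod int d)"
      proof -
        have "i + int d * - (i div int d) = i mod int d" using minus_mult_div_eq_mod[of i "int d"] by linarith
        then show ?thesis using int_pow_mult[OF y, of i "int d * - (i div int d)"] by simp
      qed
      finally have we: "?w = (h \<otimes> h0 [^] (- (i div int d))) \<otimes> y [^] (i mod int d)" .
      have hH: "h \<otimes> h0 [^] (- (i div int d)) \<in> H" using H.m_closed[OF hi(1) subgroup_int_pow_closed[OF H h0(1)]] by blast
      have "i mod int d = 0"
      proof (rule ccontr)
        assume ne: "i mod int d \<noteq> 0"
        have pos: "0 \<le> i mod int d" "i mod int d < int d" using D by auto
        have "?D (nat (i mod int d))" using ne pos we w hH by auto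
        then have "d \<le> nat (i mod int d)" unfolding d_def by (rule Least_le)
        then show False using pos by linarith
      qed
      then have "?w \<in> H" using we hH y by simp
      then have "?w \<in> generate G Y" using w Y(3) by blast
      then have "?w \<in> generate G (insert x0 Y)" using mono_generate[of Y "insert x0 Y"] by blast
      moreover have "x0 [^] (i div int d) \<in> generate G (insert x0 Y)"
        by (rule subgroup_int_pow_closed[OF G]) (simp add: generate.incl)
      ultimately have "?w \<otimes> x0 [^] (i div int d) \<in> generate G (insert x0 Y)" by (rule subgroup.m_closed[OF G])
      moreover have "?w \<otimes> x0 [^] (i div int d) = x"
        using M.mem_carrier[OF x] x0(2) by (simp add: m_assoc int_pow_mult[symmetric])
      ultimately show ?thesis by simp
    qed
    moreover have "generate G (insert x0 Y) \<subseteq> M" by (rule generate_subgroup_incl[OF _ M(1)]) (use x0 YM in auto)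
    ultimately have "M = generate G (insert x0 Y)" by blast
    then show ?thesis using Y x0 by (intro exI[of _ "insert x0 Y"]) auto
  qed
qed

lemma (in comm_group) tf_fg_torsion:
  assumes "\<And>x. x \<in> H ==> \<exists>n::nat>0. x [^] n = \<one>"
  shows "tf_fg G H"
  unfolding tf_fg_def
proof (intro allI impI)
  fix M assume M: "subgroup M G" "M \<subseteq> H" "\<forall>x\<in>M. \<forall>n::nat>0. x [^] n = \<one> --> x = \<one>"
  have "M = {\<one>}" using assms M subgroup.one_closed[OF M(1)] by blast
  then have "M = generate G {}" by (simp add: generate_empty)
  then show "\<exists>Y. finite Y \<and> Y \<subseteq> carrier G \<and> M = generate G Y" by blast
qed

text \<open>Otherwise \<open>M\<close> modulo \<open>M \<inter> H\<close> is torsion without elements of order \<open>r\<close>. Given an \<open>r\<close>-section \<open>U / W\<close>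
  of \<open>M\<close>, the group \<open>U \<inter> H\<close> is finitely generated, so raising to some power \<open>r\<^sup>N\<close> maps it into \<open>W\<close>; then it maps
  all of \<open>U\<close> into \<open>W\<close>, and by finite rank the section is finite.\<close>

lemma (in comm_group) r_divisible_element_over_fg:
  assumes fr: "finite_rank G" and M: "subgroup M G" and tf: "\<forall>x\<in>M. \<forall>n::nat>0. x [^] n = \<one> --> x = \<one>"
    and r: "r \<in> spectrum (G\<lparr>carrier := M\<rparr>)" and H: "subgroup H G" and fg: "tf_fg G H"
  shows "\<exists>y\<in>M. y \<notin> H \<and> (y [^] r \<in> H \<or> (\<forall>n::nat>0. y [^] n \<notin> H))"
proof (rule ccontr)
  assume "\<not> ?thesis"
  then have pure: "\<And>y. y \<in> M ==> y [^] r \<in> H ==> y \<in> H"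
    and tor: "\<And>y. y \<in> M ==> \<exists>n::nat>0. y [^] n \<in> H"
    using subgroup.mem_carrier[OF M] by (auto, metis nat_pow_eone zero_less_one)
  interpret M: subgroup M G by (rule M)
  have Mpow: "y [^] n \<in> M" if "y \<in> M" for y and n :: nat using subgroup_int_pow_closed[OF M that, of "int n"] by (simp add: int_pow_int)
  have pure': "y \<in> M ==> y [^] (r ^ a) \<in> H ==> y \<in> H" for y and a :: nat
  proof (induction a arbitrary: y)
    case (Suc a)
    have "(y [^] r ^ a) [^] r \<in> H" using Suc.prems by (simp add: nat_pow_pow mult.commute)
    then have "y [^] r ^ a \<in> H" using pure[OF Mpow[OF Suc.prems(1)]] by blast
    then show ?case using Suc by blast
  qed (simp add: nat_pow_eone)
  obtain U W where rp: "Factorial_Ring.prime r" and U0: "subgroup U (G\<lparr>carrier := M\<rparr>)"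
    and W0: "W \<lhd> (G\<lparr>carrier := M\<rparr>)\<lparr>carrier := U\<rparr>"
    and inf: "infinite (carrier ((G\<lparr>carrier := M\<rparr>)\<lparr>carrier := U\<rparr> Mod W))"
    and pg: "p_group r ((G\<lparr>carrier := M\<rparr>)\<lparr>carrier := U\<rparr> Mod W)"
    using r unfolding spectrum_def by blast
  have W: "W \<lhd> G\<lparr>carrier := U\<rparr>" and inf': "infinite (carrier (G\<lparr>carrier := U\<rparr> Mod W))"
    and pg': "p_group r (G\<lparr>carrier := U\<rparr> Mod W)" using W0 inf pg by simp_all
  have UM: "U \<subseteq> M" using subgroup.subset[OF U0] by simp
  have U: "subgroup U G" using incl_subgroup[OF M U0] .
  interpret U: subgroup U G by (rule U)
  interpret UG: comm_group "G\<lparr>carrier := U\<rparr>" by (rule abelian_subgroup_comm_group[OF U]) (simp add: m_comm)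
  interpret W: normal W "G\<lparr>carrier := U\<rparr>" by (rule W)
  have Wpow: "y [^] n \<in> W" if "y \<in> W" for y and n :: nat
    using W.subgroup_axioms UG.subgroup_int_pow_closed[of W y "int n"] that by (simp add: int_pow_int nat_pow_def)
  have r0: "r > 0" using rp prime_gt_0_nat by blast
  have rt: "\<exists>n::nat. u [^] (r ^ n) \<in> W" if u: "u \<in> U" for u
  proof -
    let ?h = "\<lambda>a. W #>\<^bsub>G\<lparr>carrier := U\<rparr>\<^esub> a"
    interpret Q: group "G\<lparr>carrier := U\<rparr> Mod W" by (rule W.factorgroup_is_group)
    interpret gh: group_hom "G\<lparr>carrier := U\<rparr>" "G\<lparr>carrier := U\<rparr> Mod W" ?h
      by unfold_locales (rule W.r_coset_hom_Mod)
    have uc: "u \<in> carrier (G\<lparr>carrier := U\<rparr>)" using u by simp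
    have hc: "?h u \<in> carrier (G\<lparr>carrier := U\<rparr> Mod W)" by (rule gh.hom_closed[OF uc])
    obtain n where "group.ord (G\<lparr>carrier := U\<rparr> Mod W) (?h u) = r ^ n" using pg' hc unfolding p_group_def by blast
    then have "?h u [^]\<^bsub>G\<lparr>carrier := U\<rparr> Mod W\<^esub> (r ^ n) = \<one>\<^bsub>G\<lparr>carrier := U\<rparr> Mod W\<^esub>"
      using Q.pow_ord_eq_1[OF hc] by simp
    then have e: "?h (u [^]\<^bsub>G\<lparr>carrier := U\<rparr>\<^esub> (r ^ n)) = W" using gh.hom_nat_pow[OF uc, of "r ^ n"] by (simp add: FactGroup_def)
    have "u [^]\<^bsub>G\<lparr>carrier := U\<rparr>\<^esub> (r ^ n) \<in> ?h (u [^]\<^bsub>G\<lparr>carrier := U\<rparr>\<^esub> (r ^ n))"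
      by (rule UG.rcos_self[OF UG.nat_pow_closed[OF uc] W.subgroup_axioms])
    then have "u [^]\<^bsub>G\<lparr>carrier := U\<rparr>\<^esub> (r ^ n) \<in> W" using e by simp
    then show ?thesis by (auto simp: nat_pow_def)
  qed
  have "\<exists>Y. finite Y \<and> Y \<subseteq> carrier G \<and> U \<inter> H = generate G Y"
    using fg subgroups_Inter_pair[OF U H] tf UM unfolding tf_fg_def by (metis Int_iff Int_lower2 subsetD)
  then obtain Y where Y: "finite Y" "Y \<subseteq> carrier G" "U \<inter> H = generate G Y" by blast
  have YU: "Y \<subseteq> U" using Y(3) generate.incl by (metis Int_iff subsetI)
  obtain e where e: "\<And>u. u \<in> U ==> u [^] (r ^ e u) \<in> W" using rt by metis
  define N where "N = (\<Sum>y\<in>Y. e y)"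
  have powle: "u [^] (r ^ b) \<in> W" if "u \<in> U" "u [^] (r ^ a) \<in> W" "a \<le> b" for u and a b :: nat
  proof -
    have "r ^ b = r ^ a * r ^ (b - a)" using that(3) by (simp add: power_add[symmetric])
    then show ?thesis using Wpow[OF that(2), of "r ^ (b - a)"] that(1) by (simp add: nat_pow_pow)
  qed
  have YN: "y [^] (r ^ N) \<in> W" if "y \<in> Y" for y
  proof -
    have "e y \<le> N" unfolding N_def by (rule member_le_sum) (use that Y(1) in auto)
    then show ?thesis using powle e[of y] that YU by blast
  qed
  have "subgroup {u \<in> U. u [^] (r ^ N) \<in> W} G"
  proof (rule subgroupI)
    show "{u \<in> U. u [^] (r ^ N) \<in> W} \<noteq> {}" using W.one_closed by (auto intro!: exI[of _ \<one>])
    fix a assume a: "a \<in> {u \<in> U. u [^] (r ^ N) \<in> W}"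
    have "inv\<^bsub>G\<lparr>carrier := U\<rparr>\<^esub> (a [^] (r ^ N)) \<in> W" using W.m_inv_closed a by blast
    moreover have "inv\<^bsub>G\<lparr>carrier := U\<rparr>\<^esub> (a [^] (r ^ N)) = inv (a [^] (r ^ N))"
      by (rule m_inv_consistent[OF U]) (use a W.subset in auto)
    ultimately show "inv a \<in> {u \<in> U. u [^] (r ^ N) \<in> W}" using a by (simp add: nat_pow_inv)
    fix b assume b: "b \<in> {u \<in> U. u [^] (r ^ N) \<in> W}"
    have "a [^] (r ^ N) \<otimes>\<^bsub>G\<lparr>carrier := U\<rparr>\<^esub> b [^] (r ^ N) \<in> W" using W.m_closed a b by blast
    then show "a \<otimes> b \<in> {u \<in> U. u [^] (r ^ N) \<in> W}" using a b by (simp add: nat_pow_distrib)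
  qed auto
  then have XN: "u [^] (r ^ N) \<in> W" if "u \<in> U" "u \<in> H" for u
    using generate_subgroup_incl[of Y "{u \<in> U. u [^] (r ^ N) \<in> W}"] YN YU Y(3) that by blast
  have UN: "u [^] (r ^ N) \<in> W" if u: "u \<in> U" for u
  proof -
    have uM: "u \<in> M" and uc: "u \<in> carrier G" using u UM by auto
    obtain n :: nat where n: "n > 0" "u [^] n \<in> H" using tor[OF uM] by blast
    obtain a m where am: "n = r ^ a * m" "\<not> r dvd m"
      using n(1) rp multiplicity_decompose'[of n r] not_prime_unit[of r] by (metis not_gr_zero)
    have "(u [^] m) [^] (r ^ a) \<in> H" using n(2) am(1) uc by (simp add: nat_pow_pow mult.commute)
    then have "u [^] m \<in> H" by (rule pure'[OF Mpow[OF uM]])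
    moreover have "u [^] m \<in> U" using subgroup_int_pow_closed[OF U u, of "int m"] by (simp add: int_pow_int)
    ultimately have 1: "(u [^] m) [^] (r ^ N) \<in> W" by (rule XN[rotated])
    have "coprime m (r ^ e u)" using prime_imp_coprime[OF rp am(2)] by (simp add: coprime_commute)
    moreover have "m > 0" using n(1) am(1) by (simp add: gr0I)
    ultimately obtain x y where xy: "m * x = r ^ e u * y + 1" using bezout_nat[of m "r ^ e u"] by auto
    have "r ^ N * (m * x) = r ^ e u * y * r ^ N + r ^ N" unfolding xy by (simp add: algebra_simps)
    then have eq: "((u [^] m) [^] (r ^ N)) [^] x = ((u [^] (r ^ e u)) [^] (y * r ^ N)) \<otimes> u [^] (r ^ N)"
      using uc by (simp add: nat_pow_pow nat_pow_mult mult_ac)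
    have w: "((u [^] m) [^] (r ^ N)) [^] x \<in> W" "(u [^] (r ^ e u)) [^] (y * r ^ N) \<in> W"
      using Wpow[OF 1] Wpow[OF e[OF u]] by auto
    let ?c = "(u [^] (r ^ e u)) [^] (y * r ^ N)"
    have "inv\<^bsub>G\<lparr>carrier := U\<rparr>\<^esub> ?c \<in> W" using W.m_inv_closed w(2) by blast
    moreover have "inv\<^bsub>G\<lparr>carrier := U\<rparr>\<^esub> ?c = inv ?c" by (rule m_inv_consistent[OF U]) (use w(2) W.subset in auto)
    ultimately have "inv ?c \<otimes>\<^bsub>G\<lparr>carrier := U\<rparr>\<^esub> ((u [^] m) [^] (r ^ N)) [^] x \<in> W" using W.m_closed w(1) by metis
    then show ?thesis using eq uc by (simp add: inv_cancel)
  qed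
  have "finite (carrier (G\<lparr>carrier := U\<rparr> Mod W))"
  proof (rule UG.finite_bounded_quotient[OF finite_rank_subgroup[OF fr U] W, of "r ^ N"])
    show "u [^]\<^bsub>G\<lparr>carrier := U\<rparr>\<^esub> (r ^ N) \<in> W" if "u \<in> carrier (G\<lparr>carrier := U\<rparr>)" for u using UN[of u] that by (simp add: nat_pow_def)
  qed (use r0 in simp)
  then show False using inf' by blast
qed

lemma (in group) nat_abs_pow_in_subgroup:
  assumes H: "subgroup H G" and y: "y \<in> carrier G" and i: "y [^] (i::int) \<in> H"
  shows "y [^] (nat \<bar>i\<bar>) \<in> H"
proof -
  have "y [^] int (nat \<bar>i\<bar>) \<in> H"
  proof (cases "i \<ge> 0")
    case True
    then have e: "int (nat \<bar>i\<bar>) = i" by simp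
    show ?thesis unfolding e by (rule i)
  next
    case False
    then have e: "int (nat \<bar>i\<bar>) = - i" by simp
    show ?thesis unfolding e int_pow_neg[OF y] by (rule subgroup.m_inv_closed[OF H i])
  qed
  then show ?thesis unfolding int_pow_int .
qed

text \<open>If \<open>\<chi>\<close> is trivial on \<open>M \<inter> H\<close>, an element as in \<open>r_divisible_element_over_fg\<close> may be
  given any \<open>r\<close>-th root of unity as value.\<close>

lemma (in comm_group) extend_char_nontrivially:
  assumes fr: "finite_rank G" and M: "subgroup M G" and tf: "\<forall>x\<in>M. \<forall>n::nat>0. x [^] n = \<one> --> x = \<one>"
    and r: "r \<in> spectrum (G\<lparr>carrier := M\<rparr>)" "r \<noteq> p" and H: "subgroup H G" and fg: "tf_fg G H"
    and c: "is_char G H \<chi>" and good: "\<forall>x\<in>H. root_of_unity_avoiding p (\<chi> x)"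
  shows "\<exists>H' \<chi>'. subgroup H' G \<and> tf_fg G H' \<and> is_char G H' \<chi>' \<and> (\<forall>x\<in>H'. root_of_unity_avoiding p (\<chi>' x)) \<and>
    H \<subseteq> H' \<and> (\<forall>x\<in>H. \<chi>' x = \<chi> x) \<and> (\<exists>m\<in>M \<inter> H'. \<chi>' m \<noteq> 1)"
proof (cases "\<exists>m\<in>M \<inter> H. \<chi> m \<noteq> 1")
  case True
  then show ?thesis using H fg c good by blast
next
  case False
  have rp: "Factorial_Ring.prime r" using r(1) by (simp add: spectrum_def)
  obtain y where y: "y \<in> M" "y \<notin> H" "y [^] r \<in> H \<or> (\<forall>n::nat>0. y [^] n \<notin> H)"
    using r_divisible_element_over_fg[OF fr M tf r(1) H fg] by (elim bexE conjE) (rule that)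
  have yc: "y \<in> carrier G" using subgroup.mem_carrier[OF M y(1)] .
  have r1: "r > 1" using rp prime_gt_1_nat by blast
  obtain z :: complex where zr: "z ^ r = 1" and z1: "z \<noteq> 1" by (rule nontrivial_prime_root[OF rp])
  have zgood: "root_of_unity_avoiding p z"
    unfolding root_of_unity_avoiding_def using zr r1 r(2) rp by (intro exI[of _ r]) (auto simp: prime_prime_factors)
  have compat: "\<chi> (y [^] i) = z powi i" if i: "y [^] i \<in> H" for i :: int
  proof -
    have 1: "\<chi> (y [^] i) = 1" using False i subgroup_int_pow_closed[OF M y(1)] by blast
    show ?thesis using y(3)
    proof
      assume "y [^] r \<in> H"
      then have "int r dvd i" using prime_int_pow_in_subgroup[OF H yc y(2) _ rp] i by blast
      then obtain j where "i = int r * j" by blast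
      then have "z powi i = (z ^ r) powi j" by (simp add: power_int_mult)
      then show ?thesis using 1 zr by simp
    next
      assume n: "\<forall>n::nat>0. y [^] n \<notin> H"
      have "y [^] (nat \<bar>i\<bar>) \<in> H"
        by (rule nat_abs_pow_in_subgroup[OF H yc i])
      then have "\<not> nat \<bar>i\<bar> > 0" using n by blast
      then have "i = 0" by simp
      then show ?thesis using 1 by simp
    qed
  qed
  have z0: "z \<noteq> 0" using zr r1 by (auto simp: zero_power)
  obtain \<chi>' where c': "is_char G (adjoin G H y) \<chi>'" "\<And>h (i::int). h \<in> H ==> \<chi>' (h \<otimes> y [^] i) = \<chi> h * z powi i"
  proof (rule extend_char[OF H c yc z0])
    show "\<chi> (y [^] i) = z powi i" if "y [^] i \<in> H" for i :: int by (rule compat[OF that])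
  qed (rule that)
  note ad = adjoin_facts[OF H yc]
  have "\<chi>' y = z"
    using c'(2)[OF subgroup.one_closed[OF H], of 1] is_charD(3)[OF H c] yc by (simp add: int_pow_1)
  moreover have "\<forall>x\<in>H. \<chi>' x = \<chi> x"
  proof
    fix x assume x: "x \<in> H"
    show "\<chi>' x = \<chi> x" using c'(2)[OF x, of 0] subgroup.mem_carrier[OF H x] by simp
  qed
  moreover have "\<forall>x\<in>adjoin G H y. root_of_unity_avoiding p (\<chi>' x)"
  proof
    fix x assume "x \<in> adjoin G H y"
    then obtain h i where hi: "h \<in> H" "x = h \<otimes> y [^] (i::int)" unfolding adjoin_def by blast
    show "root_of_unity_avoiding p (\<chi>' x)"
      using c'(2)[OF hi(1)] hi(2) root_of_unity_avoiding_mult[OF good[rule_format, OF hi(1)] root_of_unity_avoiding_powi[OF zgood]] by simp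
  qed
  ultimately show ?thesis
    using ad c'(1) tf_fg_adjoin[OF H fg yc] y(1) z1 by (intro exI[of _ "adjoin G H y"] exI[of _ \<chi>']) auto
qed

lemma (in comm_group) char_nontrivial_on_countably_many:
  fixes M :: "nat => 'a set"
  assumes fr: "finite_rank G" and M: "\<And>n. subgroup (M n) G"
    and tf: "\<And>n. \<forall>x\<in>M n. \<forall>m::nat>0. x [^] m = \<one> --> x = \<one>"
    and r: "\<And>n. M n \<noteq> {\<one>} ==> \<not> spectrum (G\<lparr>carrier := M n\<rparr>) \<subseteq> {p}"
    and H: "subgroup H G" and c: "is_char G H \<chi>" and good: "\<And>x. x \<in> H ==> root_of_unity_avoiding p (\<chi> x)"
    and tor: "\<And>x. x \<in> H ==> \<exists>n::nat>0. x [^] n = \<one>"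
  obtains H' \<chi>' where "subgroup H' G" "is_char G H' \<chi>'" "\<And>x. x \<in> H' ==> root_of_unity_avoiding p (\<chi>' x)"
    "H \<subseteq> H'" "\<And>x. x \<in> H ==> \<chi>' x = \<chi> x" "\<And>n. M n \<noteq> {\<one>} ==> \<exists>m\<in>M n \<inter> H'. \<chi>' m \<noteq> 1"
proof -
  define I where "I s \<longleftrightarrow> subgroup (fst s) G \<and> tf_fg G (fst s) \<and> is_char G (fst s) (snd s) \<and>
    (\<forall>x\<in>fst s. root_of_unity_avoiding p (snd s x)) \<and> H \<subseteq> fst s \<and> (\<forall>x\<in>H. snd s x = \<chi> x)" for s :: "'a set \<times> ('a => complex)"
  define R where "R n s t \<longleftrightarrow> fst s \<subseteq> fst t \<and> (\<forall>x\<in>fst s. snd t x = snd s x) \<and>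
    (M n \<noteq> {\<one>} --> (\<exists>m\<in>M n \<inter> fst t. snd t m \<noteq> 1))" for n and s t :: "'a set \<times> ('a => complex)"
  have "\<exists>f. \<forall>n. I (f n) \<and> R n (f n) (f (Suc n))"
  proof (rule dependent_nat_choice)
    have "I (H, \<chi>)" using H c good tf_fg_torsion[OF tor] by (simp add: I_def)
    then show "\<exists>s. I s" by blast
    fix s n assume s: "I s"
    show "\<exists>t. I t \<and> R n s t"
    proof (cases "M n = {\<one>}")
      case True
      then have "I s \<and> R n s s" using s by (simp add: R_def)
      then show ?thesis by blast
    next
      case False
      then obtain r' where r': "r' \<in> spectrum (G\<lparr>carrier := M n\<rparr>)" "r' \<noteq> p" using r by blast
      have s': "subgroup (fst s) G" "tf_fg G (fst s)" "is_char G (fst s) (snd s)"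
        "\<forall>x\<in>fst s. root_of_unity_avoiding p (snd s x)" "H \<subseteq> fst s" "\<And>x. x \<in> H ==> snd s x = \<chi> x" using s by (auto simp: I_def)
      obtain H' \<chi>' where h: "subgroup H' G" "tf_fg G H'" "is_char G H' \<chi>'" "\<forall>x\<in>H'. root_of_unity_avoiding p (\<chi>' x)"
        "fst s \<subseteq> H'" "\<forall>x\<in>fst s. \<chi>' x = snd s x" "\<exists>m\<in>M n \<inter> H'. \<chi>' m \<noteq> 1"
        using extend_char_nontrivially[OF fr M[of n] tf[of n] r' s'(1-4)] by (elim exE conjE) (rule that)
      have "I (H', \<chi>')" unfolding I_def fst_conv snd_conv
        using h(1-6) s'(5,6) by (intro conjI) auto
      moreover have "R n s (H', \<chi>')" unfolding R_def fst_conv snd_conv using h(5-7) by blast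
      ultimately show ?thesis by blast
    qed
  qed
  then obtain f where f: "\<And>n. I (f n)" "\<And>n. R n (f n) (f (Suc n))" by blast
  have fD: "subgroup (fst (f n)) G" "is_char G (fst (f n)) (snd (f n))" "H \<subseteq> fst (f n)" "\<And>x. x \<in> fst (f n) ==> root_of_unity_avoiding p (snd (f n) x)"
    "\<And>x. x \<in> H ==> snd (f n) x = \<chi> x" for n using f(1)[of n] by (auto simp: I_def)
  obtain \<theta> where \<theta>: "subgroup (\<Union>n. fst (f n)) G" "is_char G (\<Union>n. fst (f n)) \<theta>" "\<And>n x. x \<in> fst (f n) ==> \<theta> x = snd (f n) x"
    by (rule union_char[of "\<lambda>n. fst (f n)" "\<lambda>n. snd (f n)"]) (use f(2) fD in \<open>auto simp: R_def\<close>)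
  show thesis
  proof (rule that[OF \<theta>(1,2)])
    show "root_of_unity_avoiding p (\<theta> x)" if "x \<in> (\<Union>n. fst (f n))" for x using that \<theta>(3) fD(4) by fastforce
    show "H \<subseteq> (\<Union>n. fst (f n))" using fD(3) by blast
    show "\<theta> x = \<chi> x" if "x \<in> H" for x using \<theta>(3)[of x 0] fD(3)[of 0] fD(5)[OF that, of 0] that by auto
    show "\<exists>m\<in>M n \<inter> (\<Union>n. fst (f n)). \<theta> m \<noteq> 1" if n: "M n \<noteq> {\<one>}" for n
    proof -
      obtain m where "m \<in> M n" "m \<in> fst (f (Suc n))" "snd (f (Suc n)) m \<noteq> 1" using f(2)[of n] n unfolding R_def by blast
      then show ?thesis using \<theta>(3)[of m "Suc n"] by (intro bexI[of _ m]) auto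
    qed
  qed
qed

text \<open>Let \<open>K\<close> be maximal with \<open>K \<inter> H\<close> equal to the kernel of \<open>\<chi>\<close>. Then every nontrivial subgroup of
  \<open>G / K\<close> meets the image of \<open>H\<close>, which is a group of roots of unity; this gives all claims about \<open>G / K\<close>.\<close>

lemma (in comm_group) subgroup_cutting_out_kernel:
  assumes H: "subgroup H G" and c: "is_char G H \<chi>" and good: "\<And>x. x \<in> H ==> root_of_unity_avoiding p (\<chi> x)"
  obtains K where "subgroup K G" "K \<inter> H = {x \<in> H. \<chi> x = 1}" "\<And>a. a \<in> carrier G ==> \<exists>n::nat>0. a [^] n \<in> K"
    "\<And>q a. Factorial_Ring.prime (q::nat) ==> a \<in> carrier G ==> a [^] q \<in> K ==> a \<notin> K ==> q \<noteq> p"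
    "\<And>q a b. Factorial_Ring.prime (q::nat) ==> a \<in> carrier G ==> b \<in> carrier G ==> a [^] q \<in> K ==> b [^] q \<in> K ==> a \<notin> K ==>
      \<exists>(j::nat) x. x \<in> K \<and> b = a [^] j \<otimes> x"
proof -
  interpret H: subgroup H G by (rule H)
  note ch = is_charD[OF H c]
  let ?ker = "{x \<in> H. \<chi> x = 1}"
  let ?F = "{K. subgroup K G \<and> K \<inter> H = ?ker}"
  have ker: "subgroup ?ker G"
  proof (rule subgroupI)
    show "?ker \<noteq> {}" using ch(3) by (auto intro!: exI[of _ \<one>])
  qed (use ch in auto)
  have "\<exists>K\<in>?F. \<forall>L\<in>?F. K \<subseteq> L --> L = K"
  proof (rule subset_Zorn_nonempty)
    show "?F \<noteq> {}" using ker by blast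
    fix C assume C: "C \<noteq> {}" "subset.chain ?F C"
    have CF: "C \<subseteq> ?F" using C(2) by (simp add: subset.chain_def)
    have sg: "subgroup K G" if "K \<in> C" for K using CF that by blast
    have "subgroup (\<Union>C) G" by (rule subgroup_Union_chain(1)[OF C sg])
    moreover have "\<Union>C \<inter> H = ?ker"
    proof -
      have e: "K \<inter> H = ?ker" if "K \<in> C" for K using CF that by blast
      have "\<Union>C \<inter> H = (\<Union>K\<in>C. K \<inter> H)" by blast
      also have "\<dots> = (\<Union>K\<in>C. ?ker)" using e by (intro SUP_cong refl)
      finally show ?thesis using C(1) by simp
    qed
    ultimately show "\<Union>C \<in> ?F" by blast
  qed
  then obtain K where KF: "K \<in> ?F" and mx: "\<forall>L\<in>?F. K \<subseteq> L --> L = K" by (elim bexE) (rule that)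
  have K: "subgroup K G" "K \<inter> H = ?ker" using KF by simp_all
  have max: "L = K" if "subgroup L G" "L \<inter> H = ?ker" "K \<subseteq> L" for L using mx[rule_format, of L] that by simp
  interpret K: subgroup K G by (rule K(1))
  have hit: "\<exists>h\<in>H. \<exists>k\<in>K. \<exists>i::int. h = k \<otimes> a [^] i \<and> \<chi> h \<noteq> 1" if a: "a \<in> carrier G" "a \<notin> K" for a
  proof -
    note ad = adjoin_facts[OF K(1) a(1)]
    have "adjoin G K a \<noteq> K" using ad(3) a(2) by blast
    then have "adjoin G K a \<inter> H \<noteq> ?ker" using max[OF ad(1)] ad(2) by blast
    moreover have "?ker \<subseteq> adjoin G K a \<inter> H" using K(2) ad(2) by blast
    ultimately obtain h where "h \<in> adjoin G K a" "h \<in> H" "\<chi> h \<noteq> 1" by blast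
    then show ?thesis unfolding adjoin_def by blast
  qed
  have kerK: "x \<in> K \<longleftrightarrow> \<chi> x = 1" if "x \<in> H" for x using K(2) that by blast
  have Hpow: "x [^] (n::nat) \<in> H" if "x \<in> H" for x n using subgroup_int_pow_closed[OF H that, of "int n"] by (simp add: int_pow_int)
  have Kpow: "x [^] (n::nat) \<in> K" if "x \<in> K" for x n using subgroup_int_pow_closed[OF K(1) that, of "int n"] by (simp add: int_pow_int)
  have pp: "(a [^] i) [^] n = a [^] (i * int n)" if "a \<in> carrier G" for a n and i :: int
    using int_pow_pow[OF that, of i "int n"] by (simp only: int_pow_int)
  have root: "\<chi> h ^ q = 1" if h: "h \<in> H" "k \<in> K" "h = k \<otimes> a [^] (i::int)" and a: "a \<in> carrier G" "a [^] q \<in> K" for h k a i and q :: nat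
  proof -
    have "h [^] q = k [^] q \<otimes> (a [^] q) [^] i"
      using h a pp[OF a(1), of i q] int_pow_pow[OF a(1), of "int q" i, unfolded int_pow_int] by (simp add: nat_pow_distrib mult.commute)
    moreover have "k [^] q \<otimes> (a [^] q) [^] i \<in> K" using K.m_closed[OF Kpow[OF h(2)] subgroup_int_pow_closed[OF K(1) a(2)]] .
    ultimately have "h [^] q \<in> K" by simp
    then show ?thesis using kerK[OF Hpow[OF h(1)]] ch(5)[OF h(1)] by simp
  qed
  show thesis
  proof (rule that[OF K])
    show "\<exists>n::nat>0. a [^] n \<in> K" if a: "a \<in> carrier G" for a
    proof (cases "a \<in> K")
      case True
      then show ?thesis using a by (intro exI[of _ 1]) simp
    next
      case False
      obtain h k i where h: "h \<in> H" "k \<in> K" "h = k \<otimes> a [^] (i::int)" "\<chi> h \<noteq> 1" using hit[OF a False] by blast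
      obtain n where n: "n > 0" "\<chi> h ^ n = 1" using good[OF h(1)] by (auto simp: root_of_unity_avoiding_def)
      have i0: "i \<noteq> 0" using h kerK[OF h(1)] a by (metis int_pow_0 K.mem_carrier r_one)
      have "h [^] n \<in> K" using kerK[OF Hpow[OF h(1)]] ch(5)[OF h(1)] n(2) by simp
      moreover have "h [^] n = k [^] n \<otimes> a [^] (i * int n)"
        using h a pp[OF a, of i n] by (simp add: nat_pow_distrib)
      ultimately have "inv (k [^] n) \<otimes> (k [^] n \<otimes> a [^] (i * int n)) \<in> K"
        using K.m_closed[OF K.m_inv_closed[OF Kpow[OF h(2)]]] by metis
      then have aK: "a [^] (i * int n) \<in> K" using h(2) a by (simp add: inv_cancel)
      have "a [^] nat \<bar>i * int n\<bar> \<in> K"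
        by (rule nat_abs_pow_in_subgroup[OF K(1) a aK])
      moreover have "nat \<bar>i * int n\<bar> > 0" using i0 n(1) by simp
      ultimately show ?thesis by blast
    qed
    show "q \<noteq> p" if q: "Factorial_Ring.prime (q::nat)" and a: "a \<in> carrier G" "a [^] q \<in> K" "a \<notin> K" for q a
    proof -
      obtain h k i where h: "h \<in> H" "k \<in> K" "h = k \<otimes> a [^] (i::int)" "\<chi> h \<noteq> 1" using hit[OF a(1,3)] by blast
      obtain n where n: "n > 0" "p \<notin> prime_factors n" "\<chi> h ^ n = 1" using good[OF h(1)] by (auto simp: root_of_unity_avoiding_def)
      have "\<not> coprime n q" using coprime_root_eq_one[OF n(3) root[OF h(1-3) a(1,2)]] n(1) h(4) by blast
      then have "q dvd n" using prime_imp_coprime[OF q, of n] by (auto simp: coprime_commute)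
      then have "q \<in> prime_factors n" using q n(1) by (simp add: prime_factors_dvd)
      then show ?thesis using n(2) by blast
    qed
    show "\<exists>(j::nat) x. x \<in> K \<and> b = a [^] j \<otimes> x"
      if q: "Factorial_Ring.prime (q::nat)" and a: "a \<in> carrier G" and b: "b \<in> carrier G"
        and aq: "a [^] q \<in> K" and bq: "b [^] q \<in> K" and aK: "a \<notin> K" for q a b
    proof -
      note ad = adjoin_facts[OF K(1) a]
      have "b \<in> adjoin G K a"
      proof (rule ccontr)
        assume bn: "b \<notin> adjoin G K a"
        then have bK: "b \<notin> K" using ad(2) by blast
        obtain h k i where h: "h \<in> H" "k \<in> K" "h = k \<otimes> a [^] (i::int)" "\<chi> h \<noteq> 1" using hit[OF a aK] by blast
        obtain h' k' l where h': "h' \<in> H" "k' \<in> K" "h' = k' \<otimes> b [^] (l::int)" "\<chi> h' \<noteq> 1" using hit[OF b bK] by blast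
        obtain s :: nat where s: "\<chi> h' = \<chi> h ^ s"
          using prime_roots_are_powers[OF q root[OF h(1-3) a aq] h(4) root[OF h'(1-3) b bq]] by blast
        have hs: "h [^] s \<in> H" by (rule Hpow[OF h(1)])
        have "\<chi> (h' \<otimes> inv (h [^] s)) = 1"
          using ch(2)[OF h'(1) H.m_inv_closed[OF hs]] ch(4)[OF hs] ch(5)[OF h(1)] ch(1)[OF h'(1)] s by simp
        then have 1: "h' \<otimes> inv (h [^] s) \<in> adjoin G K a" using kerK[of "h' \<otimes> inv (h [^] s)"] h'(1) hs ad(2) by blast
        have "h \<in> adjoin G K a" using h(2,3) unfolding adjoin_def by blast
        then have 2: "h [^] s \<in> adjoin G K a" using subgroup_int_pow_closed[OF ad(1), of h "int s"] by (simp add: int_pow_int)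
        have "inv k' \<in> adjoin G K a" using K.m_inv_closed[OF h'(2)] ad(2) by blast
        then have "inv k' \<otimes> (h' \<otimes> inv (h [^] s) \<otimes> h [^] s) \<in> adjoin G K a"
          using subgroup.m_closed[OF ad(1) _ subgroup.m_closed[OF ad(1) 1 2]] by blast
        moreover have "inv k' \<otimes> (h' \<otimes> inv (h [^] s) \<otimes> h [^] s) = b [^] l"
          using h(1) h' b by (simp add: m_assoc inv_cancel)
        ultimately have "b [^] l \<in> adjoin G K a" by simp
        then have "int q dvd l" using prime_int_pow_in_subgroup[OF ad(1) b bn _ q] bq ad(2) by blast
        then have "b [^] l \<in> K" using prime_int_pow_in_subgroup[OF K(1) b bK bq q] by blast
        then have "h' \<in> K" using h'(2,3) by simp
        then show False using kerK[OF h'(1)] h'(4) by blast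
      qed
      then obtain k e where k: "k \<in> K" "b = k \<otimes> a [^] (e::int)" unfolding adjoin_def by blast
      have q0: "q > 0" using q prime_gt_0_nat by blast
      have "int (nat (e mod int q)) + int q * (e div int q) = e" using q0 by simp
      then have "a [^] e = a [^] int (nat (e mod int q)) \<otimes> a [^] (int q * (e div int q))"
        using int_pow_mult[OF a, of "int (nat (e mod int q))" "int q * (e div int q)"] by simp
      also have "\<dots> = a [^] nat (e mod int q) \<otimes> (a [^] q) [^] (e div int q)" using int_pow_pow[OF a, of "int q" "e div int q", unfolded int_pow_int] by (simp add: int_pow_int)
      finally have "b = a [^] nat (e mod int q) \<otimes> (k \<otimes> (a [^] q) [^] (e div int q))"
        using k a by (simp add: m_ac)
      moreover have "k \<otimes> (a [^] q) [^] (e div int q) \<in> K" by (rule K.m_closed[OF k(1) subgroup_int_pow_closed[OF K(1) aq]])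
      ultimately show ?thesis by blast
    qed
  qed
qed

section \<open>A maximal abelian normal subgroup and the socle\<close>

lemma (in group) commute_if_commutator_trivial:
  assumes "x \<in> carrier G" "y \<in> carrier G" "x \<otimes> y \<otimes> inv x \<otimes> inv y = \<one>"
  shows "x \<otimes> y = y \<otimes> x"
proof -
  have "x \<otimes> y \<otimes> inv x = y" using assms by (metis inv_closed inv_equality inv_inv m_closed)
  then show ?thesis using assms by (metis inv_closed inv_solve_right m_closed)
qed

text \<open>The last nontrivial term of the derived series of \<open>N\<close> will do.\<close>

lemma (in group) normal_contains_abelian_normal:
  assumes solv: "solvable G" and N: "N \<lhd> G" "N \<noteq> {\<one>}"
  obtains B where "B \<lhd> G" "B \<subseteq> N" "B \<noteq> {\<one>}" "\<And>x y. x \<in> B ==> y \<in> B ==> x \<otimes> y = y \<otimes> x"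
proof -
  let ?D = "\<lambda>n. (derived G ^^ n) N"
  have Nc: "N \<subseteq> carrier G" using normal_mem[OF N(1)] by blast
  have nor: "?D n \<lhd> G" for n by (induction n) (use N(1) derived_is_normal in auto)
  obtain n0 where "(derived G ^^ n0) (carrier G) = {\<one>}" using solv solvable_iff_trivial_derived_seq by blast
  then have "?D n0 \<subseteq> {\<one>}" using mono_exp_of_derived[OF Nc, of n0] by simp
  then have ex: "?D n0 = {\<one>}" using subgroup.one_closed[OF normal_imp_subgroup[OF nor[of n0]]] by blast
  define n where "n = (LEAST n. ?D n = {\<one>})"
  have n: "?D n = {\<one>}" unfolding n_def by (rule LeastI[of "\<lambda>n. ?D n = {\<one>}", OF ex])
  then obtain m where m: "n = Suc m" using N(2) by (cases n) auto
  have D1: "?D m \<noteq> {\<one>}"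
    using not_less_Least[of m "\<lambda>n. ?D n = {\<one>}"] m unfolding n_def[symmetric] by simp
  have sub: "?D m \<subseteq> N"
  proof (induction m)
    case (Suc m)
    have "derived G (?D m) \<subseteq> ?D m" by (rule derived_incl[OF subset_refl normal_imp_subgroup[OF nor]])
    then show ?case using Suc by simp
  qed simp
  have comm: "x \<otimes> y = y \<otimes> x" if x: "x \<in> ?D m" "y \<in> ?D m" for x y
  proof (rule commute_if_commutator_trivial)
    show "x \<in> carrier G" "y \<in> carrier G" using normal_mem[OF nor] x by auto
    have "x \<otimes> y \<otimes> inv x \<otimes> inv y \<in> derived G (?D m)" by (rule commutator_in_derived[OF x])
    then show "x \<otimes> y \<otimes> inv x \<otimes> inv y = \<one>" using n m by simp
  qed
  show thesis by (rule that[OF nor sub D1 comm])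
qed

text \<open>If \<open>N\<close> met a maximal \<open>A\<close> trivially, an abelian normal subgroup \<open>B\<close> inside \<open>N\<close> would commute with \<open>A\<close>, and
  \<open>AB\<close> would be larger.\<close>

lemma (in group) maximal_abelian_normal:
  assumes solv: "solvable G"
  obtains A where "A \<lhd> G" "\<And>x y. x \<in> A ==> y \<in> A ==> x \<otimes> y = y \<otimes> x" "socle G \<subseteq> A"
    "\<And>N. N \<lhd> G ==> N \<noteq> {\<one>} ==> N \<inter> A \<noteq> {\<one>}"
proof -
  let ?F = "{A. A \<lhd> G \<and> (\<forall>x\<in>A. \<forall>y\<in>A. x \<otimes> y = y \<otimes> x) \<and> socle G \<subseteq> A}"
  have "\<exists>A\<in>?F. \<forall>B\<in>?F. A \<subseteq> B --> B = A"
  proof (rule subset_Zorn_nonempty)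
    have "socle G \<in> ?F" using socle_facts(1,3)[OF solv] by simp
    then show "?F \<noteq> {}" by blast
    fix C assume C: "C \<noteq> {}" "subset.chain ?F C"
    have CF: "C \<subseteq> ?F" using C(2) by (simp add: subset.chain_def)
    have nor: "K \<lhd> G" if "K \<in> C" for K using CF that by blast
    note U = subgroup_Union_chain[OF C normal_imp_subgroup[OF nor]]
    have "g \<otimes> a \<otimes> inv g \<in> \<Union>C" if g: "g \<in> carrier G" and a: "a \<in> \<Union>C" for g a
      using a normal.inv_op_closed2[OF nor g] by blast
    then have "\<Union>C \<lhd> G" using U(1) by (simp add: normal_inv_iff)
    moreover have "\<forall>x\<in>\<Union>C. \<forall>y\<in>\<Union>C. x \<otimes> y = y \<otimes> x"
    proof (intro ballI)
      fix x y assume "x \<in> \<Union>C" "y \<in> \<Union>C"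
      then obtain K where "K \<in> C" "x \<in> K" "y \<in> K" using U(2) by blast
      moreover from this(1) have "K \<in> ?F" using CF by blast
      ultimately show "x \<otimes> y = y \<otimes> x" by simp
    qed
    moreover have "socle G \<subseteq> \<Union>C" using C(1) CF by blast
    ultimately show "\<Union>C \<in> ?F" by simp
  qed
  then obtain A where AF: "A \<in> ?F" and mx: "\<forall>B\<in>?F. A \<subseteq> B --> B = A" by (elim bexE) (rule that)
  have A: "A \<lhd> G" "socle G \<subseteq> A" and comm: "\<And>x y. x \<in> A ==> y \<in> A ==> x \<otimes> y = y \<otimes> x" using AF by simp_all
  have "N \<inter> A \<noteq> {\<one>}" if N: "N \<lhd> G" "N \<noteq> {\<one>}" for N
  proof
    assume NA: "N \<inter> A = {\<one>}"
    obtain B where B: "B \<lhd> G" "B \<subseteq> N" "B \<noteq> {\<one>}" and commB: "\<And>x y. x \<in> B ==> y \<in> B ==> x \<otimes> y = y \<otimes> x"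
      by (rule normal_contains_abelian_normal[OF solv N]) (rule that)
    interpret A: normal A G by (rule A(1))
    interpret B: normal B G by (rule B(1))
    have BA: "B \<inter> A = {\<one>}" using NA B(2) A.one_closed B.one_closed by blast
    have AB: "a \<otimes> b = b \<otimes> a" if a: "a \<in> A" and b: "b \<in> B" for a b
    proof (rule commute_if_commutator_trivial)
      show car: "a \<in> carrier G" "b \<in> carrier G" using a b by auto
      have "a \<otimes> b \<otimes> inv a \<otimes> inv b \<in> B" by (rule B.m_closed[OF B.inv_op_closed2[OF car(1) b] B.m_inv_closed[OF b]])
      moreover have "a \<otimes> (b \<otimes> inv a \<otimes> inv b) \<in> A"
        by (rule A.m_closed[OF a A.inv_op_closed2[OF car(2) A.m_inv_closed[OF a]]])
      then have "a \<otimes> b \<otimes> inv a \<otimes> inv b \<in> A" using car by (simp add: m_assoc)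
      ultimately show "a \<otimes> b \<otimes> inv a \<otimes> inv b = \<one>" using BA by blast
    qed
    have swap: "(a \<otimes> b) \<otimes> (a' \<otimes> b') = (a \<otimes> a') \<otimes> (b \<otimes> b')" if "a \<in> A" "a' \<in> A" "b \<in> B" "b' \<in> B" for a b a' b'
    proof -
      have car: "a \<in> carrier G" "a' \<in> carrier G" "b \<in> carrier G" "b' \<in> carrier G" using that by auto
      have "(a \<otimes> b) \<otimes> (a' \<otimes> b') = a \<otimes> (b \<otimes> a') \<otimes> b'" using car by (simp add: m_assoc)
      also have "\<dots> = a \<otimes> (a' \<otimes> b) \<otimes> b'" using AB[of a' b] that by simp
      finally show ?thesis using car by (simp add: m_assoc)
    qed
    have nAB: "A <#> B \<lhd> G"
    proof (rule normalI_conj)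
      show "A <#> B \<subseteq> carrier G" by (auto simp: set_mult_def)
      have "\<one> \<otimes> \<one> \<in> A <#> B" unfolding set_mult_def using A.one_closed B.one_closed by blast
      then show "\<one> \<in> A <#> B" by simp
      fix x assume "x \<in> A <#> B"
      then obtain a b where x: "a \<in> A" "b \<in> B" "x = a \<otimes> b" unfolding set_mult_def by blast
      have car: "a \<in> carrier G" "b \<in> carrier G" using x by auto
      have "inv x = inv a \<otimes> inv b" using x car AB[OF A.m_inv_closed[OF x(1)] B.m_inv_closed[OF x(2)]] by (simp add: inv_mult_group)
      then show "inv x \<in> A <#> B" unfolding set_mult_def using A.m_inv_closed[OF x(1)] B.m_inv_closed[OF x(2)] by blast
      show "g \<otimes> x \<otimes> inv g \<in> A <#> B" if g: "g \<in> carrier G" for g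
      proof -
        have "g \<otimes> x \<otimes> inv g = (g \<otimes> a \<otimes> inv g) \<otimes> (g \<otimes> b \<otimes> inv g)" using x car g by (simp add: m_assoc inv_cancel)
        then show ?thesis unfolding set_mult_def using A.inv_op_closed2[OF g x(1)] B.inv_op_closed2[OF g x(2)] by blast
      qed
      fix y assume "y \<in> A <#> B"
      then obtain a' b' where y: "a' \<in> A" "b' \<in> B" "y = a' \<otimes> b'" unfolding set_mult_def by blast
      have "x \<otimes> y = (a \<otimes> a') \<otimes> (b \<otimes> b')" using swap x y by simp
      then show "x \<otimes> y \<in> A <#> B" unfolding set_mult_def using A.m_closed[OF x(1) y(1)] B.m_closed[OF x(2) y(2)] by blast
    qed
    have c: "x \<otimes> y = y \<otimes> x" if xy: "x \<in> A <#> B" "y \<in> A <#> B" for x y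
    proof -
      obtain a b where x: "a \<in> A" "b \<in> B" "x = a \<otimes> b" using xy(1) unfolding set_mult_def by blast
      obtain a' b' where y: "a' \<in> A" "b' \<in> B" "y = a' \<otimes> b'" using xy(2) unfolding set_mult_def by blast
      show ?thesis using swap[of a a' b b'] swap[of a' a b' b] comm[OF x(1) y(1)] commB[OF x(2) y(2)] x y by simp
    qed
    have incA: "A \<subseteq> A <#> B"
    proof
      fix a assume a: "a \<in> A"
      have "a \<otimes> \<one> \<in> A <#> B" unfolding set_mult_def using a B.one_closed by blast
      then show "a \<in> A <#> B" using a by simp
    qed
    have incB: "B \<subseteq> A <#> B"
    proof
      fix b assume b: "b \<in> B"
      have "\<one> \<otimes> b \<in> A <#> B" unfolding set_mult_def using b A.one_closed by blast
      then show "b \<in> A <#> B" using b by simp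
    qed
    have "A <#> B = A"
    proof (rule mx[rule_format, OF _ incA], rule CollectI, intro conjI ballI)
      show "socle G \<subseteq> A <#> B" using A(2) incA by blast
    qed (use nAB c in auto)
    then have "B \<subseteq> A" using incB by simp
    then show False using BA B(3) by blast
  qed
  then show thesis using that[OF A(1) comm A(2)] by blast
qed

definition socle_part :: "('g, 'm) monoid_scheme => nat => 'g set" where
  "socle_part G q = {x \<in> socle G. x [^]\<^bsub>G\<^esub> q = \<one>\<^bsub>G\<^esub>}"

lemma (in group) socle_induct_prime_parts:
  assumes solv: "solvable G" and T: "subgroup T G" and N: "\<And>N. minimal_normal N G ==> N \<subseteq> T"
  shows "socle G \<subseteq> T"
  unfolding socle_def by (rule generate_subgroup_incl[OF _ T]) (use N in blast)

text \<open>Minimal normal subgroups have prime exponent. So if \<open>M\<close> contains those of exponent \<open>q\<close>, every element of the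
  socle has a power with exponent prime to \<open>q\<close> in \<open>M\<close>.\<close>

lemma (in group) socle_part_semisimple:
  assumes solv: "solvable G" and fr: "finite_rank G" and q: "Factorial_Ring.prime (q::nat)"
  shows "semisimple_section G (socle_part G q) q"
proof -
  note sf = socle_facts[OF solv]
  have sc: "x \<in> carrier G" if "x \<in> socle G" for x using normal_mem[OF sf(1) that] .
  have sS: "subgroup (socle G) G" by (rule normal_imp_subgroup[OF sf(1)])
  interpret S: comm_group "G\<lparr>carrier := socle G\<rparr>" by (rule abelian_subgroup_comm_group[OF sS sf(3)])
  have q0: "q > 0" using q prime_gt_0_nat by blast
  show ?thesis
  proof (intro semisimple_section.intro semisimple_section_axioms.intro is_group)
    show "socle_part G q \<lhd> G" unfolding socle_part_def by (rule normal_torsion_and_powers(1)[OF sf(1,3)])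
    show "finite (socle_part G q)"
      using S.finite_exponent_if_finite_rank[OF finite_rank_subgroup[OF fr sS] q0] by (simp add: socle_part_def nat_pow_def)
    show "Factorial_Ring.prime q" by (rule q)
    show "x \<otimes> y = y \<otimes> x" if "x \<in> socle_part G q" "y \<in> socle_part G q" for x y using that sf(3) by (simp add: socle_part_def)
    show "x [^] q = \<one>" if "x \<in> socle_part G q" for x using that by (simp add: socle_part_def)
    fix M assume M: "M \<lhd> G" and min: "\<And>N. minimal_normal N G ==> N \<subseteq> socle_part G q ==> N \<subseteq> M"
    have sM: "subgroup M G" by (rule normal_imp_subgroup[OF M])
    let ?T = "{s \<in> socle G. \<exists>m::nat>0. coprime m q \<and> s [^] m \<in> M}"
    have "subgroup ?T G"
    proof (rule subgroupI)
      show "?T \<subseteq> carrier G" using sc by blast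
      have "\<one> \<in> ?T" using subgroup.one_closed[OF sS] subgroup.one_closed[OF sM] by (auto intro!: exI[of _ 1])
      then show "?T \<noteq> {}" by blast
      fix a assume "a \<in> ?T"
      then obtain m where a: "a \<in> socle G" "m > 0" "coprime m q" "a [^] (m::nat) \<in> M" by blast
      have "inv a [^] m \<in> M" using subgroup.m_inv_closed[OF sM a(4)] sc[OF a(1)] by (simp add: nat_pow_inv)
      then show "inv a \<in> ?T" using subgroup.m_inv_closed[OF sS a(1)] a(2,3) by blast
      fix b assume "b \<in> ?T"
      then obtain n where b: "b \<in> socle G" "n > 0" "coprime n q" "b [^] (n::nat) \<in> M" by blast
      have "(a \<otimes> b) [^] (m * n) = (a [^] m) [^] n \<otimes> (b [^] n) [^] m"
        using S.nat_pow_distrib[of a b "m * n"] a(1) b(1) sc[OF a(1)] sc[OF b(1)] by (simp add: nat_pow_def[symmetric] nat_pow_pow mult.commute) (simp add: nat_pow_def)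
      then have "(a \<otimes> b) [^] (m * n) \<in> M"
        using subgroup.m_closed[OF sM normal_nat_pow[OF M a(4), of n] normal_nat_pow[OF M b(4), of m]] by simp
      moreover have "coprime (m * n) q" "m * n > 0" using a b by simp_all
      ultimately show "a \<otimes> b \<in> ?T" using subgroup.m_closed[OF sS a(1) b(1)] by blast
    qed
    moreover have "N \<subseteq> ?T" if N: "minimal_normal N G" for N
    proof
      fix x assume x: "x \<in> N"
      obtain q' :: nat where q': "Factorial_Ring.prime q'" "\<forall>x\<in>N. x [^] q' = \<one>" using minimal_normal_finite_rank[OF solv fr N] by blast
      have NS: "N \<subseteq> socle G" by (rule sf(2)[OF N])
      show "x \<in> ?T"
      proof (cases "q' = q")
        case True
        then have "N \<subseteq> socle_part G q" using NS q'(2) by (auto simp: socle_part_def)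
        then have "x \<in> M" using min[OF N] x by blast
        then show ?thesis using NS x sc by (auto intro!: exI[of _ 1])
      next
        case False
        then have "coprime q' q" using q q'(1) primes_coprime by blast
        moreover have "x [^] q' \<in> M" using q'(2) x subgroup.one_closed[OF sM] by simp
        ultimately show ?thesis using NS x prime_gt_0_nat[OF q'(1)] by blast
      qed
    qed
    ultimately have ST: "socle G \<subseteq> ?T" by (rule socle_induct_prime_parts[OF solv])
    show "socle_part G q \<subseteq> M"
    proof
      fix s assume s: "s \<in> socle_part G q"
      then have sS': "s \<in> socle G" "s [^] q = \<one>" by (auto simp: socle_part_def)
      then obtain m :: nat where m: "m > 0" "coprime m q" "s [^] m \<in> M" using ST by blast
      show "s \<in> M" by (rule coprime_pow_mem[OF sM sc[OF sS'(1)] m(3) _ m(2,1)]) (use sS'(2) subgroup.one_closed[OF sM] in simp)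
    qed
  qed
qed

lemma (in group) socle_squarefree_exponent:
  assumes solv: "solvable G" and fr: "finite_rank G" and s: "s \<in> socle G"
  shows "\<exists>P. finite P \<and> (\<forall>q\<in>P. Factorial_Ring.prime q) \<and> s [^] (\<Prod>P :: nat) = \<one>"
proof -
  note sf = socle_facts[OF solv]
  have sS: "subgroup (socle G) G" by (rule normal_imp_subgroup[OF sf(1)])
  interpret S: comm_group "G\<lparr>carrier := socle G\<rparr>" by (rule abelian_subgroup_comm_group[OF sS sf(3)])
  have sc: "x \<in> carrier G" if "x \<in> socle G" for x using normal_mem[OF sf(1) that] .
  let ?Q = "\<lambda>P. finite P \<and> (\<forall>q\<in>P. Factorial_Ring.prime (q::nat))"
  let ?T = "{s \<in> socle G. \<exists>P. ?Q P \<and> s [^] (\<Prod>P) = \<one>}"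
  have up: "x [^] (\<Prod>R) = \<one>" if "x \<in> carrier G" "x [^] (\<Prod>P) = \<one>" "P \<subseteq> R" "finite R" for x and P R :: "nat set"
  proof -
    have "\<Prod>R = \<Prod>P * \<Prod>(R - P)" using prod.subset_diff[OF that(3,4), of "\<lambda>x. x"] by (simp add: mult.commute)
    then show ?thesis using that(1,2) by (simp add: nat_pow_pow[symmetric])
  qed
  have "subgroup ?T G"
  proof (rule subgroupI)
    show "?T \<subseteq> carrier G" using sc by blast
    have "\<one> \<in> ?T" using subgroup.one_closed[OF sS] by (auto intro!: exI[of _ "{}"])
    then show "?T \<noteq> {}" by blast
    fix a assume "a \<in> ?T"
    then obtain P where a: "a \<in> socle G" "?Q P" "a [^] (\<Prod>P) = \<one>" by blast
    have "inv a [^] (\<Prod>P) = \<one>" using a(3) sc[OF a(1)] by (simp add: nat_pow_inv)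
    then show "inv a \<in> ?T" using subgroup.m_inv_closed[OF sS a(1)] a(2) by blast
    fix b assume "b \<in> ?T"
    then obtain R where b: "b \<in> socle G" "?Q R" "b [^] (\<Prod>R) = \<one>" by blast
    have "(a \<otimes> b) [^] (\<Prod>(P \<union> R)) = a [^] (\<Prod>(P \<union> R)) \<otimes> b [^] (\<Prod>(P \<union> R))"
      using S.nat_pow_distrib[of a b "\<Prod>(P \<union> R)"] a(1) b(1) by (simp add: nat_pow_def)
    also have "\<dots> = \<one>" using up[OF sc[OF a(1)] a(3), of "P \<union> R"] up[OF sc[OF b(1)] b(3), of "P \<union> R"] a(2) b(2) by simp
    finally have "(a \<otimes> b) [^] (\<Prod>(P \<union> R)) = \<one>" .
    moreover have "?Q (P \<union> R)" using a(2) b(2) by blast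
    ultimately show "a \<otimes> b \<in> ?T" using subgroup.m_closed[OF sS a(1) b(1)] by blast
  qed
  moreover have "N \<subseteq> ?T" if N: "minimal_normal N G" for N
  proof
    fix x assume x: "x \<in> N"
    obtain q' :: nat where q': "Factorial_Ring.prime q'" "\<forall>x\<in>N. x [^] q' = \<one>" using minimal_normal_finite_rank[OF solv fr N] by blast
    have "?Q {q'} \<and> x [^] (\<Prod>{q'}) = \<one>" using q' x by simp
    then show "x \<in> ?T" using sf(2)[OF N] x by blast
  qed
  ultimately have "socle G \<subseteq> ?T" by (rule socle_induct_prime_parts[OF solv])
  then show ?thesis using s by blast
qed

lemma (in group) socle_submodule_iff:
  assumes solv: "solvable G"
  shows "ZG_submodule H G (G\<lparr>carrier := socle G\<rparr>) (conj_by G) \<longleftrightarrow> H \<lhd> G \<and> H \<subseteq> socle G"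
proof -
  have sS: "subgroup (socle G) G" by (rule normal_imp_subgroup[OF socle_facts(1)[OF solv]])
  have "subgroup H (G\<lparr>carrier := socle G\<rparr>) \<longleftrightarrow> subgroup H G \<and> H \<subseteq> socle G"
    using incl_subgroup[OF sS] subgroup_incl[OF _ sS] subgroup.subset by force
  then show ?thesis unfolding ZG_submodule_def normal_inv_iff conj_by_def by blast
qed

lemma (in group) socle_span:
  assumes solv: "solvable G" and S: "S \<subseteq> socle G"
  shows "ZG_span G (G\<lparr>carrier := socle G\<rparr>) (conj_by G) S = normal_closure G S"
proof -
  have soc: "socle G \<lhd> G" by (rule socle_facts(1)[OF solv])
  have "S \<subseteq> carrier G" using S normal_mem[OF soc] by blast
  note c = normal_closure_facts[OF this]
  have "ZG_span G (G\<lparr>carrier := socle G\<rparr>) (conj_by G) S = \<Inter>{H. (H \<lhd> G \<and> H \<subseteq> socle G) \<and> S \<subseteq> H}"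
    by (simp add: ZG_span_def socle_submodule_iff[OF solv])
  also have "\<dots> = normal_closure G S"
  proof (rule antisym)
    show "\<Inter>{H. (H \<lhd> G \<and> H \<subseteq> socle G) \<and> S \<subseteq> H} \<subseteq> normal_closure G S"
      by (rule Inter_lower) (use c(1,2) c(3)[OF soc S] in simp)
    show "normal_closure G S \<subseteq> \<Inter>{H. (H \<lhd> G \<and> H \<subseteq> socle G) \<and> S \<subseteq> H}" using c(3) by (intro Inter_greatest) simp
  qed
  finally show ?thesis .
qed

lemma (in group) socle_locally_cyclic_iff:
  assumes solv: "solvable G"
  shows "locally_cyclic_ZG_module G (G\<lparr>carrier := socle G\<rparr>) (conj_by G) \<longleftrightarrow>
    (\<forall>S\<subseteq>socle G. finite S --> (\<exists>a\<in>socle G. normal_closure G S = normal_closure G {a}))"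
  using socle_ZG_module[OF is_group solv] by (simp add: locally_cyclic_ZG_module_def socle_span[OF solv])

lemma ones_eq_zero_iff:
  assumes k: "field k" and q: "Factorial_Ring.prime (q::nat)"
  shows "rsum k (\<lambda>_. \<one>\<^bsub>k\<^esub>) q = \<zero>\<^bsub>k\<^esub> \<longleftrightarrow> q = characteristic k"
proof -
  interpret field k by (rule k)
  interpret add: group "add_monoid k" by (rule a_group)
  have r: "rsum k (\<lambda>_. \<one>\<^bsub>k\<^esub>) n = [n] \<cdot>\<^bsub>k\<^esub> \<one>\<^bsub>k\<^esub>" for n by (induction n) simp_all
  have "rsum k (\<lambda>_. \<one>\<^bsub>k\<^esub>) q = \<zero>\<^bsub>k\<^esub> \<longleftrightarrow> characteristic k dvd q"
    unfolding r characteristic_def using add.pow_eq_id[OF one_closed, of q] .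
  also have "\<dots> \<longleftrightarrow> q = characteristic k"
  proof
    assume "characteristic k dvd q"
    moreover have "characteristic k \<noteq> 1" unfolding characteristic_def using add.ord_eq_1[OF one_closed] one_not_zero by simp
    ultimately show "q = characteristic k" using q by (metis prime_nat_iff)
  qed simp
  finally show ?thesis .
qed

lemma (in group) not_prime_order_iff:
  assumes solv: "solvable G" and q: "Factorial_Ring.prime (q::nat)"
  shows "q \<notin> prime_orders (G\<lparr>carrier := socle G\<rparr>) \<longleftrightarrow> socle_part G q = {\<one>}"
proof -
  have sS: "subgroup (socle G) G" by (rule normal_imp_subgroup[OF socle_facts(1)[OF solv]])
  interpret S: group "G\<lparr>carrier := socle G\<rparr>" by (rule subgroup.subgroup_is_group[OF sS is_group])
  have "S.ord x = q \<longleftrightarrow> x \<noteq> \<one> \<and> x [^] q = \<one>" if x: "x \<in> socle G" for x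
  proof -
    have xc: "x \<in> carrier (G\<lparr>carrier := socle G\<rparr>)" using x by simp
    have "x [^] q = \<one> \<longleftrightarrow> S.ord x dvd q" using S.pow_eq_id[OF xc, of q] by (simp add: nat_pow_def)
    moreover have "S.ord x = 1 \<longleftrightarrow> x = \<one>" using S.ord_eq_1[OF xc] by simp
    moreover have "S.ord x dvd q \<longleftrightarrow> S.ord x = 1 \<or> S.ord x = q" "q \<noteq> 1" using q by (auto simp: prime_nat_iff)
    ultimately show ?thesis by auto
  qed
  then show ?thesis
    unfolding prime_orders_def socle_part_def using q subgroup.one_closed[OF sS] by auto
qed

section \<open>The criterion\<close>

text \<open>The quotient by \<open>K\<close> is cyclic of order dividing \<open>q\<close>.\<close>

lemma (in comm_group) char_with_kernel_below:
  assumes q: "Factorial_Ring.prime (q::nat)" and e: "\<And>x. x \<in> carrier G ==> x [^] q = \<one>" and K: "subgroup K G"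
    and cyc: "\<And>c d. c \<in> carrier G ==> d \<in> carrier G ==> c \<notin> K ==> \<exists>i::nat. d \<otimes> c [^] i \<in> K"
  shows "\<exists>\<chi>. is_char G (carrier G) \<chi> \<and> (\<forall>x\<in>carrier G. \<chi> x = 1 --> x \<in> K)"
proof (cases "K = carrier G")
  case True
  then show ?thesis by (intro exI[of _ "\<lambda>_. 1"]) (simp add: is_char_def)
next
  case False
  then obtain c where c: "c \<in> carrier G" "c \<notin> K" using subgroup.subset[OF K] by blast
  have cq: "c [^] q \<in> K" using e[OF c(1)] subgroup.one_closed[OF K] by simp
  note dv = prime_int_pow_in_subgroup[OF K c cq q]
  obtain z :: complex where z: "z ^ q = 1" "z \<noteq> 1" by (rule nontrivial_prime_root[OF q]) (rule that)
  have z0: "z \<noteq> 0" using z(1) prime_gt_0_nat[OF q] by (auto simp: zero_power)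
  have triv: "is_char G K (\<lambda>_. 1)" by (simp add: is_char_def)
  obtain \<chi> where chi: "is_char G (adjoin G K c) \<chi>" "\<And>h (i::int). h \<in> K ==> \<chi> (h \<otimes> c [^] i) = 1 * z powi i"
  proof (rule extend_char[OF K triv c(1) z0])
    show "1 = z powi i" if i: "c [^] i \<in> K" for i :: int
    proof -
      obtain j where j: "i = int q * j" using dv[of i] i by blast
      show ?thesis unfolding j by (simp add: power_int_mult z(1))
    qed
  qed (rule that)
  note ad = adjoin_facts[OF K c(1)]
  have full: "adjoin G K c = carrier G"
  proof
    show "adjoin G K c \<subseteq> carrier G" by (rule subgroup.subset[OF ad(1)])
    show "carrier G \<subseteq> adjoin G K c"
    proof
      fix d assume d: "d \<in> carrier G"
      obtain i :: nat where i: "d \<otimes> c [^] i \<in> K" using cyc[OF c(1) d c(2)] by blast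
      have "c [^] i \<in> adjoin G K c" using subgroup_int_pow_closed[OF ad(1,3), of "int i"] by (simp add: int_pow_int)
      then have "d \<otimes> c [^] i \<otimes> inv (c [^] i) \<in> adjoin G K c"
        using subgroup.m_closed[OF ad(1) subsetD[OF ad(2) i] subgroup.m_inv_closed[OF ad(1)]] by blast
      then show "d \<in> adjoin G K c" using d c by (simp add: m_assoc)
    qed
  qed
  have "x \<in> K" if x: "x \<in> carrier G" "\<chi> x = 1" for x
  proof -
    have "x \<in> adjoin G K c" using x full by simp
    then obtain h i where hi: "h \<in> K" "x = h \<otimes> c [^] (i::int)" unfolding adjoin_def by blast
    have zi: "z powi i = 1" using chi(2)[OF hi(1), of i] hi(2) x(2) by simp
    have zn: "z ^ nat \<bar>i\<bar> = 1"
    proof (cases "i \<ge> 0")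
      case True
      then show ?thesis using zi by (simp add: power_int_def)
    next
      case False
      then show ?thesis using zi by (simp add: power_int_def power_inverse)
    qed
    have "q dvd nat \<bar>i\<bar>"
    proof (rule ccontr)
      assume "\<not> q dvd nat \<bar>i\<bar>"
      then have "coprime q (nat \<bar>i\<bar>)" by (rule prime_imp_coprime[OF q])
      then have "z = 1" by (rule coprime_root_eq_one[OF z(1) zn _ prime_gt_0_nat[OF q]])
      then show False using z(2) by blast
    qed
    then have "int q dvd i" by (simp add: int_dvd_int_iff[symmetric])
    then have "c [^] i \<in> K" using dv by blast
    then show ?thesis using hi subgroup.m_closed[OF K] by blast
  qed
  then show ?thesis using chi(1) full by metis
qed

text \<open>The product of generators of the prime parts works, since suitable powers of it give them back.\<close>

lemma (in group) single_generator_from_prime_parts: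
  assumes "finite P" "\<And>q. q \<in> P ==> Factorial_Ring.prime (q::nat)" "L \<lhd> G"
    "\<And>x y. x \<in> L ==> y \<in> L ==> x \<otimes> y = y \<otimes> x" "\<And>l. l \<in> L ==> l [^] (\<Prod>P) = \<one>"
    "\<And>q. q \<in> P ==> \<exists>a\<in>L. a [^] q = \<one> \<and> (\<forall>N. N \<lhd> G --> a \<in> N --> {x \<in> L. x [^] q = \<one>} \<subseteq> N)"
  shows "\<exists>a\<in>L. \<forall>N. N \<lhd> G --> a \<in> N --> L \<subseteq> N"
  using assms
proof (induction P arbitrary: L)
  case empty
  have "l = \<one>" if "l \<in> L" for l using empty.prems(4)[OF that] normal_mem[OF empty.prems(2) that] by simp
  moreover have "\<one> \<in> L" by (rule subgroup.one_closed[OF normal_imp_subgroup[OF empty.prems(2)]])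
  ultimately show ?case by (intro bexI[of _ \<one>] allI impI subsetI) metis+
next
  case (insert q P)
  note L = insert.prems(2) and comm = insert.prems(3)
  have sL: "subgroup L G" by (rule normal_imp_subgroup[OF L])
  have Lc: "x \<in> carrier G" if "x \<in> L" for x by (rule normal_mem[OF L that])
  have q: "Factorial_Ring.prime q" using insert.prems(1) by blast
  define m where "m = \<Prod>P"
  have qm: "coprime q m" unfolding m_def
  proof (rule prod_coprime_right)
    fix i assume i: "i \<in> P"
    have "q \<noteq> i" using i insert.hyps(2) by blast
    then show "coprime q i" using primes_coprime[OF q insert.prems(1)[of i]] i by blast
  qed
  let ?L = "{l \<in> L. l [^] m = \<one>}"
  have nL: "?L \<lhd> G" by (rule normal_torsion_and_powers(1)[OF L comm])
  have "\<exists>a\<in>?L. \<forall>N. N \<lhd> G --> a \<in> N --> ?L \<subseteq> N"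
  proof (rule insert.IH)
    show "?L \<lhd> G" by (rule nL)
    fix r assume r: "r \<in> P"
    obtain a where a: "a \<in> L" "a [^] r = \<one>" "\<forall>N. N \<lhd> G --> a \<in> N --> {x \<in> L. x [^] r = \<one>} \<subseteq> N"
      using insert.prems(5)[of r] r by blast
    obtain j where j: "m = r * j" using dvd_prodI[OF insert.hyps(1) r, of "\<lambda>x. x"] unfolding m_def by blast
    have "a [^] m = \<one>" using a(2) Lc[OF a(1)] unfolding j by (simp add: nat_pow_pow[symmetric])
    then show "\<exists>a\<in>?L. a [^] r = \<one> \<and> (\<forall>N. N \<lhd> G --> a \<in> N --> {x \<in> ?L. x [^] r = \<one>} \<subseteq> N)"
    proof (intro bexI[of _ a] conjI allI impI)
      show "a [^] r = \<one>" by (rule a(2))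
      show "{x \<in> ?L. x [^] r = \<one>} \<subseteq> N" if "N \<lhd> G" "a \<in> N" for N
        using a(3)[rule_format, OF that] by blast
    qed (use a(1) in simp)
  next
    show "Factorial_Ring.prime r" if "r \<in> P" for r using insert.prems(1) that by blast
    show "x \<otimes> y = y \<otimes> x" if "x \<in> ?L" "y \<in> ?L" for x y using comm that by simp
    show "l [^] (\<Prod>P) = \<one>" if "l \<in> ?L" for l using that by (simp add: m_def)
  qed
  then obtain a where a: "a \<in> L" "a [^] m = \<one>" and aN: "\<And>N. N \<lhd> G ==> a \<in> N ==> ?L \<subseteq> N" by blast
  obtain b where b: "b \<in> L" "b [^] q = \<one>" and bN: "\<And>N. N \<lhd> G ==> b \<in> N ==> {x \<in> L. x [^] q = \<one>} \<subseteq> N"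
    using insert.prems(5)[of q] by blast
  have pw: "(a \<otimes> b) [^] (n::nat) = a [^] n \<otimes> b [^] n" for n by (rule pow_mult_distrib[OF comm[OF a(1) b(1)] Lc[OF a(1)] Lc[OF b(1)]])
  have "L \<subseteq> N" if N: "N \<lhd> G" "a \<otimes> b \<in> N" for N
  proof
    have sN: "subgroup N G" by (rule normal_imp_subgroup[OF N(1)])
    have oneN: "\<one> \<in> N" by (rule subgroup.one_closed[OF sN])
    have "a [^] q = (a \<otimes> b) [^] q" using pw[of q] b(2) Lc[OF a(1)] by simp
    then have "a [^] q \<in> N" using normal_nat_pow[OF N] by simp
    then have "a \<in> N" using coprime_pow_mem[OF sN Lc[OF a(1)] _ _ qm prime_gt_0_nat[OF q]] a(2) oneN by simp
    then have LN: "?L \<subseteq> N" by (rule aN[OF N(1)])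
    have "b [^] m = (a \<otimes> b) [^] m" using pw[of m] a(2) Lc[OF b(1)] by simp
    then have "b [^] m \<in> N" using normal_nat_pow[OF N] by simp
    then have "b \<in> N" using coprime_pow_mem[OF sN Lc[OF b(1)] _ _ qm prime_gt_0_nat[OF q]] b(2) oneN by simp
    then have qN: "{x \<in> L. x [^] q = \<one>} \<subseteq> N" by (rule bN[OF N(1)])
    fix l assume l: "l \<in> L"
    have "l [^] (q * m) = \<one>" using insert.prems(4)[OF l] insert.hyps by (simp add: m_def)
    then have "(l [^] q) [^] m = \<one>" "(l [^] m) [^] q = \<one>" using Lc[OF l] by (simp_all add: nat_pow_pow mult.commute)
    then have "l [^] q \<in> N" "l [^] m \<in> N" using LN qN normal_nat_pow[OF L l] by blast+
    then show "l \<in> N" by (rule coprime_pow_mem[OF sN Lc[OF l] _ _ qm prime_gt_0_nat[OF q]])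
  qed
  then show ?case using subgroup.m_closed[OF sL a(1) b(1)] by blast
qed

theorem socle_locally_cyclic_if_faithful_irreducible:
  fixes G :: "('g, 'm) monoid_scheme" (structure) and k :: "('k, 'n) ring_scheme"
  assumes "group G" and solv: "solvable G" and fr: "finite_rank G" and k: "field k"
    and rep: "has_faithful_irreducible_rep k G"
  shows "locally_cyclic_ZG_module G (G\<lparr>carrier := socle G\<rparr>) (conj_by G)"
    "characteristic k \<notin> prime_orders (G\<lparr>carrier := socle G\<rparr>)"
proof -
  interpret group G by fact
  obtain V :: "('k, ('k \<times> 'g) list) module" and \<rho> where irr: "irreducible_rep k G V \<rho>" and faith: "faithful_rep G V \<rho>"
    using rep unfolding has_faithful_irreducible_rep_def by blast
  interpret L: linear_rep k G V \<rho> using irr by (simp add: irreducible_rep_def)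
  note sf = socle_facts[OF solv]
  show char: "characteristic k \<notin> prime_orders (G\<lparr>carrier := socle G\<rparr>)"
  proof (cases "Factorial_Ring.prime (characteristic k)")
    case False
    then show ?thesis by (simp add: prime_orders_def)
  next
    case True
    interpret SS: semisimple_section G "socle_part G (characteristic k)" "characteristic k"
      by (rule socle_part_semisimple[OF solv fr True])
    have ones: "rsum k (\<lambda>_. \<one>\<^bsub>k\<^esub>) (characteristic k) = \<zero>\<^bsub>k\<^esub>" using ones_eq_zero_iff[OF k True] by simp
    have "socle_part G (characteristic k) = {\<one>}"
      by (rule L.no_char_torsion_in_abelian_normal[OF irr faith SS.S_normal SS.S_finite SS.S_comm True SS.S_exp ones])
    then show ?thesis using not_prime_order_iff[OF solv True] by blast
  qed
  have part: "\<exists>a\<in>L. a [^] q = \<one> \<and> (\<forall>N. N \<lhd> G --> a \<in> N --> {x \<in> L. x [^] q = \<one>} \<subseteq> N)"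
    if Ln: "L \<lhd> G" "L \<subseteq> socle G" and q: "Factorial_Ring.prime q" for L and q :: nat
  proof -
    interpret SS: semisimple_section G "socle_part G q" q by (rule socle_part_semisimple[OF solv fr q])
    define F where "F = {x \<in> L. x [^] q = \<one>}"
    have Lcomm: "x \<otimes> y = y \<otimes> x" if "x \<in> L" "y \<in> L" for x y using that Ln(2) sf(3) by blast
    have F: "F \<lhd> G" unfolding F_def by (rule normal_torsion_and_powers(1)[OF Ln(1) Lcomm])
    have nF: "SS.nrm F" unfolding SS.nrm_def using F Ln(2) by (auto simp: F_def socle_part_def)
    note f = SS.nrmD[OF nF]
    have Fcomm: "x \<otimes> y = y \<otimes> x" if "x \<in> F" "y \<in> F" for x y using that Lcomm by (simp add: F_def)
    have Fexp: "x [^] q = \<one>" if "x \<in> F" for x using that by (simp add: F_def)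
    have "\<exists>\<chi>. SS.core_free F \<chi>"
    proof (cases "q = characteristic k")
      case True
      then have "F = {\<one>}" using not_prime_order_iff[OF solv q] char f(1,5) by blast
      then have "SS.core_free F (\<lambda>_. 1)" using SS.nrmD(1) by (auto simp: SS.core_free_def is_char_def)
      then show ?thesis by blast
    next
      case False
      then have ne: "rsum k (\<lambda>_. \<one>\<^bsub>k\<^esub>) q \<noteq> \<zero>\<^bsub>k\<^esub>" using ones_eq_zero_iff[OF k q] by simp
      obtain K where K: "subgroup K G" "K \<subseteq> F" and core: "\<And>N. N \<lhd> G ==> N \<subseteq> K ==> N = {\<one>}"
        and cyc: "\<And>c d. c \<in> F ==> d \<in> F ==> c \<notin> K ==> \<exists>i::nat. d \<otimes> c [^] i \<in> K"
        by (rule L.cyclic_core_free_quotient[OF irr faith f(8,7) Fcomm q Fexp ne]) (assumption | rule that)+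
      interpret FG: comm_group "G\<lparr>carrier := F\<rparr>" by (rule abelian_subgroup_comm_group[OF f(8) Fcomm])
      have "\<exists>\<chi>. is_char (G\<lparr>carrier := F\<rparr>) (carrier (G\<lparr>carrier := F\<rparr>)) \<chi> \<and> (\<forall>x\<in>carrier (G\<lparr>carrier := F\<rparr>). \<chi> x = 1 --> x \<in> K)"
      proof (rule FG.char_with_kernel_below[OF q])
        show "subgroup K (G\<lparr>carrier := F\<rparr>)" by (rule subgroup_incl[OF K(1) f(8) K(2)])
      qed (use Fexp cyc in \<open>simp_all add: nat_pow_def\<close>)
      then obtain \<chi> where chi: "is_char G F \<chi>" "\<forall>x\<in>F. \<chi> x = 1 --> x \<in> K" by (auto simp: is_char_def)
      have "SS.core_free F \<chi>"
        unfolding SS.core_free_def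
      proof (intro conjI allI impI chi(1))
        fix N assume N: "SS.nrm N" "N \<subseteq> F" "\<forall>x\<in>N. \<chi> x = 1"
        then have "N \<subseteq> K" using chi(2) by blast
        then show "N = {\<one>}" using core N(1) by (simp add: SS.nrm_def)
      qed
      then show ?thesis by blast
    qed
    then obtain a where a: "a \<in> F" "SS.nc a = F" using SS.cyclic_if_core_free_char[OF nF] by blast
    have "F \<subseteq> N" if N: "N \<lhd> G" "a \<in> N" for N
    proof -
      have "SS.nrm (N \<inter> socle_part G q)" unfolding SS.nrm_def using normal_subgroup_intersect[OF N(1) SS.S_normal] by blast
      then have "SS.nc a \<subseteq> N \<inter> socle_part G q" by (rule SS.nc_facts(3)[OF f(5)[OF a(1)]]) (use N(2) f(5)[OF a(1)] in blast)
      then show ?thesis using a(2) by blast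
    qed
    then show ?thesis using a(1) by (auto simp: F_def)
  qed
  show "locally_cyclic_ZG_module G (G\<lparr>carrier := socle G\<rparr>) (conj_by G)"
    unfolding socle_locally_cyclic_iff[OF solv]
  proof (intro allI impI)
    fix S assume S: "S \<subseteq> socle G" and S0: "finite S"
    define L where "L = normal_closure G S"
    have "S \<subseteq> carrier G" using S normal_mem[OF sf(1)] by blast
    note c = normal_closure_facts[OF this, folded L_def]
    note L = c(1) c(3)[OF sf(1) S] c(2,3)
    have Lcomm: "x \<otimes> y = y \<otimes> x" if "x \<in> L" "y \<in> L" for x y using that L(2) sf(3) by blast
    obtain Pf where Pf: "\<And>s. s \<in> S ==> finite (Pf s) \<and> (\<forall>q\<in>Pf s. Factorial_Ring.prime q) \<and> s [^] (\<Prod>(Pf s) :: nat) = \<one>"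
      using socle_squarefree_exponent[OF solv fr] S by (metis subsetD)
    define P where "P = \<Union>(Pf ` S)"
    have finP: "finite P" using Pf S0 by (simp add: P_def)
    have primeP: "Factorial_Ring.prime q" if "q \<in> P" for q using that Pf by (auto simp: P_def)
    have subT: "S \<subseteq> {l \<in> socle G. l [^] (\<Prod>P) = \<one>}"
    proof
      fix s assume s: "s \<in> S"
      have sub: "Pf s \<subseteq> P" using s by (auto simp: P_def)
      have "\<Prod>P = \<Prod>(Pf s) * \<Prod>(P - Pf s)" using prod.subset_diff[OF sub finP, of "\<lambda>x. x"] by (simp add: mult.commute)
      then have "s [^] (\<Prod>P) = \<one>" using Pf[OF s] normal_mem[OF sf(1) subsetD[OF S s]] by (simp add: nat_pow_pow[symmetric])
      then show "s \<in> {l \<in> socle G. l [^] (\<Prod>P) = \<one>}" using s S by blast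
    qed
    have nT: "{l \<in> socle G. l [^] (\<Prod>P) = \<one>} \<lhd> G" by (rule normal_torsion_and_powers(1)[OF sf(1,3)])
    have "L \<subseteq> {l \<in> socle G. l [^] (\<Prod>P) = \<one>}" by (rule L(4)[OF nT subT])
    then have Lexp: "l [^] (\<Prod>P) = \<one>" if "l \<in> L" for l using that by blast
    have "\<exists>a\<in>L. \<forall>N. N \<lhd> G --> a \<in> N --> L \<subseteq> N"
      by (rule single_generator_from_prime_parts[OF finP primeP L(1) Lcomm Lexp part[OF L(1,2) primeP]])
    then obtain a where a: "a \<in> L" "\<And>N. N \<lhd> G ==> a \<in> N ==> L \<subseteq> N" by blast
    have as: "a \<in> socle G" using a(1) L(2) by blast
    then have "{a} \<subseteq> carrier G" using normal_mem[OF sf(1)] by blast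
    note A = normal_closure_facts[OF this]
    have "L = normal_closure G {a}"
    proof
      show "L \<subseteq> normal_closure G {a}" by (rule a(2)[OF A(1)]) (use A(2) in blast)
      show "normal_closure G {a} \<subseteq> L" by (rule A(3)[OF L(1)]) (use a(1) in blast)
    qed
    then show "\<exists>a\<in>socle G. normal_closure G S = normal_closure G {a}" using as L_def by blast
  qed
qed

lemma (in group) socle_part_core_free_char:
  assumes solv: "solvable G" and fr: "finite_rank G"
    and lc: "locally_cyclic_ZG_module G (G\<lparr>carrier := socle G\<rparr>) (conj_by G)" and q: "Factorial_Ring.prime (q::nat)"
  shows "\<exists>\<chi>. is_char G (socle_part G q) \<chi> \<and>
    (\<forall>N. N \<lhd> G --> N \<subseteq> socle_part G q --> (\<forall>x\<in>N. \<chi> x = 1) --> N = {\<one>})"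
proof -
  interpret SS: semisimple_section G "socle_part G q" q by (rule socle_part_semisimple[OF solv fr q])
  have sub: "socle_part G q \<subseteq> socle G" by (auto simp: socle_part_def)
  obtain a where a: "a \<in> socle G" "normal_closure G (socle_part G q) = normal_closure G {a}"
    using lc sub SS.S_finite unfolding socle_locally_cyclic_iff[OF solv] by blast
  have "socle_part G q \<subseteq> carrier G" using SS.SG by blast
  note X = normal_closure_facts[OF this]
  have "{a} \<subseteq> carrier G" using a(1) normal_mem[OF socle_facts(1)[OF solv]] by blast
  note Y = normal_closure_facts[OF this]
  have "socle_part G q = normal_closure G (socle_part G q)" using X(2) X(3)[OF SS.S_normal subset_refl] by blast
  then have nc: "SS.nc a = socle_part G q" using a(2) by (simp add: SS.nc_def)
  have "a \<in> socle_part G q" using Y(2) nc by (simp add: SS.nc_def)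
  then obtain \<chi> where "SS.core_free (socle_part G q) \<chi>"
    using SS.core_free_char_if_cyclic[OF \<open>a \<in> socle_part G q\<close>] nc by auto
  then show ?thesis unfolding SS.core_free_def SS.nrm_def by blast
qed

theorem faithful_irreducible_if_socle_locally_cyclic:
  fixes G :: "('g, 'm) monoid_scheme" (structure) and k :: "('k, 'n) ring_scheme"
  assumes "group G" and solv: "solvable G" and fr: "finite_rank G" and k: "field k"
    and spec: "\<And>B. \<lbrakk>B \<lhd> G; B \<noteq> {\<one>\<^bsub>G\<^esub>}; comm_group (G\<lparr>carrier := B\<rparr>); torsion_free (G\<lparr>carrier := B\<rparr>)\<rbrakk>
           \<Longrightarrow> \<not> spectrum (G\<lparr>carrier := B\<rparr>) \<subseteq> {characteristic k}"
    and lc: "locally_cyclic_ZG_module G (G\<lparr>carrier := socle G\<rparr>) (conj_by G)"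
    and char: "characteristic k \<notin> prime_orders (G\<lparr>carrier := socle G\<rparr>)"
  shows "has_faithful_irreducible_rep k G"
proof -
  interpret group G by fact
  define p where "p = characteristic k"
  note sf = socle_facts[OF solv]
  obtain A where A: "A \<lhd> G" "socle G \<subseteq> A" and comm: "\<And>x y. x \<in> A ==> y \<in> A ==> x \<otimes> y = y \<otimes> x"
    and meet: "\<And>N. N \<lhd> G ==> N \<noteq> {\<one>} ==> N \<inter> A \<noteq> {\<one>}"
    by (rule maximal_abelian_normal[OF solv]) (rule that)
  have sA: "subgroup A G" by (rule normal_imp_subgroup[OF A(1)])
  let ?A = "G\<lparr>carrier := A\<rparr>"
  interpret AG: comm_group ?A by (rule abelian_subgroup_comm_group[OF sA comm])
  have frA: "finite_rank ?A" by (rule finite_rank_subgroup[OF fr sA])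
  have pw: "x [^]\<^bsub>?A\<^esub> n = x [^] n" for x and n :: nat by (simp add: nat_pow_def)
  have ic: "is_char ?A H \<chi> = is_char G H \<chi>" for H \<chi> by (simp add: is_char_def)
  have sub: "subgroup N ?A" if "N \<lhd> G" "N \<subseteq> A" for N by (rule subgroup_incl[OF normal_imp_subgroup[OF that(1)] sA that(2)])

  let ?Q = "{q::nat. Factorial_Ring.prime q \<and> q \<noteq> p}"
  have "\<forall>q\<in>?Q. \<exists>\<chi>. is_char G (socle_part G q) \<chi> \<and> (\<forall>N. N \<lhd> G --> N \<subseteq> socle_part G q --> (\<forall>x\<in>N. \<chi> x = 1) --> N = {\<one>})"
    using socle_part_core_free_char[OF solv fr lc] by blast
  then obtain \<psi> where \<psi>: "\<And>q. q \<in> ?Q ==> is_char G (socle_part G q) (\<psi> q)"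
    "\<And>q N. q \<in> ?Q ==> N \<lhd> G ==> N \<subseteq> socle_part G q ==> \<forall>x\<in>N. \<psi> q x = 1 ==> N = {\<one>}"
    unfolding bchoice_iff by blast
  have spA: "socle_part G q \<subseteq> A" for q using A(2) by (auto simp: socle_part_def)
  have spn: "socle_part G q \<lhd> G" for q unfolding socle_part_def by (rule normal_torsion_and_powers(1)[OF sf(1,3)])
  obtain S \<theta> where S: "subgroup S ?A" "is_char ?A S \<theta>" and Sq: "\<And>q. q \<in> ?Q ==> socle_part G q \<subseteq> S"
    and \<theta>: "\<And>q x. q \<in> ?Q ==> x \<in> socle_part G q ==> \<theta> x = \<psi> q x"
    and Sexp: "\<And>x. x \<in> S ==> \<exists>n::nat>0. prime_factors n \<subseteq> ?Q \<and> x [^]\<^bsub>?A\<^esub> n = \<one>\<^bsub>?A\<^esub>"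
  proof (rule AG.glue_prime_characters[of ?Q "socle_part G" \<psi>])
    show "Factorial_Ring.prime q \<and> subgroup (socle_part G q) ?A \<and> is_char ?A (socle_part G q) (\<psi> q)" if "q \<in> ?Q" for q
      using that \<psi>(1)[OF that] sub[OF spn spA] by (simp add: ic)
    show "x [^]\<^bsub>?A\<^esub> q = \<one>\<^bsub>?A\<^esub>" if "q \<in> ?Q" "x \<in> socle_part G q" for q x
      using that(2) by (simp add: socle_part_def pw)
  qed (rule that)

  have ntf: "\<forall>x\<in>M. \<forall>m::nat>0. x [^]\<^bsub>?A\<^esub> m = \<one>\<^bsub>?A\<^esub> --> x = \<one>\<^bsub>?A\<^esub>" if "torsion_free (G\<lparr>carrier := M\<rparr>)" for M
    using that by (simp add: torsion_free_def nat_pow_def)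
  define M where "M n = (if torsion_free (G\<lparr>carrier := normal_closure G {from_nat_into A n}\<rparr>)
    then normal_closure G {from_nat_into A n} else {\<one>})" for n
  have Ane: "A \<noteq> {}" using subgroup.one_closed[OF sA] by blast
  have fnA: "from_nat_into A n \<in> A" for n by (rule from_nat_into[OF Ane])
  have cl: "normal_closure G {from_nat_into A n} \<lhd> G" "from_nat_into A n \<in> normal_closure G {from_nat_into A n}"
    "N \<lhd> G ==> from_nat_into A n \<in> N ==> normal_closure G {from_nat_into A n} \<subseteq> N" for n N
  proof -
    have "{from_nat_into A n} \<subseteq> carrier G" using normal_mem[OF A(1) fnA] by blast
    note c = normal_closure_facts[OF this]
    show "normal_closure G {from_nat_into A n} \<lhd> G" "from_nat_into A n \<in> normal_closure G {from_nat_into A n}" using c(1,2) by auto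
    show "N \<lhd> G ==> from_nat_into A n \<in> N ==> normal_closure G {from_nat_into A n} \<subseteq> N" using c(3)[of N] by simp
  qed
  have Mn: "M n \<lhd> G" "M n \<subseteq> A" for n
    using cl(1)[of n] cl(3)[of _ n, OF A(1) fnA] one_is_normal subgroup.one_closed[OF sA] by (auto simp: M_def)
  have tf1: "torsion_free (G\<lparr>carrier := {\<one>}\<rparr>)" by (simp add: torsion_free_def)
  have Mtf: "torsion_free (G\<lparr>carrier := M n\<rparr>)" for n using tf1 by (simp add: M_def)
  have Mspec: "\<not> spectrum (?A\<lparr>carrier := M n\<rparr>) \<subseteq> {p}" if ne: "M n \<noteq> {\<one>\<^bsub>?A\<^esub>}" for n
  proof -
    have "comm_group (G\<lparr>carrier := M n\<rparr>)"
      by (rule abelian_subgroup_comm_group[OF normal_imp_subgroup[OF Mn(1)]]) (use comm Mn(2) in blast)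
    then show ?thesis using spec[OF Mn(1) _ _ Mtf] ne by (simp add: p_def)
  qed
  obtain H \<chi> where H: "subgroup H ?A" "is_char ?A H \<chi>" and good: "\<And>x. x \<in> H ==> root_of_unity_avoiding p (\<chi> x)"
    and SH: "S \<subseteq> H" "\<And>x. x \<in> S ==> \<chi> x = \<theta> x" and hit: "\<And>n. M n \<noteq> {\<one>\<^bsub>?A\<^esub>} ==> \<exists>m\<in>M n \<inter> H. \<chi> m \<noteq> 1"
  proof (rule AG.char_nontrivial_on_countably_many[OF frA sub[OF Mn] ntf[OF Mtf] Mspec S])
    fix x assume x: "x \<in> S"
    obtain n :: nat where n: "n > 0" "prime_factors n \<subseteq> ?Q" "x [^]\<^bsub>?A\<^esub> n = \<one>\<^bsub>?A\<^esub>" using Sexp[OF x] by blast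
    then show "\<exists>n::nat>0. x [^]\<^bsub>?A\<^esub> n = \<one>\<^bsub>?A\<^esub>" by blast
    have "\<theta> x ^ n = 1" using AG.is_charD(5)[OF S x, of n] n(3) AG.is_charD(3)[OF S] by simp
    moreover have "p \<notin> prime_factors n" using n(2) by blast
    ultimately show "root_of_unity_avoiding p (\<theta> x)" unfolding root_of_unity_avoiding_def using n(1) by blast
  qed (assumption | rule that)+
  obtain K where K: "subgroup K ?A" and KH: "K \<inter> H = {x \<in> H. \<chi> x = 1}"
    and Kt: "\<And>a. a \<in> carrier ?A ==> \<exists>n::nat>0. a [^]\<^bsub>?A\<^esub> n \<in> K"
    and Kp: "\<And>q a. Factorial_Ring.prime (q::nat) ==> a \<in> carrier ?A ==> a [^]\<^bsub>?A\<^esub> q \<in> K ==> a \<notin> K ==> q \<noteq> p"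
    and Kc: "\<And>q a b. Factorial_Ring.prime (q::nat) ==> a \<in> carrier ?A ==> b \<in> carrier ?A ==> a [^]\<^bsub>?A\<^esub> q \<in> K ==>
      b [^]\<^bsub>?A\<^esub> q \<in> K ==> a \<notin> K ==> \<exists>(j::nat) x. x \<in> K \<and> b = a [^]\<^bsub>?A\<^esub> j \<otimes>\<^bsub>?A\<^esub> x"
    by (rule AG.subgroup_cutting_out_kernel[OF H good]) (assumption | rule that)+
  show ?thesis
  proof (rule faithful_irreducible_from_subgroup[OF is_group k sA comm])
    show "subgroup K G" by (rule incl_subgroup[OF sA K])
    show "K \<subseteq> A" using subgroup.subset[OF K] by simp
    show "\<exists>n::nat. n > 0 \<and> a [^] n \<in> K" if "a \<in> A" for a using Kt[of a] that by (simp add: pw)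
    show "\<exists>(j::nat) x. x \<in> K \<and> b = a [^] j \<otimes> x"
      if "Factorial_Ring.prime (q::nat)" "a \<in> A" "b \<in> A" "a [^] q \<in> K" "b [^] q \<in> K" "a \<notin> K" for q a b
      using Kc[of q a b] that by (simp add: pw)
    show "rsum k (\<lambda>_. \<one>\<^bsub>k\<^esub>) q \<noteq> \<zero>\<^bsub>k\<^esub>" if "Factorial_Ring.prime (q::nat)" "a \<in> A" "a [^] q \<in> K" "a \<notin> K" for q a
      using Kp[of q a] that ones_eq_zero_iff[OF k that(1)] by (simp add: pw p_def)
    show "\<not> N \<inter> A \<subseteq> K" if N: "N \<lhd> G" "N \<noteq> {\<one>}" for N
    proof
      assume NK: "N \<inter> A \<subseteq> K"
      define B where "B = N \<inter> A"
      have B: "B \<lhd> G" "B \<noteq> {\<one>}" "B \<subseteq> A" "B \<subseteq> K"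
        using normal_subgroup_intersect[OF N(1) A(1)] meet[OF N] NK by (auto simp: B_def)
      have chiK: "\<chi> x = 1" if "x \<in> K" "x \<in> H" for x using KH that by blast
      show False
      proof (cases "torsion_free (G\<lparr>carrier := B\<rparr>)")
        case True
        obtain x where x: "x \<in> B" "x \<noteq> \<one>" using B(2) subgroup.one_closed[OF normal_imp_subgroup[OF B(1)]] by blast
        obtain n where n: "from_nat_into A n = x"
          using from_nat_into_surj[of A x] AG.countable_if_finite_rank[OF frA] x(1) B(3) by auto
        have clB: "normal_closure G {x} \<subseteq> B" using cl(3)[of _ n, OF B(1)] n x(1) by simp
        have "torsion_free (G\<lparr>carrier := normal_closure G {x}\<rparr>)"
          using True clB by (auto simp: torsion_free_def nat_pow_def)
        then have Mn': "M n = normal_closure G {x}" by (simp add: M_def n)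
        have "M n \<noteq> {\<one>}" using cl(2)[of n] x(2) unfolding Mn' n by blast
        then obtain m where "m \<in> M n" "m \<in> H" "\<chi> m \<noteq> 1" using hit[of n] by auto
        then show False using chiK[of m] clB B(4) Mn' by blast
      next
        case False
        then obtain x n where x: "x \<in> B" "(n::nat) > 0" "x [^] n = \<one>" "x \<noteq> \<one>" by (auto simp: torsion_free_def nat_pow_def)
        obtain q y where q: "Factorial_Ring.prime (q::nat)" and y: "y \<in> B" "y \<noteq> \<one>" "y [^] q = \<one>"
          by (rule torsion_prime_element[OF B(1) x(1,4,3,2)]) (rule that)
        let ?O = "{x \<in> B. x [^] q = \<one>}"
        have Bcomm: "x \<otimes> y = y \<otimes> x" if "x \<in> B" "y \<in> B" for x y using that comm B(3) by blast
        have O: "?O \<lhd> G" by (rule normal_torsion_and_powers(1)[OF B(1) Bcomm])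
        have "finite {x \<in> A. x [^] q = \<one>}"
          using AG.finite_exponent_if_finite_rank[OF frA prime_gt_0_nat[OF q]] by (simp add: pw)
        then have fO: "finite ?O" by (rule rev_finite_subset) (use B(3) in blast)
        have "?O \<noteq> {\<one>}" using y by blast
        then obtain N0 where N0: "minimal_normal N0 G" "N0 \<subseteq> ?O" using finite_normal_contains_minimal[OF O fO] by metis
        have N01: "N0 \<lhd> G" "N0 \<noteq> {\<one>}" using N0(1) by (auto simp: minimal_normal_def)
        have Ns: "N0 \<subseteq> socle_part G q" using sf(2)[OF N0(1)] N0(2) by (auto simp: socle_part_def)
        show False
        proof (cases "q = p")
          case True
          then have "socle_part G q = {\<one>}" using not_prime_order_iff[OF solv q] char by (simp add: p_def)
          then show False using Ns N01 subgroup.one_closed[OF normal_imp_subgroup[OF N01(1)]] by blast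
        next
          case False
          then have qQ: "q \<in> ?Q" using q by simp
          have "\<psi> q x = 1" if xN: "x \<in> N0" for x
          proof -
            have xs: "x \<in> socle_part G q" using xN Ns by blast
            then have xS: "x \<in> S" using Sq[OF qQ] by blast
            have "x \<in> K" using xN N0(2) B(4) by blast
            then have "\<chi> x = 1" by (rule chiK) (use xS SH(1) in blast)
            then show ?thesis using SH(2)[OF xS] \<theta>[OF qQ xs] by simp
          qed
          then show False using \<psi>(2)[OF qQ N01(1) Ns] N01(2) by blast
        qed
      qed
    qed
  qed
qed

theorem theorem5p3:
  fixes G :: "('g, 'm) monoid_scheme" and k :: "('k, 'n) ring_scheme"
  assumes "group G" and "solvable G" and "finite_rank G"
    and "locally_finite_field k"
    and "\<And>B. \<lbrakk>B \<lhd> G; B \<noteq> {\<one>\<^bsub>G\<^esub>}; comm_group (G\<lparr>carrier := B\<rparr>);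
                torsion_free (G\<lparr>carrier := B\<rparr>)\<rbrakk>
           \<Longrightarrow> \<not> spectrum (G\<lparr>carrier := B\<rparr>) \<subseteq> {characteristic k}"
  shows "has_faithful_irreducible_rep k G \<longleftrightarrow>
           locally_cyclic_ZG_module G (G\<lparr>carrier := socle G\<rparr>) (conj_by G) \<and>
           characteristic k \<notin> prime_orders (G\<lparr>carrier := socle G\<rparr>)"
proof -
  have k: "field k" using assms(4) by (simp add: locally_finite_field_def)
  show ?thesis
    using socle_locally_cyclic_if_faithful_irreducible[OF assms(1-3) k]
      faithful_irreducible_if_socle_locally_cyclic[OF assms(1-3) k assms(5)] by blast
qed

end
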